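(* The Chern character $\mathbf{Ch}:\mathbf{IVB}\to\mathbf{\Omega}$ is a map of simplicial presheaves on $\mathbb{C}Man$. That is: for every complex manifold $U$ and every $n\ge 0$ the assignment $\mathbf{Ch}(U)_n:\mathbf{IVB}(U)_n\to\mathbf{\Omega}(U)_n$ defined in the context is well defined (the labeling it produces is an $n$-simplex of $\mathbf{\Omega}(U)$), the maps $\mathbf{Ch}(U)_n$, $n\ge 0$, form a map of simplicial sets $\mathbf{Ch}(U):\mathbf{IVB}(U)\to\mathbf{\Omega}(U)$, and for every holomorphic map $\varphi:U\to U'$ one has $\mathbf{\Omega}(\varphi)\circ\mathbf{Ch}(U')=\mathbf{Ch}(U)\circ\mathbf{IVB}(\varphi)$.
   Context: $\mathbb{C}Man$ is the category of complex manifolds and holomorphic maps; a simplicial presheaf is a functor $\mathbb{C}Man^{op}\to sSet$. The dg-category $\mathcal{P}erf(U)$: objects $\mathcal E=(E_\bullet,d,\nabla)$ are finite complexes of holomorphic vector bundles on $U$ (differential $d$ of degree $+1$) with a holomorphic connection $\nabla$ on $E_\bullet$; morphisms $Hom^q(\mathcal E,\mathcal E')$ are degree $q$ holomorphic bundle maps (no compatibility with connections or differentials), with $D(f)=f\circ d-(-1)^{|f|}d'\circ f$. Holomorphic maps act by pullback. dg-nerve: for a dg-category $\mathcal C$, an $n$-simplex of $dg\mathcal N(\mathcal C)$ consists of objects $\mathcal E_0,\dots,\mathcal E_n$ and morphisms $g_{i_0\dots i_k}:\mathcal E_{i_k}\to\mathcal E_{i_0}$ of degree $1-k$ for all $0\le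 i_0<\dots<i_k\le n$, $k\ge1$, with $$D(g_{i_0\dots i_k})=\sum_{j=1}^{k-1}(-1)^{j-1}g_{i_0\dots\widehat{i_j}\dots i_k}+\sum_{j=1}^{k-1}(-1)^{k(j-1)+1}g_{i_0\dots i_j}\circ g_{i_j\dots i_k}.\quad( * )$$ For $\phi:[n]\to[m]$ the induced map sends $(\mathcal E_i,g)$ to $(\mathcal E_{\phi(i)},\tilde g)$ with $\tilde g_{i_0\dots i_k}=g_{\phi(i_0)\dots\phi(i_k)}$ if $\phi$ is injective on $\{i_0,\dots,i_k\}$, $\tilde g_{i_0i_1}=id$ if $\phi(i_0)=\phi(i_1)$, and $\tilde g_{i_0\dots i_k}=0$ otherwise. $dg\mathcal N(\mathcal C)^\circ$ is the maximal Kan subcomplex; for $\mathcal C=\mathcal{P}erf(U)$ it consists of the simplices all of whose edges $g_{i_0i_1}$ are homotopy equivalences. $\widehat\Delta^n$ is the simplicial set whose $k$-simplices are all sequences $(i_0,\dots,i_k)$ with entries in $\{0,\dots,n\}$; faces delete and degeneracies repeat an entry. It is cosimplicial in $n$ by applying $\phi:[n]\to[m]$ entrywise. Define $\mathbf{IVB}(U)_n=sSet(\widehat\Delta^n,dg\mathcal N(\mathcal{P}erf(U))^\circ)$. Concretely, an $n$-simplex is given by objects $\mathcal E_0,\dots,\mathcal E_n$ of $\mathcal{P}erf(U)$ and morphisms $g_{i_0\dots i_k}:E_{i_k}\to E_{i_0}$ of degree $1-k$ for all sequences $(i_0,\dots,i_k)$, $k\ge1$, in $\{0,\dots,n\}$,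 satisfying $( * )$, with $g_{jj}=id$ and $g_{\dots jj\dots}=0$ when $k\ge2$. $\mathbf\Omega$: let $\Omega_{hol}^\bullet(U)[u]^{\bullet\le0}$ be the complex with zero differential obtained from polynomials in $u$ ($|u|=-2$) with coefficients holomorphic forms, modulo the part of positive total degree. $\mathbf\Omega(U)$ is the simplicial set underlying its Dold–Kan simplicial abelian group: with $C=\Omega_{hol}^\bullet(U)[u]^{\bullet\le0}$, $\mathbf\Omega(U)_n$ is the set of chain maps from normalized chains $N(\mathbb Z\Delta^n)$ to $C$, i.e. labelings of the non-degenerate $k$-cells of $\Delta^n$ by elements of $C$ of degree $-k$ such that for each $k$-cell ($k\ge 1$) the alternating sum $\sum_{j=0}^k(-1)^j$ of the labels of its faces $d_j$ is $0$. Holomorphic maps act by pullback. Chern character: let an $n$-simplex of $\mathbf{IVB}(U)$ be given, i.e. objects $\mathcal E_0,\dots,\mathcal E_n$ of $\mathcal{P}erf(U)$, with underlying complexes of bundles $E_0,\dots,E_n$, and morphisms $g_{i_0\dots i_k}:E_{i_k}\to E_{i_0}$ of degree $1-k$ for all sequences $(i_0,\dots,i_k)$, $k\ge1$, in $\{0,\dots,n\}$, satisfying $D(g_{i_0\dots i_k})=\sum_{j=1}^{k-1}(-1)^{j-1}g_{i_0\dots\widehat{i_j}\dots i_k}+\sum_{j=1}^{k-1}(-1)^{k(j-1)+1}g_{i_0\dots i_j}\circ g_{i_j\dots i_k}$, with $g_{jj}=id$ and $g_{\dots jj\dots}=0$ when $k\ge2$. Consider families $f=\{f_\alpha\}$ indexed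 by simplices $\alpha=(i_0,\dots,i_p)$ of $\widehat\Delta^n$, $p\ge0$, with $f_\alpha\in\Omega^\bullet_{hol}(U,Hom^\bullet(E_{i_p},E_{i_0}))$. The product is $(f\cdot h)_{(i_0,\dots,i_m)}=\sum_{p+r=m}(-1)^{(k+q)r}f_{(i_0,\dots,i_p)}\circ h_{(i_p,\dots,i_m)}$, where $k$ is the form degree and $q$ the Hom degree of $f_{(i_0,\dots,i_p)}$ and $\circ$ wedges forms and composes homomorphisms. $d$ denotes the family with $d_{(i)}=d_{E_i}$ and zero otherwise; $g$ is the family of the $g_{i_0\dots i_k}$, $k\ge 1$ (zero on $0$-simplices). $(\nabla f)_\alpha=(-1)^p\nabla(f_\alpha)$ for a $p$-simplex $\alpha$, with $\nabla$ the induced connection on Hom-bundles. Put $A=\nabla(d+g)$, and $$Tr_g(f)_{(i_0,\dots,i_s)}=\sum_{0\le k\le\ell\le s}(-1)^{(k+1)s+\ell-k}\,tr\big(g_{(i_\ell,\dots,i_s,i_0,\dots,i_k)}\circ f_{(i_k,\dots,i_\ell)}\big),$$ with $tr$ the graded trace. Then $\mathbf{Ch}(U)_n$ labels the cell $i_0<\dots<i_k$ of $\Delta^n$ by the Euler characteristic $\chi(E_{i_0})$ if $k=0$ and by $Tr_g(A^k)_{(i_0,\dots,i_k)}\cdot\frac{u^k}{k!}$ if $k>0$. *)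

theory Defs
  imports
    "HOL-Analysis.Analysis"
    "HOL-Computational_Algebra.Polynomial"
    "HOL-Library.Function_Algebras"
begin

text \<open>Functions into an additive group carry the pointwise group structure of
  \<^theory>\<open>HOL-Library.Function_Algebras\<close>. Forms, bundle maps and labelings are functions that
  vanish outside their domain of definition, so that equality of functions is equality of the
  mathematical objects.\<close>

definition msign :: "int \<Rightarrow> complex" where
  "msign q = (if even q then 1 else - 1)"

definition signed :: "nat \<Rightarrow> 'g::ab_group_add \<Rightarrow> 'g" where
  "signed k x = (if even k then x else - x)"

section \<open>Complex manifolds\<close>

text \<open>A chart is a pair of an open set and a coordinate map on it. Charts take values in a complex
  linear subspace \<open>model\<close> of \<open>complex ^ 'm\<close>, whose dimension is the dimension of the manifold.
  The subspace is there because \<open>complex ^ 'm\<close> itself is never zero-dimensional.\<close>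

type_synonym ('a, 'm) chart = "'a set \<times> ('a \<Rightarrow> complex ^ 'm)"

record ('a, 'm::finite) cmfd =
  mtop :: "'a topology"
  model :: "(complex ^ 'm) set"
  charts :: "('a, 'm) chart set"

abbreviation pts :: "('a, 'm::finite) cmfd \<Rightarrow> 'a set" where
  "pts M \<equiv> topspace (mtop M)"

text \<open>Complex Frechet differentiability at every point of \<open>W\<close>, for \<open>W\<close> open in \<open>H\<close>.\<close>

definition holo_on :: "(complex ^ 'm) set \<Rightarrow> (complex ^ 'm) set \<Rightarrow> (complex ^ 'm \<Rightarrow> complex) \<Rightarrow> bool"
  where
  "holo_on H W f \<longleftrightarrow> (\<forall>z\<in>W. \<exists>D. (\<forall>a v w. D (a *s v + w) = a * D v + D w) \<and>
     (f has_derivative D) (at z within H))"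

abbreviation chart_inv :: "('a, 'm::finite) chart \<Rightarrow> complex ^ 'm \<Rightarrow> 'a" where
  "chart_inv ch \<equiv> inv_into (fst ch) (snd ch)"

definition holo_coords ::
  "('a, 'm::finite) cmfd \<Rightarrow> ('b, 'k::finite) cmfd \<Rightarrow> ('a \<Rightarrow> 'b) \<Rightarrow> bool" where
  "holo_coords M M' \<phi> \<longleftrightarrow> (\<forall>ch\<in>charts M. \<forall>ch'\<in>charts M'. \<forall>i.
     holo_on (model M) (snd ch ` (fst ch \<inter> \<phi> -` fst ch'))
       (\<lambda>z. snd ch' (\<phi> (chart_inv ch z)) $ i))"

definition complex_manifold :: "('a, 'm::finite) cmfd \<Rightarrow> bool" where
  "complex_manifold M \<longleftrightarrow>
     Hausdorff_space (mtop M) \<and> second_countable (mtop M) \<and> vec.subspace (model M) \<and>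
     (\<forall>ch\<in>charts M. openin (mtop M) (fst ch) \<and>
        openin (top_of_set (model M)) (snd ch ` fst ch) \<and>
        homeomorphic_map (subtopology (mtop M) (fst ch)) (top_of_set (snd ch ` fst ch)) (snd ch)) \<and>
     (\<Union>ch\<in>charts M. fst ch) = pts M \<and>
     holo_coords M M (\<lambda>x. x)"

definition holomorphic_map ::
  "('a, 'm::finite) cmfd \<Rightarrow> ('b, 'k::finite) cmfd \<Rightarrow> ('a \<Rightarrow> 'b) \<Rightarrow> bool" where
  "holomorphic_map M M' \<phi> \<longleftrightarrow> continuous_map (mtop M) (mtop M') \<phi> \<and> holo_coords M M' \<phi>"

definition holo_fun :: "('a, 'm::finite) cmfd \<Rightarrow> 'a set \<Rightarrow> ('a \<Rightarrow> complex) \<Rightarrow> bool" where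
  "holo_fun M N u \<longleftrightarrow>
     (\<forall>ch\<in>charts M. holo_on (model M) (snd ch ` (N \<inter> fst ch)) (\<lambda>z. u (chart_inv ch z)))"

text \<open>Derivative at \<open>x\<close> along the tangent vector with coordinates \<open>v\<close> in the chart \<open>ch\<close>.\<close>

definition dird :: "('a, 'm::finite) chart \<Rightarrow> 'a \<Rightarrow> complex ^ 'm \<Rightarrow> ('a \<Rightarrow> complex) \<Rightarrow> complex" where
  "dird ch x v u = deriv (\<lambda>t. u (chart_inv ch (snd ch x + t *s v))) 0"

text \<open>The differential of \<open>\<phi>\<close> at \<open>x\<close> in the coordinates given by \<open>ch\<close> and \<open>ch'\<close>.\<close>

definition jac :: "('a, 'm::finite) chart \<Rightarrow> ('b, 'k::finite) chart \<Rightarrow> ('a \<Rightarrow> 'b) \<Rightarrow> 'a \<Rightarrow>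
    complex ^ 'm \<Rightarrow> complex ^ 'k" where
  "jac ch ch' \<phi> x v = (\<chi> i. dird ch x v (\<lambda>y. snd ch' (\<phi> y) $ i))"

section \<open>Holomorphic forms\<close>

text \<open>A form is given by its local expressions: \<open>\<omega> ch x vs\<close> is the value at \<open>x\<close> on the tangent
  vectors with coordinates \<open>vs\<close> in the chart \<open>ch\<close>. Its component of degree \<open>k\<close> is its restriction
  to lists of length \<open>k\<close>, so the same type serves for inhomogeneous forms. The value type is a
  parameter since forms with values in matrices occur as well.\<close>

type_synonym ('a, 'm, 'v) form = "('a, 'm) chart \<Rightarrow> 'a \<Rightarrow> (complex ^ 'm) list \<Rightarrow> 'v"

definition alt_multilinear ::
  "(complex ^ 'm) set \<Rightarrow> nat \<Rightarrow> ((complex ^ 'm) list \<Rightarrow> complex) \<Rightarrow> bool" where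
  "alt_multilinear H k \<omega> \<longleftrightarrow>
     (\<forall>vs. \<omega> vs \<noteq> 0 \<longrightarrow> length vs = k \<and> set vs \<subseteq> H) \<and>
     (\<forall>us ws a v w. length us + 1 + length ws = k \<and> set us \<subseteq> H \<and> set ws \<subseteq> H \<and> v \<in> H \<and> w \<in> H \<longrightarrow>
        \<omega> (us @ [a *s v + w] @ ws) = a * \<omega> (us @ [v] @ ws) + \<omega> (us @ [w] @ ws)) \<and>
     (\<forall>vs. \<not> distinct vs \<longrightarrow> \<omega> vs = 0)"

definition hol_form ::
  "('a, 'm::finite) cmfd \<Rightarrow> 'a set \<Rightarrow> nat \<Rightarrow> ('a, 'm, complex) form \<Rightarrow> bool" where
  "hol_form M N k \<omega> \<longleftrightarrow>
     (\<forall>ch x. ch \<notin> charts M \<or> x \<notin> N \<inter> fst ch \<longrightarrow> \<omega> ch x = 0) \<and>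
     (\<forall>ch x. alt_multilinear (model M) k (\<omega> ch x)) \<and>
     (\<forall>ch\<in>charts M. \<forall>ch'\<in>charts M. \<forall>x \<in> N \<inter> fst ch \<inter> fst ch'.
        \<forall>vs. length vs = k \<and> set vs \<subseteq> model M \<longrightarrow>
          \<omega> ch x vs = \<omega> ch' x (map (jac ch ch' (\<lambda>y. y) x) vs)) \<and>
     (\<forall>ch\<in>charts M. \<forall>vs. holo_on (model M) (snd ch ` (N \<inter> fst ch)) (\<lambda>z. \<omega> ch (chart_inv ch z) vs))"

text \<open>The value does not depend on the chart around \<open>\<phi> x\<close> that is selected.\<close>

definition pull_form :: "('a, 'm::finite) cmfd \<Rightarrow> ('b, 'k::finite) cmfd \<Rightarrow> ('a \<Rightarrow> 'b) \<Rightarrow>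
    ('b, 'k, 'v::zero) form \<Rightarrow> ('a, 'm, 'v) form" where
  "pull_form M M' \<phi> \<omega> = (\<lambda>ch x vs.
     if ch \<in> charts M \<and> x \<in> fst ch \<and> set vs \<subseteq> model M
     then let ch' = (SOME ch'. ch' \<in> charts M' \<and> \<phi> x \<in> fst ch')
          in \<omega> ch' (\<phi> x) (map (jac ch ch' \<phi> x) vs)
     else 0)"

definition fun_form ::
  "('a, 'm::finite) cmfd \<Rightarrow> ('a \<Rightarrow> complex) \<Rightarrow> ('a, 'm, complex) form" where
  "fun_form M u = (\<lambda>ch x vs. if ch \<in> charts M \<and> x \<in> fst ch \<and> vs = [] then u x else 0)"

section \<open>Graded matrices\<close>

text \<open>The standard graded vector space with \<open>r q\<close> basis vectors in degree \<open>q\<close> has the basis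
  \<open>{(q, a). a < r q}\<close>. A linear map between two such spaces is a matrix indexed by basis vectors
  (row, column); the entry at \<open>(i, j)\<close> has degree \<open>fst i - fst j\<close>.\<close>

type_synonym gbasis = "(int \<times> nat) set"
type_synonym gmat = "int \<times> nat \<Rightarrow> int \<times> nat \<Rightarrow> complex"

definition gmats :: "gbasis \<Rightarrow> gbasis \<Rightarrow> int \<Rightarrow> gmat set" where
  "gmats B' B q = {X. \<forall>i j. X i j \<noteq> 0 \<longrightarrow> i \<in> B' \<and> j \<in> B \<and> fst i = fst j + q}"

definition gmul :: "gbasis \<Rightarrow> gmat \<Rightarrow> gmat \<Rightarrow> gmat" where
  "gmul B X Y = (\<lambda>i j. \<Sum>b\<in>B. X i b * Y b j)"

definition gid :: "gbasis \<Rightarrow> gmat" where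
  "gid B = (\<lambda>i j. if i = j \<and> i \<in> B then 1 else 0)"

definition is_ginv :: "gbasis \<Rightarrow> gmat \<Rightarrow> gmat \<Rightarrow> bool" where
  "is_ginv B X Y \<longleftrightarrow> Y \<in> gmats B B 0 \<and> gmul B X Y = gid B \<and> gmul B Y X = gid B"

definition ginv :: "gbasis \<Rightarrow> gmat \<Rightarrow> gmat" where
  "ginv B X = (THE Y. is_ginv B X Y)"

definition gtr :: "gbasis \<Rightarrow> gmat \<Rightarrow> complex" where
  "gtr B X = (\<Sum>b\<in>B. msign (fst b) * X b b)"

text \<open>Composition of (inhomogeneous) alternating forms with values in graded homomorphisms, by the
  Koszul rule \<open>(\<omega> \<otimes> X) \<circ> (\<eta> \<otimes> Y) = (-1)^(|X| |\<eta>|) (\<omega> \<and> \<eta>) \<otimes> (X Y)\<close>. The sum over \<open>S\<close> is the shuffle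
  formula for the wedge product; \<open>shuffle_inv n S\<close> is the number of inversions of the shuffle that
  lists \<open>S\<close> first and its complement in \<open>{..<n}\<close> next.\<close>

definition shuffle_inv :: "nat \<Rightarrow> nat set \<Rightarrow> nat" where
  "shuffle_inv n S = card {(i, j). i \<in> S \<and> j < n \<and> j \<notin> S \<and> j < i}"

definition fcomp :: "gbasis \<Rightarrow> ('v list \<Rightarrow> gmat) \<Rightarrow> ('v list \<Rightarrow> gmat) \<Rightarrow> 'v list \<Rightarrow> gmat" where
  "fcomp B f h = (\<lambda>vs i j. \<Sum>S\<in>Pow {..<length vs}. \<Sum>b\<in>B.
     msign (int (shuffle_inv (length vs) S)) *
     msign ((fst i - fst b) * int (length (nths vs (- S)))) *
     f (nths vs S) i b * h (nths vs (- S)) b j)"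

section \<open>The dg-category of complexes of bundles with connection\<close>

text \<open>A graded holomorphic vector bundle. The fibre at \<open>x\<close> is the standard graded vector space with
  rank function \<open>rk x\<close>; every bundle is isomorphic to one of this kind by choosing a (not necessarily
  continuous) basis in each fibre. The holomorphic structure is carried by the trivialisations: for
  every point \<open>p\<close> there is an open neighbourhood \<open>nb p\<close> and, for \<open>x\<close> in it, an isomorphism \<open>triv p x\<close>
  from the fibre at \<open>x\<close> to the constant one, such that the transition functions are holomorphic.
  Indexing trivialisations by points makes pullback strictly functorial.

  In the trivialisation \<open>triv p\<close> the connection is \<open>d + \<theta>\<close> with the matrix \<open>\<theta> = con p\<close> of 1-forms.\<close>

record ('a, 'm::finite) perf =
  rk :: "'a \<Rightarrow> int \<Rightarrow> nat"
  nb :: "'a \<Rightarrow> 'a set"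
  triv :: "'a \<Rightarrow> 'a \<Rightarrow> gmat"
  dif :: "'a \<Rightarrow> gmat"
  con :: "'a \<Rightarrow> ('a, 'm, gmat) form"

definition fib :: "('a, 'm::finite) perf \<Rightarrow> 'a \<Rightarrow> gbasis" where
  "fib E x = {(q, a). a < rk E x q}"

definition holo_mat :: "('a, 'm::finite) cmfd \<Rightarrow> 'a set \<Rightarrow> ('a \<Rightarrow> gmat) \<Rightarrow> bool" where
  "holo_mat M N X \<longleftrightarrow> (\<forall>i j. holo_fun M N (\<lambda>x. X x i j))"

text \<open>A fibrewise map \<open>f\<close> from \<open>E\<close> to \<open>E'\<close>, written in the trivialisations at \<open>p\<close> and \<open>p'\<close>.\<close>

definition loc :: "('a, 'm::finite) perf \<Rightarrow> ('a, 'm) perf \<Rightarrow> 'a \<Rightarrow> 'a \<Rightarrow> ('a \<Rightarrow> gmat) \<Rightarrow> 'a \<Rightarrow> gmat"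
  where
  "loc E E' p p' f x =
     gmul (fib E' x) (triv E' p' x) (gmul (fib E x) (f x) (ginv (fib E x) (triv E p x)))"

definition trans_fun :: "('a, 'm::finite) perf \<Rightarrow> 'a \<Rightarrow> 'a \<Rightarrow> 'a \<Rightarrow> gmat" where
  "trans_fun E p p' = loc E E p p' (\<lambda>x. gid (fib E x))"

definition graded_bundle :: "('a, 'm::finite) cmfd \<Rightarrow> ('a, 'm) perf \<Rightarrow> bool" where
  "graded_bundle M E \<longleftrightarrow>
     (\<forall>x. x \<notin> pts M \<longrightarrow> rk E x = 0 \<and> nb E x = {}) \<and>
     (\<exists>N. \<forall>x q. rk E x q \<noteq> 0 \<longrightarrow> \<bar>q\<bar> \<le> N) \<and>
     (\<forall>p\<in>pts M. openin (mtop M) (nb E p) \<and> p \<in> nb E p \<and> (\<forall>x\<in>nb E p. rk E x = rk E p)) \<and>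
     (\<forall>p x. x \<in> nb E p \<longrightarrow>
        triv E p x \<in> gmats (fib E x) (fib E x) 0 \<and> (\<exists>Y. is_ginv (fib E x) (triv E p x) Y)) \<and>
     (\<forall>p x. x \<notin> nb E p \<longrightarrow> triv E p x = 0) \<and>
     (\<forall>p p'. holo_mat M (nb E p \<inter> nb E p') (trans_fun E p p'))"

definition bundle_maps ::
  "('a, 'm::finite) cmfd \<Rightarrow> ('a, 'm) perf \<Rightarrow> ('a, 'm) perf \<Rightarrow> int \<Rightarrow> ('a \<Rightarrow> gmat) set" where
  "bundle_maps M E E' q = {f.
     (\<forall>x. x \<notin> pts M \<longrightarrow> f x = 0) \<and>
     (\<forall>x\<in>pts M. f x \<in> gmats (fib E' x) (fib E x) q) \<and>
     (\<forall>p p'. holo_mat M (nb E p \<inter> nb E' p') (loc E E' p p' f))}"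

text \<open>The last condition says that the operators \<open>d + con p\<close> agree on overlaps: with
  \<open>h = trans_fun E p p'\<close> it is the gauge law \<open>h (con p) = dh + (con p') h\<close>.\<close>

definition holomorphic_connection :: "('a, 'm::finite) cmfd \<Rightarrow> ('a, 'm) perf \<Rightarrow> bool" where
  "holomorphic_connection M E \<longleftrightarrow>
     (\<forall>p ch x vs. con E p ch x vs \<in> gmats (fib E x) (fib E x) 0) \<and>
     (\<forall>p i j. hol_form M (nb E p) 1 (\<lambda>ch x vs. con E p ch x vs i j)) \<and>
     (\<forall>p p'. \<forall>ch\<in>charts M. \<forall>x \<in> nb E p \<inter> nb E p' \<inter> fst ch. \<forall>v\<in>model M.
        gmul (fib E x) (trans_fun E p p' x) (con E p ch x [v]) =
        (\<lambda>i j. dird ch x v (\<lambda>y. trans_fun E p p' y i j)) +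
        gmul (fib E x) (con E p' ch x [v]) (trans_fun E p p' x))"

definition perf_ob :: "('a, 'm::finite) cmfd \<Rightarrow> ('a, 'm) perf \<Rightarrow> bool" where
  "perf_ob M E \<longleftrightarrow> graded_bundle M E \<and>
     dif E \<in> bundle_maps M E E 1 \<and> (\<forall>x. gmul (fib E x) (dif E x) (dif E x) = 0) \<and>
     holomorphic_connection M E"

text \<open>\<open>Dif C X Y q\<close> is the differential on \<open>Hom C X Y q\<close>, and \<open>Cmp C X Y Z g f\<close> is the composite of
  \<open>f\<close> from \<open>X\<close> to \<open>Y\<close> with \<open>g\<close> from \<open>Y\<close> to \<open>Z\<close>. All morphisms live in one ambient abelian group.\<close>

record ('o, 'h) dgcat =
  Ob :: "'o set"
  Hom :: "'o \<Rightarrow> 'o \<Rightarrow> int \<Rightarrow> 'h set"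
  Dif :: "'o \<Rightarrow> 'o \<Rightarrow> int \<Rightarrow> 'h \<Rightarrow> 'h"
  Cmp :: "'o \<Rightarrow> 'o \<Rightarrow> 'o \<Rightarrow> 'h \<Rightarrow> 'h \<Rightarrow> 'h"
  Idn :: "'o \<Rightarrow> 'h"

definition Perf :: "('a, 'm::finite) cmfd \<Rightarrow> (('a, 'm) perf, 'a \<Rightarrow> gmat) dgcat" where
  "Perf M = \<lparr>
     Ob = {E. perf_ob M E},
     Hom = bundle_maps M,
     Dif = (\<lambda>E E' q f x i j. gmul (fib E x) (f x) (dif E x) i j
                            - msign q * gmul (fib E' x) (dif E' x) (f x) i j),
     Cmp = (\<lambda>E E' E'' g f x. gmul (fib E' x) (g x) (f x)),
     Idn = (\<lambda>E x. gid (fib E x)) \<rparr>"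

definition pull_map :: "('a, 'm::finite) cmfd \<Rightarrow> ('a \<Rightarrow> 'b) \<Rightarrow> ('b \<Rightarrow> gmat) \<Rightarrow> 'a \<Rightarrow> gmat" where
  "pull_map M \<phi> f = (\<lambda>x. if x \<in> pts M then f (\<phi> x) else 0)"

definition pull_perf :: "('a, 'm::finite) cmfd \<Rightarrow> ('b, 'k::finite) cmfd \<Rightarrow> ('a \<Rightarrow> 'b) \<Rightarrow>
    ('b, 'k) perf \<Rightarrow> ('a, 'm) perf" where
  "pull_perf M M' \<phi> E = \<lparr>
     rk = (\<lambda>x. if x \<in> pts M then rk E (\<phi> x) else 0),
     nb = (\<lambda>p. if p \<in> pts M then {x \<in> pts M. \<phi> x \<in> nb E (\<phi> p)} else {}),
     triv = (\<lambda>p. if p \<in> pts M then pull_map M \<phi> (triv E (\<phi> p)) else 0),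
     dif = pull_map M \<phi> (dif E),
     con = (\<lambda>p. if p \<in> pts M then pull_form M M' \<phi> (con E (\<phi> p)) else 0) \<rparr>"

section \<open>The dg-nerve\<close>

text \<open>The morphisms of the simplex category are represented by functions on \<open>nat\<close> of which only the
  values on \<open>{..m}\<close> matter.\<close>

definition delta_map :: "nat \<Rightarrow> nat \<Rightarrow> (nat \<Rightarrow> nat) \<Rightarrow> bool" where
  "delta_map m n \<phi> \<longleftrightarrow> mono_on {..m} \<phi> \<and> \<phi> ` {..m} \<subseteq> {..n}"

definition simplicial_map :: "(nat \<Rightarrow> 'x set) \<Rightarrow> (nat \<Rightarrow> (nat \<Rightarrow> nat) \<Rightarrow> 'x \<Rightarrow> 'x) \<Rightarrow>
    (nat \<Rightarrow> 'y set) \<Rightarrow> (nat \<Rightarrow> (nat \<Rightarrow> nat) \<Rightarrow> 'y \<Rightarrow> 'y) \<Rightarrow> (nat \<Rightarrow> 'x \<Rightarrow> 'y) \<Rightarrow> bool" where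
  "simplicial_map X opX Y opY F \<longleftrightarrow>
     (\<forall>n. \<forall>x\<in>X n. F n x \<in> Y n) \<and>
     (\<forall>m n \<phi>. delta_map m n \<phi> \<longrightarrow> (\<forall>x\<in>X n. F m (opX m \<phi> x) = opY m \<phi> (F n x)))"

text \<open>Strictly increasing sequences, i.e. the non-degenerate cells of the standard \<open>n\<close>-simplex.\<close>

definition cells :: "nat \<Rightarrow> nat list set" where
  "cells n = {\<sigma>. \<sigma> \<noteq> [] \<and> sorted_wrt (<) \<sigma> \<and> set \<sigma> \<subseteq> {..n}}"

definition face :: "nat \<Rightarrow> 'x list \<Rightarrow> 'x list" where
  "face j is = take j is @ drop (Suc j) is"

type_synonym ('o, 'h) dgsimplex = "(nat \<Rightarrow> 'o) \<times> (nat list \<Rightarrow> 'h)"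

definition dgnerve :: "('o, 'h::ab_group_add) dgcat \<Rightarrow> nat \<Rightarrow> ('o, 'h) dgsimplex set" where
  "dgnerve C n = {(E, g).
     (\<forall>i\<le>n. E i \<in> Ob C) \<and> (\<forall>i>n. E i = undefined) \<and>
     (\<forall>is. \<not> (is \<in> cells n \<and> length is \<ge> 2) \<longrightarrow> g is = 0) \<and>
     (\<forall>is\<in>cells n. \<forall>k\<ge>1. length is = k + 1 \<longrightarrow>
        g is \<in> Hom C (E (last is)) (E (hd is)) (1 - int k) \<and>
        Dif C (E (last is)) (E (hd is)) (1 - int k) (g is) =
          (\<Sum>j\<in>{1..<k}. signed (j - 1) (g (face j is))) +
          (\<Sum>j\<in>{1..<k}. signed (k * (j - 1) + 1)
             (Cmp C (E (last is)) (E (is ! j)) (E (hd is)) (g (take (j + 1) is)) (g (drop j is)))))}"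

definition dgnerve_op :: "('o, 'h::ab_group_add) dgcat \<Rightarrow> nat \<Rightarrow> (nat \<Rightarrow> nat) \<Rightarrow>
    ('o, 'h) dgsimplex \<Rightarrow> ('o, 'h) dgsimplex" where
  "dgnerve_op C m \<phi> s = (case s of (E, g) \<Rightarrow>
     (\<lambda>i. if i \<le> m then E (\<phi> i) else undefined,
      \<lambda>is. if is \<notin> cells m \<or> length is < 2 then 0
           else if inj_on \<phi> (set is) then g (map \<phi> is)
           else if length is = 2 then Idn C (E (\<phi> (hd is)))
           else 0))"

definition homotopy_equiv :: "('o, 'h::ab_group_add) dgcat \<Rightarrow> 'o \<Rightarrow> 'o \<Rightarrow> 'h \<Rightarrow> bool" where
  "homotopy_equiv C X Y f \<longleftrightarrow> f \<in> Hom C X Y 0 \<and> Dif C X Y 0 f = 0 \<and>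
     (\<exists>f'\<in>Hom C Y X 0. Dif C Y X 0 f' = 0 \<and>
        (\<exists>h\<in>Hom C X X (-1). Dif C X X (-1) h = Cmp C X Y X f' f - Idn C X) \<and>
        (\<exists>h\<in>Hom C Y Y (-1). Dif C Y Y (-1) h = Cmp C Y X Y f f' - Idn C Y))"

text \<open>The simplices all of whose edges are homotopy equivalences; this is the maximal Kan subcomplex
  of the dg-nerve of \<open>Perf M\<close>.\<close>

definition dgnerve_core :: "('o, 'h::ab_group_add) dgcat \<Rightarrow> nat \<Rightarrow> ('o, 'h) dgsimplex set" where
  "dgnerve_core C n = {(E, g) \<in> dgnerve C n.
     \<forall>i j. i < j \<and> j \<le> n \<longrightarrow> homotopy_equiv C (E j) (E i) (g [i, j])}"

section \<open>The simplicial presheaf of infinity vector bundles\<close>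

text \<open>The \<open>k\<close>-simplices of the simplicial set with all sequences in \<open>{0, \<dots>, n}\<close> as simplices; a map
  \<open>\<phi>\<close> from \<open>[m]\<close> to \<open>[k]\<close> acts by \<open>hat_op m \<phi>\<close>.\<close>

definition hat :: "nat \<Rightarrow> nat \<Rightarrow> nat list set" where
  "hat n k = {is. length is = k + 1 \<and> set is \<subseteq> {..n}}"

definition hat_op :: "nat \<Rightarrow> (nat \<Rightarrow> nat) \<Rightarrow> nat list \<Rightarrow> nat list" where
  "hat_op m \<phi> is = map (\<lambda>j. is ! \<phi> j) [0..<m + 1]"

type_synonym ('a, 'm) ivb = "nat list \<Rightarrow> (('a, 'm) perf, 'a \<Rightarrow> gmat) dgsimplex"

definition IVB :: "('a, 'm::finite) cmfd \<Rightarrow> nat \<Rightarrow> ('a, 'm) ivb set" where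
  "IVB M n = {F.
     (\<forall>k. \<forall>is\<in>hat n k. F is \<in> dgnerve_core (Perf M) k) \<and>
     (\<forall>m k \<phi>. delta_map m k \<phi> \<longrightarrow>
        (\<forall>is\<in>hat n k. F (hat_op m \<phi> is) = dgnerve_op (Perf M) m \<phi> (F is))) \<and>
     (\<forall>is. is \<notin> (\<Union>k. hat n k) \<longrightarrow> F is = undefined)}"

definition IVB_op :: "nat \<Rightarrow> (nat \<Rightarrow> nat) \<Rightarrow> ('a, 'm::finite) ivb \<Rightarrow> ('a, 'm) ivb" where
  "IVB_op m \<phi> F = (\<lambda>is. if is \<in> (\<Union>k. hat m k) then F (map \<phi> is) else undefined)"

definition IVB_pull :: "('a, 'm::finite) cmfd \<Rightarrow> ('b, 'k::finite) cmfd \<Rightarrow> ('a \<Rightarrow> 'b) \<Rightarrow> nat \<Rightarrow>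
    ('b, 'k) ivb \<Rightarrow> ('a, 'm) ivb" where
  "IVB_pull M M' \<phi> n F = (\<lambda>is.
     if is \<in> (\<Union>k. hat n k)
     then (\<lambda>i. if i < length is then pull_perf M M' \<phi> (fst (F is) i) else undefined,
           \<lambda>js. pull_map M \<phi> (snd (F is) js))
     else undefined)"

section \<open>The simplicial presheaf of forms\<close>

text \<open>The part of degree \<open>-k\<close> of polynomials in \<open>u\<close> with coefficients holomorphic forms, where \<open>u\<close> has
  degree \<open>-2\<close>: the coefficient of \<open>u^j\<close> is a form of degree \<open>2 j - k\<close>.\<close>

definition form_cx :: "('a, 'm::finite) cmfd \<Rightarrow> nat \<Rightarrow> ('a, 'm, complex) form poly set" where
  "form_cx M k = {P. \<forall>j. if k \<le> 2 * j then hol_form M (pts M) (2 * j - k) (coeff P j)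
                                       else coeff P j = 0}"

type_synonym ('a, 'm) labeling = "nat list \<Rightarrow> ('a, 'm, complex) form poly"

definition Omega :: "('a, 'm::finite) cmfd \<Rightarrow> nat \<Rightarrow> ('a, 'm) labeling set" where
  "Omega M n = {l.
     (\<forall>\<sigma>. \<sigma> \<notin> cells n \<longrightarrow> l \<sigma> = 0) \<and>
     (\<forall>\<sigma>\<in>cells n. \<forall>k. length \<sigma> = k + 1 \<longrightarrow>
        l \<sigma> \<in> form_cx M k \<and>
        (k \<ge> 1 \<longrightarrow> (\<Sum>j\<le>k. signed j (l (face j \<sigma>))) = 0))}"

text \<open>A cell that becomes degenerate is zero in the normalized chains.\<close>

definition Omega_op :: "nat \<Rightarrow> (nat \<Rightarrow> nat) \<Rightarrow> ('a, 'm::finite) labeling \<Rightarrow> ('a, 'm) labeling" where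
  "Omega_op m \<phi> l = (\<lambda>\<sigma>. if \<sigma> \<in> cells m \<and> inj_on \<phi> (set \<sigma>) then l (map \<phi> \<sigma>) else 0)"

definition Omega_pull :: "('a, 'm::finite) cmfd \<Rightarrow> ('b, 'k::finite) cmfd \<Rightarrow> ('a \<Rightarrow> 'b) \<Rightarrow>
    ('b, 'k) labeling \<Rightarrow> ('a, 'm) labeling" where
  "Omega_pull M M' \<phi> l = (\<lambda>\<sigma>. map_poly (pull_form M M' \<phi>) (l \<sigma>))"

section \<open>The Chern character\<close>

text \<open>The objects and morphisms determined by an \<open>n\<close>-simplex of \<open>IVB\<close>.\<close>

definition ob_of :: "('a, 'm::finite) ivb \<Rightarrow> nat \<Rightarrow> ('a, 'm) perf" where
  "ob_of F i = fst (F [i]) 0"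

definition mor_of :: "('a, 'm::finite) ivb \<Rightarrow> nat list \<Rightarrow> 'a \<Rightarrow> gmat" where
  "mor_of F is = (if length is \<ge> 2 then snd (F is) [0..<length is] else 0)"

type_synonym ('a, 'm) family = "nat list \<Rightarrow> ('a, 'm, gmat) form"

text \<open>A family assigns a form with values in homomorphisms from the last to the first object of the
  sequence. In the product below, \<open>length vs + (fst i - fst b)\<close> is form degree plus Hom degree of the
  left factor.\<close>

definition fam_prod ::
  "(nat \<Rightarrow> ('a, 'm::finite) perf) \<Rightarrow> ('a, 'm) family \<Rightarrow> ('a, 'm) family \<Rightarrow> ('a, 'm) family" where
  "fam_prod E f h = (\<lambda>is ch x. \<Sum>p<length is.
     let r = int (length is - 1 - p) in
     fcomp (fib (E (is ! p)) x)
       (\<lambda>vs i b. msign ((int (length vs) + (fst i - fst b)) * r) * f (take (p + 1) is) ch x vs i b)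
       (h (drop p is) ch x))"

definition fam_one :: "(nat \<Rightarrow> ('a, 'm::finite) perf) \<Rightarrow> ('a, 'm) family" where
  "fam_one E = (\<lambda>is ch x vs. if length is = 1 \<and> vs = [] then gid (fib (E (hd is)) x) else 0)"

primrec fam_power ::
  "(nat \<Rightarrow> ('a, 'm::finite) perf) \<Rightarrow> ('a, 'm) family \<Rightarrow> nat \<Rightarrow> ('a, 'm) family" where
  "fam_power E f 0 = fam_one E"
| "fam_power E f (Suc k) = fam_prod E f (fam_power E f k)"

text \<open>The induced connection on \<open>Hom(E, E')\<close>, i.e. \<open>f \<mapsto> df + \<theta>' f - f \<theta>\<close> in trivialisations. At \<open>x\<close>
  the trivialisations indexed by \<open>x\<close> are used; by the gauge law others give the same.\<close>

definition hom_conn :: "('a, 'm::finite) cmfd \<Rightarrow> ('a, 'm) perf \<Rightarrow> ('a, 'm) perf \<Rightarrow>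
    ('a \<Rightarrow> gmat) \<Rightarrow> ('a, 'm, gmat) form" where
  "hom_conn M E E' f = (\<lambda>ch x vs.
     if ch \<in> charts M \<and> x \<in> fst ch \<and> length vs = 1 \<and> set vs \<subseteq> model M
     then let L = loc E E' x x f in
       gmul (fib E' x) (ginv (fib E' x) (triv E' x x))
         (gmul (fib E x)
            ((\<lambda>i j. dird ch x (hd vs) (\<lambda>y. L y i j))
             + gmul (fib E' x) (con E' x ch x vs) (L x)
             - gmul (fib E x) (L x) (con E x ch x vs))
            (triv E x x))
     else 0)"

text \<open>The family \<open>A = \<nabla>(d + g)\<close>.\<close>

definition fam_A :: "('a, 'm::finite) cmfd \<Rightarrow> ('a, 'm) ivb \<Rightarrow> ('a, 'm) family" where
  "fam_A M F = (\<lambda>is ch x vs i j.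
     msign (int (length is - 1)) *
     hom_conn M (ob_of F (last is)) (ob_of F (hd is))
       ((if length is = 1 then dif (ob_of F (hd is)) else 0) + mor_of F is) ch x vs i j)"

definition Tr :: "('a, 'm::finite) ivb \<Rightarrow> ('a, 'm) family \<Rightarrow> nat list \<Rightarrow> ('a, 'm, complex) form" where
  "Tr F f is = (\<lambda>ch x vs. let s = length is - 1 in
     \<Sum>l\<le>s. \<Sum>k\<le>l. msign ((int k + 1) * int s + int l - int k) *
       gtr (fib (ob_of F (is ! l)) x)
         (fcomp (fib (ob_of F (is ! k)) x)
            (\<lambda>us. if us = [] then mor_of F (drop l is @ take (k + 1) is) x else 0)
            (f (take (l + 1 - k) (drop k is)) ch x) vs))"

definition euler_char :: "('a, 'm::finite) perf \<Rightarrow> 'a \<Rightarrow> complex" where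
  "euler_char E x = (\<Sum>q | rk E x q \<noteq> 0. msign q * of_nat (rk E x q))"

definition Ch :: "('a, 'm::finite) cmfd \<Rightarrow> nat \<Rightarrow> ('a, 'm) ivb \<Rightarrow> ('a, 'm) labeling" where
  "Ch M n F = (\<lambda>\<sigma>. let k = length \<sigma> - 1 in
     if \<sigma> \<notin> cells n then 0
     else if k = 0 then monom (fun_form M (euler_char (ob_of F (hd \<sigma>)))) 0
     else monom (\<lambda>ch x vs. Tr F (fam_power (ob_of F) (fam_A M F) k) \<sigma> ch x vs / fact k) k)"

end

theory Submission
  imports Defs "HOL-Complex_Analysis.Complex_Analysis"
begin

text \<open>Let \<open>G\<close> be the family \<open>d + g\<close> and \<open>\<theta> = \<nabla> G\<close> up to sign. After a rescaling of matrix entries by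
  signs that depend on the degrees of row and column, products of families become convolutions
  without signs and the alternating sum over inner faces becomes a derivation \<open>del\<close>. The nerve
  relations turn into \<open>del G = G G\<close>. Applying the connection gives \<open>del \<theta> = G \<theta> + \<theta> G\<close>, so that \<open>Q = \<theta>\<^sup>m\<close>
  satisfies \<open>del Q = G Q - (-1)\<^sup>m Q G\<close>. In the alternating sum of the traces over the faces of a cell, a
  face either shortens the factor \<open>Q\<close> or the rotated factor \<open>G\<close>; both parts consist of traces of
  words with one \<open>Q\<close> and two \<open>G\<close>, and they cancel by cyclicity of the trace. On 1-cells the sum is a
  difference of Euler characteristics, which vanishes because the supertrace of the identity is a
  homotopy invariant.

  The trace is a holomorphic form since it can be computed in any system of trivialisations, and
  derivatives of holomorphic functions of several variables are holomorphic by the Cauchy integral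
  formula on lines. On a cell that a simplicial operator makes degenerate, two adjacent vertices
  agree. They are adjacent inside one of the factors of every summand of the trace, and this factor
  is 0, or the identity, which \<open>\<nabla>\<close> annihilates.\<close>

text \<open>No boundary terms arise in the sum over faces: a summand for the face without vertex
  \<open>a\<close> is cut at vertices \<open>k\<close> and \<open>l\<close> other than
  \<open>a\<close>, so \<open>a\<close> is an inner vertex of exactly one of the two factors. This
  is why \<open>del\<close> with inner faces only suffices. The main obstacle is the signs, which
  mix form degree, Hom degree and simplicial degree. For a family of known total degree the length
  of a sequence fixes the difference of row and column degree of every nonzero entry, so signs in
  the length can be traded for signs in row and column. The sign identities proved by cases on the
  vanishing of an entry are such trades. Matrices are extended by zero to one finite index set
  \<open>B\<close> that contains the fibres of all vertices of the cell; then all products sum over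
  the same set, and cyclicity is an exchange of sums. On the analytic side, the trivialisation used
  at a point is indexed by that point and need not vary continuously with it, so statements on
  holomorphy first pass to the trivialisations of one fixed centre.\<close>

lemma msign_add: "msign (a + b) = msign a * msign b"
  by (simp add: msign_def)

lemma msign_0 [simp]: "msign 0 = 1"
  by (simp add: msign_def)

lemma msign_1 [simp]: "msign 1 = -1"
  by (simp add: msign_def)

lemma msign_minus [simp]: "msign (- a) = msign a"
  by (simp add: msign_def)

lemma msign_eqI: "even (a - b) \<Longrightarrow> msign a = msign b"
  by (simp add: msign_def)

section \<open>Faces, segments and rotations of sequences\<close>

definition seg :: "nat \<Rightarrow> nat \<Rightarrow> 'v list \<Rightarrow> 'v list" where
  "seg k l \<sigma> = take (Suc l - k) (drop k \<sigma>)"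

text \<open>The complementary arc when the sequence is read cyclically: from position
  \<open>l\<close> over the end to position \<open>k\<close>. It shares both end points with
  \<open>seg k l\<close>.\<close>

definition rot :: "nat \<Rightarrow> nat \<Rightarrow> 'v list \<Rightarrow> 'v list" where
  "rot k l \<sigma> = drop l \<sigma> @ take (Suc k) \<sigma>"

text \<open>A convolution in which the two factors share the vertex at the cut, as in the cup
  product of cochains.\<close>

definition star :: "gbasis \<Rightarrow> ('v list \<Rightarrow> gmat) \<Rightarrow> ('v list \<Rightarrow> gmat) \<Rightarrow> 'v list \<Rightarrow> gmat" where
  "star B f h \<alpha> = (\<lambda>i j. \<Sum>p<length \<alpha>. \<Sum>b\<in>B. f (take (Suc p) \<alpha>) i b * h (drop p \<alpha>) b j)"

text \<open>Inner faces only, as in the nerve relation. The row degree enters the sign so that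
  \<open>del\<close> becomes an odd derivation although \<open>star\<close> itself carries no
  signs.\<close>

definition del :: "('v list \<Rightarrow> gmat) \<Rightarrow> 'v list \<Rightarrow> gmat" where
  "del f \<alpha> = (\<lambda>i j. \<Sum>a\<in>{1..<length \<alpha> - 1}. msign (fst i + int (a - 1)) * f (face a \<alpha>) i j)"

text \<open>Total degree \<open>c\<close>, the sum of the Hom degree and the simplicial degree
  \<open>length \<alpha> - 1\<close>. That \<open>g\<close> has degree \<open>1 - k\<close> on
  \<open>k\<close>-simplices means total degree 1.\<close>

definition homog :: "int \<Rightarrow> ('v list \<Rightarrow> gmat) \<Rightarrow> bool" where
  "homog c f \<longleftrightarrow> (\<forall>\<alpha> i j. f \<alpha> i j \<noteq> 0 \<longrightarrow> \<alpha> \<noteq> [] \<longrightarrow> fst i - fst j = c + 1 - int (length \<alpha>))"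

lemma length_seg: "l < length \<sigma> \<Longrightarrow> length (seg k l \<sigma>) = Suc l - k"
  by (auto simp: seg_def)

lemma length_rot: "l < length \<sigma> \<Longrightarrow> k < length \<sigma> \<Longrightarrow> length (rot k l \<sigma>) = length \<sigma> - l + Suc k"
  by (auto simp: rot_def)

lemma length_face: "a < length \<sigma> \<Longrightarrow> length (face a \<sigma>) = length \<sigma> - 1"
  by (auto simp: face_def)

lemma nth_face: "n < length \<sigma> - 1 \<Longrightarrow> a < length \<sigma> \<Longrightarrow> face a \<sigma> ! n = \<sigma> ! (if n < a then n else Suc n)"
  by (auto simp: face_def nth_append min_def)

lemma seg_eq_full: "length \<sigma> = Suc N \<Longrightarrow> seg 0 N \<sigma> = \<sigma>"
  by (simp add: seg_def)

lemma take_seg: "p \<le> l - k \<Longrightarrow> k \<le> l \<Longrightarrow> take (Suc p) (seg k l \<sigma>) = seg k (k + p) \<sigma>"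
  by (simp add: seg_def min_def)

lemma drop_seg: "p \<le> l - k \<Longrightarrow> k \<le> l \<Longrightarrow> drop p (seg k l \<sigma>) = seg (k + p) l \<sigma>"
  by (simp add: seg_def drop_take add.commute)

lemma take_rot1: "p < length \<sigma> - l \<Longrightarrow> take (Suc p) (rot k l \<sigma>) = seg l (l + p) \<sigma>"
  by (simp add: seg_def rot_def)

lemma drop_rot1: "p < length \<sigma> - l \<Longrightarrow> drop p (rot k l \<sigma>) = rot k (l + p) \<sigma>"
  by (simp add: rot_def add.commute)

lemma take_rot2: "a \<le> k \<Longrightarrow> l < length \<sigma> \<Longrightarrow> take (Suc (length \<sigma> - l + a)) (rot k l \<sigma>) = rot a l \<sigma>"
  by (simp add: rot_def min_def Suc_diff_le)

lemma drop_rot2: "a \<le> k \<Longrightarrow> l < length \<sigma> \<Longrightarrow> drop (length \<sigma> - l + a) (rot k l \<sigma>) = seg a k \<sigma>"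
  by (simp add: rot_def seg_def drop_take)

lemma nth_seg: "n < Suc l - k \<Longrightarrow> l < length \<sigma> \<Longrightarrow> seg k l \<sigma> ! n = \<sigma> ! (k + n)"
  by (simp add: seg_def)

text \<open>Deleting a vertex strictly between the cuts shortens the segment and leaves the arc
  alone (\<open>rot_face_mid\<close>). Deleting a vertex outside does the opposite; if it precedes
  the cuts, both cuts move down by one.\<close>

lemma seg_face_mid:
  assumes "k < a" "a < l" "l < length \<sigma>"
  shows "seg k (l - 1) (face a \<sigma>) = face (a - k) (seg k l \<sigma>)"
proof (rule nth_equalityI)
  have *: "l - 1 < length (face a \<sigma>)" "a - k < length (seg k l \<sigma>)"
    using assms by (auto simp: length_face length_seg)
  show "length (seg k (l - 1) (face a \<sigma>)) = length (face (a - k) (seg k l \<sigma>))"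
    unfolding length_seg[OF *(1)] length_face[OF *(2)] using assms by (simp add: length_seg)
  fix n assume "n < length (seg k (l - 1) (face a \<sigma>))"
  then have n: "n < l - k" unfolding length_seg[OF *(1)] using assms by simp
  have "face (a - k) (seg k l \<sigma>) ! n = seg k l \<sigma> ! (if n < a - k then n else Suc n)"
    using n assms by (intro nth_face *) (simp add: length_seg)
  also have "\<dots> = \<sigma> ! (k + (if n < a - k then n else Suc n))"
    using n assms by (intro nth_seg) auto
  also have "\<dots> = face a \<sigma> ! (k + n)"
    using n assms by (subst nth_face) auto
  also have "\<dots> = seg k (l - 1) (face a \<sigma>) ! n"
    using n assms * by (intro nth_seg[symmetric]) auto
  finally show "seg k (l - 1) (face a \<sigma>) ! n = face (a - k) (seg k l \<sigma>) ! n" ..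
qed

lemma drop_face: "a < l \<Longrightarrow> l < length \<sigma> \<Longrightarrow> drop (l - 1) (face a \<sigma>) = drop l \<sigma>"
  by (auto simp: face_def)

lemma take_face: "k < a \<Longrightarrow> a < length \<sigma> \<Longrightarrow> take (Suc k) (face a \<sigma>) = take (Suc k) \<sigma>"
  by (auto simp: face_def min_def)

lemma rot_face_mid:
  assumes "k < a" "a < l" "l < length \<sigma>"
  shows "rot k (l - 1) (face a \<sigma>) = rot k l \<sigma>"
  using assms by (simp add: rot_def take_face drop_face del: One_nat_def)

lemma seg_face_low:
  assumes "a < k" "k \<le> l" "l < length \<sigma>"
  shows "seg (k - 1) (l - 1) (face a \<sigma>) = seg k l \<sigma>"
proof -
  have "Suc (l - 1) - (k - 1) = Suc l - k" using assms by auto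
  then show ?thesis using assms by (simp add: seg_def drop_face del: One_nat_def)
qed

lemma take_face': "a < k \<Longrightarrow> k < length \<sigma> \<Longrightarrow> take k (face a \<sigma>) = face a (take (Suc k) \<sigma>)"
  by (simp add: face_def min_def drop_take)

lemma drop_face': "l < a \<Longrightarrow> a < length \<sigma> \<Longrightarrow> drop l (face a \<sigma>) = face (a - l) (drop l \<sigma>)"
  by (simp add: face_def min_def drop_take)

lemma face_append1: "a < length xs \<Longrightarrow> face a (xs @ ys) = face a xs @ ys"
  by (simp add: face_def)

lemma face_append2: "face (length xs + a) (xs @ ys) = xs @ face a ys"
  by (simp add: face_def)

text \<open>In the arc, position \<open>a\<close> of the sequence comes after the
  \<open>length \<sigma> - l\<close> entries that precede the wrap-around, whence the shifted face
  index.\<close>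

lemma rot_face_low:
  assumes "a < k" "k \<le> l" "l < length \<sigma>"
  shows "rot (k - 1) (l - 1) (face a \<sigma>) = face (length \<sigma> - l + a) (rot k l \<sigma>)"
proof -
  have "face (length (drop l \<sigma>) + a) (rot k l \<sigma>) = drop l \<sigma> @ face a (take (Suc k) \<sigma>)"
    unfolding rot_def by (rule face_append2)
  also have "\<dots> = rot (k - 1) (l - 1) (face a \<sigma>)"
    using assms by (simp add: rot_def drop_face take_face' del: One_nat_def)
  finally show ?thesis by simp
qed

lemma seg_face_high:
  assumes "l < a" "k \<le> l" "a < length \<sigma>"
  shows "seg k l (face a \<sigma>) = seg k l \<sigma>"
proof -
  have "seg k l (face a \<sigma>) = drop k (take (Suc l) (face a \<sigma>))" by (simp add: seg_def drop_take)
  also have "\<dots> = seg k l \<sigma>" using assms by (simp add: take_face) (simp add: seg_def drop_take)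
  finally show ?thesis .
qed

lemma rot_face_high:
  assumes "l < a" "k \<le> l" "a < length \<sigma>"
  shows "rot k l (face a \<sigma>) = face (a - l) (rot k l \<sigma>)"
  using assms by (simp add: rot_def take_face drop_face' face_append1)

section \<open>Associativity and derivation property of the convolution\<close>

lemma star_seg:
  assumes "k \<le> l" "l < length \<sigma>"
  shows "star B f h (seg k l \<sigma>) i j = (\<Sum>a\<in>{k..l}. \<Sum>b\<in>B. f (seg k a \<sigma>) i b * h (seg a l \<sigma>) b j)"
proof -
  have "star B f h (seg k l \<sigma>) i j = (\<Sum>p<Suc l - k. \<Sum>b\<in>B. f (seg k (k + p) \<sigma>) i b * h (seg (k + p) l \<sigma>) b j)"
    unfolding star_def length_seg[OF assms(2)]
    by (intro sum.cong refl) (use assms in \<open>auto simp: take_seg drop_seg\<close>)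
  also have "\<dots> = (\<Sum>a\<in>{k..l}. \<Sum>b\<in>B. f (seg k a \<sigma>) i b * h (seg a l \<sigma>) b j)"
    by (rule sum.reindex_bij_witness[of _ "\<lambda>a. a - k" "\<lambda>p. k + p"]) (use assms in auto)
  finally show ?thesis .
qed

text \<open>A cut of the arc falls before or after the wrap-around. In the first case the left
  factor is an ordinary segment and the right one an arc, in the second case it is the other way
  round.\<close>

lemma star_rot:
  assumes "k \<le> l" "l < length \<sigma>"
  shows "star B f h (rot k l \<sigma>) i j =
     (\<Sum>a\<in>{l..<length \<sigma>}. \<Sum>b\<in>B. f (seg l a \<sigma>) i b * h (rot k a \<sigma>) b j) +
     (\<Sum>a\<in>{..k}. \<Sum>b\<in>B. f (rot a l \<sigma>) i b * h (seg a k \<sigma>) b j)"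
proof -
  let ?N = "length \<sigma>"
  let ?t = "\<lambda>p. \<Sum>b\<in>B. f (take (Suc p) (rot k l \<sigma>)) i b * h (drop p (rot k l \<sigma>)) b j"
  have len: "length (rot k l \<sigma>) = (?N - l) + Suc k" using assms by (simp add: length_rot)
  have sp: "{..<(?N - l) + Suc k} = {..<?N - l} \<union> {?N - l..<(?N - l) + Suc k}" by auto
  have "star B f h (rot k l \<sigma>) i j = (\<Sum>p<?N - l. ?t p) + (\<Sum>p\<in>{?N - l..<(?N - l) + Suc k}. ?t p)"
    unfolding star_def len sp by (rule sum.union_disjoint) auto
  also have "(\<Sum>p<?N - l. ?t p) = (\<Sum>a\<in>{l..<?N}. \<Sum>b\<in>B. f (seg l a \<sigma>) i b * h (rot k a \<sigma>) b j)"
    by (rule sum.reindex_bij_witness[of _ "\<lambda>a. a - l" "\<lambda>p. l + p"])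
       (use assms in \<open>auto simp: take_rot1 drop_rot1\<close>)
  also have "(\<Sum>p\<in>{?N - l..<(?N - l) + Suc k}. ?t p) = (\<Sum>a\<in>{..k}. \<Sum>b\<in>B. f (rot a l \<sigma>) i b * h (seg a k \<sigma>) b j)"
  proof (rule sum.reindex_bij_witness[of _ "\<lambda>a. ?N - l + a" "\<lambda>p. p - (?N - l)"])
    fix p assume "p \<in> {?N - l..<(?N - l) + Suc k}"
    then have "\<exists>a. p = ?N - l + a \<and> a \<le> k" by (intro exI[of _ "p - (?N - l)"]) auto
    then obtain a where a: "p = ?N - l + a" "a \<le> k" by blast
    show "(\<Sum>b\<in>B. f (rot (p - (?N - l)) l \<sigma>) i b * h (seg (p - (?N - l)) k \<sigma>) b j) = ?t p"
      unfolding a(1) take_rot2[OF a(2) assms(2)] drop_rot2[OF a(2) assms(2)] by simp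
  qed auto
  finally show ?thesis .
qed

lemma sum_le_swap:
  fixes F :: "nat \<Rightarrow> nat \<Rightarrow> 'c::comm_monoid_add"
  shows "(\<Sum>a\<in>{k..l}. \<Sum>c\<in>{k..a}. F a c) = (\<Sum>c\<in>{k..l}. \<Sum>a\<in>{c..l}. F a c)"
proof -
  have "(\<Sum>a\<in>{k..l}. \<Sum>c | c \<in> {k..l} \<and> c \<le> a. F a c) = (\<Sum>c\<in>{k..l}. \<Sum>a | a \<in> {k..l} \<and> c \<le> a. F a c)"
    by (rule sum.swap_restrict) auto
  moreover have "a \<in> {k..l} \<Longrightarrow> {c. c \<in> {k..l} \<and> c \<le> a} = {k..a}" for a by auto
  moreover have "c \<in> {k..l} \<Longrightarrow> {a. a \<in> {k..l} \<and> c \<le> a} = {c..l}" for c by auto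
  ultimately show ?thesis by simp
qed

text \<open>Both sides sum over pairs of cuts \<open>c \<le> a\<close> and differ in the order of
  summation only.\<close>

lemma star_assoc: "star B (star B f g) h \<alpha> = star B f (star B g h) \<alpha>"
proof (cases "length \<alpha>")
  case 0 then show ?thesis by (simp add: star_def)
next
  case (Suc N)
  have \<alpha>: "\<alpha> = seg 0 N \<alpha>" using Suc by (simp add: seg_eq_full)
  show ?thesis
  proof (intro ext)
    fix i j
    have "star B (star B f g) h (seg 0 N \<alpha>) i j =
       (\<Sum>a\<in>{0..N}. \<Sum>b\<in>B. (\<Sum>c\<in>{0..a}. \<Sum>d\<in>B. f (seg 0 c \<alpha>) i d * g (seg c a \<alpha>) d b) * h (seg a N \<alpha>) b j)"
      using Suc by (simp add: star_seg)
    also have "\<dots> = (\<Sum>a\<in>{0..N}. \<Sum>c\<in>{0..a}. \<Sum>b\<in>B. \<Sum>d\<in>B. f (seg 0 c \<alpha>) i d * g (seg c a \<alpha>) d b * h (seg a N \<alpha>) b j)"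
    proof (intro sum.cong refl)
      fix a
      have "(\<Sum>b\<in>B. \<Sum>c\<in>{0..a}. \<Sum>d\<in>B. f (seg 0 c \<alpha>) i d * g (seg c a \<alpha>) d b * h (seg a N \<alpha>) b j)
        = (\<Sum>c\<in>{0..a}. \<Sum>b\<in>B. \<Sum>d\<in>B. f (seg 0 c \<alpha>) i d * g (seg c a \<alpha>) d b * h (seg a N \<alpha>) b j)"
        by (rule sum.swap)
      then show "(\<Sum>b\<in>B. (\<Sum>c\<in>{0..a}. \<Sum>d\<in>B. f (seg 0 c \<alpha>) i d * g (seg c a \<alpha>) d b) * h (seg a N \<alpha>) b j)
        = (\<Sum>c\<in>{0..a}. \<Sum>b\<in>B. \<Sum>d\<in>B. f (seg 0 c \<alpha>) i d * g (seg c a \<alpha>) d b * h (seg a N \<alpha>) b j)"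
        by (simp add: sum_distrib_right)
    qed
    also have "\<dots> = (\<Sum>c\<in>{0..N}. \<Sum>a\<in>{c..N}. \<Sum>b\<in>B. \<Sum>d\<in>B. f (seg 0 c \<alpha>) i d * g (seg c a \<alpha>) d b * h (seg a N \<alpha>) b j)"
      by (rule sum_le_swap)
    also have "\<dots> = (\<Sum>c\<in>{0..N}. \<Sum>d\<in>B. f (seg 0 c \<alpha>) i d * (\<Sum>a\<in>{c..N}. \<Sum>b\<in>B. g (seg c a \<alpha>) d b * h (seg a N \<alpha>) b j))"
    proof (intro sum.cong refl)
      fix c assume "c \<in> {0..N}"
      have "(\<Sum>a\<in>{c..N}. \<Sum>b\<in>B. \<Sum>d\<in>B. f (seg 0 c \<alpha>) i d * g (seg c a \<alpha>) d b * h (seg a N \<alpha>) b j)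
        = (\<Sum>d\<in>B. \<Sum>a\<in>{c..N}. \<Sum>b\<in>B. f (seg 0 c \<alpha>) i d * g (seg c a \<alpha>) d b * h (seg a N \<alpha>) b j)"
        by (subst sum.swap[of _ B B], subst sum.swap[of _ B "{c..N}"]) (rule refl)
      then show "(\<Sum>a\<in>{c..N}. \<Sum>b\<in>B. \<Sum>d\<in>B. f (seg 0 c \<alpha>) i d * g (seg c a \<alpha>) d b * h (seg a N \<alpha>) b j)
        = (\<Sum>d\<in>B. f (seg 0 c \<alpha>) i d * (\<Sum>a\<in>{c..N}. \<Sum>b\<in>B. g (seg c a \<alpha>) d b * h (seg a N \<alpha>) b j))"
        by (simp add: sum_distrib_left mult.assoc)
    qed
    also have "\<dots> = star B f (star B g h) (seg 0 N \<alpha>) i j"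
      using Suc by (simp add: star_seg)
    finally show "star B (star B f g) h \<alpha> i j = star B f (star B g h) \<alpha> i j"
      using \<alpha> by simp
  qed
qed

lemma homogD: "homog c f \<Longrightarrow> f \<alpha> i j \<noteq> 0 \<Longrightarrow> \<alpha> \<noteq> [] \<Longrightarrow> fst i - fst j = c + 1 - int (length \<alpha>)"
  unfolding homog_def by blast

text \<open>A cut \<open>q\<close> of a face is a vertex other than the deleted vertex
  \<open>a\<close>, so \<open>a\<close> is inner in the right factor for \<open>q < a\<close> and
  inner in the left factor for \<open>a < q\<close>. These are exactly the ranges of the two terms
  on the right.\<close>

lemma del_star:
  assumes f: "homog c f" and \<alpha>: "\<alpha> \<noteq> []"
  shows "del (star B f h) \<alpha> i j = star B (del f) h \<alpha> i j + msign c * star B f (del h) \<alpha> i j"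
proof -
  define N where "N = length \<alpha> - 1"
  have len: "length \<alpha> = Suc N" using \<alpha> by (simp add: N_def)
  \<comment> \<open>In \<open>U\<close> the deleted vertex belongs to the right factor, in
    \<open>V\<close> to the left one. The cut \<open>q\<close> counts positions of
    \<open>\<alpha>\<close>, not of the face.\<close>
  define U where "U a q = (\<Sum>b\<in>B. f (take (Suc q) \<alpha>) i b * h (face (a - q) (drop q \<alpha>)) b j)" for a q
  define V where "V a q = (\<Sum>b\<in>B. f (face a (take (Suc q) \<alpha>)) i b * h (drop q \<alpha>) b j)" for a q
  have st: "star B f h (face a \<alpha>) i j = (\<Sum>q<a. U a q) + (\<Sum>q\<in>{a<..N}. V a q)" if a: "a \<in> {1..<N}" for a
  proof -
    let ?t = "\<lambda>p. \<Sum>b\<in>B. f (take (Suc p) (face a \<alpha>)) i b * h (drop p (face a \<alpha>)) b j"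
    have "length (face a \<alpha>) = N" using a len by (simp add: length_face)
    then have "star B f h (face a \<alpha>) i j = (\<Sum>p<N. ?t p)" by (simp add: star_def)
    also have "{..<N} = {..<a} \<union> {a..<N}" using a by auto
    also have "(\<Sum>p\<in>{..<a} \<union> {a..<N}. ?t p) = (\<Sum>p<a. ?t p) + (\<Sum>p\<in>{a..<N}. ?t p)"
      by (rule sum.union_disjoint) auto
    also have "(\<Sum>p<a. ?t p) = (\<Sum>q<a. U a q)"
      using a len by (intro sum.cong refl) (simp add: U_def take_face drop_face')
    also have "(\<Sum>p\<in>{a..<N}. ?t p) = (\<Sum>q\<in>{a<..N}. V a q)"
    proof (rule sum.reindex_bij_witness[of _ "\<lambda>q. q - 1" Suc])
      fix p assume p: "p \<in> {a..<N}"
      have "take (Suc p) (face a \<alpha>) = face a (take (Suc (Suc p)) \<alpha>)"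
        using p len by (intro take_face') auto
      moreover have "drop p (face a \<alpha>) = drop (Suc p) \<alpha>"
        using drop_face[of a "Suc p" \<alpha>] p len by simp
      ultimately show "V a (Suc p) = ?t p" by (simp add: V_def)
    qed auto
    finally show ?thesis .
  qed
  have "del (star B f h) \<alpha> i j = (\<Sum>a\<in>{1..<N}. \<Sum>q | q \<in> {..N} \<and> q < a. msign (fst i + int (a - 1)) * U a q)
     + (\<Sum>a\<in>{1..<N}. \<Sum>q | q \<in> {..N} \<and> a < q. msign (fst i + int (a - 1)) * V a q)"
  proof -
    have "a \<in> {1..<N} \<Longrightarrow> {q. q \<in> {..N} \<and> q < a} = {..<a}" "{q. q \<in> {..N} \<and> a < q} = {a<..N}" for a by auto
    then show ?thesis unfolding del_def len
      by (simp add: st sum.distrib sum_distrib_left distrib_left)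
  qed
  also have "(\<Sum>a\<in>{1..<N}. \<Sum>q | q \<in> {..N} \<and> q < a. msign (fst i + int (a - 1)) * U a q)
    = (\<Sum>q\<in>{..N}. \<Sum>a | a \<in> {1..<N} \<and> q < a. msign (fst i + int (a - 1)) * U a q)"
    by (rule sum.swap_restrict) auto
  also have "\<dots> = msign c * star B f (del h) \<alpha> i j"
  proof -
    have "(\<Sum>a | a \<in> {1..<N} \<and> q < a. msign (fst i + int (a - 1)) * U a q) =
      msign c * (\<Sum>b\<in>B. f (take (Suc q) \<alpha>) i b * del h (drop q \<alpha>) b j)" if q: "q \<le> N" for q
    proof -
      have "(\<Sum>a | a \<in> {1..<N} \<and> q < a. msign (fst i + int (a - 1)) * U a q) =
        (\<Sum>e\<in>{1..<N - q}. \<Sum>b\<in>B. msign (fst i + int (e + q - 1)) * (f (take (Suc q) \<alpha>) i b * h (face e (drop q \<alpha>)) b j))"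
        by (rule sum.reindex_bij_witness[of _ "\<lambda>e. e + q" "\<lambda>a. a - q"]) (auto simp: U_def sum_distrib_left)
      also have "\<dots> = (\<Sum>b\<in>B. \<Sum>e\<in>{1..<N - q}. msign (fst i + int (e + q - 1)) * (f (take (Suc q) \<alpha>) i b * h (face e (drop q \<alpha>)) b j))"
        by (rule sum.swap)
      also have "\<dots> = (\<Sum>b\<in>B. \<Sum>e\<in>{1..<N - q}. msign c * (f (take (Suc q) \<alpha>) i b * (msign (fst b + int (e - 1)) * h (face e (drop q \<alpha>)) b j)))"
      proof (intro sum.cong refl)
        fix b :: "int \<times> nat" and e assume e: "e \<in> {1..<N - q}"
        show "msign (fst i + int (e + q - 1)) * (f (take (Suc q) \<alpha>) i b * h (face e (drop q \<alpha>)) b j) =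
          msign c * (f (take (Suc q) \<alpha>) i b * (msign (fst b + int (e - 1)) * h (face e (drop q \<alpha>)) b j))"
        proof (cases "f (take (Suc q) \<alpha>) i b = 0")
          case False
          \<comment> \<open>The row sign has to move from \<open>i\<close> to the inner index
            \<open>b\<close>. A nonzero entry of \<open>f\<close> makes their difference
            \<open>c - q\<close>, where \<open>q\<close> cancels against the shift of the face index
            and \<open>c\<close> gives the sign of the Leibniz rule.\<close>
          then have "fst i - fst b = c - int q"
            using homogD[OF f] \<alpha> q len by fastforce
          then have i: "fst i = c - int q + fst b" by simp
          have "msign (fst i + int (e + q - 1)) = msign (c + (fst b + int (e - 1)))"
            unfolding i using e by (intro msign_eqI) (simp add: of_nat_diff)
          then show ?thesis by (simp add: msign_add)
        qed simp
      qed
      finally show ?thesis using len q by (simp add: del_def sum_distrib_left)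
    qed
    then show ?thesis by (simp add: star_def len sum_distrib_left lessThan_Suc_atMost)
  qed
  also have "(\<Sum>a\<in>{1..<N}. \<Sum>q | q \<in> {..N} \<and> a < q. msign (fst i + int (a - 1)) * V a q) =
    (\<Sum>q\<in>{..N}. \<Sum>a | a \<in> {1..<N} \<and> a < q. msign (fst i + int (a - 1)) * V a q)"
    by (rule sum.swap_restrict) auto
  also have "\<dots> = star B (del f) h \<alpha> i j"
  proof -
    have "(\<Sum>a | a \<in> {1..<N} \<and> a < q. msign (fst i + int (a - 1)) * V a q) =
      (\<Sum>b\<in>B. del f (take (Suc q) \<alpha>) i b * h (drop q \<alpha>) b j)" if q: "q \<le> N" for q
    proof -
      have "{a \<in> {1..<N}. a < q} = {1..<length (take (Suc q) \<alpha>) - 1}" using q len by auto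
      then have "(\<Sum>a | a \<in> {1..<N} \<and> a < q. msign (fst i + int (a - 1)) * V a q) =
        (\<Sum>a\<in>{1..<length (take (Suc q) \<alpha>) - 1}. \<Sum>b\<in>B. msign (fst i + int (a - 1)) * f (face a (take (Suc q) \<alpha>)) i b * h (drop q \<alpha>) b j)"
        by (simp add: V_def sum_distrib_left mult.assoc)
      also have "\<dots> = (\<Sum>b\<in>B. \<Sum>a\<in>{1..<length (take (Suc q) \<alpha>) - 1}. msign (fst i + int (a - 1)) * f (face a (take (Suc q) \<alpha>)) i b * h (drop q \<alpha>) b j)"
        by (rule sum.swap)
      finally show ?thesis by (simp add: del_def sum_distrib_right)
    qed
    then show ?thesis by (simp add: star_def len lessThan_Suc_atMost)
  qed
  finally show ?thesis by simp
qed

section \<open>The trace of a Maurer--Cartan family\<close>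

text \<open>The trace as the twists leave it: the ordinary trace of the product for even
  \<open>m\<close>, the supertrace for odd \<open>m\<close>.\<close>

definition mtr :: "gbasis \<Rightarrow> int \<Rightarrow> gmat \<Rightarrow> gmat \<Rightarrow> complex" where
  "mtr B m X Y = (\<Sum>i\<in>B. \<Sum>j\<in>B. msign (m * fst i) * X i j * Y j i)"

text \<open>The twisted form of \<open>Tr\<close> (see \<open>Tr_eq_ttr\<close>). Of the sign there
  only the exponent \<open>m * k\<close> survives, apart from the sign inside
  \<open>mtr\<close>.\<close>

definition ttr :: "gbasis \<Rightarrow> int \<Rightarrow> ('v list \<Rightarrow> gmat) \<Rightarrow> ('v list \<Rightarrow> gmat) \<Rightarrow> 'v list \<Rightarrow> complex" where
  "ttr B m Q g \<sigma> = (\<Sum>l<length \<sigma>. \<Sum>k\<le>l. msign (m * int k) * mtr B m (Q (seg k l \<sigma>)) (g (rot k l \<sigma>)))"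

text \<open>The position that vertex \<open>x\<close> of the full sequence has in the face without
  vertex \<open>a\<close>, for \<open>x\<close> other than \<open>a\<close>.\<close>

definition skip :: "nat \<Rightarrow> nat \<Rightarrow> nat" where
  "skip a x = (if x < a then x else x - 1)"

lemma sum_skip:
  assumes "a \<le> N"
  shows "(\<Sum>x<N. F x) = (\<Sum>x\<in>{..N} - {a}. F (skip a x))"
  by (rule sum.reindex_bij_witness[of _ "skip a" "\<lambda>x. if x < a then x else Suc x"])
     (use assms in \<open>auto simp: skip_def\<close>)

lemma sum_skip_le:
  assumes "l \<noteq> a"
  shows "(\<Sum>x\<le>skip a l. F x) = (\<Sum>x\<in>{..l} - {a}. F (skip a x))"
  by (rule sum.reindex_bij_witness[of _ "skip a" "\<lambda>x. if x < a then x else Suc x"])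
     (use assms in \<open>auto simp: skip_def split: if_splits\<close>)

lemma sum_le_swap':
  fixes F :: "nat \<Rightarrow> nat \<Rightarrow> 'c::comm_monoid_add"
  shows "(\<Sum>l\<le>N. \<Sum>k\<le>l. F k l) = (\<Sum>k\<le>N. \<Sum>l\<in>{k..N}. F k l)"
  using sum_le_swap[of "\<lambda>l k. F k l" 0 N] by (simp add: atMost_atLeast0)

text \<open>The length \<open>m + 2\<close> is tied to the degree \<open>m\<close> of
  \<open>Q\<close>: the faces after \<open>l\<close> and those before \<open>k\<close> combine to
  one \<open>del G\<close> on the arc only because the sign acquired at the wrap-around depends on
  the length, whose parity is that of \<open>m\<close>.\<close>

lemma ttr_closed:
  fixes Q G :: "'v list \<Rightarrow> gmat" and m :: nat
  assumes B: "finite B" and len: "length \<sigma> = m + 2"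
    and hG: "homog 1 G" and hQ: "homog (int m) Q"
    and mc: "\<And>\<alpha> i j. \<alpha> \<noteq> [] \<Longrightarrow> set \<alpha> \<subseteq> set \<sigma> \<Longrightarrow> i \<in> B \<Longrightarrow> j \<in> B \<Longrightarrow> del G \<alpha> i j = star B G G \<alpha> i j"
    and dQ: "\<And>\<alpha> i j. \<alpha> \<noteq> [] \<Longrightarrow> set \<alpha> \<subseteq> set \<sigma> \<Longrightarrow> i \<in> B \<Longrightarrow> j \<in> B \<Longrightarrow>
      del Q \<alpha> i j = star B G Q \<alpha> i j - msign (int m) * star B Q G \<alpha> i j"
  shows "(\<Sum>a<m + 2. msign (int a) * ttr B (int m) Q G (face a \<sigma>)) = 0"
proof -
  define N where "N = m + 1"
  define M where "M = int m"
  have lenN: "length \<sigma> = Suc N" using len by (simp add: N_def)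
  have subs: "seg k l \<sigma> \<noteq> []" "set (seg k l \<sigma>) \<subseteq> set \<sigma>" "rot k l \<sigma> \<noteq> []" "set (rot k l \<sigma>) \<subseteq> set \<sigma>"
    if "k \<le> l" "l \<le> N" for k l
    using that lenN length_seg[of l \<sigma> k] length_rot[of l \<sigma> k]
    by (auto simp: seg_def rot_def dest!: in_set_takeD in_set_dropD)
  \<comment> \<open>The summands of all faces are indexed by cuts of the full sequence, so that
    different faces can be compared; \<open>skip\<close> translates the cuts.\<close>
  define E where "E a k l = msign (M * int (skip a k)) *
     mtr B M (Q (seg (skip a k) (skip a l) (face a \<sigma>))) (G (rot (skip a k) (skip a l) (face a \<sigma>)))" for a k l
  have ttr_face: "ttr B M Q G (face a \<sigma>) = (\<Sum>l\<in>{..N} - {a}. \<Sum>k\<in>{..l} - {a}. E a k l)" if "a \<le> N" for a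
  proof -
    have "length (face a \<sigma>) = N" using that lenN by (simp add: length_face)
    then show ?thesis unfolding ttr_def E_def using that by (simp add: sum_skip sum_skip_le)
  qed
  have rng: "{..<m + 2} = {..N}" by (auto simp: N_def)
  have "(\<Sum>a<m + 2. msign (int a) * ttr B (int m) Q G (face a \<sigma>)) =
      (\<Sum>a\<le>N. \<Sum>l\<in>{..N} - {a}. \<Sum>k\<in>{..l} - {a}. msign (int a) * E a k l)"
    unfolding rng M_def[symmetric] by (intro sum.cong refl) (simp add: ttr_face sum_distrib_left)
  also have "\<dots> = (\<Sum>a\<le>N. \<Sum>l\<le>N. \<Sum>k\<le>l. if a \<noteq> k \<and> a \<noteq> l then msign (int a) * E a k l else 0)"
  proof (rule sum.cong[OF refl])
    fix a
    have "(\<Sum>l\<in>{..N} - {a}. \<Sum>k\<in>{..l} - {a}. msign (int a) * E a k l) =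
       (\<Sum>l\<in>{..N} - {a}. \<Sum>k\<le>l. if a \<noteq> k \<and> a \<noteq> l then msign (int a) * E a k l else 0)"
      by (intro sum.cong refl sum.mono_neutral_cong_left) auto
    also have "\<dots> = (\<Sum>l\<le>N. \<Sum>k\<le>l. if a \<noteq> k \<and> a \<noteq> l then msign (int a) * E a k l else 0)"
      by (intro sum.mono_neutral_left) auto
    finally show "(\<Sum>l\<in>{..N} - {a}. \<Sum>k\<in>{..l} - {a}. msign (int a) * E a k l) =
       (\<Sum>l\<le>N. \<Sum>k\<le>l. if a \<noteq> k \<and> a \<noteq> l then msign (int a) * E a k l else 0)" .
  qed
  also have "\<dots> = (\<Sum>l\<le>N. \<Sum>a\<le>N. \<Sum>k\<le>l. if a \<noteq> k \<and> a \<noteq> l then msign (int a) * E a k l else 0)"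
    by (rule sum.swap)
  also have "\<dots> = (\<Sum>l\<le>N. \<Sum>k\<le>l. \<Sum>a\<le>N. if a \<noteq> k \<and> a \<noteq> l then msign (int a) * E a k l else 0)"
    by (rule sum.cong[OF refl], rule sum.swap)
  \<comment> \<open>For fixed cuts the sum over \<open>a\<close> amounts to applying
    \<open>del\<close> to each factor in turn. The row sign of \<open>del\<close> is absorbed into
    the trace, which turns \<open>M\<close> into \<open>M + 1\<close>.\<close>
  also have "\<dots> = (\<Sum>l\<le>N. \<Sum>k\<le>l. msign ((M + 1) * int k + 1) * mtr B (M + 1) (del Q (seg k l \<sigma>)) (G (rot k l \<sigma>))
       + msign ((M + 1) * (int k + 1)) * mtr B (M + 1) (Q (seg k l \<sigma>)) (del G (rot k l \<sigma>)))"
  proof (intro sum.cong refl)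
    fix l k assume "l \<in> {..N}" "k \<in> {..l}"
    then have kl: "k \<le> l" "l \<le> N" by auto
    let ?e = "\<lambda>a. if a \<noteq> k \<and> a \<noteq> l then msign (int a) * E a k l else 0"
    have sp: "(\<Sum>a\<le>N. ?e a) = (\<Sum>a\<in>{k<..<l}. ?e a) + ((\<Sum>a\<in>{l<..N}. ?e a) + (\<Sum>a<k. ?e a))"
    proof -
      have "(\<Sum>a\<le>N. ?e a) = (\<Sum>a\<in>{k<..<l} \<union> ({l<..N} \<union> {..<k}). ?e a)"
        by (rule sum.mono_neutral_right) (use kl in auto)
      then show ?thesis using kl by (subst (asm) sum.union_disjoint, simp, simp, force)
         (subst (asm) sum.union_disjoint, auto)
    qed
    have mid: "(\<Sum>a\<in>{k<..<l}. ?e a) = msign ((M + 1) * int k + 1) * mtr B (M + 1) (del Q (seg k l \<sigma>)) (G (rot k l \<sigma>))"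
    proof -
      have "(\<Sum>a\<in>{k<..<l}. ?e a) = (\<Sum>b\<in>{1..<l - k}. msign (int (k + b)) * msign (M * int k) * mtr B M (Q (face b (seg k l \<sigma>))) (G (rot k l \<sigma>)))"
        by (rule sum.reindex_bij_witness[of _ "\<lambda>b. k + b" "\<lambda>a. a - k"])
          (use kl lenN in \<open>auto simp: E_def skip_def seg_face_mid[unfolded One_nat_def] rot_face_mid[unfolded One_nat_def]\<close>)
      also have "\<dots> = (\<Sum>b\<in>{1..<l - k}. \<Sum>i\<in>B. \<Sum>j\<in>B. msign ((M + 1) * int k + 1) * (msign ((M + 1) * fst i) *
          (msign (fst i + int (b - 1)) * Q (face b (seg k l \<sigma>)) i j) * G (rot k l \<sigma>) j i))"
        unfolding mtr_def sum_distrib_left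
      proof (intro sum.cong refl)
        fix b and i j :: "int \<times> nat" assume b: "b \<in> {1..<l - k}"
        have "msign (int (k + b)) * msign (M * int k) * msign (M * fst i) =
          msign ((M + 1) * int k + 1) * msign ((M + 1) * fst i) * msign (fst i + int (b - 1))"
          unfolding msign_add[symmetric] using b by (intro msign_eqI) (auto simp: of_nat_diff)
        then show "msign (int (k + b)) * msign (M * int k) * (msign (M * fst i) * Q (face b (seg k l \<sigma>)) i j * G (rot k l \<sigma>) j i) =
          msign ((M + 1) * int k + 1) * (msign ((M + 1) * fst i) *
          (msign (fst i + int (b - 1)) * Q (face b (seg k l \<sigma>)) i j) * G (rot k l \<sigma>) j i)"
          by (simp only: mult.assoc[symmetric])
      qed
      also have "\<dots> = (\<Sum>i\<in>B. \<Sum>j\<in>B. \<Sum>b\<in>{1..<l - k}. msign ((M + 1) * int k + 1) * (msign ((M + 1) * fst i) *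
          (msign (fst i + int (b - 1)) * Q (face b (seg k l \<sigma>)) i j) * G (rot k l \<sigma>) j i))"
        by (subst sum.swap[of _ B], intro sum.cong refl, rule sum.swap)
      also have "\<dots> = msign ((M + 1) * int k + 1) * mtr B (M + 1) (del Q (seg k l \<sigma>)) (G (rot k l \<sigma>))"
        using kl lenN by (simp add: mtr_def del_def length_seg sum_distrib_left sum_distrib_right)
      finally show ?thesis .
    qed
    \<comment> \<open>\<open>R b\<close> belongs to the face of the arc at position
      \<open>b\<close>. The vertices after \<open>l\<close> occupy the positions \<open>1\<close> to
      \<open>N - l\<close>, and vertex \<open>a\<close> before \<open>k\<close> has position
      \<open>Suc N - l + a\<close>.\<close>
    define R where "R b = msign (M * int k + int l + int b) * mtr B M (Q (seg k l \<sigma>)) (G (face b (rot k l \<sigma>)))" for b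
    have hi: "(\<Sum>a\<in>{l<..N}. ?e a) = (\<Sum>b\<in>{1..<Suc N - l}. R b)"
    proof (rule sum.reindex_bij_witness[of _ "\<lambda>b. l + b" "\<lambda>a. a - l"])
      fix a assume a: "a \<in> {l<..N}"
      then show "R (a - l) = ?e a" using kl lenN
        by (auto simp: R_def E_def skip_def seg_face_high rot_face_high msign_add mult_ac of_nat_diff)
    qed (use kl in auto)
    have lo: "(\<Sum>a<k. ?e a) = (\<Sum>b\<in>{Suc N - l..<Suc N - l + k}. R b)"
    proof (rule sum.reindex_bij_witness[of _ "\<lambda>b. b - (Suc N - l)" "\<lambda>a. Suc N - l + a"])
      fix a assume a: "a \<in> {..<k}"
      have sgn: "msign (M * int k + int l + int (Suc N - l + a)) = msign (int a) * msign (M * (int k - 1))"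
        unfolding msign_add[symmetric] using kl
        by (intro msign_eqI) (auto simp: of_nat_diff N_def M_def algebra_simps)
      show "R (Suc N - l + a) = ?e a"
        unfolding R_def sgn using a kl lenN
        by (auto simp: E_def skip_def seg_face_low[unfolded One_nat_def] rot_face_low[unfolded One_nat_def] of_nat_diff)
    qed (use kl in auto)
    have "(\<Sum>a\<in>{l<..N}. ?e a) + (\<Sum>a<k. ?e a) = (\<Sum>b\<in>{1..<length (rot k l \<sigma>) - 1}. R b)"
      unfolding hi lo by (subst sum.union_disjoint[symmetric]) (use kl lenN in \<open>auto simp: length_rot intro!: sum.cong\<close>)
    also have "\<dots> = (\<Sum>b\<in>{1..<length (rot k l \<sigma>) - 1}. \<Sum>i\<in>B. \<Sum>j\<in>B. msign ((M + 1) * (int k + 1)) * (msign ((M + 1) * fst i) * Q (seg k l \<sigma>) i j *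
          (msign (fst j + int (b - 1)) * G (face b (rot k l \<sigma>)) j i)))"
      unfolding mtr_def sum_distrib_left R_def
    proof (intro sum.cong refl)
      fix b and i j :: "int \<times> nat" assume b: "b \<in> {1..<length (rot k l \<sigma>) - 1}"
      show "msign (M * int k + int l + int b) * (msign (M * fst i) * Q (seg k l \<sigma>) i j * G (face b (rot k l \<sigma>)) j i) =
         msign ((M + 1) * (int k + 1)) * (msign ((M + 1) * fst i) * Q (seg k l \<sigma>) i j *
          (msign (fst j + int (b - 1)) * G (face b (rot k l \<sigma>)) j i))"
      proof (cases "Q (seg k l \<sigma>) i j = 0")
        case False
        \<comment> \<open>\<open>del G\<close> needs the degree of \<open>j\<close>, the row of
          \<open>G\<close>, while the trace carries that of \<open>i\<close>, the row of
          \<open>Q\<close>. A nonzero entry of \<open>Q\<close> fixes the difference.\<close>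
        then have "fst i - fst j = M - (int l - int k)"
          using homogD[OF hQ False subs(1)[OF kl]] kl lenN by (simp add: M_def length_seg of_nat_diff)
        then have i: "fst i = fst j + M - (int l - int k)" by simp
        have "msign (M * int k + int l + int b) * msign (M * fst i) =
          msign ((M + 1) * (int k + 1)) * msign ((M + 1) * fst i) * msign (fst j + int (b - 1))"
          unfolding msign_add[symmetric] i using b by (intro msign_eqI) (auto simp: of_nat_diff)
        then show ?thesis by (simp add: mult_ac)
      qed simp
    qed
    also have "\<dots> = (\<Sum>i\<in>B. \<Sum>j\<in>B. \<Sum>b\<in>{1..<length (rot k l \<sigma>) - 1}. msign ((M + 1) * (int k + 1)) * (msign ((M + 1) * fst i) * Q (seg k l \<sigma>) i j *
          (msign (fst j + int (b - 1)) * G (face b (rot k l \<sigma>)) j i)))"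
      by (subst sum.swap[of _ B], intro sum.cong refl, rule sum.swap)
    also have "\<dots> = msign ((M + 1) * (int k + 1)) * mtr B (M + 1) (Q (seg k l \<sigma>)) (del G (rot k l \<sigma>))"
      by (simp add: mtr_def del_def sum_distrib_left)
    finally show "(\<Sum>a\<le>N. ?e a) = msign ((M + 1) * int k + 1) * mtr B (M + 1) (del Q (seg k l \<sigma>)) (G (rot k l \<sigma>))
       + msign ((M + 1) * (int k + 1)) * mtr B (M + 1) (Q (seg k l \<sigma>)) (del G (rot k l \<sigma>))"
      using sp mid by simp
  qed
  also have "\<dots> = 0"
  proof -
    \<comment> \<open>The cyclic words with cuts \<open>k \<le> a \<le> l\<close>, whose third
      factor is always \<open>G\<close> on the arc from \<open>l\<close> round to \<open>k\<close>:
      in \<open>X\<close> the factor \<open>Q\<close> sits on the first segment, in \<open>Y\<close>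
      on the second.\<close>
    define X where "X k a l = (\<Sum>i\<in>B. \<Sum>j\<in>B. \<Sum>b\<in>B. msign ((M + 1) * fst i) * Q (seg k a \<sigma>) i b * G (seg a l \<sigma>) b j * G (rot k l \<sigma>) j i)" for k a l
    define Y where "Y k a l = (\<Sum>i\<in>B. \<Sum>j\<in>B. \<Sum>b\<in>B. msign ((M + 1) * fst i) * G (seg k a \<sigma>) i b * Q (seg a l \<sigma>) b j * G (rot k l \<sigma>) j i)" for k a l
    have 1: "mtr B (M + 1) (del Q (seg k l \<sigma>)) (G (rot k l \<sigma>)) = (\<Sum>a\<in>{k..l}. Y k a l) - msign M * (\<Sum>a\<in>{k..l}. X k a l)"
      if kl: "k \<le> l" "l \<le> N" for k l
    proof -
      have l: "l < length \<sigma>" using kl lenN by simp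
      have "mtr B (M + 1) (del Q (seg k l \<sigma>)) (G (rot k l \<sigma>)) =
        (\<Sum>i\<in>B. \<Sum>j\<in>B. \<Sum>a\<in>{k..l}. \<Sum>b\<in>B. msign ((M + 1) * fst i) * G (seg k a \<sigma>) i b * Q (seg a l \<sigma>) b j * G (rot k l \<sigma>) j i)
        - msign M * (\<Sum>i\<in>B. \<Sum>j\<in>B. \<Sum>a\<in>{k..l}. \<Sum>b\<in>B. msign ((M + 1) * fst i) * Q (seg k a \<sigma>) i b * G (seg a l \<sigma>) b j * G (rot k l \<sigma>) j i)"
        unfolding mtr_def
        by (simp add: dQ subs[OF kl] star_seg[OF kl(1) l] M_def[symmetric] algebra_simps sum_subtractf sum_distrib_left sum_distrib_right)
      moreover have "(\<Sum>i\<in>B. \<Sum>j\<in>B. \<Sum>a\<in>{k..l}. F a i j) = (\<Sum>a\<in>{k..l}. \<Sum>i\<in>B. \<Sum>j\<in>B. F a i j)" for F :: "nat \<Rightarrow> _ \<Rightarrow> _ \<Rightarrow> complex"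
        by (subst sum.swap[of _ B], intro sum.cong refl, rule sum.swap)
      ultimately show ?thesis unfolding X_def Y_def by simp
    qed
    have 2: "mtr B (M + 1) (Q (seg k l \<sigma>)) (del G (rot k l \<sigma>)) = (\<Sum>a\<in>{l..N}. X k l a) + (\<Sum>a\<in>{..k}. msign ((M + 1) * (1 + int k + int a)) * Y a k l)"
      if kl: "k \<le> l" "l \<le> N" for k l
    proof -
      have l: "l < length \<sigma>" using kl lenN by simp
      have rng: "{l..<length \<sigma>} = {l..N}" using lenN by auto
      have sw: "(\<Sum>i\<in>B. \<Sum>j\<in>B. \<Sum>a\<in>S. F a i j) = (\<Sum>a\<in>S. \<Sum>i\<in>B. \<Sum>j\<in>B. F a i j)" for F :: "nat \<Rightarrow> _ \<Rightarrow> _ \<Rightarrow> complex" and S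
        by (subst sum.swap[of _ B], intro sum.cong refl, rule sum.swap)
      have "mtr B (M + 1) (Q (seg k l \<sigma>)) (del G (rot k l \<sigma>)) =
        (\<Sum>i\<in>B. \<Sum>j\<in>B. \<Sum>a\<in>{l..N}. \<Sum>b\<in>B. msign ((M + 1) * fst i) * Q (seg k l \<sigma>) i j * G (seg l a \<sigma>) j b * G (rot k a \<sigma>) b i)
        + (\<Sum>i\<in>B. \<Sum>j\<in>B. \<Sum>a\<in>{..k}. \<Sum>b\<in>B. msign ((M + 1) * fst i) * Q (seg k l \<sigma>) i j * G (rot a l \<sigma>) j b * G (seg a k \<sigma>) b i)"
        unfolding mtr_def
        by (simp add: mc subs[OF kl] star_rot[OF kl(1) l] rng algebra_simps sum.distrib sum_distrib_left sum_distrib_right)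
      also have "(\<Sum>i\<in>B. \<Sum>j\<in>B. \<Sum>a\<in>{l..N}. \<Sum>b\<in>B. msign ((M + 1) * fst i) * Q (seg k l \<sigma>) i j * G (seg l a \<sigma>) j b * G (rot k a \<sigma>) b i)
         = (\<Sum>a\<in>{l..N}. X k l a)"
        unfolding sw X_def by (rule sum.cong[OF refl], rule sum.cong[OF refl], rule sum.swap)
      also have "(\<Sum>i\<in>B. \<Sum>j\<in>B. \<Sum>a\<in>{..k}. \<Sum>b\<in>B. msign ((M + 1) * fst i) * Q (seg k l \<sigma>) i j * G (rot a l \<sigma>) j b * G (seg a k \<sigma>) b i)
         = (\<Sum>a\<in>{..k}. msign ((M + 1) * (1 + int k + int a)) * Y a k l)"
        unfolding sw
      proof (intro sum.cong refl)
        fix a assume a: "a \<in> {..k}"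
        \<comment> \<open>Cyclicity of the trace: \<open>G (seg a k \<sigma>)\<close> moves from the
          last place to the first. The trace sign is then read off at \<open>b\<close> instead of
          \<open>i\<close>, and the degree of this factor gives the difference.\<close>
        have "(\<Sum>i\<in>B. \<Sum>j\<in>B. \<Sum>b\<in>B. msign ((M + 1) * fst i) * Q (seg k l \<sigma>) i j * G (rot a l \<sigma>) j b * G (seg a k \<sigma>) b i)
          = (\<Sum>i\<in>B. \<Sum>j\<in>B. \<Sum>b\<in>B. msign ((M + 1) * (1 + int k + int a)) * (msign ((M + 1) * fst b) * G (seg a k \<sigma>) b i * Q (seg k l \<sigma>) i j * G (rot a l \<sigma>) j b))"
        proof (intro sum.cong refl)
          fix i j b :: "int \<times> nat"
          show "msign ((M + 1) * fst i) * Q (seg k l \<sigma>) i j * G (rot a l \<sigma>) j b * G (seg a k \<sigma>) b i =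
            msign ((M + 1) * (1 + int k + int a)) * (msign ((M + 1) * fst b) * G (seg a k \<sigma>) b i * Q (seg k l \<sigma>) i j * G (rot a l \<sigma>) j b)"
          proof (cases "G (seg a k \<sigma>) b i = 0")
            case False
            then have "fst b - fst i = 1 - (int k - int a)"
              using homogD[OF hG False] subs(1)[of a k] a kl lenN by (simp add: length_seg of_nat_diff)
            then have b: "fst b = fst i + 1 - (int k - int a)" by simp
            have "msign ((M + 1) * fst i) = msign ((M + 1) * (1 + int k + int a)) * msign ((M + 1) * fst b)"
              unfolding msign_add[symmetric] b by (intro msign_eqI) auto
            then show ?thesis by (simp add: mult_ac)
          qed simp
        qed
        also have "\<dots> = msign ((M + 1) * (1 + int k + int a)) * (\<Sum>i\<in>B. \<Sum>j\<in>B. \<Sum>b\<in>B. msign ((M + 1) * fst b) * G (seg a k \<sigma>) b i * Q (seg k l \<sigma>) i j * G (rot a l \<sigma>) j b)"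
          by (simp add: sum_distrib_left)
        also have "(\<Sum>i\<in>B. \<Sum>j\<in>B. \<Sum>b\<in>B. msign ((M + 1) * fst b) * G (seg a k \<sigma>) b i * Q (seg k l \<sigma>) i j * G (rot a l \<sigma>) j b) =
           (\<Sum>i\<in>B. \<Sum>b\<in>B. \<Sum>j\<in>B. msign ((M + 1) * fst b) * G (seg a k \<sigma>) b i * Q (seg k l \<sigma>) i j * G (rot a l \<sigma>) j b)"
          by (rule sum.cong[OF refl], rule sum.swap)
        also have "\<dots> = (\<Sum>b\<in>B. \<Sum>i\<in>B. \<Sum>j\<in>B. msign ((M + 1) * fst b) * G (seg a k \<sigma>) b i * Q (seg k l \<sigma>) i j * G (rot a l \<sigma>) j b)"
          by (rule sum.swap)
        also have "\<dots> = Y a k l" unfolding Y_def by (rule sum.cong[OF refl], rule sum.swap)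
        finally show "(\<Sum>i\<in>B. \<Sum>j\<in>B. \<Sum>b\<in>B. msign ((M + 1) * fst i) * Q (seg k l \<sigma>) i j * G (rot a l \<sigma>) j b * G (seg a k \<sigma>) b i)
          = msign ((M + 1) * (1 + int k + int a)) * Y a k l" .
      qed
      finally show ?thesis .
    qed
    have "(\<Sum>l\<le>N. \<Sum>k\<le>l. msign ((M + 1) * int k + 1) * mtr B (M + 1) (del Q (seg k l \<sigma>)) (G (rot k l \<sigma>))
       + msign ((M + 1) * (int k + 1)) * mtr B (M + 1) (Q (seg k l \<sigma>)) (del G (rot k l \<sigma>))) =
       (\<Sum>l\<le>N. \<Sum>k\<le>l. \<Sum>a\<in>{k..l}. msign ((M + 1) * int k + 1) * Y k a l) +
       (\<Sum>l\<le>N. \<Sum>k\<le>l. \<Sum>a\<in>{..k}. msign ((M + 1) * int a) * Y a k l) +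
       ((\<Sum>l\<le>N. \<Sum>k\<le>l. \<Sum>a\<in>{k..l}. msign ((M + 1) * int k + M) * X k a l) +
       (\<Sum>l\<le>N. \<Sum>k\<le>l. \<Sum>a\<in>{l..N}. msign ((M + 1) * (int k + 1)) * X k l a))"
      unfolding sum.distrib[symmetric]
    proof (intro sum.cong refl)
      fix l k assume "l \<in> {..N}" "k \<in> {..l}"
      then have kl: "k \<le> l" "l \<le> N" by auto
      have s1: "msign ((M + 1) * (int k + 1)) * msign ((M + 1) * (1 + int k + int a)) = msign ((M + 1) * int a)" for a
        unfolding msign_add[symmetric] by (intro msign_eqI) auto
      have s2: "msign ((M + 1) * int k + M) = - (msign ((M + 1) * int k + 1) * msign M)"
        by (simp add: msign_add)
      show "msign ((M + 1) * int k + 1) * mtr B (M + 1) (del Q (seg k l \<sigma>)) (G (rot k l \<sigma>))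
       + msign ((M + 1) * (int k + 1)) * mtr B (M + 1) (Q (seg k l \<sigma>)) (del G (rot k l \<sigma>)) =
       (\<Sum>a\<in>{k..l}. msign ((M + 1) * int k + 1) * Y k a l) +
       (\<Sum>a\<in>{..k}. msign ((M + 1) * int a) * Y a k l) +
       ((\<Sum>a\<in>{k..l}. msign ((M + 1) * int k + M) * X k a l) +
       (\<Sum>a\<in>{l..N}. msign ((M + 1) * (int k + 1)) * X k l a))"
        unfolding 1[OF kl] 2[OF kl] s2 distrib_left right_diff_distrib sum_distrib_left s1[symmetric]
        by (simp add: sum_distrib_left sum_negf mult.assoc)
    qed
    \<comment> \<open>Renaming the two smaller cuts shows that the \<open>Y\<close> terms from
      \<open>del G\<close> are the negatives of those from \<open>del Q\<close>. The
      \<open>X\<close> terms are matched next, by renaming the two larger cuts.\<close>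
    also have "(\<Sum>l\<le>N. \<Sum>k\<le>l. \<Sum>a\<in>{..k}. msign ((M + 1) * int a) * Y a k l) =
       - (\<Sum>l\<le>N. \<Sum>k\<le>l. \<Sum>a\<in>{k..l}. msign ((M + 1) * int k + 1) * Y k a l)"
    proof -
      have "(\<Sum>l\<le>N. \<Sum>k\<le>l. \<Sum>a\<in>{..k}. msign ((M + 1) * int a) * Y a k l) = (\<Sum>l\<le>N. \<Sum>k\<le>l. \<Sum>a\<in>{k..l}. msign ((M + 1) * int k) * Y k a l)"
        by (rule sum.cong[OF refl], rule sum_le_swap')
      then show ?thesis by (simp add: msign_add sum_negf)
    qed
    also have "(\<Sum>l\<le>N. \<Sum>k\<le>l. \<Sum>a\<in>{l..N}. msign ((M + 1) * (int k + 1)) * X k l a) =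
       - (\<Sum>l\<le>N. \<Sum>k\<le>l. \<Sum>a\<in>{k..l}. msign ((M + 1) * int k + M) * X k a l)"
    proof -
      have "(\<Sum>l\<le>N. \<Sum>k\<le>l. \<Sum>a\<in>{l..N}. msign ((M + 1) * (int k + 1)) * X k l a) =
         (\<Sum>k\<le>N. \<Sum>l\<in>{k..N}. \<Sum>a\<in>{l..N}. msign ((M + 1) * (int k + 1)) * X k l a)"
        by (rule sum_le_swap')
      also have "\<dots> = (\<Sum>k\<le>N. \<Sum>a\<in>{k..N}. \<Sum>l\<in>{k..a}. msign ((M + 1) * (int k + 1)) * X k l a)"
        by (rule sum.cong[OF refl], rule sum_le_swap[symmetric])
      also have "\<dots> = (\<Sum>a\<le>N. \<Sum>k\<le>a. \<Sum>l\<in>{k..a}. msign ((M + 1) * (int k + 1)) * X k l a)"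
        by (rule sum_le_swap'[symmetric])
      finally show ?thesis by (simp add: msign_add sum_negf distrib_left)
    qed
    finally show ?thesis by simp
  qed
  finally show ?thesis .
qed

section \<open>Convolution powers and their differential\<close>

lemma star_cong:
  assumes "\<And>\<beta> i j. \<beta> \<noteq> [] \<Longrightarrow> set \<beta> \<subseteq> set \<alpha> \<Longrightarrow> i \<in> B \<Longrightarrow> j \<in> B \<Longrightarrow> f \<beta> i j = f' \<beta> i j"
    and "\<And>\<beta> i j. \<beta> \<noteq> [] \<Longrightarrow> set \<beta> \<subseteq> set \<alpha> \<Longrightarrow> i \<in> B \<Longrightarrow> j \<in> B \<Longrightarrow> h \<beta> i j = h' \<beta> i j"
    and "i \<in> B" "j \<in> B"
  shows "star B f h \<alpha> i j = star B f' h' \<alpha> i j"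
  unfolding star_def
  by (intro sum.cong refl arg_cong2[of _ _ _ _ "(*)"] assms)
     (auto dest: in_set_takeD in_set_dropD)

lemma star_lin_left:
  "star B (\<lambda>\<alpha> i j. f \<alpha> i j + c * g \<alpha> i j) h \<alpha> i j = star B f h \<alpha> i j + c * star B g h \<alpha> i j"
  by (simp add: star_def sum.distrib sum_distrib_left algebra_simps)

lemma star_lin_right:
  "star B h (\<lambda>\<alpha> i j. f \<alpha> i j + c * g \<alpha> i j) \<alpha> i j = star B h f \<alpha> i j + c * star B h g \<alpha> i j"
  by (simp add: star_def sum.distrib sum_distrib_left algebra_simps)

lemma star_sum_left:
  "star B (\<lambda>\<alpha> i j. \<Sum>a\<in>S. f a \<alpha> i j) h \<alpha> i j = (\<Sum>a\<in>S. star B (f a) h \<alpha> i j)"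
proof -
  have "star B (\<lambda>\<alpha> i j. \<Sum>a\<in>S. f a \<alpha> i j) h \<alpha> i j = (\<Sum>p<length \<alpha>. \<Sum>a\<in>S. \<Sum>b\<in>B. f a (take (Suc p) \<alpha>) i b * h (drop p \<alpha>) b j)"
    unfolding star_def sum_distrib_right by (rule sum.cong[OF refl], rule sum.swap)
  then show ?thesis unfolding star_def by (subst sum.swap)
qed

lemma star_sum_right:
  "star B h (\<lambda>\<alpha> i j. \<Sum>a\<in>S. f a \<alpha> i j) \<alpha> i j = (\<Sum>a\<in>S. star B h (f a) \<alpha> i j)"
proof -
  have "star B h (\<lambda>\<alpha> i j. \<Sum>a\<in>S. f a \<alpha> i j) \<alpha> i j = (\<Sum>p<length \<alpha>. \<Sum>a\<in>S. \<Sum>b\<in>B. h (take (Suc p) \<alpha>) i b * f a (drop p \<alpha>) b j)"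
    unfolding star_def sum_distrib_left by (rule sum.cong[OF refl], rule sum.swap)
  then show ?thesis unfolding star_def by (subst sum.swap)
qed

lemma star_scale_left: "star B (\<lambda>\<alpha> i j. c * f \<alpha> i j) h \<alpha> i j = c * star B f h \<alpha> i j"
  by (simp add: star_def sum_distrib_left mult.assoc)

lemma star_scale_right: "star B h (\<lambda>\<alpha> i j. c * f \<alpha> i j) \<alpha> i j = c * star B h f \<alpha> i j"
  by (simp add: star_def sum_distrib_left mult_ac)

lemma del_sum: "del (\<lambda>\<alpha> i j. \<Sum>a\<in>S. c a * f a \<alpha> i j) \<alpha> i j = (\<Sum>a\<in>S. c a * del (f a) \<alpha> i j)"
  unfolding del_def by (simp add: sum_distrib_left mult_ac) (rule sum.swap)

text \<open>By the Leibniz rule \<open>del C\<close> and \<open>del Q\<close> both contribute a term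
  \<open>C G Q\<close>, with opposite signs because \<open>C\<close> is odd. What remains is the
  graded commutator of \<open>G\<close> with \<open>C Q\<close>, which has degree one more than
  \<open>Q\<close>.\<close>

lemma del_star_commutator:
  fixes m :: int
  assumes C: "homog 1 C" and \<alpha>: "\<alpha> \<noteq> []" and ij: "i \<in> B" "j \<in> B"
    and dC: "\<And>\<beta> i j. \<beta> \<noteq> [] \<Longrightarrow> set \<beta> \<subseteq> set \<alpha> \<Longrightarrow> i \<in> B \<Longrightarrow> j \<in> B \<Longrightarrow>
      del C \<beta> i j = star B C G \<beta> i j + star B G C \<beta> i j"
    and dQ: "\<And>\<beta> i j. \<beta> \<noteq> [] \<Longrightarrow> set \<beta> \<subseteq> set \<alpha> \<Longrightarrow> i \<in> B \<Longrightarrow> j \<in> B \<Longrightarrow>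
      del Q \<beta> i j = star B G Q \<beta> i j - msign m * star B Q G \<beta> i j"
  shows "del (star B C Q) \<alpha> i j = star B G (star B C Q) \<alpha> i j - msign (m + 1) * star B (star B C Q) G \<alpha> i j"
proof -
  have "star B (del C) Q \<alpha> i j = star B (\<lambda>\<alpha> i j. star B C G \<alpha> i j + 1 * star B G C \<alpha> i j) Q \<alpha> i j"
    by (rule star_cong) (use dC ij in auto)
  also have "\<dots> = star B C (star B G Q) \<alpha> i j + star B G (star B C Q) \<alpha> i j"
    unfolding star_lin_left by (simp add: star_assoc)
  finally have 1: "star B (del C) Q \<alpha> i j = star B C (star B G Q) \<alpha> i j + star B G (star B C Q) \<alpha> i j" .
  have "star B C (del Q) \<alpha> i j = star B C (\<lambda>\<alpha> i j. star B G Q \<alpha> i j + (- msign m) * star B Q G \<alpha> i j) \<alpha> i j"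
    by (rule star_cong) (use dQ ij in auto)
  also have "\<dots> = star B C (star B G Q) \<alpha> i j - msign m * star B (star B C Q) G \<alpha> i j"
    unfolding star_lin_right by (simp add: star_assoc)
  finally show ?thesis
    unfolding del_star[OF C \<alpha>] 1 by (simp add: msign_add)
qed

text \<open>The power of a matrix-valued 1-form, evaluated on the vectors \<open>vs\<close> and
  expanded along its first factor: \<open>C v\<close> is the value of the 1-form on
  \<open>v\<close>, and the wedge product hands one vector to this factor. In the sign,
  \<open>a\<close> is the shuffle sign and \<open>m\<close> is what the twists leave of the Koszul
  sign. The start \<open>e\<close> will be the unit.\<close>

primrec Qp :: "gbasis \<Rightarrow> ('t \<Rightarrow> 'v list \<Rightarrow> gmat) \<Rightarrow> ('v list \<Rightarrow> gmat) \<Rightarrow> nat \<Rightarrow> 't list \<Rightarrow> 'v list \<Rightarrow> gmat" where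
  "Qp B C e 0 vs = e"
| "Qp B C e (Suc m) vs = (\<lambda>\<alpha> i j. \<Sum>a<length vs. msign (int (a + m)) * star B (C (vs ! a)) (Qp B C e m (face a vs)) \<alpha> i j)"

lemma homog_star:
  assumes "homog c f" "homog c' h"
  shows "homog (c + c') (star B f h)"
  unfolding homog_def
proof (intro allI impI)
  fix \<alpha> :: "'a list" and i j assume nz: "star B f h \<alpha> i j \<noteq> 0" and \<alpha>: "\<alpha> \<noteq> []"
  then obtain p b where p: "p < length \<alpha>" "f (take (Suc p) \<alpha>) i b * h (drop p \<alpha>) b j \<noteq> 0"
    unfolding star_def by (meson lessThan_iff sum.not_neutral_contains_not_neutral)
  have "fst i - fst b = c + 1 - int (length (take (Suc p) \<alpha>))"
    using p \<alpha> by (intro homogD[OF assms(1)]) auto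
  moreover have "fst b - fst j = c' + 1 - int (length (drop p \<alpha>))"
    using p \<alpha> by (intro homogD[OF assms(2)]) auto
  ultimately show "fst i - fst j = c + c' + 1 - int (length \<alpha>)" using p(1) by simp
qed

lemma homog_Qp:
  assumes "\<And>v. homog 1 (C v)" "homog 0 e"
  shows "homog (int m) (Qp B C e m vs)"
proof (induction m arbitrary: vs)
  case (Suc m)
  have "homog (1 + int m) (star B (C (vs ! a)) (Qp B C e m (face a vs)))" for a
    by (rule homog_star[OF assms(1) Suc])
  then show ?case
    unfolding homog_def Qp.simps
    by (metis (no_types, lifting) add.commute int_Suc mult_eq_0_iff sum.neutral)
qed (use assms in simp)

text \<open>The tangent vectors are mere parameters here, as \<open>del\<close> acts on sequences of
  vertices only. So the commutator relation passes from one factor to the powers by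
  \<open>del_star_commutator\<close>, term by term in the sum over vectors.\<close>

lemma del_Qp:
  assumes C: "\<And>v. homog 1 (C v)" and \<alpha>: "\<alpha> \<noteq> []" "set \<alpha> \<subseteq> S" and ij: "i \<in> B" "j \<in> B"
    and dC: "\<And>v \<beta> i j. \<beta> \<noteq> [] \<Longrightarrow> set \<beta> \<subseteq> S \<Longrightarrow> i \<in> B \<Longrightarrow> j \<in> B \<Longrightarrow>
      del (C v) \<beta> i j = star B (C v) G \<beta> i j + star B G (C v) \<beta> i j"
    and de: "\<And>\<beta> i j. \<beta> \<noteq> [] \<Longrightarrow> set \<beta> \<subseteq> S \<Longrightarrow> i \<in> B \<Longrightarrow> j \<in> B \<Longrightarrow>
      del e \<beta> i j = star B G e \<beta> i j - star B e G \<beta> i j"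
  shows "del (Qp B C e m vs) \<alpha> i j = star B G (Qp B C e m vs) \<alpha> i j - msign (int m) * star B (Qp B C e m vs) G \<alpha> i j"
  using \<alpha> ij
proof (induction m arbitrary: vs \<alpha> i j)
  case 0
  then show ?case by (simp add: de)
next
  case (Suc m)
  let ?D = "\<lambda>a. star B (C (vs ! a)) (Qp B C e m (face a vs))"
  have "del (Qp B C e (Suc m) vs) \<alpha> i j = (\<Sum>a<length vs. msign (int (a + m)) * del (?D a) \<alpha> i j)"
    by (simp only: Qp.simps del_sum)
  also have "\<dots> = (\<Sum>a<length vs. msign (int (a + m)) * (star B G (?D a) \<alpha> i j - msign (int m + 1) * star B (?D a) G \<alpha> i j))"
    by (intro sum.cong refl arg_cong2[of _ _ _ _ "(*)"] del_star_commutator C)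
      (use Suc.prems in \<open>auto intro!: dC Suc.IH\<close>)
  also have "\<dots> = star B G (Qp B C e (Suc m) vs) \<alpha> i j - msign (int (Suc m)) * star B (Qp B C e (Suc m) vs) G \<alpha> i j"
    by (simp add: star_sum_left star_sum_right star_scale_left star_scale_right sum_subtractf
      sum_distrib_left right_diff_distrib mult_ac add.commute)
  finally show ?case .
qed

section \<open>Supports and units\<close>

text \<open>With this property a sum over the fibre at a cut may be enlarged to a sum over any
  larger index set.\<close>

definition supp :: "('v \<Rightarrow> gbasis) \<Rightarrow> ('v list \<Rightarrow> gmat) \<Rightarrow> bool" where
  "supp \<Phi> f \<longleftrightarrow> (\<forall>\<alpha> i j. f \<alpha> i j \<noteq> 0 \<longrightarrow> \<alpha> \<noteq> [] \<longrightarrow> i \<in> \<Phi> (hd \<alpha>) \<and> j \<in> \<Phi> (last \<alpha>))"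

lemma suppD: "supp \<Phi> f \<Longrightarrow> f \<alpha> i j \<noteq> 0 \<Longrightarrow> \<alpha> \<noteq> [] \<Longrightarrow> i \<in> \<Phi> (hd \<alpha>) \<and> j \<in> \<Phi> (last \<alpha>)"
  unfolding supp_def by blast

definition unit_family :: "('v \<Rightarrow> gbasis) \<Rightarrow> 'v list \<Rightarrow> gmat" where
  "unit_family \<Phi> \<alpha> = (if length \<alpha> = 1 then gid (\<Phi> (hd \<alpha>)) else 0)"

lemma homog_unit_family: "homog 0 (unit_family \<Phi>)"
  by (auto simp: homog_def unit_family_def gid_def zero_fun_def split: if_splits)

lemma supp_unit_family: "supp \<Phi> (unit_family \<Phi>)"
  unfolding supp_def
proof (intro allI impI)
  fix \<alpha> i j assume "unit_family \<Phi> \<alpha> i j \<noteq> 0" "\<alpha> \<noteq> []"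
  then show "i \<in> \<Phi> (hd \<alpha>) \<and> j \<in> \<Phi> (last \<alpha>)"
    by (cases \<alpha>) (auto simp: unit_family_def gid_def zero_fun_def split: if_splits)
qed

lemma last_take_Suc: "p < length \<alpha> \<Longrightarrow> last (take (Suc p) \<alpha>) = \<alpha> ! p"
  by (simp add: take_Suc_conv_app_nth)

lemma supp_star:
  assumes "supp \<Phi> f" "supp \<Phi> h"
  shows "supp \<Phi> (star B f h)"
  unfolding supp_def
proof (intro allI impI)
  fix \<alpha> i j assume nz: "star B f h \<alpha> i j \<noteq> 0" and \<alpha>: "\<alpha> \<noteq> []"
  then obtain p b where p: "p < length \<alpha>" "f (take (Suc p) \<alpha>) i b * h (drop p \<alpha>) b j \<noteq> 0"
    unfolding star_def by (meson lessThan_iff sum.not_neutral_contains_not_neutral)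
  have "i \<in> \<Phi> (hd (take (Suc p) \<alpha>))"
    using p \<alpha> by (intro conjunct1[OF suppD[OF assms(1)]]) auto
  moreover have "j \<in> \<Phi> (last (drop p \<alpha>))"
    using p \<alpha> by (intro conjunct2[OF suppD[OF assms(2)]]) auto
  ultimately show "i \<in> \<Phi> (hd \<alpha>) \<and> j \<in> \<Phi> (last \<alpha>)" using p \<alpha> by simp
qed

lemma supp_Qp:
  assumes "\<And>v. supp \<Phi> (C v)" "supp \<Phi> e"
  shows "supp \<Phi> (Qp B C e m vs)"
proof (induction m arbitrary: vs)
  case (Suc m)
  have "supp \<Phi> (star B (C (vs ! a)) (Qp B C e m (face a vs)))" for a
    by (rule supp_star[OF assms(1) Suc])
  then show ?case
    unfolding supp_def Qp.simps
    by (metis (no_types, lifting) mult_eq_0_iff sum.neutral)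
qed (use assms in simp)

text \<open>The unit lives on 0-simplices, so only the cut at the last vertex survives.
  \<open>B\<close> must contain the fibre there for the identity matrix to act as an
  identity.\<close>

lemma star_unit_right:
  assumes f: "supp \<Phi> f" and B: "finite B" "\<And>v. v \<in> set \<alpha> \<Longrightarrow> \<Phi> v \<subseteq> B" and \<alpha>: "\<alpha> \<noteq> []"
  shows "star B f (unit_family \<Phi>) \<alpha> i j = f \<alpha> i j"
proof -
  define N where "N = length \<alpha> - 1"
  have N: "length \<alpha> = Suc N" using \<alpha> by (simp add: N_def)
  have dr: "drop N \<alpha> = [last \<alpha>]" using N by (metis N_def \<alpha> append_butlast_last_id append_eq_conv_conj length_butlast)
  have "star B f (unit_family \<Phi>) \<alpha> i j = (\<Sum>p\<in>{N}. \<Sum>b\<in>B. f (take (Suc p) \<alpha>) i b * unit_family \<Phi> (drop p \<alpha>) b j)"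
    unfolding star_def N by (rule sum.mono_neutral_right) (auto simp: N unit_family_def)
  also have "\<dots> = (\<Sum>b\<in>B. f \<alpha> i b * gid (\<Phi> (last \<alpha>)) b j)"
    using N dr by (simp add: unit_family_def)
  also have "\<dots> = (\<Sum>b\<in>B. if b = j then f \<alpha> i j else 0)"
    by (rule sum.cong[OF refl], cases "f \<alpha> i j = 0") (use suppD[OF f _ \<alpha>, of i j] in \<open>auto simp: gid_def\<close>)
  also have "\<dots> = f \<alpha> i j"
    using suppD[OF f _ \<alpha>, of i j] B(1) B(2)[OF last_in_set[OF \<alpha>]] by (auto simp: sum.delta)
  finally show ?thesis .
qed

lemma star_unit_left:
  assumes f: "supp \<Phi> f" and B: "finite B" "\<And>v. v \<in> set \<alpha> \<Longrightarrow> \<Phi> v \<subseteq> B" and \<alpha>: "\<alpha> \<noteq> []"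
  shows "star B (unit_family \<Phi>) f \<alpha> i j = f \<alpha> i j"
proof -
  have "star B (unit_family \<Phi>) f \<alpha> i j = (\<Sum>p\<in>{0}. \<Sum>b\<in>B. unit_family \<Phi> (take (Suc p) \<alpha>) i b * f (drop p \<alpha>) b j)"
    unfolding star_def using \<alpha> by (intro sum.mono_neutral_right) (auto simp: unit_family_def)
  also have "\<dots> = (\<Sum>b\<in>B. gid (\<Phi> (hd \<alpha>)) i b * f \<alpha> b j)"
    using \<alpha> by (cases \<alpha>) (auto simp: unit_family_def)
  also have "\<dots> = (\<Sum>b\<in>B. if b = i then f \<alpha> i j else 0)"
    by (rule sum.cong[OF refl], cases "f \<alpha> i j = 0") (use suppD[OF f _ \<alpha>, of i j] in \<open>auto simp: gid_def\<close>)
  also have "\<dots> = f \<alpha> i j"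
    using suppD[OF f _ \<alpha>, of i j] B(1) B(2)[OF list.set_sel(1)[OF \<alpha>]] by (auto simp: sum.delta)
  finally show ?thesis .
qed

lemma del_unit_family:
  "del (unit_family \<Phi>) \<alpha> i j = 0"
  unfolding del_def by (rule sum.neutral) (auto simp: unit_family_def length_face)

section \<open>Twisting the product of families\<close>

text \<open>With these signs on the matrix entries the signed product of families becomes the convolution
  \<open>star\<close>, and the nerve relation with \<open>d\<^sup>2 = 0\<close> becomes \<open>del G = star G G\<close> for the twist \<open>G\<close> of \<open>d + g\<close>.
  In \<open>tw m\<close> the number \<open>m\<close> is the form degree.\<close>

definition tw :: "int \<Rightarrow> gmat \<Rightarrow> gmat" where
  "tw m X = (\<lambda>i j. msign (fst i + fst i * fst j + m * fst j) * X i j)"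

definition tg :: "gmat \<Rightarrow> gmat" where
  "tg X = (\<lambda>i j. msign (fst i * fst j) * X i j)"

text \<open>For total degree 1 the degrees of \<open>b\<close> and \<open>j\<close> are functions of
  \<open>fst i\<close>, the cut and the length. The two twists collapse to the sign
  \<open>k * (p - 1)\<close> of the nerve relation, with \<open>k\<close> the dimension, times a
  factor in row and length alone. \<open>del_tg\<close> produces the same factor, so it drops out of
  the relation.\<close>

lemma star_tg:
  assumes f: "homog 1 f" and h: "homog 1 h" and \<alpha>: "\<alpha> \<noteq> []"
  shows "star B (\<lambda>\<alpha>. tg (f \<alpha>)) (\<lambda>\<alpha>. tg (h \<alpha>)) \<alpha> i j = msign (int (length \<alpha> - 1) * fst i) *
    (\<Sum>p<length \<alpha>. \<Sum>b\<in>B. msign (int (length \<alpha> - 1) * (int p - 1)) * (f (take (Suc p) \<alpha>) i b * h (drop p \<alpha>) b j))"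
  unfolding star_def sum_distrib_left
proof (intro sum.cong refl)
  fix p b assume p: "p \<in> {..<length \<alpha>}"
  show "tg (f (take (Suc p) \<alpha>)) i b * tg (h (drop p \<alpha>)) b j = msign (int (length \<alpha> - 1) * fst i) *
     (msign (int (length \<alpha> - 1) * (int p - 1)) * (f (take (Suc p) \<alpha>) i b * h (drop p \<alpha>) b j))"
  proof (cases "f (take (Suc p) \<alpha>) i b = 0 \<or> h (drop p \<alpha>) b j = 0")
    case False
    define k where "k = int (length \<alpha>) - 1"
    have "fst i - fst b = 1 - int p"
      using homogD[OF f, of "take (Suc p) \<alpha>" i b] False \<alpha> p by auto
    moreover have "fst b - fst j = 1 - (k - int p)"
      using homogD[OF h, of "drop p \<alpha>" b j] False \<alpha> p by (auto simp: k_def of_nat_diff)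
    ultimately have e: "fst b = fst i - 1 + int p" "fst j = fst i - 2 + k" by auto
    have k: "int (length \<alpha> - 1) = k" using \<alpha> by (cases \<alpha>) (auto simp: k_def)
    have "msign (fst i * fst b) * msign (fst b * fst j) = msign (k * fst i) * msign (k * (int p - 1))"
      unfolding msign_add[symmetric] e by (intro msign_eqI) auto
    then show ?thesis unfolding k tg_def by (simp add: mult_ac)
  qed (auto simp: tg_def)
qed

lemma del_tg:
  assumes f: "homog 1 f" and \<alpha>: "\<alpha> \<noteq> []"
  shows "del (\<lambda>\<alpha>. tg (f \<alpha>)) \<alpha> i j = msign (int (length \<alpha> - 1) * fst i) *
    (\<Sum>a\<in>{1..<length \<alpha> - 1}. msign (int (a - 1)) * f (face a \<alpha>) i j)"
  unfolding del_def sum_distrib_left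
proof (intro sum.cong refl)
  fix a assume a: "a \<in> {1..<length \<alpha> - 1}"
  show "msign (fst i + int (a - 1)) * tg (f (face a \<alpha>)) i j = msign (int (length \<alpha> - 1) * fst i) * (msign (int (a - 1)) * f (face a \<alpha>) i j)"
  proof (cases "f (face a \<alpha>) i j = 0")
    case False
    define k where "k = int (length \<alpha>) - 1"
    have "length (face a \<alpha>) = length \<alpha> - 1" using a by (intro length_face) auto
    moreover from this have "face a \<alpha> \<noteq> []" using a by auto
    ultimately have "fst i - fst j = 2 - k"
      using homogD[OF f False] \<alpha> by (cases \<alpha>) (auto simp: k_def)
    then have e: "fst j = fst i - 2 + k" by simp
    have k: "int (length \<alpha> - 1) = k" using \<alpha> by (cases \<alpha>) (auto simp: k_def)
    have "msign (fst i + int (a - 1)) * msign (fst i * fst j) = msign (k * fst i) * msign (int (a - 1))"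
      unfolding msign_add[symmetric] e by (intro msign_eqI) auto
    then show ?thesis unfolding k tg_def by (simp add: mult_ac)
  qed (simp add: tg_def)
qed

section \<open>Expansion of the shuffle product\<close>

lemma nths_singleton: "a < length vs \<Longrightarrow> nths vs {a} = [vs ! a]"
  by (induction vs arbitrary: a) (auto simp: nths_Cons nth_Cons split: nat.splits)

lemma nths_compl_singleton: "a < length vs \<Longrightarrow> nths vs (- {a}) = face a vs"
proof (induction vs arbitrary: a)
  case (Cons v vs)
  show ?case
  proof (cases a)
    case 0
    then have "{j. Suc j \<in> - {a}} = UNIV" by auto
    then show ?thesis using 0 by (simp add: nths_Cons face_def nths_all)
  next
    case (Suc b)
    then have "{j. Suc j \<in> - {a}} = - {b}" by auto
    then show ?thesis using Suc Cons by (simp add: nths_Cons face_def)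
  qed
qed simp

text \<open>Only singletons hand exactly one vector to \<open>f\<close>, and the shuffle that brings
  position \<open>a\<close> to the front has \<open>a\<close> inversions.\<close>

lemma fcomp_one_form:
  assumes "\<And>us. length us \<noteq> 1 \<Longrightarrow> f us = 0"
  shows "fcomp B f h vs i j = (\<Sum>a<length vs. \<Sum>b\<in>B. msign (int a) * msign ((fst i - fst b) * int (length vs - 1)) *
     f [vs ! a] i b * h (face a vs) b j)"
proof -
  let ?n = "length vs"
  let ?t = "\<lambda>S. \<Sum>b\<in>B. msign (int (shuffle_inv (length vs) S)) *
     msign ((fst i - fst b) * int (length (nths vs (- S)))) *
     f (nths vs S) i b * h (nths vs (- S)) b j"
  have "fcomp B f h vs i j = (\<Sum>S\<in>(\<lambda>a. {a}) ` {..<?n}. ?t S)"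
    unfolding fcomp_def
  proof (rule sum.mono_neutral_right)
    show "\<forall>S\<in>Pow {..<?n} - (\<lambda>a. {a}) ` {..<?n}. ?t S = 0"
    proof
      fix S assume S: "S \<in> Pow {..<?n} - (\<lambda>a. {a}) ` {..<?n}"
      then have "{i. i < ?n \<and> i \<in> S} = S" by auto
      moreover have "card S \<noteq> 1" using S by (metis DiffD1 DiffD2 PowD card_1_singletonE image_eqI insert_subset)
      ultimately have "f (nths vs S) = 0" by (intro assms) (simp add: length_nths)
      then show "?t S = 0" by simp
    qed
  qed auto
  also have "\<dots> = (\<Sum>a<?n. ?t {a})" by (subst sum.reindex) auto
  also have "\<dots> = (\<Sum>a<?n. \<Sum>b\<in>B. msign (int a) * msign ((fst i - fst b) * int (length vs - 1)) *
     f [vs ! a] i b * h (face a vs) b j)"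
  proof (rule sum.cong[OF refl])
    fix a assume a: "a \<in> {..<?n}"
    have "{(i, j). i \<in> {a} \<and> j < ?n \<and> j \<notin> {a} \<and> j < i} = Pair a ` {..<a}" using a by auto
    then have "shuffle_inv ?n {a} = a" by (simp add: shuffle_inv_def card_image inj_on_def)
    then show "?t {a} = (\<Sum>b\<in>B. msign (int a) * msign ((fst i - fst b) * int (length vs - 1)) *
     f [vs ! a] i b * h (face a vs) b j)"
      using a by (simp add: nths_singleton nths_compl_singleton length_face)
  qed
  finally show ?thesis .
qed

lemma fcomp_zero_form:
  "fcomp B (\<lambda>us. if us = [] then X else 0) h vs i j = (\<Sum>b\<in>B. msign ((fst i - fst b) * int (length vs)) * X i b * h vs b j)"
proof -
  let ?n = "length vs"
  let ?t = "\<lambda>S. \<Sum>b\<in>B. msign (int (shuffle_inv (length vs) S)) *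
     msign ((fst i - fst b) * int (length (nths vs (- S)))) *
     (if nths vs S = [] then X else 0) i b * h (nths vs (- S)) b j"
  have "fcomp B (\<lambda>us. if us = [] then X else 0) h vs i j = (\<Sum>S\<in>{{}}. ?t S)"
    unfolding fcomp_def
  proof (rule sum.mono_neutral_right)
    show "\<forall>S\<in>Pow {..<?n} - {{}}. ?t S = 0"
    proof
      fix S assume S: "S \<in> Pow {..<?n} - {{}}"
      then have "{i. i < ?n \<and> i \<in> S} = S" "finite S" by (auto intro: finite_subset)
      then have "length (nths vs S) \<noteq> 0" using S by (simp add: length_nths)
      then show "?t S = 0" by auto
    qed
  qed auto
  also have "\<dots> = (\<Sum>b\<in>B. msign ((fst i - fst b) * int (length vs)) * X i b * h vs b j)"
    by (simp add: shuffle_inv_def nths_all)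
  finally show ?thesis .
qed

lemma tw_eq_0_iff: "tw m X i j = 0 \<longleftrightarrow> X i j = 0"
  by (simp add: tw_def msign_def)

lemma tg_eq_0_iff: "tg X i j = 0 \<longleftrightarrow> X i j = 0"
  by (simp add: tg_def msign_def)

lemma homog_tw: "homog c (\<lambda>\<alpha>. tw m (f \<alpha>)) \<longleftrightarrow> homog c f"
  by (simp add: homog_def tw_eq_0_iff)

lemma homog_tg: "homog c (\<lambda>\<alpha>. tg (f \<alpha>)) \<longleftrightarrow> homog c f"
  by (simp add: homog_def tg_eq_0_iff)

lemma supp_tw: "supp \<Phi> (\<lambda>\<alpha>. tw m (f \<alpha>)) \<longleftrightarrow> supp \<Phi> f"
  by (simp add: supp_def tw_eq_0_iff)

lemma supp_tg: "supp \<Phi> (\<lambda>\<alpha>. tg (f \<alpha>)) \<longleftrightarrow> supp \<Phi> f"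
  by (simp add: supp_def tg_eq_0_iff)

lemma sum_fun_apply: "(\<Sum>a\<in>S. f a) x = (\<Sum>a\<in>S. f a x)" for f :: "'a \<Rightarrow> 'b \<Rightarrow> 'c::comm_monoid_add"
  by (induction S rule: infinite_finite_induct) auto

text \<open>Three signs meet: the shuffle sign \<open>a\<close>, the Koszul sign of passing the left
  matrix across the remaining form degree, and the sign of the product of families, in which the
  left factor has form degree 1.\<close>

lemma fam_power_Suc_entry:
  assumes A: "\<forall>\<beta> us. length us \<noteq> 1 \<longrightarrow> A \<beta> ch x us = 0"
  shows "fam_power E A (Suc m) \<alpha> ch x vs i j =
    (\<Sum>p<length \<alpha>. \<Sum>a<length vs. \<Sum>b\<in>fib (E (\<alpha> ! p)) x.
       msign (int a) * msign ((fst i - fst b) * int (length vs - 1)) *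
       (msign ((1 + (fst i - fst b)) * int (length \<alpha> - 1 - p)) * A (take (Suc p) \<alpha>) ch x [vs ! a] i b) *
       fam_power E A m (drop p \<alpha>) ch x (face a vs) b j)"
proof -
  let ?f = "\<lambda>p vs i b. msign ((int (length vs) + (fst i - fst b)) * int (length \<alpha> - 1 - p)) * A (take (p + 1) \<alpha>) ch x vs i b"
  have "?f p us = 0" if "length us \<noteq> 1" for p us using A that by (auto simp: fun_eq_iff)
  then have *: "fcomp B (?f p) h vs i j = (\<Sum>a<length vs. \<Sum>b\<in>B. msign (int a) * msign ((fst i - fst b) * int (length vs - 1)) *
     ?f p [vs ! a] i b * h (face a vs) b j)" for B p h
    by (rule fcomp_one_form)
  have "fam_power E A (Suc m) \<alpha> ch x vs i j =
     (\<Sum>p<length \<alpha>. fcomp (fib (E (\<alpha> ! p)) x) (?f p) (fam_power E A m (drop p \<alpha>) ch x) vs i j)"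
    by (simp add: fam_prod_def Let_def sum_fun_apply)
  then show ?thesis unfolding * by simp
qed

lemma fam_power_length:
  assumes A: "\<forall>\<beta> us. length us \<noteq> 1 \<longrightarrow> A \<beta> ch x us = 0" and "length vs \<noteq> m"
  shows "fam_power E A m \<alpha> ch x vs i j = 0"
  using assms(2)
proof (induction m arbitrary: \<alpha> vs i j)
  case 0 then show ?case by (simp add: fam_one_def)
next
  case (Suc m)
  then have "a < length vs \<Longrightarrow> length (face a vs) \<noteq> m" for a by (simp add: length_face)
  then show ?case unfolding fam_power_Suc_entry[of A ch x, OF A] by (intro sum.neutral ballI) (simp add: Suc.IH)
qed

text \<open>Each step of the recursion has a sign that involves the simplicial degree of the tail.
  Since the tail is homogeneous, this degree is a function of its row and column degrees, and then
  the twists of the two factors and of the product account for all signs except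
  \<open>a + m\<close>.\<close>

lemma fam_power_twist:
  assumes A: "\<forall>\<beta> us. length us \<noteq> 1 \<longrightarrow> A \<beta> ch x us = 0"
    and hA: "\<And>v. homog 1 (\<lambda>\<beta>. A \<beta> ch x [v])"
    and sA: "\<And>v. supp (\<lambda>k. fib (E k) x) (\<lambda>\<beta>. A \<beta> ch x [v])"
    and B: "finite B" "\<And>k. k \<in> set \<alpha> \<Longrightarrow> fib (E k) x \<subseteq> B"
    and len: "length vs = m"
  shows "tw (int m) (fam_power E A m \<alpha> ch x vs) i j =
    Qp B (\<lambda>v \<beta>. tw 1 (A \<beta> ch x [v])) (unit_family (\<lambda>k. fib (E k) x)) m vs \<alpha> i j"
  using B(2) len
proof (induction m arbitrary: \<alpha> vs i j)
  case 0
  show ?case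
    using 0 by (auto simp: fam_one_def unit_family_def tw_def gid_def msign_def)
next
  case (Suc m)
  let ?\<Phi> = "\<lambda>k. fib (E k) x" and ?C = "\<lambda>v \<beta>. tw 1 (A \<beta> ch x [v])"
  have hQ: "homog (int m) (Qp B ?C (unit_family ?\<Phi>) m us)" for us
    by (rule homog_Qp[OF _ homog_unit_family]) (simp add: homog_tw hA)
  have "tw (int (Suc m)) (fam_power E A (Suc m) \<alpha> ch x vs) i j =
     (\<Sum>p<length \<alpha>. \<Sum>a<length vs. \<Sum>b\<in>fib (E (\<alpha> ! p)) x. msign (int (a + m)) *
       (?C (vs ! a) (take (Suc p) \<alpha>) i b * Qp B ?C (unit_family ?\<Phi>) m (face a vs) (drop p \<alpha>) b j))"
    unfolding fam_power_Suc_entry[of A ch x, OF A] tw_def[of "int (Suc m)"] sum_distrib_left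
  proof (intro sum.cong refl)
    fix p a b assume p: "p \<in> {..<length \<alpha>}" and a: "a \<in> {..<length vs}"
    have vs: "length (face a vs) = m" using Suc.prems(2) a by (simp add: length_face)
    have IH: "Qp B ?C (unit_family ?\<Phi>) m (face a vs) (drop p \<alpha>) b j = tw (int m) (fam_power E A m (drop p \<alpha>) ch x (face a vs)) b j"
      by (rule Suc.IH[symmetric, OF Suc.prems(1) vs]) (auto dest: in_set_dropD)
    show "msign (fst i + fst i * fst j + int (Suc m) * fst j) *
          (msign (int a) * msign ((fst i - fst b) * int (length vs - 1)) *
           (msign ((1 + (fst i - fst b)) * int (length \<alpha> - 1 - p)) * A (take (Suc p) \<alpha>) ch x [vs ! a] i b) *
           fam_power E A m (drop p \<alpha>) ch x (face a vs) b j) =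
        msign (int (a + m)) *
        (?C (vs ! a) (take (Suc p) \<alpha>) i b * Qp B ?C (unit_family ?\<Phi>) m (face a vs) (drop p \<alpha>) b j)"
    proof (cases "fam_power E A m (drop p \<alpha>) ch x (face a vs) b j = 0")
      case True then show ?thesis unfolding IH by (simp add: tw_def)
    next
      case False
      then have "Qp B ?C (unit_family ?\<Phi>) m (face a vs) (drop p \<alpha>) b j \<noteq> 0" unfolding IH by (simp add: tw_eq_0_iff)
      then have "fst b - fst j = int m + 1 - int (length (drop p \<alpha>))" using p by (intro homogD[OF hQ]) auto
      then have r: "int (length \<alpha> - 1 - p) = int m - fst b + fst j" using p by (auto simp: of_nat_diff)
      have "msign (fst i + fst i * fst j + int (Suc m) * fst j) * msign (int a) * msign ((fst i - fst b) * int m) *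
         msign ((1 + (fst i - fst b)) * int (length \<alpha> - 1 - p)) =
         msign (int (a + m)) * msign (fst i + fst i * fst b + 1 * fst b) * msign (fst b + fst b * fst j + int m * fst j)"
        unfolding msign_add[symmetric] r by (intro msign_eqI) auto
      moreover have "length vs - 1 = m" using Suc.prems by simp
      ultimately show ?thesis unfolding IH unfolding tw_def by (simp add: mult_ac)
    qed
  qed
  \<comment> \<open>Passing from the fibre to \<open>B\<close> adds only zeros: the columns of the
    left factor lie in the fibre over the cut.\<close>
  also have "\<dots> = (\<Sum>p<length \<alpha>. \<Sum>a<length vs. \<Sum>b\<in>B. msign (int (a + m)) *
       (?C (vs ! a) (take (Suc p) \<alpha>) i b * Qp B ?C (unit_family ?\<Phi>) m (face a vs) (drop p \<alpha>) b j))"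
  proof (rule sum.cong[OF refl], rule sum.cong[OF refl], rule sum.mono_neutral_left)
    fix p a assume p: "p \<in> {..<length \<alpha>}"
    then show "fib (E (\<alpha> ! p)) x \<subseteq> B" using Suc.prems(1) by auto
    have "A (take (Suc p) \<alpha>) ch x [vs ! a] i b = 0" if "b \<notin> fib (E (\<alpha> ! p)) x" for b
    proof (rule ccontr)
      assume "A (take (Suc p) \<alpha>) ch x [vs ! a] i b \<noteq> 0"
      then have "b \<in> fib (E (last (take (Suc p) \<alpha>))) x" using p by (intro conjunct2[OF suppD[OF sA]]) auto
      then show False using that p by (simp add: last_take_Suc)
    qed
    then show "\<forall>b\<in>B - fib (E (\<alpha> ! p)) x. msign (int (a + m)) *
       (?C (vs ! a) (take (Suc p) \<alpha>) i b * Qp B ?C (unit_family ?\<Phi>) m (face a vs) (drop p \<alpha>) b j) = 0"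
      by (auto simp: tw_def)
  qed (use B in auto)
  also have "\<dots> = Qp B ?C (unit_family ?\<Phi>) (Suc m) vs \<alpha> i j"
    unfolding Qp.simps star_def sum_distrib_left by (rule sum.swap)
  finally show ?case .
qed

lemma hd_seg: "k \<le> l \<Longrightarrow> l < length \<sigma> \<Longrightarrow> hd (seg k l \<sigma>) = \<sigma> ! k"
  by (subst hd_conv_nth) (auto simp: nth_seg seg_def)

lemma last_seg: "k \<le> l \<Longrightarrow> l < length \<sigma> \<Longrightarrow> last (seg k l \<sigma>) = \<sigma> ! l"
  by (subst last_conv_nth) (auto simp: nth_seg length_seg, auto simp: seg_def)

text \<open>The sign of \<open>Tr\<close> contains \<open>l - k\<close>, the simplicial degree of
  the segment. A nonzero entry of \<open>f\<close> expresses it through row and column degrees, and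
  after this the signs of \<open>tw\<close>, \<open>tg\<close> and \<open>mtr\<close> account for
  everything but \<open>m * k\<close>.\<close>

lemma Tr_eq_ttr:
  assumes hf: "homog (int m) (\<lambda>\<beta>. f \<beta> ch x vs)"
    and sf: "supp (\<lambda>k. fib (ob_of F k) x) (\<lambda>\<beta>. f \<beta> ch x vs)"
    and B: "finite B" "\<And>k. k \<in> set \<sigma> \<Longrightarrow> fib (ob_of F k) x \<subseteq> B"
    and len: "length vs = m" "length \<sigma> = Suc m"
  shows "Tr F f \<sigma> ch x vs = ttr B (int m) (\<lambda>\<beta>. tw (int m) (f \<beta> ch x vs)) (\<lambda>\<beta>. tg (mor_of F \<beta> x)) \<sigma>"
proof -
  let ?\<Phi> = "\<lambda>k. fib (ob_of F k) x"
  have "Tr F f \<sigma> ch x vs = (\<Sum>l\<le>m. \<Sum>k\<le>l. msign ((int k + 1) * int m + int l - int k) *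
       gtr (?\<Phi> (\<sigma> ! l)) (fcomp (?\<Phi> (\<sigma> ! k)) (\<lambda>us. if us = [] then mor_of F (rot k l \<sigma>) x else 0)
            (f (seg k l \<sigma>) ch x) vs))"
    unfolding Tr_def Let_def rot_def seg_def Suc_eq_plus1 using len by simp
  also have "\<dots> = (\<Sum>l\<le>m. \<Sum>k\<le>l. msign (int m * int k) * mtr B (int m) (tw (int m) (f (seg k l \<sigma>) ch x vs)) (tg (mor_of F (rot k l \<sigma>) x)))"
  proof (rule sum.cong[OF refl], rule sum.cong[OF refl])
    fix l k assume "l \<in> {..m}" "k \<in> {..l}"
    then have kl: "k \<le> l" "l < length \<sigma>" using len by auto
    have ne: "seg k l \<sigma> \<noteq> []" using kl length_seg[of l \<sigma> k] by auto
    have sub: "?\<Phi> (\<sigma> ! l) \<subseteq> B" "?\<Phi> (\<sigma> ! k) \<subseteq> B" using kl by (auto intro!: B(2))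
    let ?X = "f (seg k l \<sigma>) ch x vs" and ?g = "mor_of F (rot k l \<sigma>) x"
    have "?X i j = 0" if "i \<notin> ?\<Phi> (\<sigma> ! k) \<or> j \<notin> ?\<Phi> (\<sigma> ! l)" for i j
      using suppD[OF sf _ ne, of i j] that hd_seg[OF kl] last_seg[OF kl] by auto
    note z = this
    have "msign ((int k + 1) * int m + int l - int k) *
       gtr (?\<Phi> (\<sigma> ! l)) (fcomp (?\<Phi> (\<sigma> ! k)) (\<lambda>us. if us = [] then ?g else 0) (f (seg k l \<sigma>) ch x) vs)
      = (\<Sum>j\<in>?\<Phi> (\<sigma> ! l). \<Sum>i\<in>?\<Phi> (\<sigma> ! k). msign ((int k + 1) * int m + int l - int k) * (msign (fst j) *
           (msign ((fst j - fst i) * int m) * ?g j i * ?X i j)))"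
      unfolding gtr_def fcomp_zero_form len(1) by (simp add: sum_distrib_left)
    also have "\<dots> = (\<Sum>j\<in>B. \<Sum>i\<in>B. msign ((int k + 1) * int m + int l - int k) * (msign (fst j) *
           (msign ((fst j - fst i) * int m) * ?g j i * ?X i j)))"
    proof -
      have "(\<Sum>i\<in>?\<Phi> (\<sigma> ! k). msign ((int k + 1) * int m + int l - int k) * (msign (fst j) *
           (msign ((fst j - fst i) * int m) * ?g j i * ?X i j))) = 
         (\<Sum>i\<in>B. msign ((int k + 1) * int m + int l - int k) * (msign (fst j) *
           (msign ((fst j - fst i) * int m) * ?g j i * ?X i j)))" for j
        using B(1) sub z by (intro sum.mono_neutral_left) auto
      then show ?thesis
        using B(1) sub z by (simp only:) (rule sum.mono_neutral_left, auto)
    qed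
    also have "\<dots> = (\<Sum>j\<in>B. \<Sum>i\<in>B. msign (int m * int k) * (msign (int m * fst i) * tw (int m) ?X i j * tg ?g j i))"
    proof (rule sum.cong[OF refl], rule sum.cong[OF refl])
      fix i j
      show "msign ((int k + 1) * int m + int l - int k) * (msign (fst j) *
           (msign ((fst j - fst i) * int m) * ?g j i * ?X i j)) =
         msign (int m * int k) * (msign (int m * fst i) * tw (int m) ?X i j * tg ?g j i)"
      proof (cases "?X i j = 0")
        case False
        then have "fst i - fst j = int m - (int l - int k)"
          using homogD[OF hf False ne] kl by (simp add: length_seg of_nat_diff)
        then have e: "fst j = fst i - int m + (int l - int k)" by simp
        have "msign ((int k + 1) * int m + int l - int k) * msign (fst j) * msign ((fst j - fst i) * int m) =
          msign (int m * int k) * msign (int m * fst i) * msign (fst i + fst i * fst j + int m * fst j) * msign (fst j * fst i)"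
          unfolding msign_add[symmetric] e by (intro msign_eqI) auto
        then show ?thesis unfolding tw_def tg_def by (simp add: mult_ac)
      qed (simp add: tw_def)
    qed
    also have "\<dots> = msign (int m * int k) * mtr B (int m) (tw (int m) ?X) (tg ?g)"
      unfolding mtr_def sum_distrib_left by (rule sum.swap)
    finally show "msign ((int k + 1) * int m + int l - int k) *
       gtr (?\<Phi> (\<sigma> ! l)) (fcomp (?\<Phi> (\<sigma> ! k)) (\<lambda>us. if us = [] then ?g else 0) (f (seg k l \<sigma>) ch x) vs)
      = msign (int m * int k) * mtr B (int m) (tw (int m) ?X) (tg ?g)" .
  qed
  also have "\<dots> = ttr B (int m) (\<lambda>\<beta>. tw (int m) (f \<beta> ch x vs)) (\<lambda>\<beta>. tg (mor_of F \<beta> x)) \<sigma>"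
    unfolding ttr_def len by (simp add: lessThan_Suc_atMost)
  finally show ?thesis .
qed

text \<open>Exchanging the two sums moves the trace sign from row to column of \<open>X\<close>, and
  a nonzero entry of \<open>X\<close> changes the degree by \<open>q\<close>.\<close>

lemma gtr_gmul_swap:
  assumes X: "X \<in> gmats B' B q" and fin: "finite B" "finite B'" and Y: "Y \<in> gmats B B' (- q)"
  shows "gtr B' (gmul B X Y) = msign q * gtr B (gmul B' Y X)"
proof -
  have "gtr B' (gmul B X Y) = (\<Sum>i\<in>B'. \<Sum>j\<in>B. msign (fst i) * (X i j * Y j i))"
    by (simp add: gtr_def gmul_def sum_distrib_left)
  also have "\<dots> = (\<Sum>j\<in>B. \<Sum>i\<in>B'. msign (fst i) * (X i j * Y j i))" by (rule sum.swap)
  also have "\<dots> = (\<Sum>j\<in>B. \<Sum>i\<in>B'. msign q * (msign (fst j) * (Y j i * X i j)))"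
  proof (intro sum.cong refl)
    fix i j
    show "msign (fst i) * (X i j * Y j i) = msign q * (msign (fst j) * (Y j i * X i j))"
    proof (cases "X i j = 0")
      case False
      then have "fst i = fst j + q" using X unfolding gmats_def by blast
      then show ?thesis by (simp add: msign_add mult_ac)
    qed simp
  qed
  finally show ?thesis by (simp add: gtr_def gmul_def sum_distrib_left)
qed

section \<open>Holomorphic functions on subspaces\<close>

lemma norm_smult_vec: "norm (c *s x) = norm c * norm x" for x :: "complex ^ 'm"
  by (simp add: norm_vec_def L2_set_right_distrib norm_mult)

lemma bounded_bilinear_smult_vec: "bounded_bilinear ((*s) :: complex \<Rightarrow> complex ^ 'm \<Rightarrow> complex ^ 'm)"
proof
  show "\<exists>K. \<forall>a b. norm (a *s b :: complex ^ 'm) \<le> norm a * norm b * K"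
    by (rule exI[of _ 1]) (simp add: norm_smult_vec)
qed (simp_all add: vec_eq_iff distrib_left distrib_right)

lemmas continuous_on_smult_vec [continuous_intros] = bounded_bilinear.continuous_on[OF bounded_bilinear_smult_vec]

definition clin :: "(complex ^ 'm \<Rightarrow> complex) \<Rightarrow> bool" where
  "clin D \<longleftrightarrow> (\<forall>a v w. D (a *s v + w) = a * D v + D w)"

lemma clin_add: "clin D \<Longrightarrow> D (v + w) = D v + D w"
  unfolding clin_def by (metis mult_1 vec.scale_one)

lemma clin_0: "clin D \<Longrightarrow> D 0 = 0"
  using clin_add[of D 0 0] by simp

lemma clin_scale: "clin D \<Longrightarrow> D (a *s v) = a * D v"
  unfolding clin_def by (metis (no_types) add.right_neutral clin_0 clin_def)

definition holo_at :: "(complex ^ 'm) set \<Rightarrow> complex ^ 'm \<Rightarrow> (complex ^ 'm \<Rightarrow> complex) \<Rightarrow> bool" where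
  "holo_at H z f \<longleftrightarrow> (\<exists>D. clin D \<and> (f has_derivative D) (at z within H))"

lemma holo_on_iff: "holo_on H W f \<longleftrightarrow> (\<forall>z\<in>W. holo_at H z f)"
  by (simp add: holo_on_def holo_at_def clin_def)

lemma holo_at_const: "holo_at H z (\<lambda>_. c)"
  unfolding holo_at_def by (rule exI[of _ "\<lambda>_. 0"]) (auto simp: clin_def)

lemma holo_at_add: "holo_at H z f \<Longrightarrow> holo_at H z g \<Longrightarrow> holo_at H z (\<lambda>y. f y + g y)"
  unfolding holo_at_def
  by (elim exE conjE, rule_tac x="\<lambda>v. D v + Da v" in exI)
     (auto simp: clin_def algebra_simps intro!: derivative_eq_intros)

lemma holo_at_mult: "holo_at H z f \<Longrightarrow> holo_at H z g \<Longrightarrow> holo_at H z (\<lambda>y. f y * g y)"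
  unfolding holo_at_def
  by (elim exE conjE, rule_tac x="\<lambda>v. f z * Da v + D v * g z" in exI)
     (auto simp: clin_def algebra_simps intro!: derivative_eq_intros)

lemma holo_at_sum: "(\<And>a. a \<in> S \<Longrightarrow> holo_at H z (f a)) \<Longrightarrow> holo_at H z (\<lambda>y. \<Sum>a\<in>S. f a y)"
  by (induction S rule: infinite_finite_induct) (auto intro: holo_at_const holo_at_add)

lemma holo_at_uminus: "holo_at H z f \<Longrightarrow> holo_at H z (\<lambda>y. - f y)"
  using holo_at_mult[OF holo_at_const[of H z "-1"]] by simp

lemma holo_at_diff: "holo_at H z f \<Longrightarrow> holo_at H z g \<Longrightarrow> holo_at H z (\<lambda>y. f y - g y)"
  using holo_at_add[OF _ holo_at_uminus] by simp

lemma holo_at_cong: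
  assumes "openin (top_of_set H) W" "z \<in> W" "\<And>y. y \<in> W \<Longrightarrow> f y = g y" "holo_at H z f"
  shows "holo_at H z g"
proof -
  obtain T where T: "open T" "W = H \<inter> T" using assms(1) by (auto simp: openin_open)
  then obtain e where e: "e > 0" "ball z e \<subseteq> T" using assms(2) by (auto simp: open_contains_ball)
  obtain D where D: "clin D" "(f has_derivative D) (at z within H)" using assms(4) by (auto simp: holo_at_def)
  have "(g has_derivative D) (at z within H)"
    by (rule has_derivative_transform_within[OF D(2) e(1)])
       (use assms T e in \<open>auto simp: dist_commute subset_iff\<close>)
  then show ?thesis using D by (auto simp: holo_at_def)
qed

text \<open>The complex line stays inside the subspace \<open>H\<close>, so a derivative relative to
  \<open>H\<close> restricts to an unrestricted derivative in the parameter of the line.\<close>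

lemma has_derivative_line:
  assumes H: "vec.subspace H" "v \<in> H" "z \<in> H" and f: "(f has_derivative D) (at z within H)" "clin D"
  shows "((\<lambda>t. f (z + t *s v)) has_field_derivative D v) (at 0)"
proof -
  have "((\<lambda>t. z + t *s v) has_derivative (\<lambda>t. t *s v)) (at 0)"
    using has_derivative_add[OF has_derivative_const bounded_linear_imp_has_derivative[OF
        bounded_bilinear.bounded_linear_left[OF bounded_bilinear_smult_vec]], of z v "at 0"] by simp
  moreover have "range (\<lambda>t. z + t *s v) \<subseteq> H"
    using H by (auto intro: vec.subspace_add vec.subspace_scale)
  then have "(f has_derivative D) (at (z + 0 *s v) within (\<lambda>t. z + t *s v) ` UNIV)"
    using f(1) by (auto intro: has_derivative_subset)
  ultimately have "((\<lambda>t. f (z + t *s v)) has_derivative (\<lambda>t. D (t *s v))) (at 0)"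
    by (rule has_derivative_in_compose)
  moreover have "(\<lambda>t. D (t *s v)) = (*) (D v)" by (simp add: clin_scale[OF f(2)] fun_eq_iff mult.commute)
  ultimately show ?thesis by (simp add: has_field_derivative_def)
qed

lemma deriv_line:
  assumes "vec.subspace H" "v \<in> H" "z \<in> H" "(f has_derivative D) (at z within H)" "clin D"
  shows "deriv (\<lambda>t. f (z + t *s v)) 0 = D v"
  by (rule DERIV_imp_deriv[OF has_derivative_line[OF assms]])

lemma holo_at_line:
  assumes H: "vec.subspace H" "v \<in> H" "z \<in> H" and f: "holo_at H (z + t *s v) f"
  shows "((\<lambda>t. f (z + t *s v)) has_field_derivative deriv (\<lambda>s. f ((z + t *s v) + s *s v)) 0) (at t)"
proof -
  obtain D where D: "clin D" "(f has_derivative D) (at (z + t *s v) within H)" using f by (auto simp: holo_at_def)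
  have "z + t *s v \<in> H" using H by (auto intro: vec.subspace_add vec.subspace_scale)
  note d = has_derivative_line[OF H(1,2) this D(2,1)] deriv_line[OF H(1,2) this D(2,1)]
  have "((\<lambda>s. f (z + (s + t) *s v)) has_field_derivative D v) (at 0)"
    using d(1) by (simp add: vec.scale_left_distrib add_ac)
  then have "((\<lambda>s. f (z + s *s v)) has_field_derivative D v) (at t)"
    using DERIV_shift[of "\<lambda>s. f (z + s *s v)" "D v" 0 t] by simp
  then show ?thesis using d(2) by simp
qed

section \<open>Directional derivatives as Cauchy integrals\<close>

text \<open>Cauchy's formula for the first derivative on the circle of radius \<open>e\<close>. The
  derivative of the parametrisation \<open>\<gamma>\<close> is
  \<open>2 * pi * \<i> * \<gamma>\<close>, which cancels the constant in front and one power of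
  \<open>\<gamma>\<close> in the denominator.\<close>

lemma cauchy_line:
  fixes f :: "complex ^ 'm \<Rightarrow> complex"
  assumes W: "\<And>t. norm t \<le> e \<Longrightarrow> holo_at UNIV (z + t *s v) f" and e: "e > 0"
  defines "\<gamma> \<equiv> \<lambda>s::real. of_real e * exp (2 * of_real pi * \<i> * of_real s)"
  shows "deriv (\<lambda>t. f (z + t *s v)) 0 = integral (cbox 0 1) (\<lambda>s. f (z + \<gamma> s *s v) / \<gamma> s)"
proof -
  let ?F = "\<lambda>t. f (z + t *s v)"
  have F: "?F field_differentiable (at t)" if "norm t \<le> e" for t
    using holo_at_line[OF vec.subspace_UNIV _ _ W[OF that]] by (auto simp: field_differentiable_def)
  have cont: "continuous_on (cball 0 e) ?F"
    by (rule continuous_at_imp_continuous_on) (auto intro!: field_differentiable_imp_continuous_at F)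
  have hol: "?F holomorphic_on ball 0 e"
    unfolding holomorphic_on_def by (auto intro!: field_differentiable_at_within F)
  have 0: "(0::complex) \<in> ball 0 e" using e by simp
  note C = Cauchy_derivative_integral_circlepath[OF cont hol 0]
  have cp: "circlepath 0 e = \<gamma>" by (simp add: circlepath \<gamma>_def)
  have "((\<lambda>u. ?F u / (u - 0)^2) has_contour_integral contour_integral (circlepath 0 e) (\<lambda>u. ?F u / (u - 0)^2)) (circlepath 0 e)"
    by (rule has_contour_integral_integral[OF C(1)])
  then have "((\<lambda>s. ?F (\<gamma> s) / (\<gamma> s)^2 * (2 * pi * \<i> * e * exp (2 * of_real pi * \<i> * s))) has_integral
      contour_integral (circlepath 0 e) (\<lambda>u. ?F u / (u - 0)^2)) {0..1}"
    unfolding has_contour_integral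
    by (rule has_integral_spike_finite[of "{}", rotated 2]) (auto simp: vector_derivative_circlepath vector_derivative_at_within_ivl simp flip: cp)
  then have "((\<lambda>s. 1 / (2 * of_real pi * \<i>) * (?F (\<gamma> s) / (\<gamma> s)^2 * (2 * pi * \<i> * e * exp (2 * of_real pi * \<i> * s)))) has_integral
      1 / (2 * of_real pi * \<i>) * contour_integral (circlepath 0 e) (\<lambda>u. ?F u / (u - 0)^2)) {0..1}"
    by (rule has_integral_mult_right)
  moreover have "1 / (2 * of_real pi * \<i>) * (?F (\<gamma> s) / (\<gamma> s)^2 * (2 * pi * \<i> * e * exp (2 * of_real pi * \<i> * s))) = ?F (\<gamma> s) / \<gamma> s" for s
    using e by (simp add: \<gamma>_def power2_eq_square field_simps)
  ultimately have "((\<lambda>s. ?F (\<gamma> s) / \<gamma> s) has_integral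
      1 / (2 * of_real pi * \<i>) * contour_integral (circlepath 0 e) (\<lambda>u. ?F u / (u - 0)^2)) {0..1}"
    by simp
  then show ?thesis using DERIV_imp_deriv[OF C(2)] by (simp add: integral_unique)
qed

lemma holo_at_imp_continuous: "holo_at UNIV z f \<Longrightarrow> isCont f z"
  by (auto simp: holo_at_def dest: has_derivative_continuous)

text \<open>Directional derivatives are Cauchy integrals over circles in the line, which depend
  holomorphically on the base point.\<close>

lemma cauchy_nbhd:
  fixes z0 v :: "complex ^ 'm"
  assumes "open W" "z0 \<in> W"
  obtains r e where "r > 0" "e > 0" "\<And>z t::complex. z \<in> ball z0 r \<Longrightarrow> norm t \<le> e \<Longrightarrow> z + t *s v \<in> W"
proof -
  obtain d where d: "d > 0" "ball z0 d \<subseteq> W" using assms by (auto simp: open_contains_ball)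
  show thesis
  \<comment> \<open>Half of the radius is for the base point and half for the line; the summand 1 in
    the denominator covers \<open>v = 0\<close>.\<close>
  proof (rule that[of "d / 2" "d / 2 / (norm v + 1)"])
    fix z and t :: complex assume z: "z \<in> ball z0 (d/2)" and t: "norm t \<le> d / 2 / (norm v + 1)"
    have "norm (t *s v) \<le> d / 2 / (norm v + 1) * norm v"
      using mult_right_mono[OF t, of "norm v"] by (simp only: norm_smult_vec norm_ge_zero)
    also have "\<dots> \<le> d / 2 / (norm v + 1) * (norm v + 1)" using d by (intro mult_left_mono) auto
    also have "\<dots> = d / 2" using norm_ge_zero[of v] by (simp add: field_simps add_nonneg_eq_0_iff)
    finally have "norm (t *s v) \<le> d / 2" .
    moreover have "dist z0 (z + t *s v) \<le> dist z0 z + norm (t *s v)"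
      using norm_triangle_ineq[of "z - z0" "t *s v"] by (simp add: dist_norm norm_minus_commute algebra_simps)
    ultimately show "z + t *s v \<in> W" using z d by (auto simp: subset_iff)
  next
    show "d / 2 / (norm v + 1) > 0" using d norm_ge_zero[of v] by (intro divide_pos_pos add_nonneg_pos) auto
  qed (use d in auto)
qed

text \<open>Holomorphy here means mere differentiability, with nothing assumed on the continuity of
  the derivative. The integral formula yields it from the continuity of \<open>f\<close>, and
  differentiation under the integral sign depends on it.\<close>

lemma continuous_deriv_line:
  fixes f :: "complex ^ 'm \<Rightarrow> complex"
  assumes W: "open W" and f: "\<And>z. z \<in> W \<Longrightarrow> holo_at UNIV z f"
  shows "continuous_on W (\<lambda>z. deriv (\<lambda>t. f (z + t *s v)) 0)"
proof -
  have "isCont (\<lambda>z. deriv (\<lambda>t. f (z + t *s v)) 0) z0" if z0: "z0 \<in> W" for z0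
  proof -
    obtain r e where re: "r > 0" "e > 0" "\<And>z t. z \<in> ball z0 r \<Longrightarrow> norm t \<le> e \<Longrightarrow> z + t *s v \<in> W"
      using cauchy_nbhd[OF W z0] by blast
    define \<gamma> where "\<gamma> = (\<lambda>s::real. of_real e * exp (2 * of_real pi * \<i> * of_real s) :: complex)"
    have n\<gamma>: "norm (\<gamma> s) = e" for s using re by (simp add: \<gamma>_def norm_mult)
    have c\<gamma>: "continuous_on S \<gamma>" for S unfolding \<gamma>_def by (intro continuous_intros)
    have nz: "\<gamma> s \<noteq> 0" for s using n\<gamma>[of s] re by auto
    have fc: "continuous_on W f" using f by (auto intro!: continuous_at_imp_continuous_on holo_at_imp_continuous)
    have "continuous_on (ball z0 r \<times> cbox 0 1) (\<lambda>(z, s). f (z + \<gamma> s *s v) / \<gamma> s)"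
      unfolding split_beta
      by (intro continuous_intros continuous_on_compose2[OF fc] continuous_on_compose2[OF c\<gamma>[of UNIV]])
         (use re n\<gamma> nz in auto)
    then have "continuous_on (ball z0 r) (\<lambda>z. integral (cbox 0 1) (\<lambda>s. f (z + \<gamma> s *s v) / \<gamma> s))"
      by (rule integral_continuous_on_param)
    moreover have "deriv (\<lambda>t. f (z + t *s v)) 0 = integral (cbox 0 1) (\<lambda>s. f (z + \<gamma> s *s v) / \<gamma> s)" if "z \<in> ball z0 r" for z
      unfolding \<gamma>_def by (rule cauchy_line) (use re that in \<open>auto intro!: f\<close>)
    ultimately have "continuous_on (ball z0 r) (\<lambda>z. deriv (\<lambda>t. f (z + t *s v)) 0)"
      by (rule continuous_on_eq[OF _ sym])
    then show ?thesis using re(1) by (simp add: continuous_on_eq_continuous_at)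
  qed
  then show ?thesis by (auto intro: continuous_at_imp_continuous_on)
qed

lemma holo_at_deriv_line_UNIV:
  fixes f :: "complex ^ 'm \<Rightarrow> complex"
  assumes W: "open W" and f: "\<And>z. z \<in> W \<Longrightarrow> holo_at UNIV z f" and z0: "z0 \<in> W"
  shows "holo_at UNIV z0 (\<lambda>z. deriv (\<lambda>t. f (z + t *s v)) 0)"
proof -
  obtain r e where re: "r > 0" "e > 0" "\<And>z t. z \<in> ball z0 r \<Longrightarrow> norm t \<le> e \<Longrightarrow> z + t *s v \<in> W"
    using cauchy_nbhd[OF W z0] by blast
  define \<gamma> where "\<gamma> = (\<lambda>s::real. of_real e * exp (2 * of_real pi * \<i> * of_real s) :: complex)"
  have n\<gamma>: "norm (\<gamma> s) = e" for s using re by (simp add: \<gamma>_def norm_mult)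
  have c\<gamma>: "continuous_on S \<gamma>" for S unfolding \<gamma>_def by (intro continuous_intros)
  have nz: "\<gamma> s \<noteq> 0" for s using n\<gamma>[of s] re by auto
  have fc: "continuous_on W f" using f by (auto intro!: continuous_at_imp_continuous_on holo_at_imp_continuous)
  define D where "D z = (SOME D. clin D \<and> (f has_derivative D) (at z))" for z
  have D: "clin (D z)" "(f has_derivative D z) (at z)" if "z \<in> W" for z
    using someI_ex[OF f[OF that, unfolded holo_at_def]] by (simp_all add: D_def)
  have Dv: "D z h = deriv (\<lambda>t. f (z + t *s h)) 0" if "z \<in> W" for z h
    using deriv_line[OF vec.subspace_UNIV _ _ D(2,1)[OF that]] by simp
  \<comment> \<open>The derivative of the integrand in the base point, as an element of the normed
    space of bounded linear maps, in which \<open>leibniz_rule\<close> integrates.\<close>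
  define fx where "fx z s = Blinfun (\<lambda>h. D (z + \<gamma> s *s v) h / \<gamma> s)" for z s
  have mem: "z + \<gamma> s *s v \<in> W" if "z \<in> ball z0 r" for z s by (rule re(3)[OF that]) (simp add: n\<gamma>)
  have fx: "blinfun_apply (fx z s) = (\<lambda>h. D (z + \<gamma> s *s v) h / \<gamma> s)" if "z \<in> ball z0 r" for z s
    unfolding fx_def
    by (rule bounded_linear_Blinfun_apply[OF bounded_linear_compose[OF bounded_linear_divide
        has_derivative_bounded_linear[OF D(2)[OF mem[OF that]]]]])
  let ?K = "\<lambda>z s. f (z + \<gamma> s *s v) / \<gamma> s"
  have contW: "continuous_on (ball z0 r \<times> cbox 0 1) (\<lambda>x. g (fst x + \<gamma> (snd x) *s v) / \<gamma> (snd x))"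
    if "continuous_on W g" for g :: "complex ^ 'm \<Rightarrow> complex"
    by (intro continuous_intros continuous_on_compose2[OF that] continuous_on_compose2[OF c\<gamma>[of UNIV]])
       (use mem nz in auto)
  have "((\<lambda>z. integral (cbox 0 1) (?K z)) has_derivative integral (cbox 0 1) (fx z0)) (at z0 within ball z0 r)"
  proof (rule leibniz_rule)
    fix z s assume z: "z \<in> ball z0 r"
    have "((\<lambda>z. z + \<gamma> s *s v) has_derivative (\<lambda>h. h)) (at z)" by (auto intro!: derivative_eq_intros)
    then have "((\<lambda>z. f (z + \<gamma> s *s v)) has_derivative D (z + \<gamma> s *s v)) (at z)"
      using diff_chain_at[of "\<lambda>z. z + \<gamma> s *s v" "\<lambda>h. h" z f] D(2)[OF mem[OF z]] by (simp add: o_def)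
    then show "((\<lambda>z. ?K z s) has_derivative blinfun_apply (fx z s)) (at z within ball z0 r)"
      unfolding fx[OF z]
      by (rule has_derivative_at_withinI[OF bounded_linear.has_derivative[OF bounded_linear_divide]])
  next
    fix z assume z: "z \<in> ball z0 r"
    have "continuous_on (cbox 0 1) (?K z)"
      by (intro continuous_intros continuous_on_compose2[OF fc] c\<gamma>) (use mem[OF z] nz in auto)
    then show "?K z integrable_on cbox 0 1" by (rule integrable_continuous)
  next
    show "continuous_on (ball z0 r \<times> cbox 0 1) (\<lambda>(z, s). fx z s)"
    \<comment> \<open>In finite dimension an operator-valued function is continuous if its values on
      fixed vectors are, and these are directional derivatives.\<close>
    proof (rule continuous_on_blinfun_componentwise)
      fix i :: "complex ^ 'm"
      have "continuous_on W (\<lambda>z. D z i)"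
        using continuous_deriv_line[OF W f, of i] by (simp add: Dv cong: continuous_on_cong)
      from contW[OF this]
      show "continuous_on (ball z0 r \<times> cbox 0 1) (\<lambda>x. blinfun_apply (case x of (z, s) \<Rightarrow> fx z s) i)"
        by (rule continuous_on_eq) (auto simp: fx)
    qed
  qed (use re in auto)
  then have der: "((\<lambda>z. integral (cbox 0 1) (?K z)) has_derivative integral (cbox 0 1) (fx z0)) (at z0)"
    using re(1) by (simp add: at_within_open[of _ "ball z0 r"])
  have "((\<lambda>z. deriv (\<lambda>t. f (z + t *s v)) 0) has_derivative integral (cbox 0 1) (fx z0)) (at z0)"
  proof (rule has_derivative_transform_within_open[OF der])
    show "open (ball z0 r)" "z0 \<in> ball z0 r" using re(1) by auto
    show "integral (cbox 0 1) (?K z) = deriv (\<lambda>t. f (z + t *s v)) 0" if "z \<in> ball z0 r" for z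
      unfolding \<gamma>_def by (rule cauchy_line[symmetric]) (use re that in \<open>auto intro!: f\<close>)
  qed
  \<comment> \<open>The Leibniz rule gives a derivative that is linear over the reals only. Complex
    linearity passes from the integrand to the integral by evaluation on vectors.\<close>
  moreover have "clin (blinfun_apply (integral (cbox 0 1) (fx z0)))"
  proof -
    have z0r: "z0 \<in> ball z0 r" using re(1) by simp
    have fxc: "continuous_on (cbox 0 1) (fx z0)"
    proof (rule continuous_on_blinfun_componentwise)
      fix i :: "complex ^ 'm"
      have "continuous_on W (\<lambda>z. D z i)"
        using continuous_deriv_line[OF W f, of i] by (simp add: Dv cong: continuous_on_cong)
      then have "continuous_on (cbox 0 1) (\<lambda>s. D (z0 + \<gamma> s *s v) i / \<gamma> s)"
        by (intro continuous_intros continuous_on_compose2[OF \<open>continuous_on W (\<lambda>z. D z i)\<close>] c\<gamma>) (use mem[OF z0r] nz in auto)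
      then show "continuous_on (cbox 0 1) (\<lambda>x. blinfun_apply (fx z0 x) i)" by (simp add: fx[OF z0r])
    qed
    have int: "fx z0 integrable_on cbox 0 1" using fxc by (rule integrable_continuous)
    have I: "((\<lambda>s. D (z0 + \<gamma> s *s v) h / \<gamma> s) has_integral blinfun_apply (integral (cbox 0 1) (fx z0)) h) (cbox 0 1)" for h
      using has_integral_linear[OF integrable_integral[OF int] blinfun.bounded_linear_left, of h]
      by (simp add: o_def fx[OF z0r])
    show ?thesis unfolding clin_def
    proof (intro allI)
      fix a u w
      let ?J = "blinfun_apply (integral (cbox 0 1) (fx z0))"
      have "((\<lambda>s. a * (D (z0 + \<gamma> s *s v) u / \<gamma> s) + D (z0 + \<gamma> s *s v) w / \<gamma> s) has_integral a * ?J u + ?J w) (cbox 0 1)"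
        by (intro has_integral_add has_integral_mult_right I)
      moreover have "a * (D (z0 + \<gamma> s *s v) u / \<gamma> s) + D (z0 + \<gamma> s *s v) w / \<gamma> s = D (z0 + \<gamma> s *s v) (a *s u + w) / \<gamma> s" for s
        using D(1)[OF mem[OF z0r], of s] by (simp add: clin_def add_divide_distrib)
      ultimately show "?J (a *s u + w) = a * ?J u + ?J w"
        using has_integral_unique[OF I[of "a *s u + w"]] by simp
    qed
  qed
  ultimately show ?thesis unfolding holo_at_def by blast
qed

section \<open>From the full space to subspaces, and the chain rule\<close>

lemma subspace_projection:
  fixes H :: "(complex ^ 'm) set"
  assumes "vec.subspace H"
  obtains \<pi> where "Vector_Spaces.linear (*s) (*s) \<pi>" "range \<pi> \<subseteq> H" "\<And>z. z \<in> H \<Longrightarrow> \<pi> z = z"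
  using vec.linear_exists_left_inverse_on[OF vec.linear_id assms inj_on_id2[of H, unfolded id_def[symmetric]]]
  by (auto simp: id_def)

lemma scaleR_smult_vec: "r *\<^sub>R (x :: complex ^ 'm) = of_real r *s x"
  unfolding vec_eq_iff vector_scaleR_component vector_smult_component by (simp only: scaleR_conv_of_real simp_thms)

lemma bounded_linear_vec_linear:
  fixes \<pi> :: "complex ^ 'm \<Rightarrow> complex ^ 'k"
  assumes "Vector_Spaces.linear (*s) (*s) \<pi>"
  shows "bounded_linear \<pi>"
proof -
  interpret p: Vector_Spaces.linear "(*s)" "(*s)" \<pi> by (rule assms)
  have "\<pi> (r *\<^sub>R x) = r *\<^sub>R \<pi> x" for r x
    by (simp only: scaleR_smult_vec p.scale)
  then show ?thesis
    by (intro linear_conv_bounded_linear[THEN iffD1] linearI p.add)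
qed

text \<open>Composition with a linear projection onto \<open>H\<close> extends \<open>f\<close> to
  an open subset of the full space, where the Cauchy integral is available. On lines inside
  \<open>H\<close> the extension is \<open>f\<close> itself, so the directional derivatives
  coincide.\<close>

lemma holo_at_deriv_line:
  fixes f :: "complex ^ 'm \<Rightarrow> complex"
  assumes H: "vec.subspace H" and W: "openin (top_of_set H) W" and f: "\<And>z. z \<in> W \<Longrightarrow> holo_at H z f"
    and z0: "z0 \<in> W" and v: "v \<in> H"
  shows "holo_at H z0 (\<lambda>z. deriv (\<lambda>t. f (z + t *s v)) 0)"
proof -
  obtain \<pi> where \<pi>: "Vector_Spaces.linear (*s) (*s) \<pi>" "range \<pi> \<subseteq> H" "\<And>z. z \<in> H \<Longrightarrow> \<pi> z = z"
    using subspace_projection[OF H] by blast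
  interpret p: Vector_Spaces.linear "(*s)" "(*s)" \<pi> by (rule \<pi>(1))
  have bl: "bounded_linear \<pi>" by (rule bounded_linear_vec_linear[OF \<pi>(1)])
  have WH: "W \<subseteq> H" using W by (auto simp: openin_open)
  obtain T where T: "open T" "W = H \<inter> T" using W by (auto simp: openin_open)
  define W' where "W' = \<pi> -` T"
  have W': "open W'" unfolding W'_def using T(1) bl
    by (auto intro!: open_vimage linear_continuous_on)
  have in_W: "\<pi> z \<in> W" if "z \<in> W'" for z using that \<pi>(2) T by (auto simp: W'_def)
  have f': "holo_at UNIV z (f \<circ> \<pi>)" if z: "z \<in> W'" for z
  proof -
    obtain D where D: "clin D" "(f has_derivative D) (at (\<pi> z) within H)"
      using f[OF in_W[OF z]] by (auto simp: holo_at_def)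
    have "(\<pi> has_derivative \<pi>) (at z)" by (rule bounded_linear_imp_has_derivative[OF bl])
    moreover have "(f has_derivative D) (at (\<pi> z) within range \<pi>)"
      by (rule has_derivative_subset[OF D(2) \<pi>(2)])
    ultimately have "((\<lambda>x. f (\<pi> x)) has_derivative (\<lambda>x. D (\<pi> x))) (at z)"
      by (rule has_derivative_in_compose)
    moreover have "clin (\<lambda>x. D (\<pi> x))" using D(1) by (simp add: clin_def p.add p.scale)
    ultimately show ?thesis unfolding holo_at_def o_def by blast
  qed
  have z0': "z0 \<in> W'" using z0 T \<pi>(3) WH by (auto simp: W'_def)
  have "holo_at UNIV z0 (\<lambda>z. deriv (\<lambda>t. (f \<circ> \<pi>) (z + t *s v)) 0)"
    by (rule holo_at_deriv_line_UNIV[OF W' f' z0'])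
  then have "holo_at H z0 (\<lambda>z. deriv (\<lambda>t. (f \<circ> \<pi>) (z + t *s v)) 0)"
    unfolding holo_at_def by (blast intro: has_derivative_subset)
  then show ?thesis
    by (rule holo_at_cong[OF W z0, rotated])
       (use WH v \<pi>(3) H in \<open>auto simp: subset_iff vec.subspace_add vec.subspace_scale\<close>)
qed

lemma has_derivative_vec_components:
  fixes \<psi> :: "complex ^ 'm \<Rightarrow> complex ^ 'k"
  assumes "\<And>i. ((\<lambda>z. \<psi> z $ i) has_derivative (\<lambda>v. J v $ i)) (at z within H)"
  shows "(\<psi> has_derivative J) (at z within H)"
proof (subst has_derivative_componentwise_within, intro ballI)
  fix b :: "complex ^ 'k" assume "b \<in> Basis"
  then obtain i u where b: "b = axis i u" "u \<in> Basis" by (auto simp: Basis_vec_def)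
  have "((\<lambda>z. \<psi> z $ i \<bullet> u) has_derivative (\<lambda>v. J v $ i \<bullet> u)) (at z within H)"
    by (rule has_derivative_inner_left[OF assms])
  then show "((\<lambda>x. \<psi> x \<bullet> b) has_derivative (\<lambda>x. J x \<bullet> b)) (at z within H)"
    by (simp add: b inner_axis)
qed

text \<open>Both sides are the derivative of \<open>g\<close> applied to the velocity of the image
  curve. The second claim says that this velocity is tangent to \<open>H'\<close>; without it
  \<open>g\<close>, which is differentiable relative to \<open>H'\<close> only, could not be
  differentiated along the line on the right.\<close>

lemma holo_chain:
  fixes \<psi> :: "complex ^ 'm \<Rightarrow> complex ^ 'k"
  assumes H: "vec.subspace H" "vec.subspace H'" and W: "openin (top_of_set H) W" "z \<in> W"
    and \<psi>: "\<And>i. holo_at H z (\<lambda>y. \<psi> y $ i)" "\<psi> ` W \<subseteq> H'"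
    and g: "holo_at H' (\<psi> z) g" and v: "v \<in> H"
  shows "deriv (\<lambda>t. g (\<psi> (z + t *s v))) 0 =
      deriv (\<lambda>t. g (\<psi> z + t *s (\<chi> i. deriv (\<lambda>t. \<psi> (z + t *s v) $ i) 0))) 0"
    and "(\<chi> i. deriv (\<lambda>t. \<psi> (z + t *s v) $ i) 0) \<in> H'"
proof -
  have zH: "z \<in> H" using W by (auto simp: openin_open)
  have \<psi>H: "\<psi> z \<in> H'" using W \<psi> by auto
  obtain D where D: "clin D" "(g has_derivative D) (at (\<psi> z) within H')" using g by (auto simp: holo_at_def)
  have "\<forall>i. \<exists>D. clin D \<and> ((\<lambda>y. \<psi> y $ i) has_derivative D) (at z within H)" using \<psi>(1) by (auto simp: holo_at_def)
  then obtain Ji where Ji: "\<And>i. clin (Ji i)" "\<And>i. ((\<lambda>y. \<psi> y $ i) has_derivative Ji i) (at z within H)" by metis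
  define J where "J v = (\<chi> i. Ji i v)" for v
  have J: "(\<psi> has_derivative J) (at z within H)"
    by (rule has_derivative_vec_components) (simp add: J_def Ji)
  have Jl: "J (a *s v + w) = a *s J v + J w" for a v w
    using Ji(1) by (simp add: J_def vec_eq_iff clin_def)
  obtain T where T: "open T" "W = H \<inter> T" using W(1) by (auto simp: openin_open)
  have JW: "(\<psi> has_derivative J) (at z within W)" by (rule has_derivative_subset[OF J]) (use T in auto)
  have "(g has_derivative D) (at (\<psi> z) within \<psi> ` W)" by (rule has_derivative_subset[OF D(2) \<psi>(2)])
  from has_derivative_in_compose[OF JW this]
  have "((\<lambda>y. g (\<psi> y)) has_derivative (\<lambda>v. D (J v))) (at z within W)" .
  then have gD: "((\<lambda>y. g (\<psi> y)) has_derivative (\<lambda>v. D (J v))) (at z within H)"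
    using at_within_nhd[of z T W H] T W(2) by simp
  have DJ: "clin (\<lambda>v. D (J v))" using D(1) by (simp add: clin_def Jl)
  have Jv: "(\<chi> i. deriv (\<lambda>t. \<psi> (z + t *s v) $ i) 0) = J v"
    unfolding J_def vec_eq_iff using deriv_line[OF H(1) v zH Ji(2,1)] by simp
  show JH: "(\<chi> i. deriv (\<lambda>t. \<psi> (z + t *s v) $ i) 0) \<in> H'"
  proof -
    obtain \<pi> where \<pi>: "Vector_Spaces.linear (*s) (*s) \<pi>" "range \<pi> \<subseteq> H'" "\<And>z. z \<in> H' \<Longrightarrow> \<pi> z = z"
      using subspace_projection[OF H(2)] by blast
    interpret p: Vector_Spaces.linear "(*s)" "(*s)" \<pi> by (rule \<pi>(1))
    have bl: "bounded_linear \<pi>" by (rule bounded_linear_vec_linear[OF \<pi>(1)])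
    define \<phi> where "\<phi> t = \<psi> (z + of_real t *s v)" for t :: real
    have line: "((\<lambda>t::real. z + of_real t *s v) has_derivative (\<lambda>t. t *\<^sub>R v)) (at 0)"
      using has_derivative_add[OF has_derivative_const bounded_linear_imp_has_derivative[OF
        bounded_linear_scaleR_left[of v]], of z "at 0"] by (simp add: scaleR_smult_vec)
    have sub: "(\<lambda>t::real. z + of_real t *s v) ` UNIV \<subseteq> H"
      using H v zH by (auto intro: vec.subspace_add vec.subspace_scale)
    have "(\<phi> has_derivative (\<lambda>t. J (t *\<^sub>R v))) (at 0)"
      unfolding \<phi>_def
      by (rule has_derivative_in_compose[OF line]) (use has_derivative_subset[OF J sub] in simp)
    moreover have "J (t *\<^sub>R v) = t *\<^sub>R J v" for t
      using Jl[of "of_real t" v 0] Jl[of 1 0 0] by (simp add: scaleR_smult_vec)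
    ultimately have \<phi>: "(\<phi> has_vector_derivative J v) (at 0)" by (simp add: has_vector_derivative_def)
    then have "((\<lambda>t. \<pi> (\<phi> t)) has_vector_derivative \<pi> (J v)) (at 0)"
      by (rule bounded_linear.has_vector_derivative[OF bl])
    \<comment> \<open>Near 0 the curve stays in \<open>H'\<close> and is fixed by the projection.
      Uniqueness of derivatives then shows that its velocity is fixed as well, hence lies in
      \<open>H'\<close>.\<close>
    moreover have "((\<lambda>t. \<pi> (\<phi> t)) has_vector_derivative J v) (at 0)"
    proof (rule has_vector_derivative_transform_within_open[OF \<phi>])
      have "continuous_on UNIV (\<lambda>t::real. z + of_real t *s v)" by (intro continuous_intros)
      then show "open ((\<lambda>t::real. z + of_real t *s v) -` T)" using T(1) by (auto intro: open_vimage)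
      show "0 \<in> (\<lambda>t::real. z + of_real t *s v) -` T" using T W(2) by simp
      fix t assume "t \<in> (\<lambda>t::real. z + of_real t *s v) -` T"
      then have "z + of_real t *s v \<in> W" using sub T by auto
      then show "\<phi> t = \<pi> (\<phi> t)" using \<psi>(2) \<pi>(3) by (auto simp: \<phi>_def)
    qed
    ultimately have "\<pi> (J v) = J v" by (rule vector_derivative_unique_at)
    then show ?thesis unfolding Jv using \<pi>(2) by (metis rangeI subsetD)
  qed
  show "deriv (\<lambda>t. g (\<psi> (z + t *s v))) 0 =
      deriv (\<lambda>t. g (\<psi> z + t *s (\<chi> i. deriv (\<lambda>t. \<psi> (z + t *s v) $ i) 0))) 0"
    using deriv_line[OF H(1) v zH gD DJ] deriv_line[OF H(2) JH \<psi>H D(2,1)] by (simp only: Jv)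
qed

section \<open>Derivatives in charts\<close>

text \<open>Differentiability at a single point in a single chart. Holomorphy on a set is this at
  all its points (\<open>holo_fun_iff\<close>), so identities that hold only near one point can be
  applied point by point.\<close>

definition hdiff :: "('a, 'm::finite) cmfd \<Rightarrow> ('a, 'm) chart \<Rightarrow> 'a \<Rightarrow> ('a \<Rightarrow> complex) \<Rightarrow> bool" where
  "hdiff M ch x u \<longleftrightarrow> holo_at (model M) (snd ch x) (\<lambda>z. u (chart_inv ch z))"

lemma chart_facts:
  assumes "complex_manifold M" "ch \<in> charts M"
  shows chart_open: "openin (mtop M) (fst ch)"
    and chart_image: "openin (top_of_set (model M)) (snd ch ` fst ch)"
    and chart_homeo: "homeomorphic_map (subtopology (mtop M) (fst ch)) (top_of_set (snd ch ` fst ch)) (snd ch)"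
    and model_subspace: "vec.subspace (model M)"
  using assms by (auto simp: complex_manifold_def)

lemma chart_pts: "complex_manifold M \<Longrightarrow> ch \<in> charts M \<Longrightarrow> x \<in> fst ch \<Longrightarrow> x \<in> pts M"
  using openin_subset[OF chart_open] by blast

lemma chart_inj:
  assumes "complex_manifold M" "ch \<in> charts M"
  shows "inj_on (snd ch) (fst ch)"
proof -
  have "topspace (subtopology (mtop M) (fst ch)) = fst ch"
    using openin_subset[OF chart_open[OF assms]] by auto
  then show ?thesis using homeomorphic_imp_injective_map[OF chart_homeo[OF assms]] by simp
qed

lemma chart_inv_eq [simp]: "complex_manifold M \<Longrightarrow> ch \<in> charts M \<Longrightarrow> x \<in> fst ch \<Longrightarrow> chart_inv ch (snd ch x) = x"
  by (simp add: chart_inj inv_into_f_f)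

lemma chart_model: "complex_manifold M \<Longrightarrow> ch \<in> charts M \<Longrightarrow> x \<in> fst ch \<Longrightarrow> snd ch x \<in> model M"
  using openin_imp_subset[OF chart_image] by blast

lemma chart_image_open:
  assumes M: "complex_manifold M" "ch \<in> charts M" and N: "openin (mtop M) N"
  shows "openin (top_of_set (model M)) (snd ch ` (N \<inter> fst ch))"
proof -
  have "openin (subtopology (mtop M) (fst ch)) (N \<inter> fst ch)"
    using N by (auto simp: openin_subtopology)
  then have "openin (top_of_set (snd ch ` fst ch)) (snd ch ` (N \<inter> fst ch))"
    using homeomorphic_imp_open_map[OF chart_homeo[OF M]] by (auto simp: open_map_def)
  then show ?thesis using chart_image[OF M] by (rule openin_trans)
qed

lemma holo_fun_iff:
  assumes M: "complex_manifold M"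
  shows "holo_fun M N u \<longleftrightarrow> (\<forall>ch\<in>charts M. \<forall>x\<in>N \<inter> fst ch. hdiff M ch x u)"
  by (simp add: holo_fun_def holo_on_iff hdiff_def)

lemma hdiff_cong:
  assumes M: "complex_manifold M" "ch \<in> charts M" and N: "openin (mtop M) N" "x \<in> N" "x \<in> fst ch"
    and eq: "\<And>y. y \<in> N \<Longrightarrow> y \<in> fst ch \<Longrightarrow> u y = w y" and u: "hdiff M ch x u"
  shows "hdiff M ch x w"
  unfolding hdiff_def
  by (rule holo_at_cong[OF chart_image_open[OF M N(1)] _ _ u[unfolded hdiff_def]])
     (use N eq M in auto)

lemma eventually_line_openin:
  fixes H :: "(complex ^ 'm) set"
  assumes H: "vec.subspace H" and W: "openin (top_of_set H) W" "z \<in> W" and v: "v \<in> H"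
  shows "eventually (\<lambda>t. z + t *s v \<in> W) (nhds 0)"
proof -
  obtain T where T: "open T" "W = H \<inter> T" using W by (auto simp: openin_open)
  have "continuous_on UNIV (\<lambda>t. z + t *s v)" by (intro continuous_intros)
  then have "open ((\<lambda>t. z + t *s v) -` T)" using T(1) by (auto intro: open_vimage)
  moreover have "0 \<in> (\<lambda>t. z + t *s v) -` T" using T W by simp
  ultimately have "eventually (\<lambda>t. t \<in> (\<lambda>t. z + t *s v) -` T) (nhds 0)" by (rule eventually_nhds_in_open)
  then show ?thesis
    by eventually_elim (use T W v H in \<open>auto intro: vec.subspace_add vec.subspace_scale\<close>)
qed

lemma dird_cong:
  assumes M: "complex_manifold M" "ch \<in> charts M" and N: "openin (mtop M) N" "x \<in> N" "x \<in> fst ch"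
    and v: "v \<in> model M" and eq: "\<And>y. y \<in> N \<Longrightarrow> y \<in> fst ch \<Longrightarrow> u y = w y"
  shows "dird ch x v u = dird ch x v w"
proof -
  have "eventually (\<lambda>t. snd ch x + t *s v \<in> snd ch ` (N \<inter> fst ch)) (nhds 0)"
    by (rule eventually_line_openin[OF model_subspace[OF M] chart_image_open[OF M N(1)] _ v]) (use N in auto)
  then have "eventually (\<lambda>t. u (chart_inv ch (snd ch x + t *s v)) = w (chart_inv ch (snd ch x + t *s v))) (nhds 0)"
    by eventually_elim (use M eq in auto)
  then show ?thesis unfolding dird_def by (rule deriv_cong_ev) simp
qed

lemma dird_deriv:
  assumes M: "complex_manifold M" "ch \<in> charts M" and x: "x \<in> fst ch" and v: "v \<in> model M" and u: "hdiff M ch x u"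
  shows "((\<lambda>t. u (chart_inv ch (snd ch x + t *s v))) has_field_derivative dird ch x v u) (at 0)"
proof -
  obtain D where D: "clin D" "((\<lambda>z. u (chart_inv ch z)) has_derivative D) (at (snd ch x) within model M)"
    using u by (auto simp: hdiff_def holo_at_def)
  have "((\<lambda>t. u (chart_inv ch (snd ch x + t *s v))) has_field_derivative D v) (at 0)"
    by (rule has_derivative_line[OF model_subspace[OF M] v chart_model[OF M x] D(2,1)])
  then show ?thesis by (simp add: dird_def DERIV_imp_deriv)
qed

lemma dird_linear:
  assumes M: "complex_manifold M" "ch \<in> charts M" and x: "x \<in> fst ch" and v: "v \<in> model M" "w \<in> model M" and u: "hdiff M ch x u"
  shows "dird ch x (a *s v + w) u = a * dird ch x v u + dird ch x w u"
proof -
  obtain D where D: "clin D" "((\<lambda>z. u (chart_inv ch z)) has_derivative D) (at (snd ch x) within model M)"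
    using u by (auto simp: hdiff_def holo_at_def)
  have "dird ch x v u = D v" if "v \<in> model M" for v
    unfolding dird_def by (rule deriv_line[OF model_subspace[OF M] that chart_model[OF M x] D(2,1)])
  moreover have "a *s v + w \<in> model M"
    using v model_subspace[OF M] by (auto intro: vec.subspace_add vec.subspace_scale)
  ultimately show ?thesis using v D(1) by (simp add: clin_def)
qed

lemma hdiff_const: "hdiff M ch x (\<lambda>_. c)"
  by (simp add: hdiff_def holo_at_const)

lemma hdiff_add: "hdiff M ch x u \<Longrightarrow> hdiff M ch x w \<Longrightarrow> hdiff M ch x (\<lambda>y. u y + w y)"
  by (simp add: hdiff_def holo_at_add)

lemma hdiff_mult: "hdiff M ch x u \<Longrightarrow> hdiff M ch x w \<Longrightarrow> hdiff M ch x (\<lambda>y. u y * w y)"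
  by (simp add: hdiff_def holo_at_mult)

lemma hdiff_diff: "hdiff M ch x u \<Longrightarrow> hdiff M ch x w \<Longrightarrow> hdiff M ch x (\<lambda>y. u y - w y)"
  by (simp add: hdiff_def holo_at_diff)

lemma hdiff_sum: "(\<And>a. a \<in> S \<Longrightarrow> hdiff M ch x (u a)) \<Longrightarrow> hdiff M ch x (\<lambda>y. \<Sum>a\<in>S. u a y)"
  by (simp add: hdiff_def holo_at_sum)

context
  fixes M :: "('a, 'm::finite) cmfd" and ch x v
  assumes M: "complex_manifold M" "ch \<in> charts M" and x: "x \<in> fst ch" and v: "v \<in> model M"
begin

lemma dird_const: "dird ch x v (\<lambda>_. c) = 0"
  by (simp add: dird_def)

lemma dird_add:
  assumes "hdiff M ch x u" "hdiff M ch x w"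
  shows "dird ch x v (\<lambda>y. u y + w y) = dird ch x v u + dird ch x v w"
  using DERIV_imp_deriv[OF DERIV_add[OF dird_deriv[OF M x v assms(1)] dird_deriv[OF M x v assms(2)]]]
  unfolding dird_def[of ch x v "\<lambda>y. u y + w y"] .

lemma dird_mult:
  assumes "hdiff M ch x u" "hdiff M ch x w"
  shows "dird ch x v (\<lambda>y. u y * w y) = dird ch x v u * w x + u x * dird ch x v w"
  using DERIV_imp_deriv[OF DERIV_mult[OF dird_deriv[OF M x v assms(1)] dird_deriv[OF M x v assms(2)]]] M x
  unfolding dird_def[of ch x v "\<lambda>y. u y * w y"] by (simp add: mult.commute)

lemma dird_sum:
  assumes "\<And>a. a \<in> S \<Longrightarrow> hdiff M ch x (u a)"
  shows "dird ch x v (\<lambda>y. \<Sum>a\<in>S. u a y) = (\<Sum>a\<in>S. dird ch x v (u a))"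
  using assms
  by (induction S rule: infinite_finite_induct) (simp_all add: dird_const dird_add hdiff_sum)

end

text \<open>The coordinates \<open>v\<close> of the tangent vector stay fixed while the point moves
  within one chart, so the statement reduces to directional derivatives on the model space.\<close>

lemma hdiff_dird:
  assumes M: "complex_manifold M" "ch \<in> charts M" and N: "openin (mtop M) N" "x \<in> N" "x \<in> fst ch"
    and v: "v \<in> model M" and u: "\<And>y. y \<in> N \<Longrightarrow> y \<in> fst ch \<Longrightarrow> hdiff M ch y u"
  shows "hdiff M ch x (\<lambda>y. dird ch y v u)"
proof -
  let ?W = "snd ch ` (N \<inter> fst ch)"
  have W: "openin (top_of_set (model M)) ?W" by (rule chart_image_open[OF M N(1)])
  have z: "snd ch x \<in> ?W" using N by auto
  have "holo_at (model M) (snd ch x) (\<lambda>z. deriv (\<lambda>t. u (chart_inv ch (z + t *s v))) 0)"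
    by (rule holo_at_deriv_line[OF model_subspace[OF M] W _ z v]) (use u in \<open>auto simp: hdiff_def\<close>)
  then show ?thesis unfolding hdiff_def
    by (rule holo_at_cong[OF W z, rotated]) (use M in \<open>auto simp: dird_def\<close>)
qed

lemma holomorphic_map_id: "complex_manifold M \<Longrightarrow> holomorphic_map M M (\<lambda>x. x)"
  by (auto simp: holomorphic_map_def complex_manifold_def)

text \<open>The chain rule in coordinates. It serves pullback and, with the identity as
  \<open>\<phi>\<close>, the change of charts.\<close>

lemma
  assumes M: "complex_manifold M" "ch \<in> charts M" and M': "complex_manifold M'" "ch' \<in> charts M'"
    and \<phi>: "holomorphic_map M M' \<phi>" and x: "x \<in> fst ch" "\<phi> x \<in> fst ch'"
    and u: "hdiff M' ch' (\<phi> x) u" and v: "v \<in> model M"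
  shows dird_pull: "dird ch x v (\<lambda>y. u (\<phi> y)) = dird ch' (\<phi> x) (jac ch ch' \<phi> x v) u"
    and jac_model: "jac ch ch' \<phi> x v \<in> model M'"
proof -
  define N where "N = {y \<in> pts M. \<phi> y \<in> fst ch'}"
  have N: "openin (mtop M) N"
    using \<phi> chart_open[OF M'] unfolding N_def holomorphic_map_def continuous_map_def by blast
  have xN: "x \<in> N" using x chart_pts[OF M] by (auto simp: N_def)
  define W where "W = snd ch ` (N \<inter> fst ch)"
  have W: "openin (top_of_set (model M)) W" unfolding W_def by (rule chart_image_open[OF M N])
  have z: "snd ch x \<in> W" using x xN by (auto simp: W_def)
  define \<psi> where "\<psi> z = snd ch' (\<phi> (chart_inv ch z))" for z
  have Weq: "W = snd ch ` (fst ch \<inter> \<phi> -` fst ch')"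
    using chart_pts[OF M] by (auto simp: W_def N_def)
  have \<psi>1: "holo_at (model M) (snd ch x) (\<lambda>y. \<psi> y $ i)" for i
    using \<phi> M(2) M'(2) z unfolding holomorphic_map_def holo_coords_def Weq \<psi>_def holo_on_iff by blast
  have \<psi>2: "\<psi> ` W \<subseteq> model M'"
    using M M' chart_model[OF M'] by (auto simp: \<psi>_def W_def N_def)
  have \<psi>x: "\<psi> (snd ch x) = snd ch' (\<phi> x)" using M x by (simp add: \<psi>_def)
  have g: "holo_at (model M') (\<psi> (snd ch x)) (\<lambda>z. u (chart_inv ch' z))"
    using u by (simp add: \<psi>x hdiff_def)
  note C = holo_chain[OF model_subspace[OF M] model_subspace[OF M'] W z \<psi>1 \<psi>2 g v]
  have inv: "chart_inv ch' (\<psi> y) = \<phi> (chart_inv ch y)" if "y \<in> W" for y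
    using that M M' by (auto simp: \<psi>_def W_def N_def)
  have J: "jac ch ch' \<phi> x v = (\<chi> i. deriv (\<lambda>t. \<psi> (snd ch x + t *s v) $ i) 0)"
    by (simp add: jac_def dird_def \<psi>_def)
  show "jac ch ch' \<phi> x v \<in> model M'" unfolding J by (rule C(2))
  have "dird ch x v (\<lambda>y. u (\<phi> y)) = deriv (\<lambda>t. u (chart_inv ch' (\<psi> (snd ch x + t *s v)))) 0"
    unfolding dird_def
    by (rule deriv_cong_ev[OF eventually_mono[OF eventually_line_openin[OF model_subspace[OF M] W z v]]]) (simp_all add: inv)
  also have "\<dots> = dird ch' (\<phi> x) (jac ch ch' \<phi> x v) u"
    unfolding C(1) J[symmetric] by (simp add: dird_def \<psi>x)
  finally show "dird ch x v (\<lambda>y. u (\<phi> y)) = dird ch' (\<phi> x) (jac ch ch' \<phi> x v) u" .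
qed

section \<open>Graded bundles and the induced connections\<close>

lemma gmul_assoc: "gmul B (gmul C X Y) Z = gmul C X (gmul B Y Z)"
proof (intro ext)
  fix i j
  have "gmul B (gmul C X Y) Z i j = (\<Sum>b\<in>B. \<Sum>c\<in>C. X i c * Y c b * Z b j)"
    by (simp add: gmul_def sum_distrib_right)
  also have "\<dots> = (\<Sum>c\<in>C. \<Sum>b\<in>B. X i c * Y c b * Z b j)" by (rule sum.swap)
  also have "\<dots> = gmul C X (gmul B Y Z) i j" by (simp add: gmul_def sum_distrib_left mult.assoc)
  finally show "gmul B (gmul C X Y) Z i j = gmul C X (gmul B Y Z) i j" .
qed

lemma gmul_add_left: "gmul B (X + Y) Z = gmul B X Z + gmul B Y Z"
  by (simp add: gmul_def fun_eq_iff sum.distrib distrib_right)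

lemma gmul_add_right: "gmul B X (Y + Z) = gmul B X Y + gmul B X Z"
  by (simp add: gmul_def fun_eq_iff sum.distrib distrib_left)

lemma gmul_diff_left: "gmul B (X - Y) Z = gmul B X Z - gmul B Y Z"
  by (simp add: gmul_def fun_eq_iff sum_subtractf left_diff_distrib)

lemma gmul_diff_right: "gmul B X (Y - Z) = gmul B X Y - gmul B X Z"
  by (simp add: gmul_def fun_eq_iff sum_subtractf right_diff_distrib)

lemma gmul_zero [simp]: "gmul B 0 X = 0" "gmul B X 0 = 0"
  by (simp_all add: gmul_def fun_eq_iff)

lemmas gmul_distribs = gmul_add_left gmul_add_right gmul_diff_left gmul_diff_right

lemma gmatsD: "X \<in> gmats B' B q \<Longrightarrow> X i j \<noteq> 0 \<Longrightarrow> i \<in> B' \<and> j \<in> B \<and> fst i = fst j + q"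
  unfolding gmats_def by blast

lemma gmats_gmul:
  assumes "X \<in> gmats C B q" "Y \<in> gmats B A r"
  shows "gmul B X Y \<in> gmats C A (q + r)"
  unfolding gmats_def mem_Collect_eq
proof (intro allI impI)
  fix i j assume "gmul B X Y i j \<noteq> 0"
  then have "(\<Sum>b\<in>B. X i b * Y b j) \<noteq> 0" unfolding gmul_def .
  then obtain b where "X i b * Y b j \<noteq> 0" by (rule sum.not_neutral_contains_not_neutral)
  then have "X i b \<noteq> 0" "Y b j \<noteq> 0" by simp_all
  from gmatsD[OF assms(1) this(1)] gmatsD[OF assms(2) this(2)]
  show "i \<in> C \<and> j \<in> A \<and> fst i = fst j + (q + r)" by simp
qed

lemma gmats_0: "0 \<in> gmats C B q" by (simp add: gmats_def)

lemma gmats_gid: "gid B \<in> gmats B B 0" by (simp add: gmats_def gid_def)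

lemma gmats_add: "X \<in> gmats C B q \<Longrightarrow> Y \<in> gmats C B q \<Longrightarrow> X + Y \<in> gmats C B q"
  unfolding gmats_def mem_Collect_eq plus_fun_def by (metis add.right_neutral)

lemma gmats_diff: "X \<in> gmats C B q \<Longrightarrow> Y \<in> gmats C B q \<Longrightarrow> X - Y \<in> gmats C B q"
  unfolding gmats_def mem_Collect_eq fun_diff_def by (metis diff_0_right)

lemma sum_gid_left: "finite B \<Longrightarrow> (\<Sum>b\<in>B. gid B i b * Z b) = (if i \<in> B then Z i else 0)"
proof -
  assume B: "finite B"
  have "(\<Sum>b\<in>B. gid B i b * Z b) = (\<Sum>b\<in>B. if i = b then Z b else 0)"
    by (rule sum.cong[OF refl]) (simp add: gid_def)
  also have "\<dots> = (if i \<in> B then Z i else 0)" by (rule sum.delta'[OF B])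
  finally show ?thesis .
qed

lemma sum_gid_right: "finite B \<Longrightarrow> (\<Sum>b\<in>B. Z b * gid B b j) = (if j \<in> B then Z j else 0)"
proof -
  assume B: "finite B"
  have "(\<Sum>b\<in>B. Z b * gid B b j) = (\<Sum>b\<in>B. if b = j then Z b else 0)"
    by (rule sum.cong[OF refl]) (simp add: gid_def)
  also have "\<dots> = (if j \<in> B then Z j else 0)" by (rule sum.delta[OF B])
  finally show ?thesis .
qed

lemma gmul_gid_left:
  assumes X: "X \<in> gmats B C q" and B: "finite B"
  shows "gmul B (gid B) X = X"
proof (intro ext)
  fix i j
  have "X i j = 0" if "i \<notin> B" using gmatsD[OF X, of i j] that by blast
  then show "gmul B (gid B) X i j = X i j" unfolding gmul_def sum_gid_left[OF B] by simp
qed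

lemma gmul_gid_right:
  assumes X: "X \<in> gmats C B q" and B: "finite B"
  shows "gmul B X (gid B) = X"
proof (intro ext)
  fix i j
  have "X i j = 0" if "j \<notin> B" using gmatsD[OF X, of i j] that by blast
  then show "gmul B X (gid B) i j = X i j" unfolding gmul_def sum_gid_right[OF B] by simp
qed

lemma is_ginv_ginv:
  assumes X: "X \<in> gmats B B 0" and "is_ginv B X Y" and B: "finite B"
  shows "is_ginv B X (ginv B X)"
  unfolding ginv_def
proof (rule theI[of "is_ginv B X", OF assms(2)])
  fix Z assume Z: "is_ginv B X Z"
  have "Z = gmul B (gmul B Y X) Z"
    using Z assms(2) B gmul_gid_left[of Z B B 0] by (simp add: is_ginv_def)
  also have "\<dots> = Y"
    unfolding gmul_assoc using Z assms(2) B gmul_gid_right[of Y B B 0] by (simp add: is_ginv_def)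
  finally show "Z = Y" .
qed

lemma perf_ob_bundle: "perf_ob M E \<Longrightarrow> graded_bundle M E"
  by (simp add: perf_ob_def)

lemma finite_fib:
  assumes "graded_bundle M E"
  shows "finite (fib E x)"
proof -
  obtain N where N: "\<And>x q. rk E x q \<noteq> 0 \<Longrightarrow> \<bar>q\<bar> \<le> N" using assms by (auto simp: graded_bundle_def)
  have "fib E x \<subseteq> (SIGMA q:{-N..N}. {..<rk E x q})"
  proof
    fix b assume "b \<in> fib E x"
    then obtain q a where b: "b = (q, a)" "a < rk E x q" by (auto simp: fib_def)
    then have "\<bar>q\<bar> \<le> N" by (intro N[of x q]) simp
    then show "b \<in> (SIGMA q:{-N..N}. {..<rk E x q})" using b by auto
  qed
  then show ?thesis by (rule finite_subset) auto
qed

lemma graded_bundleD: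
  assumes "graded_bundle M E"
  shows "\<forall>x. x \<notin> pts M \<longrightarrow> rk E x = 0 \<and> nb E x = {}"
    and "\<forall>p\<in>pts M. openin (mtop M) (nb E p) \<and> p \<in> nb E p \<and> (\<forall>x\<in>nb E p. rk E x = rk E p)"
    and "\<forall>p x. x \<in> nb E p \<longrightarrow>
        triv E p x \<in> gmats (fib E x) (fib E x) 0 \<and> (\<exists>Y. is_ginv (fib E x) (triv E p x) Y)"
    and "\<forall>p x. x \<notin> nb E p \<longrightarrow> triv E p x = 0"
    and "\<forall>p p'. holo_mat M (nb E p \<inter> nb E p') (trans_fun E p p')"
proof -
  note D = assms[unfolded graded_bundle_def]
  show "\<forall>x. x \<notin> pts M \<longrightarrow> rk E x = 0 \<and> nb E x = {}" by (rule conjunct1[OF D])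
  note D = conjunct2[OF conjunct2[OF D]]
  show "\<forall>p\<in>pts M. openin (mtop M) (nb E p) \<and> p \<in> nb E p \<and> (\<forall>x\<in>nb E p. rk E x = rk E p)"
    by (rule conjunct1[OF D])
  note D = conjunct2[OF D]
  show "\<forall>p x. x \<in> nb E p \<longrightarrow>
        triv E p x \<in> gmats (fib E x) (fib E x) 0 \<and> (\<exists>Y. is_ginv (fib E x) (triv E p x) Y)"
    by (rule conjunct1[OF D])
  note D = conjunct2[OF D]
  show "\<forall>p x. x \<notin> nb E p \<longrightarrow> triv E p x = 0" by (rule conjunct1[OF D])
  show "\<forall>p p'. holo_mat M (nb E p \<inter> nb E p') (trans_fun E p p')" by (rule conjunct2[OF D])
qed

lemma nb_facts:
  assumes E: "graded_bundle M E"
  shows nb_openin: "openin (mtop M) (nb E p)"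
    and nb_self: "p \<in> pts M \<Longrightarrow> p \<in> nb E p"
    and nb_fib: "x \<in> nb E p \<Longrightarrow> fib E x = fib E p"
proof -
  note out = graded_bundleD(1)[OF E, rule_format, of p, THEN conjunct2]
  note ins = graded_bundleD(2)[OF E, rule_format, of p]
  show "openin (mtop M) (nb E p)"
  proof (cases "p \<in> pts M")
    case True then show ?thesis by (rule conjunct1[OF ins])
  next
    case False
    then have "nb E p = {}" by (rule out)
    then show ?thesis by (simp only: openin_empty)
  qed
  show "p \<in> pts M \<Longrightarrow> p \<in> nb E p" using ins by blast
  show "fib E x = fib E p" if "x \<in> nb E p"
  proof -
    have "rk E x = rk E p" using out ins that by blast
    then show ?thesis by (simp only: fib_def)
  qed
qed

abbreviation trinv :: "('a, 'm::finite) perf \<Rightarrow> 'a \<Rightarrow> 'a \<Rightarrow> gmat" where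
  "trinv E p x \<equiv> ginv (fib E x) (triv E p x)"

lemma triv_facts:
  assumes E: "graded_bundle M E" and x: "x \<in> nb E p"
  shows triv_gmats: "triv E p x \<in> gmats (fib E x) (fib E x) 0"
    and trinv_gmats: "trinv E p x \<in> gmats (fib E x) (fib E x) 0"
    and triv_trinv: "gmul (fib E x) (triv E p x) (trinv E p x) = gid (fib E x)"
    and trinv_triv: "gmul (fib E x) (trinv E p x) (triv E p x) = gid (fib E x)"
proof -
  have T: "triv E p x \<in> gmats (fib E x) (fib E x) 0" "\<exists>Y. is_ginv (fib E x) (triv E p x) Y"
    using graded_bundleD(3)[OF E, rule_format, OF x] by blast+
  then have I: "is_ginv (fib E x) (triv E p x) (trinv E p x)"
    using is_ginv_ginv[OF T(1) _ finite_fib[OF E]] by blast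
  show "triv E p x \<in> gmats (fib E x) (fib E x) 0" by (rule T(1))
  show "trinv E p x \<in> gmats (fib E x) (fib E x) 0" "gmul (fib E x) (triv E p x) (trinv E p x) = gid (fib E x)"
     "gmul (fib E x) (trinv E p x) (triv E p x) = gid (fib E x)"
    using I by (auto simp: is_ginv_def)
qed

lemma triv_cancel:
  assumes E: "graded_bundle M E" and x: "x \<in> nb E p" and X: "X \<in> gmats (fib E x) C q"
  shows triv_trinv_cancel: "gmul (fib E x) (triv E p x) (gmul (fib E x) (trinv E p x) X) = X"
    and trinv_triv_cancel: "gmul (fib E x) (trinv E p x) (gmul (fib E x) (triv E p x) X) = X"
  unfolding gmul_assoc[symmetric] triv_trinv[OF E x] trinv_triv[OF E x]
  by (rule gmul_gid_left[OF X finite_fib[OF E]])+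

lemma loc_gmats:
  assumes E: "graded_bundle M E" and E': "graded_bundle M E'" and x: "x \<in> nb E p" "x \<in> nb E' p'"
    and f: "f x \<in> gmats (fib E' x) (fib E x) q"
  shows "loc E E' p p' f x \<in> gmats (fib E' x) (fib E x) q"
  using gmats_gmul[OF triv_gmats[OF E' x(2)] gmats_gmul[OF f trinv_gmats[OF E x(1)]]] by (simp add: loc_def)

lemma loc_comp:
  assumes E: "graded_bundle M E" and E': "graded_bundle M E'" and E'': "graded_bundle M E''"
    and x: "x \<in> nb E p" "x \<in> nb E' p'" "x \<in> nb E'' p''"
    and f: "f x \<in> gmats (fib E' x) (fib E x) q"
  shows "loc E E'' p p'' (\<lambda>x. gmul (fib E' x) (g x) (f x)) x =
    gmul (fib E' x) (loc E' E'' p' p'' g x) (loc E E' p p' f x)"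
proof -
  have f1: "gmul (fib E x) (f x) (trinv E p x) \<in> gmats (fib E' x) (fib E x) (q + 0)"
    by (rule gmats_gmul[OF f trinv_gmats[OF E x(1)]])
  show ?thesis by (simp add: loc_def gmul_assoc trinv_triv_cancel[OF E' x(2) f1])
qed

lemma loc_gid:
  assumes E: "graded_bundle M E" and x: "x \<in> nb E p"
  shows "loc E E p p (\<lambda>x. gid (fib E x)) x = gid (fib E x)"
  by (simp add: loc_def gmul_gid_left[OF trinv_gmats[OF E x] finite_fib[OF E]] triv_trinv[OF E x])

text \<open>Between the factors the trivialisations at \<open>p\<close> and \<open>p'\<close> are
  inserted with their inverses. On the source side the transition runs backwards, from
  \<open>q\<close> to \<open>p\<close>.\<close>

lemma loc_change:
  assumes E: "graded_bundle M E" and E': "graded_bundle M E'"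
    and x: "x \<in> nb E p" "x \<in> nb E' p'" "x \<in> nb E q" "x \<in> nb E' q'"
    and f: "f x \<in> gmats (fib E' x) (fib E x) d"
  shows "loc E E' q q' f x =
    gmul (fib E' x) (trans_fun E' p' q' x) (gmul (fib E x) (loc E E' p p' f x) (trans_fun E q p x))"
proof -
  let ?B = "fib E x" and ?B' = "fib E' x"
  have f1: "gmul ?B (f x) (trinv E q x) \<in> gmats ?B' ?B (d + 0)" by (rule gmats_gmul[OF f trinv_gmats[OF E x(3)]])
  have "gmul ?B' (trans_fun E' p' q' x) (gmul ?B (loc E E' p p' f x) (trans_fun E q p x)) =
     gmul ?B' (triv E' q' x) (gmul ?B' (trinv E' p' x) (gmul ?B' (triv E' p' x)
        (gmul ?B (f x) (gmul ?B (trinv E p x) (gmul ?B (triv E p x) (trinv E q x))))))"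
    by (simp add: trans_fun_def loc_def gmul_assoc gmul_gid_left[OF trinv_gmats[OF E x(3)] finite_fib[OF E]]
       gmul_gid_left[OF trinv_gmats[OF E' x(2)] finite_fib[OF E']])
  also have "\<dots> = loc E E' q q' f x"
    by (simp add: trinv_triv_cancel[OF E x(1) trinv_gmats[OF E x(3)]] trinv_triv_cancel[OF E' x(2) f1] loc_def)
  finally show ?thesis ..
qed

section \<open>The induced connection in trivialisations\<close>

definition dmat :: "('a, 'm::finite) chart \<Rightarrow> 'a \<Rightarrow> complex ^ 'm \<Rightarrow> ('a \<Rightarrow> gmat) \<Rightarrow> gmat" where
  "dmat ch x v X = (\<lambda>i j. dird ch x v (\<lambda>y. X y i j))"

definition hdiffm :: "('a, 'm::finite) cmfd \<Rightarrow> ('a, 'm) chart \<Rightarrow> 'a \<Rightarrow> ('a \<Rightarrow> gmat) \<Rightarrow> bool" where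
  "hdiffm M ch x X \<longleftrightarrow> (\<forall>i j. hdiff M ch x (\<lambda>y. X y i j))"

lemma hdiffmD: "hdiffm M ch x X \<Longrightarrow> hdiff M ch x (\<lambda>y. X y i j)"
  by (simp only: hdiffm_def)

lemma holo_matD:
  assumes "complex_manifold M" "holo_mat M N X" "ch \<in> charts M" "x \<in> N" "x \<in> fst ch"
  shows "hdiffm M ch x X"
  using assms by (auto simp: holo_mat_def holo_fun_iff hdiffm_def)

lemma hdiffm_gmul: "hdiffm M ch x X \<Longrightarrow> hdiffm M ch x Y \<Longrightarrow> hdiffm M ch x (\<lambda>y. gmul B (X y) (Y y))"
  by (auto simp: hdiffm_def gmul_def intro!: hdiff_sum hdiff_mult)

lemma dmat_gmul:
  assumes M: "complex_manifold M" "ch \<in> charts M" and x: "x \<in> fst ch" and v: "v \<in> model M"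
    and X: "hdiffm M ch x X" and Y: "hdiffm M ch x Y"
  shows "dmat ch x v (\<lambda>y. gmul B (X y) (Y y)) = gmul B (dmat ch x v X) (Y x) + gmul B (X x) (dmat ch x v Y)"
proof (intro ext)
  fix i j
  have "hdiff M ch x (\<lambda>y. X y i b * Y y b j)" for b
    by (rule hdiff_mult[OF hdiffmD[OF X] hdiffmD[OF Y]])
  then have "dmat ch x v (\<lambda>y. gmul B (X y) (Y y)) i j = (\<Sum>b\<in>B. dird ch x v (\<lambda>y. X y i b * Y y b j))"
    unfolding dmat_def gmul_def by (intro dird_sum[OF M x v])
  also have "\<dots> = (\<Sum>b\<in>B. dird ch x v (\<lambda>y. X y i b) * Y x b j + X x i b * dird ch x v (\<lambda>y. Y y b j))"
    by (rule sum.cong[OF refl dird_mult[OF M x v hdiffmD[OF X] hdiffmD[OF Y]]])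
  finally show "dmat ch x v (\<lambda>y. gmul B (X y) (Y y)) i j =
     (gmul B (dmat ch x v X) (Y x) + gmul B (X x) (dmat ch x v Y)) i j"
    by (simp add: gmul_def dmat_def sum.distrib)
qed

lemma dmat_cong:
  assumes M: "complex_manifold M" "ch \<in> charts M" and N: "openin (mtop M) N" "x \<in> N" "x \<in> fst ch"
    and v: "v \<in> model M" and eq: "\<And>y. y \<in> N \<Longrightarrow> y \<in> fst ch \<Longrightarrow> X y = Y y"
  shows "dmat ch x v X = dmat ch x v Y"
  unfolding dmat_def by (intro ext dird_cong[OF M N v]) (simp add: eq)

lemma hdiffm_cong:
  assumes M: "complex_manifold M" "ch \<in> charts M" and N: "openin (mtop M) N" "x \<in> N" "x \<in> fst ch"
    and eq: "\<And>y. y \<in> N \<Longrightarrow> y \<in> fst ch \<Longrightarrow> X y = Y y" and X: "hdiffm M ch x X"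
  shows "hdiffm M ch x Y"
  unfolding hdiffm_def
proof (intro allI)
  fix i j show "hdiff M ch x (\<lambda>y. Y y i j)"
    by (rule hdiff_cong[OF M N _ hdiffmD[OF X]]) (simp add: eq)
qed

lemma dmat_gmats:
  assumes M: "complex_manifold M" "ch \<in> charts M" and N: "openin (mtop M) N" "x \<in> N" "x \<in> fst ch"
    and v: "v \<in> model M" and X: "\<And>y. y \<in> N \<Longrightarrow> X y \<in> gmats C B q"
  shows "dmat ch x v X \<in> gmats C B q"
  unfolding gmats_def mem_Collect_eq
proof (intro allI impI, rule ccontr)
  fix i j assume nz: "dmat ch x v X i j \<noteq> 0" and "\<not> (i \<in> C \<and> j \<in> B \<and> fst i = fst j + q)"
  then have "X y i j = 0" if "y \<in> N" for y using gmatsD[OF X[OF that], of i j] by blast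
  then have "dmat ch x v X i j = dird ch x v (\<lambda>_. 0)"
    unfolding dmat_def by (intro dird_cong[OF M N v]) simp
  then show False using nz by (simp add: dird_def)
qed

text \<open>The local expression \<open>dL + \<theta>' L - L \<theta>\<close> of the connection on a
  Hom-bundle. Source and target may be trivialised at different points.\<close>

definition nconn :: "('a, 'm::finite) perf \<Rightarrow> ('a, 'm) perf \<Rightarrow> 'a \<Rightarrow> 'a \<Rightarrow> ('a \<Rightarrow> gmat) \<Rightarrow>
    ('a, 'm) chart \<Rightarrow> 'a \<Rightarrow> complex ^ 'm \<Rightarrow> gmat" where
  "nconn E E' p p' f ch x v = dmat ch x v (loc E E' p p' f)
     + gmul (fib E' x) (con E' p' ch x [v]) (loc E E' p p' f x)
     - gmul (fib E x) (loc E E' p p' f x) (con E p ch x [v])"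

lemma hom_conn_eq:
  assumes "ch \<in> charts M" "x \<in> fst ch" "v \<in> model M"
  shows "hom_conn M E E' f ch x [v] =
    gmul (fib E' x) (trinv E' x x) (gmul (fib E x) (nconn E E' x x f ch x v) (triv E x x))"
  using assms by (simp add: hom_conn_def nconn_def dmat_def Let_def)

lemma hom_conn_eq_0:
  assumes "\<not> (ch \<in> charts M \<and> x \<in> fst ch \<and> length vs = 1 \<and> set vs \<subseteq> model M)"
  shows "hom_conn M E E' f ch x vs = 0"
  using assms by (auto simp: hom_conn_def)

lemma bundle_maps_gmats:
  assumes "f \<in> bundle_maps M E E' q"
  shows "f x \<in> gmats (fib E' x) (fib E x) q"
  using assms gmats_0 by (cases "x \<in> pts M") (auto simp: bundle_maps_def)

lemma bundle_maps_hdiffm: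
  assumes "complex_manifold M" "f \<in> bundle_maps M E E' q" "ch \<in> charts M" "x \<in> fst ch" "x \<in> nb E p" "x \<in> nb E' p'"
  shows "hdiffm M ch x (loc E E' p p' f)"
proof (rule holo_matD[OF assms(1) _ assms(3) _ assms(4)])
  show "holo_mat M (nb E p \<inter> nb E' p') (loc E E' p p' f)" using assms(2) by (simp add: bundle_maps_def)
qed (use assms in blast)

lemma trans_hdiffm:
  assumes "complex_manifold M" "graded_bundle M E" "ch \<in> charts M" "x \<in> fst ch" "x \<in> nb E p" "x \<in> nb E p'"
  shows "hdiffm M ch x (trans_fun E p p')"
  by (rule holo_matD[OF assms(1) graded_bundleD(5)[OF assms(2), rule_format] assms(3) _ assms(4)])
     (use assms in blast)

lemma con_gmats: "perf_ob M E \<Longrightarrow> con E p ch x vs \<in> gmats (fib E x) (fib E x) 0"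
  unfolding perf_ob_def holomorphic_connection_def by blast

lemma gauge:
  assumes "perf_ob M E" "ch \<in> charts M" "x \<in> fst ch" "x \<in> nb E p" "x \<in> nb E p'" "v \<in> model M"
  shows "gmul (fib E x) (trans_fun E p p' x) (con E p ch x [v]) =
    dmat ch x v (trans_fun E p p') + gmul (fib E x) (con E p' ch x [v]) (trans_fun E p p' x)"
  using assms by (simp add: perf_ob_def holomorphic_connection_def dmat_def)

lemma nconn_gmats:
  assumes M: "complex_manifold M" and E: "perf_ob M E" and E': "perf_ob M E'" and ch: "ch \<in> charts M" "x \<in> fst ch"
    and x: "x \<in> nb E p" "x \<in> nb E' p'" and v: "v \<in> model M" and f: "f \<in> bundle_maps M E E' q"
  shows "nconn E E' p p' f ch x v \<in> gmats (fib E' x) (fib E x) q"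
proof -
  note b = perf_ob_bundle[OF E] perf_ob_bundle[OF E']
  have L: "loc E E' p p' f y \<in> gmats (fib E' x) (fib E x) q" if "y \<in> nb E p \<inter> nb E' p'" for y
    using loc_gmats[OF b, of y p p' f q] that bundle_maps_gmats[OF f] nb_fib[OF b(1)] nb_fib[OF b(2)] x by fastforce
  have "dmat ch x v (loc E E' p p' f) \<in> gmats (fib E' x) (fib E x) q"
    by (rule dmat_gmats[OF M ch(1) openin_Int[OF nb_openin[OF b(1)] nb_openin[OF b(2)]] _ ch(2) v L]) (use x in auto)
  moreover have "gmul (fib E' x) (con E' p' ch x [v]) (loc E E' p p' f x) \<in> gmats (fib E' x) (fib E x) (0 + q)"
    by (rule gmats_gmul[OF con_gmats[OF E'] L]) (use x in auto)
  moreover have "gmul (fib E x) (loc E E' p p' f x) (con E p ch x [v]) \<in> gmats (fib E' x) (fib E x) (q + 0)"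
    by (rule gmats_gmul[OF L con_gmats[OF E]]) (use x in auto)
  ultimately show ?thesis unfolding nconn_def by (auto intro!: gmats_add gmats_diff)
qed

text \<open>Gauge covariance: the Leibniz rule produces derivatives of the two transition functions,
  and the gauge laws of target and source turn them into connection terms. Those of the old and new
  connection then regroup as required.\<close>

lemma nconn_change:
  assumes M: "complex_manifold M" and E: "perf_ob M E" and E': "perf_ob M E'" and ch: "ch \<in> charts M" "x \<in> fst ch"
    and x: "x \<in> nb E p" "x \<in> nb E' p'" "x \<in> nb E q" "x \<in> nb E' q'" and v: "v \<in> model M"
    and f: "f \<in> bundle_maps M E E' d"
  shows "nconn E E' q q' f ch x v =
    gmul (fib E' x) (trans_fun E' p' q' x) (gmul (fib E x) (nconn E E' p p' f ch x v) (trans_fun E q p x))"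
proof -
  note b = perf_ob_bundle[OF E] perf_ob_bundle[OF E']
  let ?B = "fib E x" and ?B' = "fib E' x"
  let ?h = "trans_fun E' p' q'" and ?k = "trans_fun E q p" and ?L = "loc E E' p p' f"
  define N where "N = nb E p \<inter> nb E q \<inter> (nb E' p' \<inter> nb E' q')"
  have N: "openin (mtop M) N" "x \<in> N"
    unfolding N_def using x by (intro openin_Int nb_openin[OF b(1)] nb_openin[OF b(2)], blast)
  have Leq: "loc E E' q q' f y = gmul ?B' (?h y) (gmul ?B (?L y) (?k y))" if "y \<in> N" for y
  proof -
    have "fib E y = ?B" "fib E' y = ?B'"
      using that x nb_fib[OF b(1)] nb_fib[OF b(2)] unfolding N_def by (metis IntD1 IntD2)+
    then show ?thesis
      using loc_change[OF b, of y p p' q q' f d] that bundle_maps_gmats[OF f, of y] by (simp add: N_def)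
  qed
  have hd: "hdiffm M ch x ?h" "hdiffm M ch x ?k" "hdiffm M ch x ?L"
    using x ch b by (auto intro!: trans_hdiffm[OF M] bundle_maps_hdiffm[OF M f])
  have "dmat ch x v (loc E E' q q' f) = dmat ch x v (\<lambda>y. gmul ?B' (?h y) (gmul ?B (?L y) (?k y)))"
    by (rule dmat_cong[OF M ch(1) N ch(2) v Leq])
  also have "\<dots> = gmul ?B' (dmat ch x v ?h) (gmul ?B (?L x) (?k x)) +
     gmul ?B' (?h x) (gmul ?B (dmat ch x v ?L) (?k x) + gmul ?B (?L x) (dmat ch x v ?k))"
    by (simp add: dmat_gmul[OF M ch v hd(1) hdiffm_gmul[OF hd(3,2)]] dmat_gmul[OF M ch v hd(3,2)])
  finally have d: "dmat ch x v (loc E E' q q' f) = \<dots>" .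
  have gh: "gmul ?B' (dmat ch x v ?h) Z = gmul ?B' (?h x) (gmul ?B' (con E' p' ch x [v]) Z) - gmul ?B' (con E' q' ch x [v]) (gmul ?B' (?h x) Z)" for Z
  proof -
    have "dmat ch x v ?h = gmul ?B' (?h x) (con E' p' ch x [v]) - gmul ?B' (con E' q' ch x [v]) (?h x)"
      unfolding gauge[OF E' ch x(2,4) v] by (rule add_diff_cancel_right'[symmetric])
    then show ?thesis by (simp only: gmul_diff_left gmul_assoc)
  qed
  have gk: "gmul ?B (?k x) (con E q ch x [v]) = dmat ch x v ?k + gmul ?B (con E p ch x [v]) (?k x)"
    by (rule gauge[OF E ch x(3,1) v])
  let ?Lk = "gmul ?B (?L x) (?k x)" and ?\<theta>' = "con E' p' ch x [v]" and ?\<theta> = "con E p ch x [v]"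
  have 1: "gmul ?B (gmul ?B' (?h x) ?Lk) (con E q ch x [v]) =
     gmul ?B' (?h x) (gmul ?B (?L x) (dmat ch x v ?k)) + gmul ?B' (?h x) (gmul ?B (?L x) (gmul ?B ?\<theta> (?k x)))"
    by (simp only: gmul_assoc gk gmul_add_right)
  have 2: "gmul ?B' (?h x) (gmul ?B (nconn E E' p p' f ch x v) (?k x)) =
     gmul ?B' (?h x) (gmul ?B (dmat ch x v ?L) (?k x)) + gmul ?B' (?h x) (gmul ?B' ?\<theta>' ?Lk) -
     gmul ?B' (?h x) (gmul ?B (?L x) (gmul ?B ?\<theta> (?k x)))"
    by (simp only: nconn_def gmul_distribs gmul_assoc)
  have abel: "(a - b + (c + e)) + b - (e + g) = c + a - g" for a b c e g :: gmat
    by (simp add: algebra_simps)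
  show ?thesis
    unfolding nconn_def[of E E' q q'] d Leq[OF N(2)] 2 1 gh gmul_add_right
    by (rule abel)
qed

text \<open>\<open>hom_conn\<close> takes at each point the trivialisation indexed by this point.
  The expression with \<open>p\<close> and \<open>p'\<close> fixed is what can be differentiated
  when the point varies.\<close>

lemma hom_conn_local:
  assumes M: "complex_manifold M" and E: "perf_ob M E" and E': "perf_ob M E'" and ch: "ch \<in> charts M" "x \<in> fst ch"
    and x: "x \<in> nb E p" "x \<in> nb E' p'" and v: "v \<in> model M"
    and f: "f \<in> bundle_maps M E E' d"
  shows "hom_conn M E E' f ch x [v] =
    gmul (fib E' x) (trinv E' p' x) (gmul (fib E x) (nconn E E' p p' f ch x v) (triv E p x))"
proof -
  note b = perf_ob_bundle[OF E] perf_ob_bundle[OF E']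
  let ?B = "fib E x" and ?B' = "fib E' x"
  have xx: "x \<in> nb E x" "x \<in> nb E' x" using nb_self[OF b(1)] nb_self[OF b(2)] chart_pts[OF M ch] by auto
  let ?N = "nconn E E' p p' f ch x v"
  have N: "?N \<in> gmats ?B' ?B d" by (rule nconn_gmats[OF M E E' ch x v f])
  have NT: "gmul ?B ?N (triv E p x) \<in> gmats ?B' ?B (d + 0)" by (rule gmats_gmul[OF N triv_gmats[OF b(1) x(1)]])
  have NTT: "gmul ?B' (trinv E' p' x) (gmul ?B ?N (triv E p x)) \<in> gmats ?B' ?B (0 + (d + 0))"
    by (rule gmats_gmul[OF trinv_gmats[OF b(2) x(2)] NT])
  have "hom_conn M E E' f ch x [v] = gmul ?B' (trinv E' x x) (gmul ?B (nconn E E' x x f ch x v) (triv E x x))"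
    by (rule hom_conn_eq[OF ch v])
  also have "\<dots> = gmul ?B' (trinv E' x x) (gmul ?B' (triv E' x x) (gmul ?B' (trinv E' p' x) (gmul ?B ?N (gmul ?B (triv E p x) (gmul ?B (trinv E x x) (triv E x x))))))"
    unfolding nconn_change[OF M E E' ch x xx v f]
    by (simp add: trans_fun_def loc_def gmul_assoc gmul_gid_left[OF trinv_gmats[OF b(1) xx(1)] finite_fib[OF b(1)]]
       gmul_gid_left[OF trinv_gmats[OF b(2) x(2)] finite_fib[OF b(2)]])
  also have "\<dots> = gmul ?B' (trinv E' p' x) (gmul ?B ?N (triv E p x))"
    by (simp add: trinv_triv[OF b(1) xx(1)] gmul_gid_right[OF triv_gmats[OF b(1) x(1)] finite_fib[OF b(1)]]
       trinv_triv_cancel[OF b(2) xx(2) NTT])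
  finally show ?thesis .
qed

lemma hom_conn_gmats:
  assumes M: "complex_manifold M" and E: "perf_ob M E" and E': "perf_ob M E'" and f: "f \<in> bundle_maps M E E' q"
  shows "hom_conn M E E' f ch x vs \<in> gmats (fib E' x) (fib E x) q"
proof (cases "ch \<in> charts M \<and> x \<in> fst ch \<and> length vs = 1 \<and> set vs \<subseteq> model M")
  case True
  then obtain v where v: "vs = [v]" "v \<in> model M" by (cases vs) auto
  note b = perf_ob_bundle[OF E] perf_ob_bundle[OF E']
  have ch: "ch \<in> charts M" "x \<in> fst ch" using True by auto
  have xx: "x \<in> nb E x" "x \<in> nb E' x" using nb_self[OF b(1)] nb_self[OF b(2)] chart_pts[OF M ch] by auto
  show ?thesis unfolding v(1) hom_conn_eq[OF ch v(2)]
    using gmats_gmul[OF trinv_gmats[OF b(2) xx(2)] gmats_gmul[OF nconn_gmats[OF M E E' ch xx v(2) f] triv_gmats[OF b(1) xx(1)]]]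
    by simp
qed (simp add: hom_conn_eq_0 gmats_0)

text \<open>The Leibniz rule. The two terms with the connection matrix of the middle bundle
  \<open>E'\<close> have opposite signs and cancel.\<close>

lemma hom_conn_comp:
  assumes M: "complex_manifold M" and E: "perf_ob M E" and E': "perf_ob M E'" and E'': "perf_ob M E''"
    and f: "f \<in> bundle_maps M E E' q" and g: "g \<in> bundle_maps M E' E'' r"
  shows "hom_conn M E E'' (\<lambda>x. gmul (fib E' x) (g x) (f x)) ch x [v] =
    gmul (fib E' x) (hom_conn M E' E'' g ch x [v]) (f x) + gmul (fib E' x) (g x) (hom_conn M E E' f ch x [v])"
proof (cases "ch \<in> charts M \<and> x \<in> fst ch \<and> v \<in> model M")
  case True
  then have ch: "ch \<in> charts M" "x \<in> fst ch" and v: "v \<in> model M" by auto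
  note b = perf_ob_bundle[OF E] perf_ob_bundle[OF E'] perf_ob_bundle[OF E'']
  have xx: "x \<in> nb E x" "x \<in> nb E' x" "x \<in> nb E'' x"
    using nb_self[OF b(1)] nb_self[OF b(2)] nb_self[OF b(3)] chart_pts[OF M ch] by auto
  let ?B = "fib E x" and ?B' = "fib E' x" and ?B'' = "fib E'' x"
  let ?Lf = "loc E E' x x f" and ?Lg = "loc E' E'' x x g"
  define N where "N = nb E x \<inter> nb E' x \<inter> nb E'' x"
  have N: "openin (mtop M) N" "x \<in> N" unfolding N_def using xx
    by (intro openin_Int nb_openin[OF b(1)] nb_openin[OF b(2)] nb_openin[OF b(3)], blast)
  have L: "loc E E'' x x (\<lambda>x. gmul (fib E' x) (g x) (f x)) y = gmul ?B' (?Lg y) (?Lf y)" if "y \<in> N" for y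
  proof -
    have "fib E' y = ?B'" using that xx nb_fib[OF b(2)] unfolding N_def by (metis IntD1 IntD2)
    then show ?thesis using loc_comp[OF b, of y x x x f q g] that bundle_maps_gmats[OF f, of y] by (simp add: N_def)
  qed
  have hd: "hdiffm M ch x ?Lg" "hdiffm M ch x ?Lf"
    using xx ch by (auto intro!: bundle_maps_hdiffm[OF M f] bundle_maps_hdiffm[OF M g])
  have d: "dmat ch x v (loc E E'' x x (\<lambda>x. gmul (fib E' x) (g x) (f x))) =
     gmul ?B' (dmat ch x v ?Lg) (?Lf x) + gmul ?B' (?Lg x) (dmat ch x v ?Lf)"
    using dmat_cong[OF M ch(1) N ch(2) v L] dmat_gmul[OF M ch v hd] by simp
  have n: "nconn E E'' x x (\<lambda>x. gmul (fib E' x) (g x) (f x)) ch x v =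
     gmul ?B' (nconn E' E'' x x g ch x v) (?Lf x) + gmul ?B' (?Lg x) (nconn E E' x x f ch x v)"
    unfolding nconn_def d L[OF N(2)] by (simp add: gmul_assoc gmul_distribs)
  have Nf: "gmul ?B (nconn E E' x x f ch x v) (triv E x x) \<in> gmats ?B' ?B (q + 0)"
    by (rule gmats_gmul[OF nconn_gmats[OF M E E' ch xx(1,2) v f] triv_gmats[OF b(1) xx(1)]])
  have 1: "gmul ?B' (hom_conn M E' E'' g ch x [v]) (f x) =
     gmul ?B'' (trinv E'' x x) (gmul ?B' (nconn E' E'' x x g ch x v) (gmul ?B (?Lf x) (triv E x x)))"
  proof -
    have "gmul ?B (?Lf x) (triv E x x) = gmul ?B' (triv E' x x) (f x)"
      unfolding loc_def gmul_assoc trinv_triv[OF b(1) xx(1)]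
      by (simp add: gmul_gid_right[OF bundle_maps_gmats[OF f] finite_fib[OF b(1)]])
    then show ?thesis by (simp add: hom_conn_eq[OF ch v] gmul_assoc)
  qed
  have 2: "gmul ?B' (g x) (hom_conn M E E' f ch x [v]) =
     gmul ?B'' (trinv E'' x x) (gmul ?B' (?Lg x) (gmul ?B (nconn E E' x x f ch x v) (triv E x x)))"
  proof -
    have "gmul ?B'' (trinv E'' x x) (gmul ?B' (?Lg x) Z) = gmul ?B' (g x) (gmul ?B' (trinv E' x x) Z)"
      if Z: "Z \<in> gmats ?B' ?B s" for Z s
    proof -
      have "gmul ?B' (g x) (gmul ?B' (trinv E' x x) Z) \<in> gmats ?B'' ?B (r + (0 + s))"
        by (rule gmats_gmul[OF bundle_maps_gmats[OF g] gmats_gmul[OF trinv_gmats[OF b(2) xx(2)] Z]])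
      from trinv_triv_cancel[OF b(3) xx(3) this] show ?thesis by (simp add: loc_def gmul_assoc)
    qed
    from this[OF Nf] show ?thesis by (simp add: hom_conn_eq[OF ch v] gmul_assoc)
  qed
  show ?thesis unfolding 1 2 unfolding hom_conn_eq[OF ch v] n by (simp add: gmul_assoc gmul_distribs)
qed (auto simp: hom_conn_eq_0)

text \<open>In every trivialisation the identity is a constant matrix that commutes with the
  connection matrix.\<close>

lemma hom_conn_gid:
  assumes M: "complex_manifold M" and E: "perf_ob M E"
  shows "hom_conn M E E (\<lambda>x. gid (fib E x)) ch x [v] = 0"
proof (cases "ch \<in> charts M \<and> x \<in> fst ch \<and> v \<in> model M")
  case True
  then have ch: "ch \<in> charts M" "x \<in> fst ch" and v: "v \<in> model M" by auto
  note b = perf_ob_bundle[OF E]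
  have xx: "x \<in> nb E x" using nb_self[OF b] chart_pts[OF M ch] by auto
  have L: "loc E E x x (\<lambda>x. gid (fib E x)) y = gid (fib E x)" if "y \<in> nb E x" for y
    using loc_gid[OF b that] nb_fib[OF b that] by simp
  have "dmat ch x v (loc E E x x (\<lambda>x. gid (fib E x))) = dmat ch x v (\<lambda>_. gid (fib E x))"
    by (rule dmat_cong[OF M ch(1) nb_openin[OF b] xx ch(2) v L])
  also have "\<dots> = 0" by (simp add: dmat_def fun_eq_iff dird_const[OF M ch v])
  finally show ?thesis unfolding hom_conn_eq[OF ch v] nconn_def L[OF xx]
    by (simp add: gmul_gid_left[OF con_gmats[OF E] finite_fib[OF b]] gmul_gid_right[OF con_gmats[OF E] finite_fib[OF b]])
qed (auto simp: hom_conn_eq_0)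

text \<open>The degrees \<open>q a\<close> may vary with the summand, so that sums of composites
  over all cuts of a sequence are covered although their degrees are given by different
  expressions.\<close>

lemma hom_conn_sum:
  assumes M: "complex_manifold M" and E: "perf_ob M E" and E': "perf_ob M E'"
    and f: "\<And>a. a \<in> S \<Longrightarrow> f a \<in> bundle_maps M E E' (q a)"
  shows "hom_conn M E E' (\<lambda>x i j. \<Sum>a\<in>S. c a * f a x i j) ch x [v] i j = (\<Sum>a\<in>S. c a * hom_conn M E E' (f a) ch x [v] i j)"
proof (cases "ch \<in> charts M \<and> x \<in> fst ch \<and> v \<in> model M")
  case True
  then have ch: "ch \<in> charts M" "x \<in> fst ch" and v: "v \<in> model M" by auto
  note b = perf_ob_bundle[OF E] perf_ob_bundle[OF E']
  have xx: "x \<in> nb E x" "x \<in> nb E' x" using nb_self[OF b(1)] nb_self[OF b(2)] chart_pts[OF M ch] by auto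
  have lin_r: "gmul B X (\<lambda>i j. \<Sum>a\<in>S. c a * Y a i j) = (\<lambda>i j. \<Sum>a\<in>S. c a * gmul B X (Y a) i j)" for B X Y
    unfolding gmul_def sum_distrib_left by (intro ext, subst sum.swap) (simp add: mult_ac)
  have lin_l: "gmul B (\<lambda>i j. \<Sum>a\<in>S. c a * Y a i j) X = (\<lambda>i j. \<Sum>a\<in>S. c a * gmul B (Y a) X i j)" for B X Y
    unfolding gmul_def sum_distrib_left sum_distrib_right by (intro ext, subst sum.swap) (simp add: mult_ac)
  have L: "loc E E' x x (\<lambda>x i j. \<Sum>a\<in>S. c a * f a x i j) = (\<lambda>y i j. \<Sum>a\<in>S. c a * loc E E' x x (f a) y i j)"
    by (intro ext) (simp add: loc_def lin_l lin_r)
  have hd: "hdiff M ch x (\<lambda>y. loc E E' x x (f a) y i j)" if "a \<in> S" for a i j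
    by (rule hdiffmD[OF bundle_maps_hdiffm[OF M f[OF that] ch xx]])
  have "dmat ch x v (loc E E' x x (\<lambda>x i j. \<Sum>a\<in>S. c a * f a x i j)) =
     (\<lambda>i j. \<Sum>a\<in>S. c a * dmat ch x v (loc E E' x x (f a)) i j)"
  proof (intro ext)
    fix i j
    have "dmat ch x v (loc E E' x x (\<lambda>x i j. \<Sum>a\<in>S. c a * f a x i j)) i j =
       (\<Sum>a\<in>S. dird ch x v (\<lambda>y. c a * loc E E' x x (f a) y i j))"
      unfolding L dmat_def by (intro dird_sum[OF M ch v] hdiff_mult hdiff_const hd)
    also have "\<dots> = (\<Sum>a\<in>S. c a * dmat ch x v (loc E E' x x (f a)) i j)"
      by (intro sum.cong refl) (simp add: dird_mult[OF M ch v hdiff_const hd] dird_const[OF M ch v] dmat_def)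
    finally show "dmat ch x v (loc E E' x x (\<lambda>x i j. \<Sum>a\<in>S. c a * f a x i j)) i j =
      (\<Sum>a\<in>S. c a * dmat ch x v (loc E E' x x (f a)) i j)" .
  qed
  then have "nconn E E' x x (\<lambda>x i j. \<Sum>a\<in>S. c a * f a x i j) ch x v = (\<lambda>i j. \<Sum>a\<in>S. c a * nconn E E' x x (f a) ch x v i j)"
    unfolding nconn_def L lin_l lin_r
    by (intro ext) (simp add: sum.distrib sum_subtractf algebra_simps)
  then show ?thesis unfolding hom_conn_eq[OF ch v] by (simp add: lin_l lin_r)
qed (auto simp: hom_conn_eq_0)

lemma con_form: "perf_ob M E \<Longrightarrow> hol_form M (nb E p) 1 (\<lambda>ch x vs. con E p ch x vs i j)"
  unfolding perf_ob_def holomorphic_connection_def by (elim conjE) (rule allE, assumption, blast)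

lemma hol_formD:
  assumes "hol_form M N k \<omega>"
  shows "ch \<notin> charts M \<or> x \<notin> N \<inter> fst ch \<Longrightarrow> \<omega> ch x = 0"
    and "alt_multilinear (model M) k (\<omega> ch x)"
    and "ch \<in> charts M \<Longrightarrow> ch' \<in> charts M \<Longrightarrow> x \<in> N \<Longrightarrow> x \<in> fst ch \<Longrightarrow> x \<in> fst ch' \<Longrightarrow> length vs = k \<Longrightarrow>
       set vs \<subseteq> model M \<Longrightarrow> \<omega> ch x vs = \<omega> ch' x (map (jac ch ch' (\<lambda>y. y) x) vs)"
    and "ch \<in> charts M \<Longrightarrow> holo_on (model M) (snd ch ` (N \<inter> fst ch)) (\<lambda>z. \<omega> ch (chart_inv ch z) vs)"
  using assms unfolding hol_form_def by blast+

lemma con_hdiffm: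
  assumes "perf_ob M E" "ch \<in> charts M" "x \<in> nb E p" "x \<in> fst ch"
  shows "hdiffm M ch x (\<lambda>y. con E p ch y vs)"
  unfolding hdiffm_def
proof (intro allI)
  fix i j
  show "hdiff M ch x (\<lambda>y. con E p ch y vs i j)"
    using hol_formD(4)[OF con_form[OF assms(1), of p i j] assms(2), of vs] assms
    by (auto simp: holo_on_iff hdiff_def)
qed

lemma con_linear:
  assumes "perf_ob M E" "v \<in> model M" "w \<in> model M"
  shows "con E p ch x [a *s v + w] i j = a * con E p ch x [v] i j + con E p ch x [w] i j"
proof -
  have "alt_multilinear (model M) 1 (\<lambda>vs. con E p ch x vs i j)"
    by (rule hol_formD(2)[OF con_form[OF assms(1), of p i j]])
  then have "\<And>us ws a v w. length us + 1 + length ws = 1 \<and> set us \<subseteq> model M \<and> set ws \<subseteq> model M \<and> v \<in> model M \<and> w \<in> model M \<Longrightarrow>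
    con E p ch x (us @ [a *s v + w] @ ws) i j = a * con E p ch x (us @ [v] @ ws) i j + con E p ch x (us @ [w] @ ws) i j"
    unfolding alt_multilinear_def by blast
  from this[of "[]" "[]" v w a] show ?thesis using assms by simp
qed

text \<open>The term with the derivative of \<open>f\<close> is differentiable by
  \<open>hdiff_dird\<close>. This is the place where the proof uses that derivatives of holomorphic
  functions are holomorphic.\<close>

lemma nconn_hdiffm:
  assumes M: "complex_manifold M" and E: "perf_ob M E" and E': "perf_ob M E'" and ch: "ch \<in> charts M" "x \<in> fst ch"
    and x: "x \<in> nb E p" "x \<in> nb E' p'" and v: "v \<in> model M" and f: "f \<in> bundle_maps M E E' q"
  shows "hdiffm M ch x (\<lambda>y. nconn E E' p p' f ch y v)"
proof -
  note b = perf_ob_bundle[OF E] perf_ob_bundle[OF E']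
  let ?L = "loc E E' p p' f"
  define N where "N = nb E p \<inter> nb E' p'"
  have N: "openin (mtop M) N" "x \<in> N"
    using x nb_openin[OF b(1)] nb_openin[OF b(2)] unfolding N_def by auto
  have fib: "fib E y = fib E x" "fib E' y = fib E' x" if "y \<in> N" for y
    using that x nb_fib[OF b(1), of _ p] nb_fib[OF b(2), of _ p'] unfolding N_def by auto
  have L: "hdiffm M ch y ?L" if "y \<in> N" "y \<in> fst ch" for y
    using that ch by (intro bundle_maps_hdiffm[OF M f]) (auto simp: N_def)
  have dL: "hdiffm M ch x (\<lambda>y. dmat ch y v ?L)"
    unfolding hdiffm_def dmat_def
  proof (intro allI)
    fix i j show "hdiff M ch x (\<lambda>y. dird ch y v (\<lambda>y. ?L y i j))"
      by (rule hdiff_dird[OF M ch(1) N ch(2) v]) (rule hdiffmD[OF L])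
  qed
  have "hdiffm M ch x (\<lambda>y. dmat ch y v ?L + gmul (fib E' x) (con E' p' ch y [v]) (?L y) - gmul (fib E x) (?L y) (con E p ch y [v]))"
  proof -
    have "hdiffm M ch x (\<lambda>y. gmul (fib E' x) (con E' p' ch y [v]) (?L y))"
      by (rule hdiffm_gmul[OF con_hdiffm[OF E' ch(1) x(2) ch(2)] L[OF N(2) ch(2)]])
    moreover have "hdiffm M ch x (\<lambda>y. gmul (fib E x) (?L y) (con E p ch y [v]))"
      by (rule hdiffm_gmul[OF L[OF N(2) ch(2)] con_hdiffm[OF E ch(1) x(1) ch(2)]])
    ultimately show ?thesis using dL by (simp add: hdiffm_def hdiff_add hdiff_diff)
  qed
  then show ?thesis
    by (rule hdiffm_cong[OF M ch(1) N ch(2), rotated]) (simp add: nconn_def fib)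
qed

lemma hom_conn_linear:
  assumes M: "complex_manifold M" and E: "perf_ob M E" and E': "perf_ob M E'"
    and v: "v \<in> model M" "w \<in> model M" and f: "f \<in> bundle_maps M E E' q"
  shows "hom_conn M E E' f ch x [a *s v + w] i j = a * hom_conn M E E' f ch x [v] i j + hom_conn M E E' f ch x [w] i j"
proof (cases "ch \<in> charts M \<and> x \<in> fst ch")
  case True
  then have ch: "ch \<in> charts M" "x \<in> fst ch" by auto
  note b = perf_ob_bundle[OF E] perf_ob_bundle[OF E']
  have xx: "x \<in> nb E x" "x \<in> nb E' x" using nb_self[OF b(1)] nb_self[OF b(2)] chart_pts[OF M ch] by auto
  have vw: "a *s v + w \<in> model M"
    using v model_subspace[OF M ch(1)] by (auto intro: vec.subspace_add vec.subspace_scale)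
  have lin_r: "gmul B X (\<lambda>i j. a * Y i j + Z i j) = (\<lambda>i j. a * gmul B X Y i j + gmul B X Z i j)" for B X Y Z
    unfolding gmul_def by (intro ext) (simp add: sum_distrib_left sum.distrib algebra_simps)
  have lin_l: "gmul B (\<lambda>i j. a * Y i j + Z i j) X = (\<lambda>i j. a * gmul B Y X i j + gmul B Z X i j)" for B X Y Z
    unfolding gmul_def by (intro ext) (simp add: sum_distrib_left sum.distrib algebra_simps)
  have con: "con E x ch x [a *s v + w] = (\<lambda>i j. a * con E x ch x [v] i j + con E x ch x [w] i j)"
     "con E' x ch x [a *s v + w] = (\<lambda>i j. a * con E' x ch x [v] i j + con E' x ch x [w] i j)"
    by (intro ext con_linear[OF E v] con_linear[OF E' v])+
  have "dmat ch x (a *s v + w) (loc E E' x x f) = (\<lambda>i j. a * dmat ch x v (loc E E' x x f) i j + dmat ch x w (loc E E' x x f) i j)"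
    unfolding dmat_def
    by (intro ext dird_linear[OF M ch v]) (rule hdiffmD[OF bundle_maps_hdiffm[OF M f ch xx]])
  then have "nconn E E' x x f ch x (a *s v + w) = (\<lambda>i j. a * nconn E E' x x f ch x v i j + nconn E E' x x f ch x w i j)"
    unfolding nconn_def con lin_l lin_r by (intro ext) (simp add: algebra_simps)
  then show ?thesis unfolding hom_conn_eq[OF ch vw] hom_conn_eq[OF ch v(1)] hom_conn_eq[OF ch v(2)]
    by (simp only: lin_l lin_r)
qed (auto simp: hom_conn_eq_0)

lemma hom_conn_chart:
  assumes M: "complex_manifold M" and E: "perf_ob M E" and E': "perf_ob M E'"
    and f: "f \<in> bundle_maps M E E' q"
    and ch: "ch \<in> charts M" "x \<in> fst ch" and ch': "ch' \<in> charts M" "x \<in> fst ch'" and v: "v \<in> model M"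
  shows "hom_conn M E E' f ch x [v] = hom_conn M E E' f ch' x [jac ch ch' (\<lambda>y. y) x v]"
proof -
  note b = perf_ob_bundle[OF E] perf_ob_bundle[OF E']
  have xx: "x \<in> nb E x" "x \<in> nb E' x" using nb_self[OF b(1)] nb_self[OF b(2)] chart_pts[OF M ch] by auto
  let ?w = "jac ch ch' (\<lambda>y. y) x v"
  have u: "hdiff M ch' x (\<lambda>y. loc E E' x x f y i j)" for i j
    by (rule hdiffmD[OF bundle_maps_hdiffm[OF M f ch' xx]])
  note pull = dird_pull[OF M ch(1) M ch'(1) holomorphic_map_id[OF M] ch(2) ch'(2) _ v]
  have w: "?w \<in> model M"
    by (rule jac_model[OF M ch(1) M ch'(1) holomorphic_map_id[OF M] ch(2) ch'(2) hdiff_const[of M ch' x 0] v])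
  have "dmat ch x v (loc E E' x x f) = dmat ch' x ?w (loc E E' x x f)"
    unfolding dmat_def by (intro ext pull[OF u])
  moreover have "con E x ch x [v] = con E x ch' x [?w]"
  proof (intro ext)
    fix i j show "con E x ch x [v] i j = con E x ch' x [?w] i j"
      using hol_formD(3)[OF con_form[OF E, of x i j] ch(1) ch'(1) xx(1) ch(2) ch'(2), of "[v]"] v by simp
  qed
  moreover have "con E' x ch x [v] = con E' x ch' x [?w]"
  proof (intro ext)
    fix i j show "con E' x ch x [v] i j = con E' x ch' x [?w] i j"
      using hol_formD(3)[OF con_form[OF E', of x i j] ch(1) ch'(1) xx(2) ch(2) ch'(2), of "[v]"] v by simp
  qed
  ultimately have "nconn E E' x x f ch x v = nconn E E' x x f ch' x ?w" by (simp only: nconn_def)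
  then show ?thesis by (simp only: hom_conn_eq[OF ch v] hom_conn_eq[OF ch' w])
qed

section \<open>Pullback of connections\<close>

lemma charts_cover:
  assumes "complex_manifold M" "x \<in> pts M"
  shows "\<exists>ch\<in>charts M. x \<in> fst ch"
proof -
  have "(\<Union>ch\<in>charts M. fst ch) = pts M" using assms(1) unfolding complex_manifold_def by blast
  then show ?thesis using assms(2) by blast
qed

lemma fib_pull: "x \<in> pts M \<Longrightarrow> fib (pull_perf M M' \<phi> E) x = fib E (\<phi> x)"
  by (simp add: fib_def pull_perf_def)

text \<open>The pulled back bundle at \<open>x\<close> carries the trivialisation of the original
  one at \<open>\<phi> x\<close>. So both sides are written in corresponding trivialisations, and
  only the chain rule is left to apply.\<close>

lemma hom_conn_pull:
  assumes M: "complex_manifold M" and M': "complex_manifold M'" and \<phi>: "holomorphic_map M M' \<phi>"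
    and E: "perf_ob M' E" and E': "perf_ob M' E'" and f: "f \<in> bundle_maps M' E E' q"
    and ch: "ch \<in> charts M" "x \<in> fst ch" and v: "v \<in> model M"
    and ch'_def: "ch' = (SOME ch'. ch' \<in> charts M' \<and> \<phi> x \<in> fst ch')"
  shows "hom_conn M (pull_perf M M' \<phi> E) (pull_perf M M' \<phi> E') (pull_map M \<phi> f) ch x [v] =
     hom_conn M' E E' f ch' (\<phi> x) [jac ch ch' \<phi> x v]"
    and "ch' \<in> charts M'" "\<phi> x \<in> fst ch'"
proof -
  note b = perf_ob_bundle[OF E] perf_ob_bundle[OF E']
  have xp: "x \<in> pts M" by (rule chart_pts[OF M ch])
  have \<phi>p: "\<phi> y \<in> pts M'" if "y \<in> pts M" for y
    using \<phi> that by (auto simp: holomorphic_map_def continuous_map_def)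
  have "\<exists>ch'. ch' \<in> charts M' \<and> \<phi> x \<in> fst ch'"
    using charts_cover[OF M' \<phi>p[OF xp]] by blast
  from someI_ex[OF this] show ch': "ch' \<in> charts M'" "\<phi> x \<in> fst ch'" by (simp_all add: ch'_def)
  have xx: "\<phi> x \<in> nb E (\<phi> x)" "\<phi> x \<in> nb E' (\<phi> x)" using nb_self[OF b(1)] nb_self[OF b(2)] \<phi>p[OF xp] by auto
  let ?P = "pull_perf M M' \<phi>" and ?w = "jac ch ch' \<phi> x v"
  have L: "loc (?P E) (?P E') x x (pull_map M \<phi> f) y = loc E E' (\<phi> x) (\<phi> x) f (\<phi> y)" if "y \<in> pts M" for y
    using that xp by (simp add: loc_def fib_pull) (simp add: pull_perf_def pull_map_def)
  have u: "hdiff M' ch' (\<phi> x) (\<lambda>y. loc E E' (\<phi> x) (\<phi> x) f y i j)" for i j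
    by (rule hdiffmD[OF bundle_maps_hdiffm[OF M' f ch' xx]])
  have w: "?w \<in> model M'"
    by (rule jac_model[OF M ch(1) M' ch'(1) \<phi> ch(2) ch'(2) hdiff_const[of M' ch' "\<phi> x" 0] v])
  have d: "dmat ch x v (loc (?P E) (?P E') x x (pull_map M \<phi> f)) = dmat ch' (\<phi> x) ?w (loc E E' (\<phi> x) (\<phi> x) f)"
  proof -
    have "dmat ch x v (loc (?P E) (?P E') x x (pull_map M \<phi> f)) = dmat ch x v (\<lambda>y. loc E E' (\<phi> x) (\<phi> x) f (\<phi> y))"
      by (rule dmat_cong[OF M ch(1) openin_topspace xp ch(2) v L])
    also have "\<dots> = dmat ch' (\<phi> x) ?w (loc E E' (\<phi> x) (\<phi> x) f)"
      unfolding dmat_def by (intro ext dird_pull[OF M ch(1) M' ch'(1) \<phi> ch(2) ch'(2) u v])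
    finally show ?thesis .
  qed
  have con: "con (?P E0) x ch x [v] = con E0 (\<phi> x) ch' (\<phi> x) [?w]" for E0
    using xp ch v by (simp add: pull_perf_def pull_form_def ch'_def[symmetric] Let_def)
  have "nconn (?P E) (?P E') x x (pull_map M \<phi> f) ch x v = nconn E E' (\<phi> x) (\<phi> x) f ch' (\<phi> x) ?w"
    by (simp only: nconn_def d con L[OF xp] fib_pull[OF xp])
  moreover have "triv (?P E0) x x = triv E0 (\<phi> x) (\<phi> x)" for E0
    using xp by (simp add: pull_perf_def pull_map_def)
  ultimately show "hom_conn M (?P E) (?P E') (pull_map M \<phi> f) ch x [v] = hom_conn M' E E' f ch' (\<phi> x) [?w]"
    by (simp only: hom_conn_eq[OF ch v] hom_conn_eq[OF ch' w] fib_pull[OF xp])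
qed

section \<open>The simplices of infinity vector bundles\<close>

lemma hat_iff: "is \<in> (\<Union>k. hat n k) \<longleftrightarrow> is \<noteq> [] \<and> set is \<subseteq> {..n}"
proof
  assume "is \<noteq> [] \<and> set is \<subseteq> {..n}"
  then have "is \<in> hat n (length is - 1)" by (cases "is") (auto simp: hat_def)
  then show "is \<in> (\<Union>k. hat n k)" by blast
qed (auto simp: hat_def)

lemma map_face: "map f (face j xs) = face j (map f xs)"
  by (simp add: face_def take_map drop_map)

lemma map_nth_upt: "length js = Suc m \<Longrightarrow> map (\<lambda>j. f (js ! j)) [0..<m + 1] = map f js"
  by (rule nth_equalityI) (auto simp del: upt_Suc)

context
  fixes M :: "('a, 'm::finite) cmfd" and F :: "('a, 'm) ivb" and n :: nat
  assumes F: "F \<in> IVB M n"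
begin

lemma IVB_core: "is \<in> hat n k \<Longrightarrow> F is \<in> dgnerve_core (Perf M) k"
  and IVB_natural: "delta_map m k \<phi> \<Longrightarrow> is \<in> hat n k \<Longrightarrow> F (hat_op m \<phi> is) = dgnerve_op (Perf M) m \<phi> (F is)"
  using F unfolding IVB_def by blast+

text \<open>Naturality of \<open>F\<close> for the inclusion of the \<open>i\<close>-th
  vertex.\<close>

lemma IVB_ob:
  assumes "is \<in> hat n k" "i \<le> k"
  shows "fst (F is) i = ob_of F (is ! i)"
proof -
  have d: "delta_map 0 k (\<lambda>_. i)" using assms by (auto simp: delta_map_def mono_on_def)
  have "F [is ! i] = dgnerve_op (Perf M) 0 (\<lambda>_. i) (F is)"
    using IVB_natural[OF d assms(1)] by (simp add: hat_op_def)
  then show ?thesis by (simp add: ob_of_def dgnerve_op_def split: prod.split)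
qed

text \<open>Naturality of \<open>F\<close> for the increasing map that lists \<open>js\<close>: the
  restriction of \<open>F is\<close> to the face \<open>js\<close> is the value of \<open>F\<close>
  on the subsequence, and \<open>mor_of\<close> is the top component of that value.\<close>

lemma IVB_mor:
  assumes "is \<in> hat n k" "js \<in> cells k" "length js \<ge> 2"
  shows "snd (F is) js = mor_of F (map ((!) is) js)"
proof -
  obtain m where m: "length js = Suc m" using assms(3) by (cases "length js") auto
  have sw: "sorted_wrt (<) js" "set js \<subseteq> {..k}" using assms(2) by (auto simp: cells_def)
  have lt: "i < j \<Longrightarrow> j \<le> m \<Longrightarrow> js ! i < js ! j" for i j
    using sw(1) m by (auto simp: sorted_wrt_iff_nth_less)
  have d: "delta_map m k ((!) js)"
    unfolding delta_map_def mono_on_def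
  proof (intro conjI allI impI)
    fix r s assume "r \<in> {..m} \<and> s \<in> {..m} \<and> r \<le> s"
    then show "js ! r \<le> js ! s" using lt[of r s] by (cases "r = s") auto
  next
    have "js ! j \<in> {..k}" if "j \<le> m" for j
    proof (rule subsetD[OF sw(2)])
      show "js ! j \<in> set js" using m that by (intro nth_mem) simp
    qed
    then show "(!) js ` {..m} \<subseteq> {..k}" by auto
  qed
  have inj: "inj_on ((!) js) (set [0..<m + 1])"
    by (rule inj_on_nth) (use sw(1) m in \<open>auto simp: strict_sorted_iff\<close>)
  have "hat_op m ((!) js) is = map ((!) is) js"
    unfolding hat_op_def by (rule map_nth_upt[OF m])
  then have "F (map ((!) is) js) = dgnerve_op (Perf M) m ((!) js) (F is)"
    using IVB_natural[OF d assms(1)] by simp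
  moreover have "[0..<m + 1] \<in> cells m" by (auto simp: cells_def simp del: upt_Suc)
  moreover have "map ((!) js) [0..<m + 1] = js" using map_nth_upt[OF m, of "\<lambda>x. x"] by simp
  moreover have "length js = m + 1" using m by simp
  ultimately show ?thesis using inj assms(3)
    by (simp add: mor_of_def dgnerve_op_def split_beta del: upt_Suc)
qed

lemma IVB_perf_ob:
  assumes "i \<le> n"
  shows "perf_ob M (ob_of F i)"
proof -
  have "F [i] \<in> dgnerve (Perf M) 0" using IVB_core[of "[i]" 0] assms by (auto simp: hat_def dgnerve_core_def)
  then show ?thesis by (auto simp: ob_of_def dgnerve_def Perf_def)
qed

text \<open>The nerve relation of the simplex \<open>F is\<close> on its top cell
  \<open>[0..<k + 1]\<close>. The vertices in \<open>is\<close> may repeat and need not increase,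
  but inside the nerve it is their positions that form the cell.\<close>

lemma mor_of_bundle_maps:
  assumes "set is \<subseteq> {..n}" "length is = k + 1" "k \<ge> 1"
  shows "mor_of F is \<in> bundle_maps M (ob_of F (last is)) (ob_of F (hd is)) (1 - int k)"
    and "Dif (Perf M) (ob_of F (last is)) (ob_of F (hd is)) (1 - int k) (mor_of F is) =
          (\<Sum>j\<in>{1..<k}. signed (j - 1) (mor_of F (face j is))) +
          (\<Sum>j\<in>{1..<k}. signed (k * (j - 1) + 1)
             (Cmp (Perf M) (ob_of F (last is)) (ob_of F (is ! j)) (ob_of F (hd is)) (mor_of F (take (j + 1) is)) (mor_of F (drop j is))))"
proof -
  have h: "is \<in> hat n k" using assms by (simp add: hat_def)
  let ?r = "[0..<k + 1]"
  have rc: "?r \<in> cells k" by (auto simp: cells_def simp del: upt_Suc)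
  have len: "length ?r = k + 1" by simp
  have ne: "is \<noteq> []" using assms by auto
  have "F is \<in> dgnerve (Perf M) k" using IVB_core[OF h] by (auto simp: dgnerve_core_def)
  then have D: "snd (F is) ?r \<in> Hom (Perf M) (fst (F is) (last ?r)) (fst (F is) (hd ?r)) (1 - int k) \<and>
        Dif (Perf M) (fst (F is) (last ?r)) (fst (F is) (hd ?r)) (1 - int k) (snd (F is) ?r) =
          (\<Sum>j\<in>{1..<k}. signed (j - 1) (snd (F is) (face j ?r))) +
          (\<Sum>j\<in>{1..<k}. signed (k * (j - 1) + 1)
             (Cmp (Perf M) (fst (F is) (last ?r)) (fst (F is) (?r ! j)) (fst (F is) (hd ?r))
               (snd (F is) (take (j + 1) ?r)) (snd (F is) (drop j ?r))))"
    using rc len assms(3) unfolding dgnerve_def by (cases "F is") (auto simp del: upt_Suc)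
  have mapr: "map ((!) is) ?r = is" using map_nth[of "is"] assms(2) by simp
  have g: "snd (F is) ?r = mor_of F is" using IVB_mor[OF h rc] assms(3) mapr by simp
  have last: "fst (F is) (last ?r) = ob_of F (last is)"
    using IVB_ob[OF h, of k] assms(2) ne by (simp add: last_conv_nth)
  have hd: "fst (F is) (hd ?r) = ob_of F (hd is)"
    using IVB_ob[OF h, of 0] ne by (simp add: hd_conv_nth upt_conv_Cons del: upt_Suc)
  have mid: "fst (F is) (?r ! j) = ob_of F (is ! j)" if "j \<in> {1..<k}" for j
    using that IVB_ob[OF h, of j] by (simp del: upt_Suc)
  have sub: "xs \<in> cells k" if "xs \<noteq> []" "sorted_wrt (<) xs" "set xs \<subseteq> set ?r" for xs
    using that by (auto simp: cells_def simp del: upt_Suc)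
  have face: "snd (F is) (face j ?r) = mor_of F (face j is)" if j: "j \<in> {1..<k}" for j
  proof -
    have 1: "length (face j ?r) = k" using j by (subst length_face) auto
    have "sorted_wrt (<) (face j ?r)"
      using j by (auto simp: face_def sorted_wrt_append drop_upt take_upt simp del: upt_Suc)
    moreover have "set (face j ?r) \<subseteq> set ?r" by (auto simp: face_def dest: in_set_takeD in_set_dropD simp del: upt_Suc)
    ultimately have "face j ?r \<in> cells k" using 1 j by (intro sub) auto
    moreover have "map ((!) is) (face j ?r) = face j is"
      unfolding map_face mapr ..
    ultimately show ?thesis using IVB_mor[OF h, of "face j ?r"] 1 j by auto
  qed
  have tk: "snd (F is) (take (j + 1) ?r) = mor_of F (take (j + 1) is)" if j: "j \<in> {1..<k}" for j
  proof -
    have "take (j + 1) ?r \<in> cells k"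
      using j by (intro sub) (auto simp: sorted_wrt_take dest: in_set_takeD simp del: upt_Suc)
    moreover have "map ((!) is) (take (j + 1) ?r) = take (j + 1) is"
      unfolding take_map[symmetric] mapr ..
    ultimately show ?thesis using IVB_mor[OF h, of "take (j + 1) ?r"] j by (auto simp del: upt_Suc)
  qed
  have dr: "snd (F is) (drop j ?r) = mor_of F (drop j is)" if j: "j \<in> {1..<k}" for j
  proof -
    have "drop j ?r \<in> cells k"
      using j by (intro sub) (auto simp: sorted_wrt_drop dest: in_set_dropD simp del: upt_Suc)
    moreover have "map ((!) is) (drop j ?r) = drop j is"
      unfolding drop_map[symmetric] mapr ..
    ultimately show ?thesis using IVB_mor[OF h, of "drop j ?r"] j by (auto simp del: upt_Suc)
  qed
  show "mor_of F is \<in> bundle_maps M (ob_of F (last is)) (ob_of F (hd is)) (1 - int k)"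
    using conjunct1[OF D] unfolding g last hd by (simp add: Perf_def)
  show "Dif (Perf M) (ob_of F (last is)) (ob_of F (hd is)) (1 - int k) (mor_of F is) =
          (\<Sum>j\<in>{1..<k}. signed (j - 1) (mor_of F (face j is))) +
          (\<Sum>j\<in>{1..<k}. signed (k * (j - 1) + 1)
             (Cmp (Perf M) (ob_of F (last is)) (ob_of F (is ! j)) (ob_of F (hd is)) (mor_of F (take (j + 1) is)) (mor_of F (drop j is))))"
    using conjunct2[OF D] unfolding g last hd
    by (rule trans) (rule arg_cong2[of _ _ _ _ "(+)"]; rule sum.cong[OF refl]; simp only: mid face tk dr)
qed

end

text \<open>Near each point the middle bundle is trivialised at this very point, which exhibits the
  composite as a product of holomorphic matrices.\<close>

lemma bundle_maps_comp:
  assumes M: "complex_manifold M" and E: "perf_ob M E" and E': "perf_ob M E'" and E'': "perf_ob M E''"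
    and f: "f \<in> bundle_maps M E E' q" and g: "g \<in> bundle_maps M E' E'' r"
  shows "(\<lambda>x. gmul (fib E' x) (g x) (f x)) \<in> bundle_maps M E E'' (r + q)"
  unfolding bundle_maps_def mem_Collect_eq
proof (intro conjI allI impI ballI)
  note b = perf_ob_bundle[OF E] perf_ob_bundle[OF E'] perf_ob_bundle[OF E'']
  fix x
  show "x \<notin> pts M \<Longrightarrow> gmul (fib E' x) (g x) (f x) = 0"
    using f unfolding bundle_maps_def by simp
  show "gmul (fib E' x) (g x) (f x) \<in> gmats (fib E'' x) (fib E x) (r + q)"
    by (rule gmats_gmul[OF bundle_maps_gmats[OF g] bundle_maps_gmats[OF f]])
  fix p p''
  have "hdiffm M ch x (loc E E'' p p'' (\<lambda>x. gmul (fib E' x) (g x) (f x)))"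
    if ch: "ch \<in> charts M" "x \<in> fst ch" and x: "x \<in> nb E p" "x \<in> nb E'' p''" for ch x
  proof -
    have x': "x \<in> nb E' x" by (rule nb_self[OF b(2) chart_pts[OF M ch]])
    define N where "N = nb E p \<inter> nb E' x \<inter> nb E'' p''"
    have N: "openin (mtop M) N" "x \<in> N"
      using x x' nb_openin[OF b(1)] nb_openin[OF b(2)] nb_openin[OF b(3)] unfolding N_def by auto
    have L: "loc E E'' p p'' (\<lambda>x. gmul (fib E' x) (g x) (f x)) y = gmul (fib E' x) (loc E' E'' x p'' g y) (loc E E' p x f y)"
      if "y \<in> N" for y
    proof -
      have "y \<in> nb E' x" using that by (simp add: N_def)
      then have "fib E' y = fib E' x" by (rule nb_fib[OF b(2)])
      have ys: "y \<in> nb E p" "y \<in> nb E' x" "y \<in> nb E'' p''" using that by (simp_all add: N_def)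
      show ?thesis
        using loc_comp[OF b, of y p x p'' f q g, OF ys bundle_maps_gmats[OF f]] unfolding \<open>fib E' y = fib E' x\<close> .
    qed
    have "hdiffm M ch x (\<lambda>y. gmul (fib E' x) (loc E' E'' x p'' g y) (loc E E' p x f y))"
      by (rule hdiffm_gmul[OF bundle_maps_hdiffm[OF M g ch x' x(2)] bundle_maps_hdiffm[OF M f ch x(1) x']])
    then show ?thesis
      by (rule hdiffm_cong[OF M ch(1) N ch(2), rotated]) (rule L[symmetric])
  qed
  note h = this
  show "holo_mat M (nb E p \<inter> nb E'' p'') (loc E E'' p p'' (\<lambda>x. gmul (fib E' x) (g x) (f x)))"
    unfolding holo_mat_def holo_fun_iff[OF M] by (intro allI ballI) (rule hdiffmD[OF h], auto)
qed

section \<open>The Maurer--Cartan relation\<close>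

text \<open>The family \<open>d + g\<close>. Putting \<open>d\<close> on the 0-simplices turns the
  differential \<open>D\<close> into the two extreme terms of a sum over cuts.\<close>

definition gfam :: "('a, 'm::finite) ivb \<Rightarrow> nat list \<Rightarrow> 'a \<Rightarrow> gmat" where
  "gfam F \<alpha> = (if length \<alpha> = 1 then dif (ob_of F (hd \<alpha>)) else 0) + mor_of F \<alpha>"

lemma fam_A_eq: "fam_A M F \<alpha> ch x vs i j = msign (int (length \<alpha> - 1)) *
    hom_conn M (ob_of F (last \<alpha>)) (ob_of F (hd \<alpha>)) (gfam F \<alpha>) ch x vs i j"
  by (simp add: fam_A_def gfam_def)

lemma fam_A_one_form: "\<forall>\<beta> us. length us \<noteq> 1 \<longrightarrow> fam_A M F \<beta> ch x us = 0"
  by (auto simp: fun_eq_iff fam_A_eq hom_conn_eq_0)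

lemma gfam_eq_mor: "length \<alpha> \<noteq> 1 \<Longrightarrow> gfam F \<alpha> = mor_of F \<alpha>"
  by (simp add: gfam_def)

text \<open>The simplices of \<open>IVB\<close> carry junk on sequences that leave \<open>{..n}\<close>. Coherent families satisfy the
  relations on all sequences; \<open>total_ivb\<close> makes a simplex coherent by moving all vertices beyond \<open>n\<close>
  to \<open>n\<close>.\<close>

definition coherent :: "('a, 'm::finite) cmfd \<Rightarrow> ('a, 'm) ivb \<Rightarrow> bool" where
  "coherent M F \<longleftrightarrow> (\<forall>i. perf_ob M (ob_of F i)) \<and>
     (\<forall>\<alpha>. \<alpha> \<noteq> [] \<longrightarrow> gfam F \<alpha> \<in> bundle_maps M (ob_of F (last \<alpha>)) (ob_of F (hd \<alpha>)) (2 - int (length \<alpha>))) \<and>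
     (\<forall>\<alpha> x i j. \<alpha> \<noteq> [] \<longrightarrow>
        (\<Sum>p<length \<alpha>. msign (int (length \<alpha> - 1) * (int p - 1)) *
           gmul (fib (ob_of F (\<alpha> ! p)) x) (gfam F (take (Suc p) \<alpha>) x) (gfam F (drop p \<alpha>) x) i j) =
        (\<Sum>a\<in>{1..<length \<alpha> - 1}. msign (int (a - 1)) * gfam F (face a \<alpha>) x i j))"

definition total_ivb :: "nat \<Rightarrow> ('a, 'm::finite) ivb \<Rightarrow> ('a, 'm) ivb" where
  "total_ivb n F = (\<lambda>is. F (map (\<lambda>i. min i n) is))"

lemma ob_of_total: "ob_of (total_ivb n F) i = ob_of F (min i n)"
  by (simp add: ob_of_def total_ivb_def)

lemma mor_of_total: "mor_of (total_ivb n F) is = mor_of F (map (\<lambda>i. min i n) is)"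
  by (simp add: mor_of_def total_ivb_def)

lemma gfam_total: "gfam (total_ivb n F) is = gfam F (map (\<lambda>i. min i n) is)"
  by (cases "is") (simp_all add: gfam_def ob_of_total mor_of_total)

lemma signed_apply: "signed k f x i j = msign (int k) * f x i j" for f :: "'a \<Rightarrow> gmat"
  by (simp add: signed_def msign_def)

text \<open>The cuts at the two ends give \<open>d g\<close> and \<open>g d\<close>, the cuts in
  between the compositions of the nerve relation. On 0-simplices the statement is
  \<open>d d = 0\<close>.\<close>

lemma gfam_IVB:
  assumes F: "F \<in> IVB M n" and \<alpha>: "\<alpha> \<noteq> []" "set \<alpha> \<subseteq> {..n}"
  shows "gfam F \<alpha> \<in> bundle_maps M (ob_of F (last \<alpha>)) (ob_of F (hd \<alpha>)) (2 - int (length \<alpha>))"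
    and "(\<Sum>p<length \<alpha>. msign (int (length \<alpha> - 1) * (int p - 1)) *
           gmul (fib (ob_of F (\<alpha> ! p)) x) (gfam F (take (Suc p) \<alpha>) x) (gfam F (drop p \<alpha>) x) i j) =
        (\<Sum>a\<in>{1..<length \<alpha> - 1}. msign (int (a - 1)) * gfam F (face a \<alpha>) x i j)"
proof -
  define k where "k = length \<alpha> - 1"
  have len: "length \<alpha> = k + 1" using \<alpha>(1) by (cases \<alpha>) (auto simp: k_def)
  let ?E = "ob_of F"
  have "gfam F \<alpha> \<in> bundle_maps M (?E (last \<alpha>)) (?E (hd \<alpha>)) (2 - int (length \<alpha>)) \<and>
    (\<Sum>p<length \<alpha>. msign (int (length \<alpha> - 1) * (int p - 1)) *
           gmul (fib (?E (\<alpha> ! p)) x) (gfam F (take (Suc p) \<alpha>) x) (gfam F (drop p \<alpha>) x) i j) =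
        (\<Sum>a\<in>{1..<length \<alpha> - 1}. msign (int (a - 1)) * gfam F (face a \<alpha>) x i j)"
  proof (cases "k = 0")
    case True
    then obtain e where e: "\<alpha> = [e]" using len by (cases \<alpha>) auto
    have P: "perf_ob M (?E e)" using IVB_perf_ob[OF F] \<alpha> e by auto
    have g: "gfam F [e] = dif (?E e)" by (simp add: gfam_def mor_of_def)
    show ?thesis using P unfolding e by (simp add: g perf_ob_def)
  next
    case False
    then have k: "k \<ge> 1" by simp
    note mor = mor_of_bundle_maps[OF F \<alpha>(2) len k]
    have g: "gfam F \<alpha> = mor_of F \<alpha>" using k len by (simp add: gfam_eq_mor)
    let ?h = "\<lambda>p. gmul (fib (?E (\<alpha> ! p)) x) (gfam F (take (Suc p) \<alpha>) x) (gfam F (drop p \<alpha>) x) i j"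
    have s: "(\<Sum>p<length \<alpha>. msign (int k * (int p - 1)) * ?h p) =
      msign (int k * (int 0 - 1)) * ?h 0 + (\<Sum>p\<in>{1..<k}. msign (int k * (int p - 1)) * ?h p) + msign (int k * (int k - 1)) * ?h k"
    proof -
      have "{..<length \<alpha>} = insert 0 (insert k {1..<k})" using len k by auto
      then show ?thesis using k by simp
    qed
    have h0: "?h 0 = gmul (fib (?E (hd \<alpha>)) x) (dif (?E (hd \<alpha>)) x) (mor_of F \<alpha> x) i j"
    proof -
      have "take (Suc 0) \<alpha> = [hd \<alpha>]" "\<alpha> ! 0 = hd \<alpha>" using \<alpha>(1) by (cases \<alpha>; simp)+
      then show ?thesis using g by (simp add: gfam_def[of F "[hd \<alpha>]"] mor_of_def[of F "[hd \<alpha>]"])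
    qed
    have hk: "?h k = gmul (fib (?E (last \<alpha>)) x) (mor_of F \<alpha> x) (dif (?E (last \<alpha>)) x) i j"
    proof -
      have "drop k \<alpha> = [last \<alpha>]"
        by (metis k_def \<alpha>(1) append_butlast_last_id append_eq_conv_conj length_butlast)
      moreover have "\<alpha> ! k = last \<alpha>" using len \<alpha>(1) by (simp add: last_conv_nth)
      ultimately show ?thesis using g len by (simp add: gfam_def[of F "[last \<alpha>]"] mor_of_def[of F "[last \<alpha>]"])
    qed
    have mid: "(\<Sum>p\<in>{1..<k}. msign (int k * (int p - 1)) * ?h p) =
      (\<Sum>p\<in>{1..<k}. msign (int k * (int p - 1)) * gmul (fib (?E (\<alpha> ! p)) x) (mor_of F (take (p + 1) \<alpha>) x) (mor_of F (drop p \<alpha>) x) i j)"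
    proof (rule sum.cong[OF refl])
      fix p assume p: "p \<in> {1..<k}"
      have "length (take (Suc p) \<alpha>) \<noteq> 1" "length (drop p \<alpha>) \<noteq> 1" using p len by auto
      then show "msign (int k * (int p - 1)) * ?h p = msign (int k * (int p - 1)) *
         gmul (fib (?E (\<alpha> ! p)) x) (mor_of F (take (p + 1) \<alpha>) x) (mor_of F (drop p \<alpha>) x) i j"
        by (simp only: gfam_eq_mor not_False_eq_True Suc_eq_plus1)
    qed
    have faces: "(\<Sum>a\<in>{1..<k}. msign (int (a - 1)) * gfam F (face a \<alpha>) x i j) =
       (\<Sum>a\<in>{1..<k}. msign (int (a - 1)) * mor_of F (face a \<alpha>) x i j)"
      using len by (intro sum.cong refl) (simp add: gfam_eq_mor length_face)
    have D: "gmul (fib (?E (last \<alpha>)) x) (mor_of F \<alpha> x) (dif (?E (last \<alpha>)) x) i j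
       - msign (1 - int k) * gmul (fib (?E (hd \<alpha>)) x) (dif (?E (hd \<alpha>)) x) (mor_of F \<alpha> x) i j =
       (\<Sum>a\<in>{1..<k}. msign (int (a - 1)) * mor_of F (face a \<alpha>) x i j) +
       (\<Sum>p\<in>{1..<k}. msign (int (k * (p - 1) + 1)) * gmul (fib (?E (\<alpha> ! p)) x) (mor_of F (take (p + 1) \<alpha>) x) (mor_of F (drop p \<alpha>) x) i j)"
      using fun_cong[OF fun_cong[OF fun_cong[OF mor(2)], of x i], of j]
      by (simp add: Perf_def sum_fun_apply signed_apply del: One_nat_def)
    have neg: "(\<Sum>p\<in>{1..<k}. msign (int (k * (p - 1) + 1)) * gmul (fib (?E (\<alpha> ! p)) x) (mor_of F (take (p + 1) \<alpha>) x) (mor_of F (drop p \<alpha>) x) i j)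
      = - (\<Sum>p\<in>{1..<k}. msign (int k * (int p - 1)) * gmul (fib (?E (\<alpha> ! p)) x) (mor_of F (take (p + 1) \<alpha>) x) (mor_of F (drop p \<alpha>) x) i j)"
      unfolding sum_negf[symmetric]
    proof (rule sum.cong[OF refl])
      fix p assume "p \<in> {1..<k}"
      then have "msign (int (k * (p - 1) + 1)) = - msign (int k * (int p - 1))"
        by (auto simp: msign_def of_nat_diff)
      then show "msign (int (k * (p - 1) + 1)) * gmul (fib (?E (\<alpha> ! p)) x) (mor_of F (take (p + 1) \<alpha>) x) (mor_of F (drop p \<alpha>) x) i j =
        - (msign (int k * (int p - 1)) * gmul (fib (?E (\<alpha> ! p)) x) (mor_of F (take (p + 1) \<alpha>) x) (mor_of F (drop p \<alpha>) x) i j)"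
        by simp
    qed
    \<comment> \<open>\<open>k * (k - 1)\<close> is even and the exponent at cut 0 is
      \<open>- k\<close>: these are the signs of the two terms of \<open>D\<close>, brought to the
      side of the compositions.\<close>
    have e: "msign (int k * (int k - 1)) = 1" "msign (int k * (int 0 - 1)) = - msign (1 - int k)"
      by (auto simp: msign_def)
    have abel: "X - c * Y = Z + - W \<Longrightarrow> - c * Y + W + 1 * X = Z" for X c Y Z W :: complex
      by (simp add: algebra_simps)
    have lk: "length \<alpha> - 1 = k" using len by simp
    have "(\<Sum>p<length \<alpha>. msign (int k * (int p - 1)) * ?h p) = (\<Sum>a\<in>{1..<k}. msign (int (a - 1)) * gfam F (face a \<alpha>) x i j)"
      unfolding s h0 hk mid faces e by (rule abel[OF D[unfolded neg]])
    moreover have "gfam F \<alpha> \<in> bundle_maps M (?E (last \<alpha>)) (?E (hd \<alpha>)) (2 - int (length \<alpha>))"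
      using mor(1) len unfolding g by simp
    ultimately show ?thesis unfolding lk by blast
  qed
  then show "gfam F \<alpha> \<in> bundle_maps M (?E (last \<alpha>)) (?E (hd \<alpha>)) (2 - int (length \<alpha>))"
    "(\<Sum>p<length \<alpha>. msign (int (length \<alpha> - 1) * (int p - 1)) *
           gmul (fib (?E (\<alpha> ! p)) x) (gfam F (take (Suc p) \<alpha>) x) (gfam F (drop p \<alpha>) x) i j) =
        (\<Sum>a\<in>{1..<length \<alpha> - 1}. msign (int (a - 1)) * gfam F (face a \<alpha>) x i j)"
    by auto
qed

text \<open>Moving vertices into \<open>{..n}\<close> is applied entrywise and therefore commutes
  with faces and cuts.\<close>

lemma coherent_total:
  assumes F: "F \<in> IVB M n"
  shows "coherent M (total_ivb n F)"
  unfolding coherent_def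
proof (intro conjI allI impI)
  fix i show "perf_ob M (ob_of (total_ivb n F) i)" by (simp add: ob_of_total IVB_perf_ob[OF F])
next
  let ?c = "\<lambda>i. min i n"
  fix \<alpha> :: "nat list" and x i j assume \<alpha>: "\<alpha> \<noteq> []"
  have m: "map ?c \<alpha> \<noteq> []" "set (map ?c \<alpha>) \<subseteq> {..n}" using \<alpha> by auto
  show "gfam (total_ivb n F) \<alpha> \<in> bundle_maps M (ob_of (total_ivb n F) (last \<alpha>)) (ob_of (total_ivb n F) (hd \<alpha>)) (2 - int (length \<alpha>))"
    using gfam_IVB(1)[OF F m] \<alpha> by (simp add: gfam_total ob_of_total last_map hd_map)
  show "(\<Sum>p<length \<alpha>. msign (int (length \<alpha> - 1) * (int p - 1)) *
           gmul (fib (ob_of (total_ivb n F) (\<alpha> ! p)) x) (gfam (total_ivb n F) (take (Suc p) \<alpha>) x) (gfam (total_ivb n F) (drop p \<alpha>) x) i j) =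
        (\<Sum>a\<in>{1..<length \<alpha> - 1}. msign (int (a - 1)) * gfam (total_ivb n F) (face a \<alpha>) x i j)"
    by (rule trans[OF _ trans[OF gfam_IVB(2)[OF F m, of x i j]]])
       (auto intro!: sum.cong simp: gfam_total ob_of_total map_face take_map drop_map)
qed

section \<open>Closedness of the trace\<close>

lemma ttr_cong:
  assumes "\<And>k l. k \<le> l \<Longrightarrow> l < length \<sigma> \<Longrightarrow> Q (seg k l \<sigma>) = Q' (seg k l \<sigma>)"
    and "\<And>k l. k \<le> l \<Longrightarrow> l < length \<sigma> \<Longrightarrow> g (rot k l \<sigma>) = g' (rot k l \<sigma>)"
  shows "ttr B m Q g \<sigma> = ttr B m Q' g' \<sigma>"
  unfolding ttr_def using assms by (intro sum.cong refl) auto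

context
  fixes M :: "('a, 'm::finite) cmfd" and F :: "('a, 'm) ivb"
  assumes M: "complex_manifold M" and coh: "coherent M F"
begin

lemma coh_ob: "perf_ob M (ob_of F e)"
  and coh_maps: "\<alpha> \<noteq> [] \<Longrightarrow> gfam F \<alpha> \<in> bundle_maps M (ob_of F (last \<alpha>)) (ob_of F (hd \<alpha>)) (2 - int (length \<alpha>))"
  and coh_rel: "\<alpha> \<noteq> [] \<Longrightarrow>
        (\<Sum>p<length \<alpha>. msign (int (length \<alpha> - 1) * (int p - 1)) *
           gmul (fib (ob_of F (\<alpha> ! p)) x) (gfam F (take (Suc p) \<alpha>) x) (gfam F (drop p \<alpha>) x) i j) =
        (\<Sum>a\<in>{1..<length \<alpha> - 1}. msign (int (a - 1)) * gfam F (face a \<alpha>) x i j)"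
  using coh unfolding coherent_def by (elim conjE; blast)+

lemma gfam_homog: "homog 1 (\<lambda>\<beta>. gfam F \<beta> x)"
  unfolding homog_def
proof (intro allI impI)
  fix \<alpha> i j assume "gfam F \<alpha> x i j \<noteq> 0" "\<alpha> \<noteq> []"
  from gmatsD[OF bundle_maps_gmats[OF coh_maps[OF this(2)]] this(1)]
  show "fst i - fst j = 1 + 1 - int (length \<alpha>)" by simp
qed

lemma gfam_supp: "supp (\<lambda>k. fib (ob_of F k) x) (\<lambda>\<beta>. gfam F \<beta> x)"
  unfolding supp_def
proof (intro allI impI)
  fix \<alpha> i j assume "gfam F \<alpha> x i j \<noteq> 0" "\<alpha> \<noteq> []"
  from gmatsD[OF bundle_maps_gmats[OF coh_maps[OF this(2)]] this(1)]
  show "i \<in> fib (ob_of F (hd \<alpha>)) x \<and> j \<in> fib (ob_of F (last \<alpha>)) x" by simp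
qed

text \<open>The connection applied to \<open>d + g\<close> and evaluated on \<open>v\<close>,
  without the simplicial sign that \<open>fam_A\<close> carries.\<close>

definition hfam :: "('a, 'm) chart \<Rightarrow> 'a \<Rightarrow> complex ^ 'm \<Rightarrow> nat list \<Rightarrow> gmat" where
  "hfam ch x v \<beta> = hom_conn M (ob_of F (last \<beta>)) (ob_of F (hd \<beta>)) (gfam F \<beta>) ch x [v]"

lemma hfam_gmats: "\<beta> \<noteq> [] \<Longrightarrow> hfam ch x v \<beta> \<in> gmats (fib (ob_of F (hd \<beta>)) x) (fib (ob_of F (last \<beta>)) x) (2 - int (length \<beta>))"
  unfolding hfam_def by (rule hom_conn_gmats[OF M coh_ob coh_ob coh_maps])

lemma hfam_homog: "homog 1 (hfam ch x v)"
  unfolding homog_def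
proof (intro allI impI)
  fix \<alpha> i j assume "hfam ch x v \<alpha> i j \<noteq> 0" "\<alpha> \<noteq> []"
  from gmatsD[OF hfam_gmats[OF this(2)] this(1)]
  show "fst i - fst j = 1 + 1 - int (length \<alpha>)" by simp
qed

lemma hfam_supp: "supp (\<lambda>k. fib (ob_of F k) x) (hfam ch x v)"
  unfolding supp_def
proof (intro allI impI)
  fix \<alpha> i j assume "hfam ch x v \<alpha> i j \<noteq> 0" "\<alpha> \<noteq> []"
  from gmatsD[OF hfam_gmats[OF this(2)] this(1)]
  show "i \<in> fib (ob_of F (hd \<alpha>)) x \<and> j \<in> fib (ob_of F (last \<alpha>)) x" by simp
qed

lemma fam_A_hfam: "fam_A M F \<beta> ch x [v] = (\<lambda>i j. msign (int (length \<beta> - 1)) * hfam ch x v \<beta> i j)"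
  by (intro ext) (simp add: fam_A_eq hfam_def)

lemma fam_A_homog: "homog 1 (\<lambda>\<beta>. fam_A M F \<beta> ch x [v])"
proof -
  have "fam_A M F \<beta> ch x [v] i j = 0 \<longleftrightarrow> hfam ch x v \<beta> i j = 0" for \<beta> i j
    by (simp add: fam_A_hfam msign_def)
  then show ?thesis using hfam_homog[of ch x v] unfolding homog_def by (simp only:)
qed

lemma fam_A_supp: "supp (\<lambda>k. fib (ob_of F k) x) (\<lambda>\<beta>. fam_A M F \<beta> ch x [v])"
proof -
  have "fam_A M F \<beta> ch x [v] i j = 0 \<longleftrightarrow> hfam ch x v \<beta> i j = 0" for \<beta> i j
    by (simp add: fam_A_hfam msign_def)
  then show ?thesis using hfam_supp[of x ch v] unfolding supp_def by (simp only:)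
qed

text \<open>Total degree 1 ties the length to row and column degrees. So the simplicial sign of
  \<open>A\<close> together with the twist \<open>tw 1\<close> is the twist \<open>tg\<close> up to
  the constant -1, and \<open>A\<close> inherits the relations of \<open>hfam\<close>, which are
  linear.\<close>

lemma tw_fam_A: "\<beta> \<noteq> [] \<Longrightarrow> tw 1 (fam_A M F \<beta> ch x [v]) i j = - tg (hfam ch x v \<beta>) i j"
proof (cases "hfam ch x v \<beta> i j = 0")
  case False
  assume \<beta>: "\<beta> \<noteq> []"
  then have "fst i - fst j = 1 + 1 - int (length \<beta>)" by (rule homogD[OF hfam_homog False])
  then have e: "int (length \<beta> - 1) = 1 - fst i + fst j" using \<beta> by (cases \<beta>) auto
  have "msign (fst i + fst i * fst j + 1 * fst j) * msign (int (length \<beta> - 1)) = msign (fst i * fst j + 1)"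
    unfolding msign_add[symmetric] e by (intro msign_eqI) auto
  moreover have "tw 1 (fam_A M F \<beta> ch x [v]) i j =
      (msign (fst i + fst i * fst j + 1 * fst j) * msign (int (length \<beta> - 1))) * hfam ch x v \<beta> i j"
    by (simp only: tw_def fam_A_hfam mult.assoc)
  ultimately show ?thesis by (simp only: tg_def msign_add) simp
qed (simp add: tw_def tg_def fam_A_hfam)

lemma gmul_sum_supp:
  assumes "supp (\<lambda>k. fib (ob_of F k) x) f" "finite B" "fib (ob_of F (\<alpha> ! p)) x \<subseteq> B" "p < length \<alpha>"
  shows "gmul (fib (ob_of F (\<alpha> ! p)) x) (f (take (Suc p) \<alpha>)) Y i j = (\<Sum>b\<in>B. f (take (Suc p) \<alpha>) i b * Y b j)"
  unfolding gmul_def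
proof (rule sum.mono_neutral_left)
  have "f (take (Suc p) \<alpha>) i b = 0" if "b \<notin> fib (ob_of F (\<alpha> ! p)) x" for b
  proof (rule ccontr)
    assume "f (take (Suc p) \<alpha>) i b \<noteq> 0"
    then have "b \<in> fib (ob_of F (last (take (Suc p) \<alpha>))) x"
      using assms(4) by (intro conjunct2[OF suppD[OF assms(1)]]) auto
    then show False using that assms(4) by (simp add: last_take_Suc)
  qed
  then show "\<forall>b\<in>B - fib (ob_of F (\<alpha> ! p)) x. f (take (Suc p) \<alpha>) i b * Y b j = 0" by simp
qed (use assms in auto)

context
  fixes B :: gbasis and x :: 'a and S :: "nat set"
  assumes B: "finite B" "\<And>k. k \<in> S \<Longrightarrow> fib (ob_of F k) x \<subseteq> B"
begin

lemma maurer_cartan: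
  assumes \<alpha>: "\<alpha> \<noteq> []" "set \<alpha> \<subseteq> S"
  shows "del (\<lambda>\<beta>. tg (gfam F \<beta> x)) \<alpha> i j = star B (\<lambda>\<beta>. tg (gfam F \<beta> x)) (\<lambda>\<beta>. tg (gfam F \<beta> x)) \<alpha> i j"
proof -
  have "(\<Sum>p<length \<alpha>. \<Sum>b\<in>B. msign (int (length \<alpha> - 1) * (int p - 1)) * (gfam F (take (Suc p) \<alpha>) x i b * gfam F (drop p \<alpha>) x b j)) =
     (\<Sum>a\<in>{1..<length \<alpha> - 1}. msign (int (a - 1)) * gfam F (face a \<alpha>) x i j)"
    unfolding coh_rel[OF \<alpha>(1), symmetric]
  proof (rule sum.cong[OF refl])
    fix p assume p: "p \<in> {..<length \<alpha>}"
    then have "\<alpha> ! p \<in> S" using \<alpha>(2) by auto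
    then show "(\<Sum>b\<in>B. msign (int (length \<alpha> - 1) * (int p - 1)) * (gfam F (take (Suc p) \<alpha>) x i b * gfam F (drop p \<alpha>) x b j)) =
       msign (int (length \<alpha> - 1) * (int p - 1)) * gmul (fib (ob_of F (\<alpha> ! p)) x) (gfam F (take (Suc p) \<alpha>) x) (gfam F (drop p \<alpha>) x) i j"
      using p gmul_sum_supp[OF gfam_supp B(1), of \<alpha> p x] B(2) by (simp add: sum_distrib_left)
  qed
  then show ?thesis
    unfolding del_tg[OF gfam_homog \<alpha>(1)] star_tg[OF gfam_homog gfam_homog \<alpha>(1)] by (simp only:)
qed

text \<open>The connection applied to both sides of the relation for \<open>d + g\<close>. This is
  done before twisting, where the Leibniz rule has no signs and holds for each cut
  separately.\<close>

lemma hfam_rel: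
  assumes \<alpha>: "\<alpha> \<noteq> []" "set \<alpha> \<subseteq> S"
  shows "(\<Sum>p<length \<alpha>. \<Sum>b\<in>B. msign (int (length \<alpha> - 1) * (int p - 1)) * (hfam ch x v (take (Suc p) \<alpha>) i b * gfam F (drop p \<alpha>) x b j)) +
     (\<Sum>p<length \<alpha>. \<Sum>b\<in>B. msign (int (length \<alpha> - 1) * (int p - 1)) * (gfam F (take (Suc p) \<alpha>) x i b * hfam ch x v (drop p \<alpha>) b j)) =
     (\<Sum>a\<in>{1..<length \<alpha> - 1}. msign (int (a - 1)) * hfam ch x v (face a \<alpha>) i j)"
proof -
  let ?E = "ob_of F" and ?c = "\<lambda>p. msign (int (length \<alpha> - 1) * (int p - 1))"
  let ?hc = "\<lambda>f. hom_conn M (?E (last \<alpha>)) (?E (hd \<alpha>)) f ch x [v] i j"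
  let ?gg = "\<lambda>p x. gmul (fib (?E (\<alpha> ! p)) x) (gfam F (take (Suc p) \<alpha>) x) (gfam F (drop p \<alpha>) x)"
  have tk: "gfam F (take (Suc p) \<alpha>) \<in> bundle_maps M (?E (\<alpha> ! p)) (?E (hd \<alpha>)) (2 - int (length (take (Suc p) \<alpha>)))"
    if "p < length \<alpha>" for p
    using coh_maps[of "take (Suc p) \<alpha>"] that \<alpha>(1) by (simp add: last_take_Suc)
  have dr: "gfam F (drop p \<alpha>) \<in> bundle_maps M (?E (last \<alpha>)) (?E (\<alpha> ! p)) (2 - int (length (drop p \<alpha>)))"
    if "p < length \<alpha>" for p
    using coh_maps[of "drop p \<alpha>"] that by (simp add: hd_drop_conv_nth)
  have fc: "gfam F (face a \<alpha>) \<in> bundle_maps M (?E (last \<alpha>)) (?E (hd \<alpha>)) (2 - int (length (face a \<alpha>)))"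
    and hfc: "hfam ch x v (face a \<alpha>) i j = ?hc (gfam F (face a \<alpha>))"
    if a: "a \<in> {1..<length \<alpha> - 1}" for a
  proof -
    have "hd (face a \<alpha>) = hd \<alpha>" "last (face a \<alpha>) = last \<alpha>" "face a \<alpha> \<noteq> []"
      using a by (auto simp: face_def hd_append)
    then show "gfam F (face a \<alpha>) \<in> bundle_maps M (?E (last \<alpha>)) (?E (hd \<alpha>)) (2 - int (length (face a \<alpha>)))"
      "hfam ch x v (face a \<alpha>) i j = ?hc (gfam F (face a \<alpha>))"
      using coh_maps[of "face a \<alpha>"] by (simp_all add: hfam_def)
  qed
  have "(\<Sum>p<length \<alpha>. ?c p * ?hc (?gg p)) = ?hc (\<lambda>x i j. \<Sum>p<length \<alpha>. ?c p * ?gg p x i j)"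
    by (rule hom_conn_sum[OF M coh_ob coh_ob, symmetric])
       (rule bundle_maps_comp[OF M coh_ob coh_ob coh_ob dr tk]; simp)
  also have "\<dots> = ?hc (\<lambda>x i j. \<Sum>a\<in>{1..<length \<alpha> - 1}. msign (int (a - 1)) * gfam F (face a \<alpha>) x i j)"
    unfolding coh_rel[OF \<alpha>(1)] ..
  also have "\<dots> = (\<Sum>a\<in>{1..<length \<alpha> - 1}. msign (int (a - 1)) * ?hc (gfam F (face a \<alpha>)))"
    by (rule hom_conn_sum[OF M coh_ob coh_ob fc])
  also have "\<dots> = (\<Sum>a\<in>{1..<length \<alpha> - 1}. msign (int (a - 1)) * hfam ch x v (face a \<alpha>) i j)"
    by (rule sum.cong[OF refl]) (simp only: hfc)
  finally have 1: "(\<Sum>p<length \<alpha>. ?c p * ?hc (?gg p)) = \<dots>" .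
  have "(\<Sum>p<length \<alpha>. ?c p * ?hc (?gg p)) =
     (\<Sum>p<length \<alpha>. (\<Sum>b\<in>B. ?c p * (hfam ch x v (take (Suc p) \<alpha>) i b * gfam F (drop p \<alpha>) x b j)) +
       (\<Sum>b\<in>B. ?c p * (gfam F (take (Suc p) \<alpha>) x i b * hfam ch x v (drop p \<alpha>) b j)))"
  proof (rule sum.cong[OF refl])
    fix p assume "p \<in> {..<length \<alpha>}"
    then have p: "p < length \<alpha>" by simp
    have fB: "fib (?E (\<alpha> ! p)) x \<subseteq> B" by (rule B(2)[OF subsetD[OF \<alpha>(2) nth_mem[OF p]]])
    have h1: "hom_conn M (?E (\<alpha> ! p)) (?E (hd \<alpha>)) (gfam F (take (Suc p) \<alpha>)) ch x [v] = hfam ch x v (take (Suc p) \<alpha>)"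
      using p by (simp add: hfam_def last_take_Suc)
    have h2: "hom_conn M (?E (last \<alpha>)) (?E (\<alpha> ! p)) (gfam F (drop p \<alpha>)) ch x [v] = hfam ch x v (drop p \<alpha>)"
      using p by (simp add: hfam_def hd_drop_conv_nth)
    have "?hc (?gg p) = gmul (fib (?E (\<alpha> ! p)) x) (hfam ch x v (take (Suc p) \<alpha>)) (gfam F (drop p \<alpha>) x) i j +
       gmul (fib (?E (\<alpha> ! p)) x) (gfam F (take (Suc p) \<alpha>) x) (hfam ch x v (drop p \<alpha>)) i j"
      unfolding hom_conn_comp[OF M coh_ob coh_ob coh_ob dr[OF p] tk[OF p]] h1 h2 by simp
    then show "?c p * ?hc (?gg p) = (\<Sum>b\<in>B. ?c p * (hfam ch x v (take (Suc p) \<alpha>) i b * gfam F (drop p \<alpha>) x b j)) +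
       (\<Sum>b\<in>B. ?c p * (gfam F (take (Suc p) \<alpha>) x i b * hfam ch x v (drop p \<alpha>) b j))"
      using gmul_sum_supp[OF gfam_supp B(1) fB p] gmul_sum_supp[OF hfam_supp B(1) fB p]
      by (simp add: sum_distrib_left distrib_left)
  qed
  then show ?thesis using 1 by (simp add: sum.distrib)
qed

lemma del_tw_fam_A:
  assumes \<alpha>: "\<alpha> \<noteq> []" "set \<alpha> \<subseteq> S" and ij: "i \<in> B" "j \<in> B"
  shows "del (\<lambda>\<beta>. tw 1 (fam_A M F \<beta> ch x [v])) \<alpha> i j =
    star B (\<lambda>\<beta>. tw 1 (fam_A M F \<beta> ch x [v])) (\<lambda>\<beta>. tg (gfam F \<beta> x)) \<alpha> i j +
    star B (\<lambda>\<beta>. tg (gfam F \<beta> x)) (\<lambda>\<beta>. tw 1 (fam_A M F \<beta> ch x [v])) \<alpha> i j"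
proof -
  let ?C = "\<lambda>\<beta>. tw 1 (fam_A M F \<beta> ch x [v])" and ?H = "\<lambda>\<beta>. tg (hfam ch x v \<beta>)" and ?G = "\<lambda>\<beta>. tg (gfam F \<beta> x)"
  have "star B ?C ?G \<alpha> i j = star B (\<lambda>\<beta> i j. (-1) * ?H \<beta> i j) ?G \<alpha> i j"
    by (rule star_cong[OF _ _ ij]) (simp_all only: tw_fam_A mult_minus1 not_False_eq_True)
  moreover have "star B ?G ?C \<alpha> i j = star B ?G (\<lambda>\<beta> i j. (-1) * ?H \<beta> i j) \<alpha> i j"
    by (rule star_cong[OF _ _ ij]) (simp_all only: tw_fam_A mult_minus1 not_False_eq_True)
  moreover have "del ?C \<alpha> i j = - del ?H \<alpha> i j"
  proof -
    have "face a \<alpha> \<noteq> []" if "a \<in> {1..<length \<alpha> - 1}" for a using that by (auto simp: face_def)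
    then show ?thesis unfolding del_def sum_negf[symmetric]
      by (intro sum.cong refl) (simp add: tw_fam_A)
  qed
  moreover have "del ?H \<alpha> i j = star B ?H ?G \<alpha> i j + star B ?G ?H \<alpha> i j"
    unfolding del_tg[OF hfam_homog \<alpha>(1)] star_tg[OF hfam_homog gfam_homog \<alpha>(1)] star_tg[OF gfam_homog hfam_homog \<alpha>(1)]
      distrib_left[symmetric] hfam_rel[OF \<alpha>] by (rule refl)
  moreover have "star B (\<lambda>\<beta> i j. (-1) * ?H \<beta> i j) ?G \<alpha> i j = (-1) * star B ?H ?G \<alpha> i j"
    by (rule star_scale_left)
  moreover have "star B ?G (\<lambda>\<beta> i j. (-1) * ?H \<beta> i j) \<alpha> i j = (-1) * star B ?G ?H \<alpha> i j"
    by (rule star_scale_right)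
  ultimately show ?thesis by (simp only: minus_add_distrib mult_minus1)
qed

end

lemma Tr_face_sum:
  assumes len: "length \<sigma> = m + 2" "length vs = m"
  shows "(\<Sum>a<m + 2. msign (int a) * Tr F (fam_power (ob_of F) (fam_A M F) m) (face a \<sigma>) ch x vs) = 0"
proof -
  let ?\<Phi> = "\<lambda>k. fib (ob_of F k) x"
  define B where "B = (\<Union>k\<in>set \<sigma>. ?\<Phi> k)"
  have B: "finite B" "\<And>k. k \<in> set \<sigma> \<Longrightarrow> ?\<Phi> k \<subseteq> B"
    unfolding B_def using finite_fib[OF perf_ob_bundle[OF coh_ob]] by auto
  let ?C = "\<lambda>v \<beta>. tw 1 (fam_A M F \<beta> ch x [v])" and ?G = "\<lambda>\<beta>. tg (gfam F \<beta> x)"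
  let ?Q = "Qp B ?C (unit_family ?\<Phi>) m vs"
  have hC: "homog 1 (?C v)" for v by (simp only: homog_tw fam_A_homog)
  have sC: "supp ?\<Phi> (?C v)" for v by (simp only: supp_tw fam_A_supp)
  have hG: "homog 1 ?G" by (simp only: homog_tg gfam_homog)
  have sG: "supp ?\<Phi> ?G" by (simp only: supp_tg gfam_supp)
  have hQ: "homog (int m) ?Q" by (rule homog_Qp[OF hC homog_unit_family])
  have sQ: "supp ?\<Phi> ?Q" by (rule supp_Qp[OF sC supp_unit_family])
  have closed: "(\<Sum>a<m + 2. msign (int a) * ttr B (int m) ?Q ?G (face a \<sigma>)) = 0"
  proof (rule ttr_closed[OF B(1) len(1) hG hQ])
    fix \<alpha> :: "nat list" and i j assume \<alpha>: "\<alpha> \<noteq> []" "set \<alpha> \<subseteq> set \<sigma>" and ij: "i \<in> B" "j \<in> B"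
    show "del ?G \<alpha> i j = star B ?G ?G \<alpha> i j" by (rule maurer_cartan[OF B \<alpha>])
    \<comment> \<open>Start of the induction over powers: both products with the unit give
      \<open>G\<close>, and the unit vanishes on the inner faces, which are not 0-simplices.\<close>
    have e: "del (unit_family ?\<Phi>) \<beta> i j = star B ?G (unit_family ?\<Phi>) \<beta> i j - star B (unit_family ?\<Phi>) ?G \<beta> i j"
      if "\<beta> \<noteq> []" "set \<beta> \<subseteq> set \<sigma>" for \<beta> i j
      using that B by (subst star_unit_right[OF sG B(1)], blast, simp, subst star_unit_left[OF sG B(1)], blast, simp)
        (simp add: del_unit_family)
    show "del ?Q \<alpha> i j = star B ?G ?Q \<alpha> i j - msign (int m) * star B ?Q ?G \<alpha> i j"
      by (rule del_Qp[OF hC \<alpha> ij]) (rule del_tw_fam_A[OF B], assumption+, rule e, assumption+)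
  qed
  have "Tr F (fam_power (ob_of F) (fam_A M F) m) (face a \<sigma>) ch x vs = ttr B (int m) ?Q ?G (face a \<sigma>)"
    if a: "a < m + 2" for a
  proof -
    have la: "length (face a \<sigma>) = Suc m" using a len by (simp add: length_face)
    have sa: "set (face a \<sigma>) \<subseteq> set \<sigma>" by (auto simp: face_def dest: in_set_takeD in_set_dropD)
    \<comment> \<open>The power agrees with \<open>?Q\<close> only where \<open>B\<close> contains
      the fibres, that is on sequences in \<open>\<sigma>\<close>. Cut off elsewhere, it becomes
      homogeneous and supported on all sequences, and \<open>Tr\<close> does not see the change
      because it uses segments only.\<close>
    define f where "f = (\<lambda>\<beta> ch x vs. if set \<beta> \<subseteq> set \<sigma> then fam_power (ob_of F) (fam_A M F) m \<beta> ch x vs else 0)"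
    have twf: "tw (int m) (fam_power (ob_of F) (fam_A M F) m \<beta> ch x vs) = ?Q \<beta>" if "set \<beta> \<subseteq> set \<sigma>" for \<beta>
      using that B by (intro ext fam_power_twist[OF fam_A_one_form fam_A_homog fam_A_supp B(1) _ len(2)]) auto
    have f0: "?Q \<beta> i j \<noteq> 0" if "f \<beta> ch x vs i j \<noteq> 0" for \<beta> i j
      using that twf[of \<beta>, THEN fun_cong, THEN fun_cong, of i j]
      by (auto simp: f_def tw_def msign_def split: if_splits)
    have hf: "homog (int m) (\<lambda>\<beta>. f \<beta> ch x vs)" using hQ f0 unfolding homog_def by blast
    have sf: "supp ?\<Phi> (\<lambda>\<beta>. f \<beta> ch x vs)" using sQ f0 unfolding supp_def by blast
    have segs: "set (seg k l (face a \<sigma>)) \<subseteq> set \<sigma>" for k l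
      using sa by (auto simp: seg_def dest!: in_set_takeD in_set_dropD)
    have "Tr F (fam_power (ob_of F) (fam_A M F) m) (face a \<sigma>) ch x vs = Tr F f (face a \<sigma>) ch x vs"
    proof -
      have "take (l + 1 - k) (drop k (face a \<sigma>)) = seg k l (face a \<sigma>)" for k l by (simp add: seg_def)
      then show ?thesis unfolding Tr_def Let_def using segs by (simp add: f_def fcomp_zero_form gtr_def)
    qed
    also have "\<dots> = ttr B (int m) (\<lambda>\<beta>. tw (int m) (f \<beta> ch x vs)) (\<lambda>\<beta>. tg (mor_of F \<beta> x)) (face a \<sigma>)"
      by (rule Tr_eq_ttr[where f = f and ch = ch and x = x and vs = vs, OF hf sf B(1) _ len(2) la]) (use B sa in blast)
    \<comment> \<open>The trace contains \<open>g\<close> whereas the relation holds for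
      \<open>d + g\<close>. Arcs have at least two entries, and there both agree.\<close>
    also have "\<dots> = ttr B (int m) ?Q ?G (face a \<sigma>)"
      by (rule ttr_cong) (use segs twf in \<open>auto simp: f_def gfam_eq_mor length_rot\<close>)
    finally show ?thesis .
  qed
  then show ?thesis using closed by simp
qed

end

section \<open>Alternating forms\<close>

lemma alt_multilinearD:
  assumes "alt_multilinear H k \<omega>"
  shows "\<omega> vs \<noteq> 0 \<Longrightarrow> length vs = k \<and> set vs \<subseteq> H"
    and "length us + 1 + length ws = k \<Longrightarrow> set us \<subseteq> H \<Longrightarrow> set ws \<subseteq> H \<Longrightarrow> v \<in> H \<Longrightarrow> w \<in> H \<Longrightarrow>
        \<omega> (us @ [a *s v + w] @ ws) = a * \<omega> (us @ [v] @ ws) + \<omega> (us @ [w] @ ws)"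
    and "\<not> distinct vs \<Longrightarrow> \<omega> vs = 0"
  using assms unfolding alt_multilinear_def by blast+

lemma alt_multilinear_cmult:
  assumes "alt_multilinear H k f"
  shows "alt_multilinear H k (\<lambda>vs. c * f vs)"
  unfolding alt_multilinear_def
proof (intro conjI allI impI; (elim conjE)?)
  show "length vs = k" "set vs \<subseteq> H" if "c * f vs \<noteq> 0" for vs using alt_multilinearD(1)[OF assms, of vs] that by auto
  show "c * f (us @ [a *s v + w] @ ws) = a * (c * f (us @ [v] @ ws)) + c * f (us @ [w] @ ws)"
    if "length us + 1 + length ws = k" "set us \<subseteq> H" "set ws \<subseteq> H" "v \<in> H" "w \<in> H" for us ws a v w
    unfolding alt_multilinearD(2)[OF assms that] by (simp add: algebra_simps)
  show "c * f vs = 0" if "\<not> distinct vs" for vs using alt_multilinearD(3)[OF assms that] by simp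
qed

lemma alt_multilinear_sum:
  assumes "\<And>a. a \<in> S \<Longrightarrow> alt_multilinear H k (f a)"
  shows "alt_multilinear H k (\<lambda>vs. \<Sum>a\<in>S. f a vs)"
  unfolding alt_multilinear_def
proof (intro conjI allI impI; (elim conjE)?)
  fix vs assume "(\<Sum>a\<in>S. f a vs) \<noteq> 0"
  then obtain a where "a \<in> S" "f a vs \<noteq> 0" by (rule sum.not_neutral_contains_not_neutral)
  then show "length vs = k" "set vs \<subseteq> H" using alt_multilinearD(1)[OF assms] by blast+
next
  fix us ws a v w assume *: "length us + 1 + length ws = k" "set us \<subseteq> H" "set ws \<subseteq> H" "v \<in> H" "w \<in> H"
  have "(\<Sum>e\<in>S. f e (us @ [a *s v + w] @ ws)) = (\<Sum>e\<in>S. a * f e (us @ [v] @ ws) + f e (us @ [w] @ ws))"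
    by (rule sum.cong[OF refl]) (rule alt_multilinearD(2)[OF assms *])
  then show "(\<Sum>e\<in>S. f e (us @ [a *s v + w] @ ws)) = a * (\<Sum>e\<in>S. f e (us @ [v] @ ws)) + (\<Sum>e\<in>S. f e (us @ [w] @ ws))"
    by (simp only: sum.distrib sum_distrib_left)
next
  fix vs :: "(complex ^ 'b) list" assume "\<not> distinct vs"
  then show "(\<Sum>a\<in>S. f a vs) = 0" using alt_multilinearD(3)[OF assms] by (intro sum.neutral) blast
qed

text \<open>Polarisation: expand the value with \<open>v + w\<close> in both places, which is
  0.\<close>

lemma alt_swap:
  assumes H: "vec.subspace H" and f: "alt_multilinear H k f"
    and k: "length us + 2 + length ws = k" and sub: "set us \<subseteq> H" "set ws \<subseteq> H" "v \<in> H" "w \<in> H"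
  shows "f (us @ [v, w] @ ws) = - f (us @ [w, v] @ ws)"
proof -
  have vw: "1 *s v + w \<in> H" using H sub by (auto intro: vec.subspace_add)
  have e1: "f (us @ [1 *s v + w] @ ([1 *s v + w] @ ws)) = 1 * f (us @ [v] @ ([1 *s v + w] @ ws)) + f (us @ [w] @ ([1 *s v + w] @ ws))"
    by (rule alt_multilinearD(2)[OF f]) (use k sub vw in auto)
  have e2: "f ((us @ [z]) @ [1 *s v + w] @ ws) = 1 * f ((us @ [z]) @ [v] @ ws) + f ((us @ [z]) @ [w] @ ws)" if "z \<in> H" for z
    by (rule alt_multilinearD(2)[OF f]) (use k sub that in auto)
  have "f (us @ [1 *s v + w] @ ([1 *s v + w] @ ws)) = 0" "f ((us @ [v]) @ [v] @ ws) = 0" "f ((us @ [w]) @ [w] @ ws) = 0"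
    by (rule alt_multilinearD(3)[OF f], simp)+
  then show ?thesis using e1 e2[OF sub(3)] e2[OF sub(4)] by (simp add: eq_neg_iff_add_eq_0)
qed

lemma alt_move:
  assumes H: "vec.subspace H" and f: "alt_multilinear H k f"
    and "length us + length ms + 1 + length ws = k" "set us \<subseteq> H" "set ms \<subseteq> H" "set ws \<subseteq> H" "v \<in> H"
  shows "f (us @ ms @ [v] @ ws) = msign (int (length ms)) * f (us @ [v] @ ms @ ws)"
  using assms(3-)
proof (induction ms arbitrary: us)
  case (Cons m ms)
  have "f ((us @ [m]) @ ms @ [v] @ ws) = msign (int (length ms)) * f ((us @ [m]) @ [v] @ ms @ ws)"
    by (rule Cons.IH) (use Cons.prems in auto)
  moreover have "f (us @ [m, v] @ (ms @ ws)) = - f (us @ [v, m] @ (ms @ ws))"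
    by (rule alt_swap[OF H f]) (use Cons.prems in auto)
  ultimately show ?case by (simp add: msign_add)
qed simp

lemma set_face: "a < length vs \<Longrightarrow> set vs = insert (vs ! a) (set (face a vs))"
  by (subst id_take_nth_drop[of a vs]) (auto simp: face_def)

text \<open>If a vector stands at positions \<open>p < q\<close>, only the terms that hand one of
  its two copies to \<open>L\<close> survive. Their remaining arguments differ by moving the other
  copy past the \<open>q - p - 1\<close> vectors in between, and this sign is opposite to the
  quotient of the position signs.\<close>

lemma alt_wedge:
  assumes H: "vec.subspace H" and f: "alt_multilinear H m f"
    and L: "\<And>v. L v \<noteq> 0 \<Longrightarrow> v \<in> H" "\<And>a v w. v \<in> H \<Longrightarrow> w \<in> H \<Longrightarrow> L (a *s v + w) = a * L v + L w"
  shows "alt_multilinear H (Suc m) (\<lambda>vs. if length vs = Suc m then \<Sum>a<Suc m. msign (int a) * (L (vs ! a) * f (face a vs)) else 0)"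
    (is "alt_multilinear H (Suc m) ?W")
proof -
  have nz: "length vs = Suc m \<and> set vs \<subseteq> H" if "?W vs \<noteq> 0" for vs
  proof -
    have len: "length vs = Suc m" using that by (auto split: if_splits)
    then have "(\<Sum>a<Suc m. msign (int a) * (L (vs ! a) * f (face a vs))) \<noteq> 0" using that by simp
    then obtain a where a: "a \<in> {..<Suc m}" "msign (int a) * (L (vs ! a) * f (face a vs)) \<noteq> 0"
      by (rule sum.not_neutral_contains_not_neutral)
    then have "vs ! a \<in> H" "set (face a vs) \<subseteq> H" using L(1) alt_multilinearD(1)[OF f] by auto
    then show ?thesis using set_face[of a vs] a len by auto
  qed
  show ?thesis
    unfolding alt_multilinear_def
  proof (intro conjI allI impI; (elim conjE)?)
    show "length vs = Suc m" "set vs \<subseteq> H" if "?W vs \<noteq> 0" for vs using nz[OF that] by auto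
  next
    fix us ws c v w assume len: "length us + 1 + length ws = Suc m" and sub: "set us \<subseteq> H" "set ws \<subseteq> H" "v \<in> H" "w \<in> H"
    let ?t = "\<lambda>a z. msign (int a) * (L ((us @ [z] @ ws) ! a) * f (face a (us @ [z] @ ws)))"
    have t: "?t a (c *s v + w) = c * ?t a v + ?t a w" if a: "a < Suc m" for a
    proof -
      consider "a < length us" | "a = length us" | b where "a = length us + Suc b" "b < length ws"
      proof -
        have "a = length us + Suc (a - Suc (length us))" "a - Suc (length us) < length ws" if "length us < a"
          using that a len by auto
        then show ?thesis using that by (metis linorder_neqE_nat)
      qed
      then show ?thesis
      proof cases
        case 1
        have "f (face a us @ [c *s v + w] @ ws) = c * f (face a us @ [v] @ ws) + f (face a us @ [w] @ ws)"
        proof (rule alt_multilinearD(2)[OF f])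
          show "length (face a us) + 1 + length ws = m" using 1 len by (simp add: length_face)
          show "set (face a us) \<subseteq> H" using sub(1) set_face[OF 1] by auto
        qed (use sub in auto)
        then show ?thesis using 1 by (simp add: face_append1 nth_append algebra_simps)
      next
        case 2
        have "face a (us @ [z] @ ws) = us @ ws" for z
          using 2 by (simp add: face_def)
        then show ?thesis using 2 L(2)[OF sub(3,4)] by (simp add: algebra_simps)
      next
        case 3
        have "f (us @ [c *s v + w] @ face b ws) = c * f (us @ [v] @ face b ws) + f (us @ [w] @ face b ws)"
        proof (rule alt_multilinearD(2)[OF f])
          show "length us + 1 + length (face b ws) = m" using 3 len by (simp add: length_face)
          show "set (face b ws) \<subseteq> H" using sub(2) set_face[OF 3(2)] by auto
        qed (use sub in auto)
        moreover have "face a (us @ [z] @ ws) = us @ [z] @ face b ws" for z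
          unfolding 3(1) face_append2 by (simp add: face_def)
        moreover have "(us @ [z] @ ws) ! a = ws ! b" for z using 3 by (simp add: nth_append)
        ultimately show ?thesis by (simp add: algebra_simps)
      qed
    qed
    have "length (us @ [z] @ ws) = Suc m" for z using len by simp
    then have W: "?W (us @ [z] @ ws) = (\<Sum>a<Suc m. ?t a z)" for z by (simp only: if_True simp_thms)
    have S: "(\<Sum>a<Suc m. ?t a (c *s v + w)) = c * (\<Sum>a<Suc m. ?t a v) + (\<Sum>a<Suc m. ?t a w)"
      unfolding sum_distrib_left sum.distrib[symmetric] by (rule sum.cong[OF refl]) (rule t, simp)
    show "?W (us @ [c *s v + w] @ ws) = c * ?W (us @ [v] @ ws) + ?W (us @ [w] @ ws)"
      unfolding W by (rule S)
  next
    fix vs :: "(complex ^ 'a) list" assume nd: "\<not> distinct vs"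
    show "?W vs = 0"
    proof (rule ccontr)
      assume "?W vs \<noteq> 0"
      then have len: "length vs = Suc m" and sub: "set vs \<subseteq> H" using nz by blast+
      obtain us v ms ws where vs: "vs = us @ [v] @ ms @ [v] @ ws" using not_distinct_decomp[OF nd] by blast
      define p q where "p = length us" and "q = length us + Suc (length ms)"
      let ?t = "\<lambda>a. msign (int a) * (L (vs ! a) * f (face a vs))"
      have "?W vs = (\<Sum>a<Suc m. ?t a)" using len by simp
      also have "\<dots> = (\<Sum>a\<in>{p, q}. ?t a)"
      proof (rule sum.mono_neutral_right)
        show "{p, q} \<subseteq> {..<Suc m}" using len by (auto simp: vs p_def q_def)
        show "\<forall>a\<in>{..<Suc m} - {p, q}. ?t a = 0"
        proof
          fix a assume a: "a \<in> {..<Suc m} - {p, q}"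
          have "\<not> distinct (face a vs)"
          proof -
            have pq: "p < q" "q < length vs" "vs ! p = vs ! q"
              by (auto simp: vs p_def q_def nth_append)
            let ?s = "\<lambda>x. if x < a then x else x - 1"
            have av: "a < length vs" "a \<noteq> p" "a \<noteq> q" using a len by auto
            have fp: "face a vs ! ?s p = vs ! p" using av pq by (subst nth_face) auto
            have fq: "face a vs ! ?s q = vs ! q" using av pq by (subst nth_face) auto
            have "?s p < ?s q" "?s q < length (face a vs)" using av pq by (auto simp: length_face)
            then show ?thesis using fp fq pq(3) by (metis distinct_conv_nth order_less_trans less_irrefl)
          qed
          then show "?t a = 0" using alt_multilinearD(3)[OF f] by simp
        qed
      qed simp
      also have "\<dots> = ?t p + ?t q" by (simp add: p_def q_def)
      also have "\<dots> = 0"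
      proof -
        have fp: "face p vs = us @ ms @ [v] @ ws" by (simp add: vs p_def face_def)
        have fq: "face q vs = us @ [v] @ ms @ ws"
          using face_append2[of "us @ [v] @ ms" 0 "[v] @ ws"] by (simp add: vs q_def face_def)
        have n: "vs ! p = v" "vs ! q = v" by (auto simp: vs p_def q_def nth_append)
        have "f (us @ ms @ [v] @ ws) = msign (int (length ms)) * f (us @ [v] @ ms @ ws)"
          by (rule alt_move[OF H f]) (use len sub in \<open>auto simp: vs\<close>)
        then show ?thesis unfolding fp fq n by (simp add: p_def q_def msign_add)
      qed
      finally show False using \<open>?W vs \<noteq> 0\<close> by simp
    qed
  qed
qed

text \<open>Each entry of the product is a combination of wedge products of an entry of the 1-form
  with an entry of the lower power, so \<open>alt_wedge\<close> applies entry by entry. The Koszul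
  signs depend on the entries and are constants here.\<close>

lemma alt_fam_power:
  assumes H: "vec.subspace H" and A: "\<forall>\<beta> us. length us \<noteq> 1 \<longrightarrow> A \<beta> ch x us = 0"
    and L: "\<And>\<beta> v i j. A \<beta> ch x [v] i j \<noteq> 0 \<Longrightarrow> v \<in> H"
      "\<And>\<beta> a v w i j. \<beta> \<noteq> [] \<Longrightarrow> v \<in> H \<Longrightarrow> w \<in> H \<Longrightarrow> A \<beta> ch x [a *s v + w] i j = a * A \<beta> ch x [v] i j + A \<beta> ch x [w] i j"
  shows "alt_multilinear H m (\<lambda>vs. fam_power E A m \<alpha> ch x vs i j)"
proof (induction m arbitrary: \<alpha> i j)
  case 0
  show ?case by (auto simp: alt_multilinear_def fam_one_def zero_fun_def)
next
  case (Suc m)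
  let ?W = "\<lambda>p b vs. if length vs = Suc m then \<Sum>a<Suc m. msign (int a) * (A (take (Suc p) \<alpha>) ch x [vs ! a] i b * fam_power E A m (drop p \<alpha>) ch x (face a vs) b j) else 0"
  let ?c = "\<lambda>p b. msign ((fst i - fst b) * int m) * msign ((1 + (fst i - fst b)) * int (length \<alpha> - 1 - p))"
  have "fam_power E A (Suc m) \<alpha> ch x vs i j = (\<Sum>p<length \<alpha>. \<Sum>b\<in>fib (E (\<alpha> ! p)) x. ?c p b * ?W p b vs)" for vs
  proof (cases "length vs = Suc m")
    case True
    have "fam_power E A (Suc m) \<alpha> ch x vs i j = (\<Sum>p<length \<alpha>. \<Sum>a<Suc m. \<Sum>b\<in>fib (E (\<alpha> ! p)) x. ?c p b * (msign (int a) * (A (take (Suc p) \<alpha>) ch x [vs ! a] i b * fam_power E A m (drop p \<alpha>) ch x (face a vs) b j)))"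
      unfolding fam_power_Suc_entry[of A ch x, OF A] True by (simp add: mult_ac)
    also have "\<dots> = (\<Sum>p<length \<alpha>. \<Sum>b\<in>fib (E (\<alpha> ! p)) x. \<Sum>a<Suc m. ?c p b * (msign (int a) * (A (take (Suc p) \<alpha>) ch x [vs ! a] i b * fam_power E A m (drop p \<alpha>) ch x (face a vs) b j)))"
      by (rule sum.cong[OF refl], rule sum.swap)
    finally show ?thesis using True by (simp only: sum_distrib_left if_True simp_thms)
  next
    case False
    then show ?thesis by (simp add: fam_power_length[of A ch x, OF A] del: fam_power.simps)
  qed
  moreover have "alt_multilinear H (Suc m) (\<lambda>vs. \<Sum>p<length \<alpha>. \<Sum>b\<in>fib (E (\<alpha> ! p)) x. ?c p b * ?W p b vs)"
  proof (intro alt_multilinear_sum alt_multilinear_cmult alt_wedge[OF H Suc.IH])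
    fix p v b assume "p \<in> {..<length \<alpha>}"
    then have ne: "take (Suc p) \<alpha> \<noteq> []" by auto
    show "A (take (Suc p) \<alpha>) ch x [v] i b \<noteq> 0 \<Longrightarrow> v \<in> H" by (rule L(1))
    show "\<And>a w. v \<in> H \<Longrightarrow> w \<in> H \<Longrightarrow> A (take (Suc p) \<alpha>) ch x [a *s v + w] i b = a * A (take (Suc p) \<alpha>) ch x [v] i b + A (take (Suc p) \<alpha>) ch x [w] i b"
      by (rule L(2)[OF ne])
  qed
  ultimately show ?case by (simp only:)
qed

lemma Tr_expand:
  assumes "\<forall>\<beta> us. length us \<noteq> m \<longrightarrow> f \<beta> ch x us = 0"
  shows "Tr F f \<sigma> ch x vs = (\<Sum>l\<le>length \<sigma> - 1. \<Sum>k\<le>l. msign ((int k + 1) * int (length \<sigma> - 1) + int l - int k) *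
     (\<Sum>j\<in>fib (ob_of F (\<sigma> ! l)) x. \<Sum>i\<in>fib (ob_of F (\<sigma> ! k)) x.
        msign (fst j) * msign ((fst j - fst i) * int m) * mor_of F (rot k l \<sigma>) x j i * f (seg k l \<sigma>) ch x vs i j))"
proof (cases "length vs = m")
  case True
  show ?thesis unfolding Tr_def Let_def gtr_def fcomp_zero_form rot_def seg_def Suc_eq_plus1
    using True by (simp add: sum_distrib_left mult.assoc)
next
  case False
  then have "f \<beta> ch x vs = 0" for \<beta> using assms by blast
  then show ?thesis unfolding Tr_def Let_def gtr_def fcomp_zero_form by simp
qed

lemma alt_Tr:
  assumes f: "\<And>\<beta> i j. alt_multilinear H m (\<lambda>vs. f \<beta> ch x vs i j)"
  shows "alt_multilinear H m (Tr F f \<sigma> ch x)"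
proof -
  have f0: "f \<beta> ch x us = 0" if "length us \<noteq> m" for \<beta> us
  proof (intro ext)
    fix i j show "f \<beta> ch x us i j = 0 i j"
      using alt_multilinearD(1)[OF f[of \<beta> i j], of us] that by auto
  qed
  then have "Tr F f \<sigma> ch x = (\<lambda>vs. \<Sum>l\<le>length \<sigma> - 1. \<Sum>k\<le>l. msign ((int k + 1) * int (length \<sigma> - 1) + int l - int k) *
     (\<Sum>j\<in>fib (ob_of F (\<sigma> ! l)) x. \<Sum>i\<in>fib (ob_of F (\<sigma> ! k)) x.
        msign (fst j) * msign ((fst j - fst i) * int m) * mor_of F (rot k l \<sigma>) x j i * f (seg k l \<sigma>) ch x vs i j))"
    by (intro ext) (rule Tr_expand, blast intro: f0)
  then show ?thesis by (simp only:) (intro alt_multilinear_sum alt_multilinear_cmult f)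
qed

section \<open>Transport of powers and traces\<close>

text \<open>One statement for several uses: \<open>J\<close> is the differential for a change of
  chart or a pullback, and \<open>\<phi>\<close> is the map of vertices for a simplicial operator.
  The comparison is needed on \<open>S\<close> and \<open>V\<close> only.\<close>

lemma fam_power_map:
  assumes A: "\<forall>\<beta> us. length us \<noteq> 1 \<longrightarrow> A \<beta> ch x us = 0" "\<forall>\<beta> us. length us \<noteq> 1 \<longrightarrow> A' \<beta> ch' x' us = 0"
    and eq: "\<And>\<beta> v. \<beta> \<noteq> [] \<Longrightarrow> set \<beta> \<subseteq> S \<Longrightarrow> v \<in> V \<Longrightarrow> A \<beta> ch x [v] = A' (map \<phi> \<beta>) ch' x' [J v]"
    and fib: "\<And>k. k \<in> S \<Longrightarrow> fib (E k) x = fib (E' (\<phi> k)) x'"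
    and S: "set \<alpha> \<subseteq> S" and V: "set vs \<subseteq> V"
  shows "fam_power E A m \<alpha> ch x vs = fam_power E' A' m (map \<phi> \<alpha>) ch' x' (map J vs)"
  using S V
proof (induction m arbitrary: \<alpha> vs)
  case 0
  show ?case using 0 fib by (cases \<alpha>) (auto simp: fam_one_def)
next
  case (Suc m)
  show ?case
  proof (intro ext)
    fix i j
    have "fam_power E A (Suc m) \<alpha> ch x vs i j =
      (\<Sum>p<length \<alpha>. \<Sum>a<length vs. \<Sum>b\<in>fib (E' (\<phi> (\<alpha> ! p))) x'.
       msign (int a) * msign ((fst i - fst b) * int (length vs - 1)) *
       (msign ((1 + (fst i - fst b)) * int (length \<alpha> - 1 - p)) * A' (map \<phi> (take (Suc p) \<alpha>)) ch' x' [J (vs ! a)] i b) *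
       fam_power E' A' m (map \<phi> (drop p \<alpha>)) ch' x' (map J (face a vs)) b j)"
      unfolding fam_power_Suc_entry[of A ch x, OF A(1)]
    proof (rule sum.cong[OF refl], rule sum.cong[OF refl], rule sum.cong)
      fix p a assume p: "p \<in> {..<length \<alpha>}" and a: "a \<in> {..<length vs}"
      have "\<alpha> ! p \<in> set \<alpha>" using p by (intro nth_mem) simp
      then show "fib (E (\<alpha> ! p)) x = fib (E' (\<phi> (\<alpha> ! p))) x'" by (intro fib subsetD[OF Suc.prems(1)])
      fix b
      have t: "take (Suc p) \<alpha> \<noteq> []" "set (take (Suc p) \<alpha>) \<subseteq> S" "set (drop p \<alpha>) \<subseteq> S"
        using p Suc.prems(1) by (auto dest: in_set_takeD in_set_dropD)
      have v: "vs ! a \<in> V" "set (face a vs) \<subseteq> V" using set_face[of a vs] a Suc.prems(2) by auto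
      show "msign (int a) * msign ((fst i - fst b) * int (length vs - 1)) *
       (msign ((1 + (fst i - fst b)) * int (length \<alpha> - 1 - p)) * A (take (Suc p) \<alpha>) ch x [vs ! a] i b) *
       fam_power E A m (drop p \<alpha>) ch x (face a vs) b j = 
       msign (int a) * msign ((fst i - fst b) * int (length vs - 1)) *
       (msign ((1 + (fst i - fst b)) * int (length \<alpha> - 1 - p)) * A' (map \<phi> (take (Suc p) \<alpha>)) ch' x' [J (vs ! a)] i b) *
       fam_power E' A' m (map \<phi> (drop p \<alpha>)) ch' x' (map J (face a vs)) b j"
        unfolding eq[OF t(1,2) v(1)] Suc.IH[OF t(3) v(2)] ..
    qed
    also have "\<dots> = fam_power E' A' (Suc m) (map \<phi> \<alpha>) ch' x' (map J vs) i j"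
      unfolding fam_power_Suc_entry[of A' ch' x', OF A(2)] length_map
      by (intro sum.cong refl) (simp_all add: take_map drop_map map_face)
    finally show "fam_power E A (Suc m) \<alpha> ch x vs i j = fam_power E' A' (Suc m) (map \<phi> \<alpha>) ch' x' (map J vs) i j" .
  qed
qed

lemma seg_subset: "set (seg k l \<sigma>) \<subseteq> set \<sigma>"
  by (auto simp: seg_def dest!: in_set_takeD in_set_dropD)

lemma rot_subset: "set (rot k l \<sigma>) \<subseteq> set \<sigma>"
  by (auto simp: rot_def dest!: in_set_takeD in_set_dropD)

lemma map_seg: "map \<phi> (seg k l \<sigma>) = seg k l (map \<phi> \<sigma>)"
  by (simp add: seg_def take_map drop_map)

lemma map_rot: "map \<phi> (rot k l \<sigma>) = rot k l (map \<phi> \<sigma>)"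
  by (simp add: rot_def take_map drop_map)

lemma Tr_map:
  assumes f0: "\<forall>\<beta> us. length us \<noteq> m \<longrightarrow> f \<beta> ch x us = 0" "\<forall>\<beta> us. length us \<noteq> m \<longrightarrow> f' \<beta> ch' x' us = 0"
    and mor: "\<And>\<beta>. set \<beta> \<subseteq> set \<sigma> \<Longrightarrow> mor_of F \<beta> x = mor_of F' (map \<phi> \<beta>) x'"
    and f: "\<And>\<beta>. set \<beta> \<subseteq> set \<sigma> \<Longrightarrow> f \<beta> ch x vs = f' (map \<phi> \<beta>) ch' x' (map J vs)"
    and fib: "\<And>k. k \<in> set \<sigma> \<Longrightarrow> fib (ob_of F k) x = fib (ob_of F' (\<phi> k)) x'"
    and \<sigma>: "\<sigma> \<noteq> []"
  shows "Tr F f \<sigma> ch x vs = Tr F' f' (map \<phi> \<sigma>) ch' x' (map J vs)"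
proof -
  have fib': "fib (ob_of F (\<sigma> ! k)) x = fib (ob_of F' (map \<phi> \<sigma> ! k)) x'" if "k \<le> length \<sigma> - 1" for k
  proof -
    have k: "k < length \<sigma>" using that \<sigma> by (cases \<sigma>) auto
    show ?thesis unfolding nth_map[OF k] by (rule fib[OF nth_mem[OF k]])
  qed
  have 1: "mor_of F (rot k l \<sigma>) x = mor_of F' (rot k l (map \<phi> \<sigma>)) x'" for k l
    unfolding map_rot[symmetric] by (rule mor[OF rot_subset])
  have 2: "f (seg k l \<sigma>) ch x vs = f' (seg k l (map \<phi> \<sigma>)) ch' x' (map J vs)" for k l
    unfolding map_seg[symmetric] by (rule f[OF seg_subset])
  show ?thesis
    unfolding Tr_expand[of m f ch x, OF f0(1)] Tr_expand[of m f' ch' x', OF f0(2)] length_map 1 2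
    by (rule sum.cong[OF refl], rule sum.cong[OF refl]) (simp add: fib')
qed

section \<open>Holomorphy of the traces\<close>

text \<open>The Koszul sign of passing a matrix across something of degree \<open>t\<close>. It
  depends on the degree of the entry alone, hence commutes with trivialisations, which have degree
  0.\<close>

definition tws :: "int \<Rightarrow> gmat \<Rightarrow> gmat" where
  "tws t X = (\<lambda>i j. msign ((fst i - fst j) * t) * X i j)"

lemma tws_gmats: "X \<in> gmats C B q \<Longrightarrow> tws t X \<in> gmats C B q"
  by (simp add: gmats_def tws_def msign_def)

lemma gmats_scale: "X \<in> gmats C B q \<Longrightarrow> (\<lambda>i j. c * X i j) \<in> gmats C B q"
  unfolding gmats_def mem_Collect_eq by (metis mult_zero_right)

lemma gmats_sum:
  assumes "\<And>a. a \<in> S \<Longrightarrow> X a \<in> gmats C B q"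
  shows "(\<lambda>i j. \<Sum>a\<in>S. X a i j) \<in> gmats C B q"
  unfolding gmats_def mem_Collect_eq
proof (intro allI impI)
  fix i j assume "(\<Sum>a\<in>S. X a i j) \<noteq> 0"
  then obtain a where "a \<in> S" "X a i j \<noteq> 0" by (rule sum.not_neutral_contains_not_neutral)
  then show "i \<in> C \<and> j \<in> B \<and> fst i = fst j + q" using gmatsD[OF assms] by blast
qed

text \<open>The signs are pulled into the left factor, so that the recursion consists of genuine
  matrix products and each can be rewritten in trivialisations by \<open>loc_comp\<close>.\<close>

lemma fam_power_gmul:
  assumes A: "\<forall>\<beta> us. length us \<noteq> 1 \<longrightarrow> A \<beta> ch x us = 0" and len: "length vs = Suc m"
  shows "fam_power E A (Suc m) \<alpha> ch x vs = (\<lambda>i j. \<Sum>p<length \<alpha>. \<Sum>a<Suc m.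
     msign (int a) * msign (int (length \<alpha> - 1 - p)) *
     gmul (fib (E (\<alpha> ! p)) x) (tws (int m + int (length \<alpha> - 1 - p)) (A (take (Suc p) \<alpha>) ch x [vs ! a]))
       (fam_power E A m (drop p \<alpha>) ch x (face a vs)) i j)"
proof (intro ext)
  fix i j
  show "fam_power E A (Suc m) \<alpha> ch x vs i j = (\<Sum>p<length \<alpha>. \<Sum>a<Suc m.
     msign (int a) * msign (int (length \<alpha> - 1 - p)) *
     gmul (fib (E (\<alpha> ! p)) x) (tws (int m + int (length \<alpha> - 1 - p)) (A (take (Suc p) \<alpha>) ch x [vs ! a]))
       (fam_power E A m (drop p \<alpha>) ch x (face a vs)) i j)"
    unfolding fam_power_Suc_entry[of A ch x, OF A] len gmul_def sum_distrib_left tws_def diff_Suc_1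
  proof (rule sum.cong[OF refl], rule sum.cong[OF refl], rule sum.cong[OF refl])
    fix p a and b :: "int \<times> nat"
    have "msign ((fst i - fst b) * int m) * msign ((1 + (fst i - fst b)) * int (length \<alpha> - 1 - p)) =
      msign (int (length \<alpha> - 1 - p)) * msign ((fst i - fst b) * (int m + int (length \<alpha> - 1 - p)))"
      unfolding msign_add[symmetric] by (rule arg_cong[of _ _ msign]) (simp add: algebra_simps)
    then show "msign (int a) * msign ((fst i - fst b) * int m) *
       (msign ((1 + (fst i - fst b)) * int (length \<alpha> - 1 - p)) * A (take (Suc p) \<alpha>) ch x [vs ! a] i b) *
       fam_power E A m (drop p \<alpha>) ch x (face a vs) b j =
       msign (int a) * msign (int (length \<alpha> - 1 - p)) *
       (msign ((fst i - fst b) * (int m + int (length \<alpha> - 1 - p))) * A (take (Suc p) \<alpha>) ch x [vs ! a] i b *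
        fam_power E A m (drop p \<alpha>) ch x (face a vs) b j)"
      by (metis (no_types, opaque_lifting) mult.assoc)
  qed
qed

lemma fam_power_gmats:
  assumes A: "\<forall>\<beta> us. length us \<noteq> 1 \<longrightarrow> A \<beta> ch x us = 0"
    and g: "\<And>\<beta> v. \<beta> \<noteq> [] \<Longrightarrow> A \<beta> ch x [v] \<in> gmats (fib (E (hd \<beta>)) x) (fib (E (last \<beta>)) x) (2 - int (length \<beta>))"
    and \<alpha>: "\<alpha> \<noteq> []"
  shows "fam_power E A m \<alpha> ch x vs \<in> gmats (fib (E (hd \<alpha>)) x) (fib (E (last \<alpha>)) x) (int m + 1 - int (length \<alpha>))"
  using \<alpha>
proof (induction m arbitrary: \<alpha> vs)
  case 0
  then show ?case using gmats_gid by (cases \<alpha>) (auto simp: fam_one_def gmats_0)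
next
  case (Suc m)
  show ?case
  proof (cases "length vs = Suc m")
    case True
    show ?thesis
      unfolding fam_power_gmul[of A ch x, OF A True]
    proof (intro gmats_sum gmats_scale)
      fix p a assume "p \<in> {..<length \<alpha>}"
      then have p: "p < length \<alpha>" by simp
      have "A (take (Suc p) \<alpha>) ch x [vs ! a] \<in> gmats (fib (E (hd \<alpha>)) x) (fib (E (\<alpha> ! p)) x) (1 - int p)"
        using g[of "take (Suc p) \<alpha>" "vs ! a"] p Suc.prems by (simp add: last_take_Suc)
      from tws_gmats[OF this]
      have t: "tws (int m + int (length \<alpha> - 1 - p)) (A (take (Suc p) \<alpha>) ch x [vs ! a]) \<in> gmats (fib (E (hd \<alpha>)) x) (fib (E (\<alpha> ! p)) x) (1 - int p)" .
      have d: "fam_power E A m (drop p \<alpha>) ch x (face a vs) \<in> gmats (fib (E (\<alpha> ! p)) x) (fib (E (last \<alpha>)) x) (int m + 1 - (int (length \<alpha>) - int p))"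
        using Suc.IH[of "drop p \<alpha>" "face a vs"] p by (simp add: hd_drop_conv_nth of_nat_diff)
      have e: "1 - int p + (int m + 1 - (int (length \<alpha>) - int p)) = int (Suc m) + 1 - int (length \<alpha>)" by simp
      show "gmul (fib (E (\<alpha> ! p)) x) (tws (int m + int (length \<alpha> - 1 - p)) (A (take (Suc p) \<alpha>) ch x [vs ! a]))
       (fam_power E A m (drop p \<alpha>) ch x (face a vs)) \<in> gmats (fib (E (hd \<alpha>)) x) (fib (E (last \<alpha>)) x) (int (Suc m) + 1 - int (length \<alpha>))"
        using gmats_gmul[OF t d] unfolding e .
    qed
  next
    case False
    have "fam_power E A (Suc m) \<alpha> ch x vs = 0"
      by (intro ext) (simp add: fam_power_length[of A ch x, OF A False] del: fam_power.simps)
    then show ?thesis by (simp only: gmats_0)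
  qed
qed

lemma gmul_lin_right: "gmul B X (\<lambda>i j. \<Sum>a\<in>S. c a * Y a i j) = (\<lambda>i j. \<Sum>a\<in>S. c a * gmul B X (Y a) i j)"
  unfolding gmul_def sum_distrib_left by (intro ext, subst sum.swap) (simp add: mult_ac)

lemma gmul_lin_left: "gmul B (\<lambda>i j. \<Sum>a\<in>S. c a * Y a i j) X = (\<lambda>i j. \<Sum>a\<in>S. c a * gmul B (Y a) X i j)"
  unfolding gmul_def sum_distrib_left sum_distrib_right by (intro ext, subst sum.swap) (simp add: mult_ac)

lemma loc_lin: "loc E E' p p' (\<lambda>y i j. \<Sum>a\<in>S. c a * f a y i j) y = (\<lambda>i j. \<Sum>a\<in>S. c a * loc E E' p p' (f a) y i j)"
  unfolding loc_def gmul_lin_left gmul_lin_right ..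

lemma loc_sum: "loc E E' p p' (\<lambda>y i j. \<Sum>a\<in>S. f a y i j) y = (\<lambda>i j. \<Sum>a\<in>S. loc E E' p p' (f a) y i j)"
  using loc_lin[of E E' p p' "\<lambda>_. 1" f S y] by simp

lemma loc_scale: "loc E E' p p' (\<lambda>y i j. c * f y i j) y = (\<lambda>i j. c * loc E E' p p' f y i j)"
  using loc_lin[of E E' p p' "\<lambda>_. c" "\<lambda>_. f" "{()}" y] by simp

lemma loc_zero: "loc E E' p p' (\<lambda>y. 0) = (\<lambda>y. 0)"
  unfolding loc_def gmul_zero by (rule refl)

lemma tws_gmul_left: "T \<in> gmats C B 0 \<Longrightarrow> tws t (gmul B T X) = gmul B T (tws t X)"
  unfolding tws_def gmul_def sum_distrib_left
proof (intro ext sum.cong refl)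
  fix i j b assume T: "T \<in> gmats C B 0"
  show "msign ((fst i - fst j) * t) * (T i b * X b j) = T i b * (msign ((fst b - fst j) * t) * X b j)"
  proof (cases "T i b = 0")
    case False
    then have "fst i = fst b" using gmatsD[OF T] by simp
    then show ?thesis by simp
  qed simp
qed

lemma tws_gmul_right: "T \<in> gmats C B 0 \<Longrightarrow> tws t (gmul C X T) = gmul C (tws t X) T"
  unfolding tws_def gmul_def sum_distrib_left
proof (intro ext sum.cong refl)
  fix i j b assume T: "T \<in> gmats C B 0"
  show "msign ((fst i - fst j) * t) * (X i b * T b j) = msign ((fst i - fst b) * t) * X i b * T b j"
  proof (cases "T b j = 0")
    case False
    then have "fst b = fst j" using gmatsD[OF T] by simp
    then show ?thesis by simp
  qed simp
qed

lemma loc_tws: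
  assumes "graded_bundle M E" "graded_bundle M E'" "y \<in> nb E p" "y \<in> nb E' p'"
  shows "loc E E' p p' (\<lambda>y. tws t (f y)) y = tws t (loc E E' p p' f y)"
  unfolding loc_def tws_gmul_left[OF triv_gmats[OF assms(2,4)]] tws_gmul_right[OF trinv_gmats[OF assms(1,3)]] ..

text \<open>The supertrace is invariant under conjugation by maps of degree 0, for which cyclicity
  costs no sign.\<close>

lemma gtr_loc:
  assumes E: "graded_bundle M E" and y: "y \<in> nb E p" and f: "f y \<in> gmats (fib E y) (fib E y) 0"
  shows "gtr (fib E y) (loc E E p p f y) = gtr (fib E y) (f y)"
proof -
  have 1: "gmul (fib E y) (f y) (trinv E p y) \<in> gmats (fib E y) (fib E y) (- 0)"
    using gmats_gmul[OF f trinv_gmats[OF E y]] by simp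
  show ?thesis unfolding loc_def gtr_gmul_swap[OF triv_gmats[OF E y] finite_fib[OF E] finite_fib[OF E] 1]
    by (simp add: gmul_assoc trinv_triv[OF E y] gmul_gid_right[OF f finite_fib[OF E]])
qed

lemma loc_hom_conn:
  assumes M: "complex_manifold M" and E: "perf_ob M E" and E': "perf_ob M E'" and ch: "ch \<in> charts M" "y \<in> fst ch"
    and y: "y \<in> nb E p" "y \<in> nb E' p'" and v: "v \<in> model M" and f: "f \<in> bundle_maps M E E' q"
  shows "loc E E' p p' (\<lambda>y. hom_conn M E E' f ch y [v]) y = nconn E E' p p' f ch y v"
proof -
  note b = perf_ob_bundle[OF E] perf_ob_bundle[OF E']
  have N: "nconn E E' p p' f ch y v \<in> gmats (fib E' y) (fib E y) q" by (rule nconn_gmats[OF M E E' ch y v f])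
  have "loc E E' p p' (\<lambda>y. hom_conn M E E' f ch y [v]) y = gmul (fib E' y) (triv E' p' y)
     (gmul (fib E' y) (trinv E' p' y) (gmul (fib E y) (nconn E E' p p' f ch y v) (gmul (fib E y) (triv E p y) (trinv E p y))))"
    unfolding loc_def hom_conn_local[OF M E E' ch y v f] gmul_assoc ..
  also have "\<dots> = nconn E E' p p' f ch y v"
    unfolding triv_trinv[OF b(1) y(1)] gmul_gid_right[OF N finite_fib[OF b(1)]] triv_trinv_cancel[OF b(2) y(2) N]
    by (rule refl)
  finally show ?thesis .
qed

lemma hdiffm_zero: "hdiffm M ch x (\<lambda>y. 0)"
  unfolding hdiffm_def zero_fun_def by (intro allI) (rule hdiff_const)

lemma hdiffm_const: "hdiffm M ch x (\<lambda>y. X)"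
  unfolding hdiffm_def by (intro allI) (rule hdiff_const)

lemma hdiffm_scale: "hdiffm M ch x X \<Longrightarrow> hdiffm M ch x (\<lambda>y i j. c i j * X y i j)"
  unfolding hdiffm_def by (intro allI hdiff_mult hdiff_const) blast

lemma hdiffm_sum:
  assumes "\<And>a. a \<in> S \<Longrightarrow> hdiffm M ch x (X a)"
  shows "hdiffm M ch x (\<lambda>y i j. \<Sum>a\<in>S. X a y i j)"
  unfolding hdiffm_def
proof (intro allI hdiff_sum)
  fix i j a assume "a \<in> S"
  then show "hdiff M ch x (\<lambda>y. X a y i j)" by (rule hdiffmD[OF assms])
qed

context
  fixes M :: "('a, 'm::finite) cmfd" and F :: "('a, 'm) ivb"
  assumes M: "complex_manifold M" and coh: "coherent M F"
begin

abbreviation "FP \<equiv> fam_power (ob_of F) (fam_A M F)"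

lemmas ob = coh_ob[OF M coh]
lemmas gb = perf_ob_bundle[OF ob]

lemma fam_A_gmats: "\<beta> \<noteq> [] \<Longrightarrow> fam_A M F \<beta> ch x [v] \<in> gmats (fib (ob_of F (hd \<beta>)) x) (fib (ob_of F (last \<beta>)) x) (2 - int (length \<beta>))"
  unfolding fam_A_hfam[OF M coh] by (rule gmats_scale[OF hfam_gmats[OF M coh]])

lemma FP_gmats: "\<alpha> \<noteq> [] \<Longrightarrow> FP m \<alpha> ch x vs \<in> gmats (fib (ob_of F (hd \<alpha>)) x) (fib (ob_of F (last \<alpha>)) x) (int m + 1 - int (length \<alpha>))"
  by (rule fam_power_gmats[of "fam_A M F" ch x, OF fam_A_one_form fam_A_gmats])

lemma FP_length: "length vs \<noteq> m \<Longrightarrow> FP m \<alpha> ch x vs = 0"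
  by (intro ext) (simp add: fam_power_length[of "fam_A M F" ch x, OF fam_A_one_form])

text \<open>A common domain for the trivialisations at \<open>p\<close> over all vertices in
  \<open>S\<close>. Intersecting with the points of \<open>M\<close> keeps it meaningful for empty
  \<open>S\<close>.\<close>

definition nbs :: "nat set \<Rightarrow> 'a \<Rightarrow> 'a set" where
  "nbs S p = (\<Inter>k\<in>S. nb (ob_of F k) p) \<inter> pts M"

lemma nbs_open: "finite S \<Longrightarrow> openin (mtop M) (nbs S p)"
  unfolding nbs_def by (rule openin_INT) (auto intro: nb_openin[OF gb])

lemma nbs_self: "p \<in> pts M \<Longrightarrow> p \<in> nbs S p"
  unfolding nbs_def using nb_self[OF gb] by auto

lemma nbs_nb: "y \<in> nbs S p \<Longrightarrow> k \<in> S \<Longrightarrow> y \<in> nb (ob_of F k) p"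
  by (auto simp: nbs_def)

lemma nbs_fib: "y \<in> nbs S p \<Longrightarrow> k \<in> S \<Longrightarrow> fib (ob_of F k) y = fib (ob_of F k) p"
  by (rule nb_fib[OF gb nbs_nb])

context
  fixes p :: 'a and S :: "nat set" and ch
  assumes S: "finite S" and ch: "ch \<in> charts M" and p: "p \<in> fst ch"
begin

abbreviation "lc \<alpha> f \<equiv> loc (ob_of F (last \<alpha>)) (ob_of F (hd \<alpha>)) p p f"

lemma p_nbs: "p \<in> nbs S p" by (rule nbs_self[OF chart_pts[OF M ch p]])

lemma hdiffm_gfam:
  assumes \<beta>: "\<beta> \<noteq> []" "set \<beta> \<subseteq> S" and x: "x \<in> nbs S p" "x \<in> fst ch"
  shows "hdiffm M ch x (lc \<beta> (gfam F \<beta>))"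
proof -
  have "hd \<beta> \<in> S" "last \<beta> \<in> S" using \<beta> by auto
  then show ?thesis
    by (intro bundle_maps_hdiffm[OF M coh_maps[OF M coh \<beta>(1)] ch x(2)] nbs_nb[OF x(1)])
qed

lemma hdiffm_fam_A:
  assumes \<beta>: "\<beta> \<noteq> []" "set \<beta> \<subseteq> S"
  shows "hdiffm M ch p (lc \<beta> (\<lambda>y. fam_A M F \<beta> ch y [v]))"
proof -
  have hl: "hd \<beta> \<in> S" "last \<beta> \<in> S" using \<beta> by auto
  note h = coh_maps[OF M coh \<beta>(1)]
  show ?thesis
  proof (cases "v \<in> model M")
    case True
    have "hdiffm M ch p (\<lambda>y i j. msign (int (length \<beta> - 1)) * nconn (ob_of F (last \<beta>)) (ob_of F (hd \<beta>)) p p (gfam F \<beta>) ch y v i j)"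
      by (intro hdiffm_scale nconn_hdiffm[OF M ob ob ch p nbs_nb[OF p_nbs hl(2)] nbs_nb[OF p_nbs hl(1)] True h])
    then show ?thesis
    proof (rule hdiffm_cong[OF M ch nbs_open[OF S] p_nbs p, rotated])
      fix y assume y: "y \<in> nbs S p" "y \<in> fst ch"
      show "(\<lambda>i j. msign (int (length \<beta> - 1)) * nconn (ob_of F (last \<beta>)) (ob_of F (hd \<beta>)) p p (gfam F \<beta>) ch y v i j) =
        lc \<beta> (\<lambda>y. fam_A M F \<beta> ch y [v]) y"
        unfolding fam_A_hfam[OF M coh] loc_scale hfam_def[OF M coh]
          loc_hom_conn[OF M ob ob ch y(2) nbs_nb[OF y(1) hl(2)] nbs_nb[OF y(1) hl(1)] True h] ..
    qed
  next
    case False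
    then have "fam_A M F \<beta> ch y [v] = 0" for y
      by (intro ext) (simp add: fam_A_eq hom_conn_eq_0)
    then show ?thesis by (simp only: loc_zero hdiffm_zero)
  qed
qed

text \<open>Differentiability is claimed at the centre \<open>p\<close> only, but the rewriting into
  trivialisations holds on all of \<open>nbs S p\<close>, where the fibres are constant and the
  index sets of the sums do not move.\<close>

lemma hdiffm_FP:
  assumes "\<alpha> \<noteq> []" "set \<alpha> \<subseteq> S"
  shows "hdiffm M ch p (lc \<alpha> (\<lambda>y. FP m \<alpha> ch y vs))"
  using assms
proof (induction m arbitrary: \<alpha> vs)
  case 0
  show ?case
  proof (cases "length \<alpha> = 1 \<and> vs = []")
    case True
    then obtain e where e: "\<alpha> = [e]" by (cases \<alpha>) auto
    have "hdiffm M ch p (\<lambda>y. gid (fib (ob_of F e) p))" by (rule hdiffm_const)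
    then show ?thesis
    proof (rule hdiffm_cong[OF M ch nbs_open[OF S] p_nbs p, rotated])
      fix y assume y: "y \<in> nbs S p"
      have eS: "e \<in> S" using 0 e by simp
      have "lc \<alpha> (\<lambda>y. FP 0 \<alpha> ch y vs) y = loc (ob_of F e) (ob_of F e) p p (\<lambda>y. gid (fib (ob_of F e) y)) y"
        using True by (simp add: e fam_one_def)
      also have "\<dots> = gid (fib (ob_of F e) p)"
        unfolding loc_gid[OF gb nbs_nb[OF y eS]] nbs_fib[OF y eS] ..
      finally show "gid (fib (ob_of F e) p) = lc \<alpha> (\<lambda>y. FP 0 \<alpha> ch y vs) y" ..
    qed
  next
    case False
    then have "FP 0 \<alpha> ch y vs = 0" for y by (auto simp: fam_one_def)
    then show ?thesis by (simp only: loc_zero hdiffm_zero)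
  qed
next
  case (Suc m)
  have hl: "hd \<alpha> \<in> S" "last \<alpha> \<in> S" using Suc.prems by auto
  show ?case
  proof (cases "length vs = Suc m")
    case True
    let ?c = "\<lambda>q a. msign (int a) * msign (int (length \<alpha> - 1 - q))"
    let ?t = "\<lambda>q. int m + int (length \<alpha> - 1 - q)"
    let ?X = "\<lambda>q a y. tws (?t q) (lc (take (Suc q) \<alpha>) (\<lambda>y. fam_A M F (take (Suc q) \<alpha>) ch y [vs ! a]) y)"
    let ?Y = "\<lambda>q a y. lc (drop q \<alpha>) (\<lambda>y. FP m (drop q \<alpha>) ch y (face a vs)) y"
    have "hdiffm M ch p (\<lambda>y i j. \<Sum>q<length \<alpha>. \<Sum>a<Suc m. ?c q a * gmul (fib (ob_of F (\<alpha> ! q)) p) (?X q a y) (?Y q a y) i j)"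
    proof (rule hdiffm_sum, rule hdiffm_sum, rule hdiffm_scale)
      fix q a assume "q \<in> {..<length \<alpha>}"
      then have ne: "take (Suc q) \<alpha> \<noteq> []" "set (take (Suc q) \<alpha>) \<subseteq> S" "drop q \<alpha> \<noteq> []" "set (drop q \<alpha>) \<subseteq> S"
        using Suc.prems by (auto dest: in_set_takeD in_set_dropD)
      have "hdiffm M ch p (?X q a)"
        unfolding tws_def by (rule hdiffm_scale[OF hdiffm_fam_A[OF ne(1,2)]])
      then show "hdiffm M ch p (\<lambda>y. gmul (fib (ob_of F (\<alpha> ! q)) p) (?X q a y) (?Y q a y))"
        by (rule hdiffm_gmul[OF _ Suc.IH[OF ne(3,4)]])
    qed
    then show ?thesis
    proof (rule hdiffm_cong[OF M ch nbs_open[OF S] p_nbs p, rotated])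
      fix y assume y: "y \<in> nbs S p"
      have "lc \<alpha> (\<lambda>y. FP (Suc m) \<alpha> ch y vs) y = (\<lambda>i j. \<Sum>q<length \<alpha>. \<Sum>a<Suc m. ?c q a *
         lc \<alpha> (\<lambda>y. gmul (fib (ob_of F (\<alpha> ! q)) y) (tws (?t q) (fam_A M F (take (Suc q) \<alpha>) ch y [vs ! a])) (FP m (drop q \<alpha>) ch y (face a vs))) y i j)"
        unfolding fam_power_gmul[of "fam_A M F" ch, OF fam_A_one_form True] loc_sum loc_scale by (rule refl)
      also have "\<dots> = (\<lambda>i j. \<Sum>q<length \<alpha>. \<Sum>a<Suc m. ?c q a * gmul (fib (ob_of F (\<alpha> ! q)) p) (?X q a y) (?Y q a y) i j)"
      proof (intro ext, rule sum.cong[OF refl], rule sum.cong[OF refl])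
        fix i j q a assume "q \<in> {..<length \<alpha>}"
        then have q: "q < length \<alpha>" by simp
        have qS: "\<alpha> ! q \<in> S" using nth_mem[OF q] Suc.prems(2) by blast
        have e: "hd (drop q \<alpha>) = \<alpha> ! q" "last (take (Suc q) \<alpha>) = \<alpha> ! q" "hd (take (Suc q) \<alpha>) = hd \<alpha>" "last (drop q \<alpha>) = last \<alpha>"
          using q Suc.prems(1) by (auto simp: hd_drop_conv_nth last_take_Suc)
        have dn: "drop q \<alpha> \<noteq> []" using q by simp
        have "lc \<alpha> (\<lambda>y. gmul (fib (ob_of F (\<alpha> ! q)) y) (tws (?t q) (fam_A M F (take (Suc q) \<alpha>) ch y [vs ! a])) (FP m (drop q \<alpha>) ch y (face a vs))) y =
          gmul (fib (ob_of F (\<alpha> ! q)) y) (loc (ob_of F (\<alpha> ! q)) (ob_of F (hd \<alpha>)) p p (\<lambda>y. tws (?t q) (fam_A M F (take (Suc q) \<alpha>) ch y [vs ! a])) y)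
            (loc (ob_of F (last \<alpha>)) (ob_of F (\<alpha> ! q)) p p (\<lambda>y. FP m (drop q \<alpha>) ch y (face a vs)) y)"
          by (rule loc_comp[where f = "\<lambda>y. FP m (drop q \<alpha>) ch y (face a vs)" and x = y
              and g = "\<lambda>y. tws (?t q) (fam_A M F (take (Suc q) \<alpha>) ch y [vs ! a])", OF gb gb gb nbs_nb[OF y hl(2)] nbs_nb[OF y qS] nbs_nb[OF y hl(1)] FP_gmats[OF dn, unfolded e]])
        also have "\<dots> = gmul (fib (ob_of F (\<alpha> ! q)) p) (?X q a y) (?Y q a y)"
        proof -
          have 1: "loc (ob_of F (\<alpha> ! q)) (ob_of F (hd \<alpha>)) p p (\<lambda>y. tws (?t q) (fam_A M F (take (Suc q) \<alpha>) ch y [vs ! a])) y = ?X q a y"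
            unfolding e by (rule loc_tws[OF gb gb nbs_nb[OF y qS] nbs_nb[OF y hl(1)]])
          have 2: "loc (ob_of F (last \<alpha>)) (ob_of F (\<alpha> ! q)) p p (\<lambda>y. FP m (drop q \<alpha>) ch y (face a vs)) y = ?Y q a y"
            unfolding e by (rule refl)
          show ?thesis unfolding 1 2 nbs_fib[OF y qS] by (rule refl)
        qed
        finally show "?c q a * lc \<alpha> (\<lambda>y. gmul (fib (ob_of F (\<alpha> ! q)) y) (tws (?t q) (fam_A M F (take (Suc q) \<alpha>) ch y [vs ! a])) (FP m (drop q \<alpha>) ch y (face a vs))) y i j =
           ?c q a * gmul (fib (ob_of F (\<alpha> ! q)) p) (?X q a y) (?Y q a y) i j"
          by (rule arg_cong[where f = "\<lambda>Z. ?c q a * Z i j"])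
      qed
      finally show "(\<lambda>i j. \<Sum>q<length \<alpha>. \<Sum>a<Suc m. ?c q a * gmul (fib (ob_of F (\<alpha> ! q)) p) (?X q a y) (?Y q a y) i j) =
         lc \<alpha> (\<lambda>y. FP (Suc m) \<alpha> ch y vs) y" by (rule sym)
    qed
  next
    case False
    then have "FP (Suc m) \<alpha> ch y vs = 0" for y by (rule FP_length)
    then show ?thesis by (simp only: loc_zero hdiffm_zero)
  qed
qed

end

text \<open>Near \<open>p\<close> the trace may be computed from the factors as written in the
  trivialisations at \<open>p\<close>, with index sets frozen at \<open>p\<close>. This is a
  polynomial in differentiable entries.\<close>

lemma hdiff_Tr:
  assumes ch: "ch \<in> charts M" and p: "p \<in> fst ch" and len: "length \<sigma> = Suc m" "m \<ge> 1"
  shows "hdiff M ch p (\<lambda>y. Tr F (FP m) \<sigma> ch y vs)"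
proof -
  let ?E = "ob_of F" and ?S = "set \<sigma>"
  have S: "finite ?S" by simp
  let ?c = "\<lambda>k l. msign ((int k + 1) * int (length \<sigma> - 1) + int l - int k)"
  let ?g = "\<lambda>k l y. loc (?E (\<sigma> ! k)) (?E (\<sigma> ! l)) p p (gfam F (rot k l \<sigma>)) y"
  let ?f = "\<lambda>k l y. loc (?E (\<sigma> ! l)) (?E (\<sigma> ! k)) p p (\<lambda>y. FP m (seg k l \<sigma>) ch y vs) y"
  have ends: "rot k l \<sigma> \<noteq> []" "seg k l \<sigma> \<noteq> []" "hd (rot k l \<sigma>) = \<sigma> ! l" "last (rot k l \<sigma>) = \<sigma> ! k"
      "hd (seg k l \<sigma>) = \<sigma> ! k" "last (seg k l \<sigma>) = \<sigma> ! l" "length (rot k l \<sigma>) \<noteq> 1" "\<sigma> ! l \<in> ?S" "\<sigma> ! k \<in> ?S"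
    if "k \<le> l" "l \<le> length \<sigma> - 1" for k l
  proof -
    have l: "l < length \<sigma>" "k < length \<sigma>" using that len by auto
    show "rot k l \<sigma> \<noteq> []" "length (rot k l \<sigma>) \<noteq> 1" using length_rot[OF l] l by auto
    show "seg k l \<sigma> \<noteq> []" using length_seg[OF l(1), of k] that by auto
    show "hd (rot k l \<sigma>) = \<sigma> ! l" using l by (simp add: rot_def hd_drop_conv_nth)
    show "last (rot k l \<sigma>) = \<sigma> ! k" using l by (simp add: rot_def take_Suc_conv_app_nth)
    show "hd (seg k l \<sigma>) = \<sigma> ! k" "last (seg k l \<sigma>) = \<sigma> ! l" using hd_seg last_seg that l by auto
    show "\<sigma> ! l \<in> ?S" "\<sigma> ! k \<in> ?S" using l by auto
  qed
  have "hdiff M ch p (\<lambda>y. \<Sum>l\<le>length \<sigma> - 1. \<Sum>k\<le>l. ?c k l * (\<Sum>j\<in>fib (?E (\<sigma> ! l)) p. \<Sum>i\<in>fib (?E (\<sigma> ! k)) p.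
      msign (fst j) * msign ((fst j - fst i) * int m) * ?g k l y j i * ?f k l y i j))"
  proof (rule hdiff_sum, rule hdiff_sum, rule hdiff_mult[OF hdiff_const], rule hdiff_sum, rule hdiff_sum, rule hdiff_mult[OF hdiff_mult[OF hdiff_const]])
    fix l k i j assume "l \<in> {..length \<sigma> - 1}" "k \<in> {..l}"
    then have kl: "k \<le> l" "l \<le> length \<sigma> - 1" by auto
    note e = ends[OF kl]
    show "hdiff M ch p (\<lambda>y. ?g k l y j i)"
      using hdiffmD[OF hdiffm_gfam[OF S ch p e(1) rot_subset p_nbs[OF S ch p] p]] unfolding e(3,4) .
    show "hdiff M ch p (\<lambda>y. ?f k l y i j)"
      using hdiffmD[OF hdiffm_FP[OF S ch p e(2) seg_subset]] unfolding e(5,6) .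
  qed
  then show ?thesis
  proof (rule hdiff_cong[OF M ch nbs_open[OF S] p_nbs[OF S ch p] p, rotated])
    fix y assume y: "y \<in> nbs ?S p"
    have f0: "\<forall>\<beta> us. length us \<noteq> m \<longrightarrow> FP m \<beta> ch y us = 0" using FP_length by blast
    show "(\<Sum>l\<le>length \<sigma> - 1. \<Sum>k\<le>l. ?c k l * (\<Sum>j\<in>fib (?E (\<sigma> ! l)) p. \<Sum>i\<in>fib (?E (\<sigma> ! k)) p.
      msign (fst j) * msign ((fst j - fst i) * int m) * ?g k l y j i * ?f k l y i j)) = Tr F (FP m) \<sigma> ch y vs"
      unfolding Tr_expand[of m "FP m" ch y, OF f0]
    proof (rule sum.cong[OF refl], rule sum.cong[OF refl], rule arg_cong[of _ _ "(*) _"])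
      fix l k assume "l \<in> {..length \<sigma> - 1}" "k \<in> {..l}"
      then have kl: "k \<le> l" "l \<le> length \<sigma> - 1" by auto
      note e = ends[OF kl]
      note nl = nbs_nb[OF y e(8)] and nk = nbs_nb[OF y e(9)]
      let ?B = "fib (?E (\<sigma> ! l)) y" and ?C = "fib (?E (\<sigma> ! k)) y"
      have tr: "gtr ?B (gmul ?C (tws (int m) Z) W) = (\<Sum>j\<in>?B. \<Sum>i\<in>?C. msign (fst j) * msign ((fst j - fst i) * int m) * Z j i * W i j)" for Z W
        by (simp add: gtr_def gmul_def tws_def sum_distrib_left mult.assoc)
      have ms: "mor_of F (rot k l \<sigma>) = gfam F (rot k l \<sigma>)" using e(7) by (simp only: gfam_eq_mor not_False_eq_True)
      have fg: "FP m (seg k l \<sigma>) ch z vs \<in> gmats (fib (?E (\<sigma> ! k)) z) (fib (?E (\<sigma> ! l)) z) (int m + 1 - int (length (seg k l \<sigma>)))" for z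
        using FP_gmats[OF e(2)] unfolding e(5,6) .
      have gg: "gfam F (rot k l \<sigma>) y \<in> gmats ?B ?C (2 - int (length (rot k l \<sigma>)))"
        using bundle_maps_gmats[OF coh_maps[OF M coh e(1)], of y] unfolding e(3,4) .
      \<comment> \<open>Segment and arc overlap in the two cuts, so their lengths add up to
        \<open>m + 3\<close>. Therefore the product has degree 0, as invariance of the supertrace
        requires.\<close>
      have deg: "2 - int (length (rot k l \<sigma>)) + (int m + 1 - int (length (seg k l \<sigma>))) = 0"
        using kl len by (simp add: length_rot length_seg of_nat_diff)
      have prod: "gmul ?C (tws (int m) (gfam F (rot k l \<sigma>) y)) (FP m (seg k l \<sigma>) ch y vs) \<in> gmats ?B ?B 0"
        using gmats_gmul[OF tws_gmats[OF gg] fg] unfolding deg .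
      have "gtr ?B (gmul ?C (tws (int m) (?g k l y)) (?f k l y)) =
        gtr ?B (loc (?E (\<sigma> ! l)) (?E (\<sigma> ! l)) p p (\<lambda>y. gmul (fib (?E (\<sigma> ! k)) y) (tws (int m) (gfam F (rot k l \<sigma>) y)) (FP m (seg k l \<sigma>) ch y vs)) y)"
        unfolding loc_comp[where f = "\<lambda>y. FP m (seg k l \<sigma>) ch y vs", OF gb gb gb nl nk nl fg] loc_tws[OF gb gb nk nl] ..
      also have "\<dots> = gtr ?B (gmul ?C (tws (int m) (gfam F (rot k l \<sigma>) y)) (FP m (seg k l \<sigma>) ch y vs))"
        by (rule gtr_loc[where f = "\<lambda>y. gmul (fib (?E (\<sigma> ! k)) y) (tws (int m) (gfam F (rot k l \<sigma>) y)) (FP m (seg k l \<sigma>) ch y vs)",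
            OF gb nl prod])
      finally show "(\<Sum>j\<in>fib (?E (\<sigma> ! l)) p. \<Sum>i\<in>fib (?E (\<sigma> ! k)) p.
        msign (fst j) * msign ((fst j - fst i) * int m) * ?g k l y j i * ?f k l y i j) =
        (\<Sum>j\<in>?B. \<Sum>i\<in>?C. msign (fst j) * msign ((fst j - fst i) * int m) * mor_of F (rot k l \<sigma>) y j i * FP m (seg k l \<sigma>) ch y vs i j)"
        unfolding nbs_fib[OF y e(8), symmetric] nbs_fib[OF y e(9), symmetric] ms tr[symmetric] .
    qed
  qed
qed

section \<open>The trace as a holomorphic form\<close>

lemma fam_A_bad: "\<not> (ch \<in> charts M \<and> x \<in> fst ch) \<Longrightarrow> fam_A M F \<beta> ch x vs = 0"
proof -
  assume "\<not> (ch \<in> charts M \<and> x \<in> fst ch)"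
  then have "hom_conn M E E' f ch x vs = 0" for E E' f by (intro hom_conn_eq_0) blast
  then show ?thesis by (intro ext) (simp add: fam_A_eq)
qed

text \<open>At least one factor \<open>A\<close> has to be present: the connection vanishes outside
  the charts, while the unit \<open>FP 0\<close> pays no regard to the chart.\<close>

lemma FP_bad: "\<not> (ch \<in> charts M \<and> x \<in> fst ch) \<Longrightarrow> m \<ge> 1 \<Longrightarrow> FP m \<beta> ch x vs = 0"
proof (cases m)
  case (Suc m')
  assume "\<not> (ch \<in> charts M \<and> x \<in> fst ch)"
  then have "fam_A M F \<beta> ch x us = 0" for \<beta> us by (rule fam_A_bad)
  then show ?thesis unfolding Suc
    by (intro ext) (simp add: fam_power_Suc_entry[of "fam_A M F" ch x, OF fam_A_one_form] del: fam_power.simps)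
qed simp

lemma Tr_bad: "\<not> (ch \<in> charts M \<and> x \<in> fst ch) \<Longrightarrow> m \<ge> 1 \<Longrightarrow> Tr F (FP m) \<sigma> ch x = 0"
proof (intro ext)
  fix vs assume "\<not> (ch \<in> charts M \<and> x \<in> fst ch)" "m \<ge> 1"
  then have "FP m \<beta> ch x vs = 0" for \<beta> vs by (rule FP_bad)
  then show "Tr F (FP m) \<sigma> ch x vs = 0 vs"
    by (simp add: Tr_expand[of m "FP m" ch x])
qed

lemma alt_FP_Tr:
  assumes "m \<ge> 1"
  shows "alt_multilinear (model M) m (Tr F (FP m) \<sigma> ch x)"
proof (cases "ch \<in> charts M \<and> x \<in> fst ch")
  case True
  show ?thesis
  proof (rule alt_Tr, rule alt_fam_power[of _ "fam_A M F" ch x, OF _ fam_A_one_form])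
    show "vec.subspace (model M)" using model_subspace[OF M] True by blast
    show "v \<in> model M" if "fam_A M F \<beta> ch x [v] i j \<noteq> 0" for \<beta> v i j
      using that by (rule contrapos_np) (simp add: fam_A_eq hom_conn_eq_0)
    show "fam_A M F \<beta> ch x [a *s v + w] i j = a * fam_A M F \<beta> ch x [v] i j + fam_A M F \<beta> ch x [w] i j"
      if "\<beta> \<noteq> []" "v \<in> model M" "w \<in> model M" for \<beta> a v w i j
      unfolding fam_A_eq hom_conn_linear[OF M ob ob that(2,3) coh_maps[OF M coh that(1)]]
      by (simp add: algebra_simps)
  qed
next
  case False
  then show ?thesis using Tr_bad[OF False assms] by (simp add: alt_multilinear_def)
qed

lemma hol_form_Tr:
  assumes len: "length \<sigma> = Suc m" "m \<ge> 1"
  shows "hol_form M (pts M) m (\<lambda>ch x vs. Tr F (FP m) \<sigma> ch x vs / fact m)"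
  unfolding hol_form_def
proof (intro conjI allI impI ballI)
  fix ch x assume "ch \<notin> charts M \<or> x \<notin> pts M \<inter> fst ch"
  then have "\<not> (ch \<in> charts M \<and> x \<in> fst ch)" using chart_pts[OF M] by blast
  from Tr_bad[OF this len(2)] show "(\<lambda>vs. Tr F (FP m) \<sigma> ch x vs / fact m) = 0" by (simp add: fun_eq_iff)
next
  fix ch x
  show "alt_multilinear (model M) m (\<lambda>vs. Tr F (FP m) \<sigma> ch x vs / fact m)"
    using alt_multilinear_cmult[OF alt_FP_Tr[OF len(2)], of "1 / fact m"] by simp
next
  fix ch ch' x and vs :: "(complex ^ 'm) list"
  assume ch: "ch \<in> charts M" "ch' \<in> charts M" and x: "x \<in> pts M \<inter> fst ch \<inter> fst ch'" and vs: "length vs = m \<and> set vs \<subseteq> model M"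
  let ?J = "jac ch ch' (\<lambda>y. y) x"
  have x': "x \<in> fst ch" "x \<in> fst ch'" using x by auto
  have "Tr F (FP m) \<sigma> ch x vs = Tr F (FP m) (map (\<lambda>k. k) \<sigma>) ch' x (map ?J vs)"
  proof (rule Tr_map[where f = "FP m" and f' = "FP m" and m = m])
    fix \<beta> :: "nat list"
    show "FP m \<beta> ch x vs = FP m (map (\<lambda>k. k) \<beta>) ch' x (map ?J vs)"
    proof (rule fam_power_map[where V = "model M" and S = UNIV])
      fix \<gamma> :: "nat list" and v assume "\<gamma> \<noteq> []" "v \<in> model M"
      then show "fam_A M F \<gamma> ch x [v] = fam_A M F (map (\<lambda>k. k) \<gamma>) ch' x [?J v]"
        by (intro ext) (simp add: fam_A_eq hom_conn_chart[OF M ob ob coh_maps[OF M coh] ch(1) x'(1) ch(2) x'(2)])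
    qed (use fam_A_one_form[of M F ch x] fam_A_one_form[of M F ch' x] vs in auto)
  next
    show "\<forall>\<beta> us. length us \<noteq> m \<longrightarrow> FP m \<beta> ch x us = 0" "\<forall>\<beta> us. length us \<noteq> m \<longrightarrow> FP m \<beta> ch' x us = 0"
      using FP_length by blast+
  qed (use len in auto)
  then show "Tr F (FP m) \<sigma> ch x vs / fact m = Tr F (FP m) \<sigma> ch' x (map ?J vs) / fact m" by simp
next
  fix ch and vs :: "(complex ^ 'm) list" assume ch: "ch \<in> charts M"
  show "holo_on (model M) (snd ch ` (pts M \<inter> fst ch)) (\<lambda>z. Tr F (FP m) \<sigma> ch (chart_inv ch z) vs / fact m)"
    unfolding holo_on_iff
  proof
    fix z assume "z \<in> snd ch ` (pts M \<inter> fst ch)"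
    then obtain x where x: "x \<in> fst ch" "z = snd ch x" by auto
    have "hdiff M ch x (\<lambda>y. (1 / fact m) * Tr F (FP m) \<sigma> ch y vs)"
      by (rule hdiff_mult[OF hdiff_const hdiff_Tr[OF ch x(1) len]])
    then show "holo_at (model M) z (\<lambda>z. Tr F (FP m) \<sigma> ch (chart_inv ch z) vs / fact m)"
      by (simp add: hdiff_def x(2))
  qed
qed

end

section \<open>Degenerate cells\<close>

lemma hd_last_le:
  fixes \<beta> :: "nat list"
  assumes "\<beta> \<noteq> []" "set \<beta> \<subseteq> {..n}"
  shows "hd \<beta> \<le> n" "last \<beta> \<le> n"
  using assms(2) hd_in_set[OF assms(1)] last_in_set[OF assms(1)] by auto

lemma fam_power_fam_A_length: "\<forall>\<beta> us. length us \<noteq> m \<longrightarrow> fam_power E (fam_A M F) m \<beta> ch x us = 0"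
  by (intro allI impI ext) (simp add: fam_power_length[of "fam_A M F" ch x, OF fam_A_one_form])

text \<open>Every vector of the list is handed to some factor \<open>A\<close>, so one vector on
  which all values of \<open>A\<close> vanish is enough.\<close>

lemma fam_power_support:
  assumes A: "\<forall>\<beta> us. length us \<noteq> 1 \<longrightarrow> A \<beta> ch x us = 0" and H: "\<And>\<beta> v. v \<notin> H \<Longrightarrow> A \<beta> ch x [v] = 0"
    and vs: "v \<in> set vs" "v \<notin> H"
  shows "fam_power E A m \<alpha> ch x vs i j = 0"
  using vs(1)
proof (induction m arbitrary: \<alpha> vs i j)
  case 0
  then show ?case by (auto simp: fam_one_def)
next
  case (Suc m)
  show ?case unfolding fam_power_Suc_entry[of A ch x, OF A]
  proof (rule sum.neutral, rule ballI, rule sum.neutral, rule ballI, rule sum.neutral, rule ballI)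
    fix p a b assume "a \<in> {..<length vs}"
    then have "v = vs ! a \<or> v \<in> set (face a vs)" using Suc.prems set_face[of a vs] by auto
    then show "msign (int a) * msign ((fst i - fst b) * int (length vs - 1)) *
       (msign ((1 + (fst i - fst b)) * int (length \<alpha> - 1 - p)) * A (take (Suc p) \<alpha>) ch x [vs ! a] i b) *
       fam_power E A m (drop p \<alpha>) ch x (face a vs) b j = 0"
    proof
      assume "v = vs ! a"
      then show ?thesis using H[OF vs(2)] by simp
    next
      assume "v \<in> set (face a vs)"
      then show ?thesis using Suc.IH by simp
    qed
  qed
qed

lemma Tr_index:
  assumes ob: "\<And>k. k \<in> S \<Longrightarrow> ob_of F k = ob_of F' (\<phi> k)"
    and mor: "\<And>\<beta>. set \<beta> \<subseteq> S \<Longrightarrow> mor_of F \<beta> = mor_of F' (map \<phi> \<beta>)"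
    and \<sigma>: "\<sigma> \<noteq> []" "set \<sigma> \<subseteq> S"
  shows "Tr F (fam_power (ob_of F) (fam_A M F) m) \<sigma> ch x vs = Tr F' (fam_power (ob_of F') (fam_A M F') m) (map \<phi> \<sigma>) ch x vs"
proof -
  have A: "fam_A M F \<beta> ch x [v] = fam_A M F' (map \<phi> \<beta>) ch x [v]" if "\<beta> \<noteq> []" "set \<beta> \<subseteq> S" for \<beta> v
  proof -
    have "last \<beta> \<in> S" "hd \<beta> \<in> S" using that by auto
    then have e: "ob_of F (last \<beta>) = ob_of F' (last (map \<phi> \<beta>))" "ob_of F (hd \<beta>) = ob_of F' (hd (map \<phi> \<beta>))"
      using that(1) ob by (simp_all add: last_map hd_map)
    then have "gfam F \<beta> = gfam F' (map \<phi> \<beta>)" using mor[OF that(2)] by (simp add: gfam_def)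
    then show ?thesis by (intro ext) (simp add: fam_A_eq e)
  qed
  have "Tr F (fam_power (ob_of F) (fam_A M F) m) \<sigma> ch x vs =
    Tr F' (fam_power (ob_of F') (fam_A M F') m) (map \<phi> \<sigma>) ch x (map (\<lambda>v. v) vs)"
  proof (rule Tr_map[where f = "fam_power (ob_of F) (fam_A M F) m" and f' = "fam_power (ob_of F') (fam_A M F') m" and m = m])
    fix \<beta> assume \<beta>: "set \<beta> \<subseteq> set \<sigma>"
    show "mor_of F \<beta> x = mor_of F' (map \<phi> \<beta>) x" using mor[of \<beta>] \<beta> \<sigma>(2) by simp
    show "fam_power (ob_of F) (fam_A M F) m \<beta> ch x vs = fam_power (ob_of F') (fam_A M F') m (map \<phi> \<beta>) ch x (map (\<lambda>v. v) vs)"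
      by (rule fam_power_map[where A = "fam_A M F" and A' = "fam_A M F'" and S = S and V = UNIV and J = "\<lambda>v. v" and \<phi> = \<phi>, OF fam_A_one_form[of M F ch x] fam_A_one_form[of M F' ch x]])
        (use ob \<beta> \<sigma>(2) A in auto)
  next
    fix k assume "k \<in> set \<sigma>"
    then show "fib (ob_of F k) x = fib (ob_of F' (\<phi> k)) x" using ob \<sigma>(2) by auto
  qed (rule fam_power_fam_A_length fam_power_fam_A_length \<sigma>(1))+
  then show ?thesis by simp
qed

text \<open>On sequences in \<open>{..n}\<close> moving the vertices changes nothing, so what holds
  for coherent families applies to the cells of the simplex.\<close>

lemma Tr_total:
  assumes "\<sigma> \<noteq> []" "set \<sigma> \<subseteq> {..n}"
  shows "Tr F (fam_power (ob_of F) (fam_A M F) m) \<sigma> ch x vs =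
     Tr (total_ivb n F) (fam_power (ob_of (total_ivb n F)) (fam_A M (total_ivb n F)) m) \<sigma> ch x vs"
proof -
  have id: "map (\<lambda>i. min i n) \<beta> = \<beta>" if "set \<beta> \<subseteq> {..n}" for \<beta> using that by (induction \<beta>) auto
  have "Tr F (fam_power (ob_of F) (fam_A M F) m) \<sigma> ch x vs =
     Tr (total_ivb n F) (fam_power (ob_of (total_ivb n F)) (fam_A M (total_ivb n F)) m) (map (\<lambda>k. k) \<sigma>) ch x vs"
    by (rule Tr_index[where S = "{..n}"]) (use assms in \<open>auto simp: ob_of_total mor_of_total id\<close>)
  then show ?thesis by simp
qed

context
  fixes M :: "('a, 'm::finite) cmfd" and F :: "('a, 'm) ivb" and n :: nat
  assumes M: "complex_manifold M" and F: "F \<in> IVB M n"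
begin

text \<open>A sequence with equal neighbours is obtained from its face by the degeneracy that
  repeats position \<open>a\<close>. Naturality of \<open>F\<close> and the rule of the nerve for
  non-injective maps determine the value.\<close>

lemma mor_of_repeat:
  assumes \<beta>: "set \<beta> \<subseteq> {..n}" and a: "Suc a < length \<beta>" "\<beta> ! a = \<beta> ! Suc a"
  shows "mor_of F \<beta> = (if length \<beta> = 2 then (\<lambda>x. gid (fib (ob_of F (hd \<beta>)) x)) else 0)"
proof -
  define m where "m = length \<beta> - 1"
  have len: "length \<beta> = m + 1" "m \<ge> 1" using a by (auto simp: m_def)
  define \<gamma> where "\<gamma> = face (Suc a) \<beta>"
  define \<phi> where "\<phi> j = (if j \<le> a then j else j - 1)" for j
  have l\<gamma>: "length \<gamma> = m" using a len by (simp add: \<gamma>_def length_face)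
  have "set \<gamma> \<subseteq> set \<beta>" by (auto simp: \<gamma>_def face_def dest: in_set_takeD in_set_dropD)
  then have h: "\<gamma> \<in> hat n (m - 1)" using \<beta> l\<gamma> len by (auto simp: hat_def)
  have d: "delta_map m (m - 1) \<phi>"
    using a len by (auto simp: delta_map_def mono_on_def \<phi>_def)
  have "hat_op m \<phi> \<gamma> = \<beta>"
  proof (rule nth_equalityI)
    show "length (hat_op m \<phi> \<gamma>) = length \<beta>" using len by (simp add: hat_op_def)
    fix j assume "j < length (hat_op m \<phi> \<gamma>)"
    then have j: "j \<le> m" by (simp add: hat_op_def)
    have "\<phi> j < length \<beta> - 1" using j a len by (auto simp: \<phi>_def)
    then have "\<gamma> ! \<phi> j = \<beta> ! (if \<phi> j < Suc a then \<phi> j else Suc (\<phi> j))"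
      unfolding \<gamma>_def by (rule nth_face) (rule a(1))
    also have "\<dots> = \<beta> ! j" using a(2) by (cases "j = Suc a") (auto simp: \<phi>_def)
    finally show "hat_op m \<phi> \<gamma> ! j = \<beta> ! j" using j by (simp add: hat_op_def del: upt_Suc)
  qed
  then have F\<beta>: "F \<beta> = dgnerve_op (Perf M) m \<phi> (F \<gamma>)" using IVB_natural[OF F d h] by simp
  have c: "[0..<m + 1] \<in> cells m" by (auto simp: cells_def simp del: upt_Suc)
  have ni: "\<not> inj_on \<phi> (set [0..<m + 1])"
  proof
    assume "inj_on \<phi> (set [0..<m + 1])"
    moreover have "\<phi> a = \<phi> (Suc a)" by (simp add: \<phi>_def)
    ultimately have "a = Suc a" by (rule inj_onD) (use a len in auto)
    then show False by simp
  qed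
  have "snd (F \<beta>) [0..<m + 1] = (if m + 1 = 2 then Idn (Perf M) (fst (F \<gamma>) (\<phi> (hd [0..<m + 1]))) else 0)"
    using c ni len unfolding F\<beta> dgnerve_op_def by (simp add: split_beta del: upt_Suc)
  moreover have "fst (F \<gamma>) (\<phi> (hd [0..<m + 1])) = ob_of F (hd \<beta>)"
  proof -
    have "hd [0..<m + 1] = 0" by (simp add: upt_conv_Cons del: upt_Suc)
    then have "fst (F \<gamma>) (\<phi> (hd [0..<m + 1])) = ob_of F (\<gamma> ! 0)"
      using IVB_ob[OF F h, of 0] by (simp add: \<phi>_def)
    also have "\<gamma> ! 0 = \<beta> ! 0" unfolding \<gamma>_def using a by (subst nth_face) auto
    also have "\<beta> ! 0 = hd \<beta>" using len by (cases \<beta>) auto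
    finally show ?thesis .
  qed
  ultimately show ?thesis using len by (simp add: mor_of_def Perf_def del: upt_Suc)
qed

lemma fam_A_repeat:
  assumes \<beta>: "set \<beta> \<subseteq> {..n}" and a: "Suc a < length \<beta>" "\<beta> ! a = \<beta> ! Suc a"
  shows "fam_A M F \<beta> ch x [v] = 0"
proof -
  have ne: "\<beta> \<noteq> []" using a by auto
  have "last \<beta> \<le> n" "hd \<beta> \<le> n" using hd_last_le[OF ne \<beta>] by simp_all
  note P = IVB_perf_ob[OF F this(1)] IVB_perf_ob[OF F this(2)]
  have g: "gfam F \<beta> = mor_of F \<beta>" using a by (simp add: gfam_eq_mor)
  have "hom_conn M (ob_of F (last \<beta>)) (ob_of F (hd \<beta>)) (gfam F \<beta>) ch x [v] = 0"
  proof (cases "length \<beta> = 2")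
    case True
    then obtain e e' where e: "\<beta> = [e, e']" by (metis One_nat_def Suc_1 length_0_conv length_Suc_conv)
    then have "e = e'" using a by (cases a) auto
    then have "last \<beta> = hd \<beta>" using e by simp
    then show ?thesis
      unfolding g mor_of_repeat[OF \<beta> a] using True hom_conn_gid[OF M P(2)] by simp
  next
    case False
    \<comment> \<open>The zero map is written as an empty sum, so that linearity of the connection
      applies to it.\<close>
    have "hom_conn M (ob_of F (last \<beta>)) (ob_of F (hd \<beta>)) (\<lambda>x i j. \<Sum>a\<in>({}::nat set). 1 * (0 :: 'a \<Rightarrow> gmat) x i j) ch x [v] i j = 0" for i j
      by (subst hom_conn_sum[OF M P, where q = "\<lambda>_. 0"]) auto
    then show ?thesis
      unfolding g mor_of_repeat[OF \<beta> a] using False by (simp add: fun_eq_iff zero_fun_def)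
  qed
  then show ?thesis by (intro ext) (simp add: fam_A_eq)
qed

text \<open>The vertex at a cut belongs to both factors, so no cut separates neighbours: positions
  \<open>a\<close> and \<open>Suc a\<close> lie in the left factor for \<open>a < p\<close> and in
  the right one otherwise.\<close>

lemma fam_power_repeat:
  assumes "set \<beta> \<subseteq> {..n}" "Suc a < length \<beta>" "\<beta> ! a = \<beta> ! Suc a"
  shows "fam_power (ob_of F) (fam_A M F) m \<beta> ch x vs i j = 0"
  using assms
proof (induction m arbitrary: \<beta> a vs i j)
  case 0
  then show ?case by (auto simp: fam_one_def)
next
  case (Suc m)
  show ?case unfolding fam_power_Suc_entry[of "fam_A M F" ch x, OF fam_A_one_form]
  proof (rule sum.neutral, rule ballI, rule sum.neutral, rule ballI, rule sum.neutral, rule ballI)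
    fix p e b assume p: "p \<in> {..<length \<beta>}"
    show "msign (int e) * msign ((fst i - fst b) * int (length vs - 1)) *
       (msign ((1 + (fst i - fst b)) * int (length \<beta> - 1 - p)) * fam_A M F (take (Suc p) \<beta>) ch x [vs ! e] i b) *
       fam_power (ob_of F) (fam_A M F) m (drop p \<beta>) ch x (face e vs) b j = 0"
    proof (cases "a < p")
      case True
      have "fam_A M F (take (Suc p) \<beta>) ch x [vs ! e] = 0"
        by (rule fam_A_repeat[of _ a]) (use True p Suc.prems in \<open>auto dest: in_set_takeD\<close>)
      then show ?thesis by simp
    next
      case False
      have "fam_power (ob_of F) (fam_A M F) m (drop p \<beta>) ch x (face e vs) b j = 0"
        by (rule Suc.IH[of _ "a - p"]) (use False p Suc.prems in \<open>auto dest: in_set_dropD\<close>)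
      then show ?thesis by simp
    qed
  qed
qed

text \<open>Segment and arc share the cuts, so the repeated pair lies in one of them. If it lies in
  the arc, then the arc has at least three entries and its value is 0; the identity can occur only
  inside the segment, where the connection is applied.\<close>

lemma Tr_repeat:
  assumes \<sigma>: "set \<sigma> \<subseteq> {..n}" and a: "Suc a < length \<sigma>" "\<sigma> ! a = \<sigma> ! Suc a"
  shows "Tr F (fam_power (ob_of F) (fam_A M F) m) \<sigma> ch x vs = 0"
  unfolding Tr_expand[of m "fam_power (ob_of F) (fam_A M F) m" ch x, OF fam_power_fam_A_length]
proof (rule sum.neutral, rule ballI, rule sum.neutral, rule ballI)
  fix l k assume "l \<in> {..length \<sigma> - 1}" "k \<in> {..l}"
  then have kl: "k \<le> l" "l < length \<sigma>" using a by auto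
  have rs: "set (rot k l \<sigma>) \<subseteq> {..n}" "set (seg k l \<sigma>) \<subseteq> {..n}" by (rule subset_trans[OF rot_subset \<sigma>], rule subset_trans[OF seg_subset \<sigma>])
  have lr: "length (rot k l \<sigma>) = length \<sigma> - l + Suc k" using kl by (intro length_rot) auto
  have "mor_of F (rot k l \<sigma>) x j i * fam_power (ob_of F) (fam_A M F) m (seg k l \<sigma>) ch x vs i j = 0" for i j
  proof -
    consider "a < k" | "k \<le> a" "a < l" | "l \<le> a" by linarith
    then show ?thesis
    proof cases
      case 1
      let ?b = "length \<sigma> - l + a"
      have n1: "rot k l \<sigma> ! ?b = \<sigma> ! a" "rot k l \<sigma> ! Suc ?b = \<sigma> ! Suc a"
        using 1 kl by (auto simp: rot_def nth_append Suc_diff_le)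
      have "mor_of F (rot k l \<sigma>) = 0"
        by (subst mor_of_repeat[OF rs(1), of ?b]) (use 1 kl lr n1 a in auto)
      then show ?thesis by simp
    next
      case 2
      have "fam_power (ob_of F) (fam_A M F) m (seg k l \<sigma>) ch x vs i j = 0"
        by (rule fam_power_repeat[OF rs(2), of "a - k"]) (use 2 kl a in \<open>auto simp: length_seg nth_seg\<close>)
      then show ?thesis by simp
    next
      case 3
      have n1: "rot k l \<sigma> ! (a - l) = \<sigma> ! a" "rot k l \<sigma> ! Suc (a - l) = \<sigma> ! Suc a"
        using 3 a kl by (auto simp: rot_def nth_append)
      have "mor_of F (rot k l \<sigma>) = 0"
        by (subst mor_of_repeat[OF rs(1), of "a - l"]) (use 3 kl lr n1 a in auto)
      then show ?thesis by simp
    qed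
  qed
  note z = this
  have "msign (fst j) * msign ((fst j - fst i) * int m) * mor_of F (rot k l \<sigma>) x j i *
        fam_power (ob_of F) (fam_A M F) m (seg k l \<sigma>) ch x vs i j = 0" for i j
    using z[where j = j and i = i] by (simp only: mult.assoc mult_zero_right)
  then show "msign ((int k + 1) * int (length \<sigma> - 1) + int l - int k) *
     (\<Sum>j\<in>fib (ob_of F (\<sigma> ! l)) x. \<Sum>i\<in>fib (ob_of F (\<sigma> ! k)) x.
        msign (fst j) * msign ((fst j - fst i) * int m) * mor_of F (rot k l \<sigma>) x j i *
        fam_power (ob_of F) (fam_A M F) m (seg k l \<sigma>) ch x vs i j) = 0"
    by (simp only: sum.neutral_const mult_zero_right)
qed

end

section \<open>The Chern character\<close>

lemma euler_char_gtr:
  assumes E: "graded_bundle M E"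
  shows "euler_char E x = gtr (fib E x) (gid (fib E x))"
proof -
  have f: "fib E x = (SIGMA q:{q. rk E x q \<noteq> 0}. {..<rk E x q})" by (auto simp: fib_def)
  obtain N where N: "\<And>x q. rk E x q \<noteq> 0 \<Longrightarrow> \<bar>q\<bar> \<le> N" using E by (auto simp: graded_bundle_def)
  have fin: "finite {q. rk E x q \<noteq> 0}"
    by (rule finite_subset[of _ "{-N..N}"]) (use N[of x] in \<open>auto simp: abs_le_iff minus_le_iff\<close>)
  have "gtr (fib E x) (gid (fib E x)) = (\<Sum>b\<in>fib E x. msign (fst b))"
    unfolding gtr_def by (rule sum.cong[OF refl]) (simp add: gid_def)
  also have "\<dots> = (\<Sum>q\<in>{q. rk E x q \<noteq> 0}. \<Sum>a<rk E x q. msign q)"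
    unfolding f by (subst sum.Sigma) (use fin in \<open>auto simp: split_beta\<close>)
  finally show ?thesis by (simp add: euler_char_def mult.commute)
qed

lemma gtr_diff: "gtr B (X - Y) = gtr B X - gtr B Y"
  by (simp add: gtr_def sum_subtractf right_diff_distrib)

text \<open>\<open>f' f\<close> and \<open>f f'\<close> have the same supertrace by cyclicity. Each
  differs from an identity by \<open>D\<close> of a homotopy, which is a graded commutator with
  \<open>d\<close> and has supertrace 0.\<close>

lemma homotopy_equiv_euler_char:
  assumes E: "perf_ob M E" and E': "perf_ob M E'" and h: "homotopy_equiv (Perf M) E E' f"
  shows "euler_char E x = euler_char E' x"
proof -
  note b = perf_ob_bundle[OF E] perf_ob_bundle[OF E']
  have null: "gtr (fib E0 x) (gmul (fib E1 x) (v x) (u x)) = gtr (fib E0 x) (gid (fib E0 x))"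
    if E0: "perf_ob M E0" and k: "k \<in> Hom (Perf M) E0 E0 (-1)"
      "Dif (Perf M) E0 E0 (-1) k = Cmp (Perf M) E0 E1 E0 v u - Idn (Perf M) E0" for E0 E1 k u v
  proof -
    let ?B = "fib E0 x"
    have km: "k x \<in> gmats ?B ?B (-1)" using k(1) by (intro bundle_maps_gmats) (simp add: Perf_def)
    have dm: "dif E0 x \<in> gmats ?B ?B (- (-1))"
      using E0 bundle_maps_gmats[of "dif E0" M E0 E0 1] by (simp add: perf_ob_def)
    have "gmul (fib E1 x) (v x) (u x) - gid ?B = gmul ?B (k x) (dif E0 x) - (\<lambda>i j. msign (-1) * gmul ?B (dif E0 x) (k x) i j)"
      using fun_cong[OF k(2), of x] by (simp add: Perf_def fun_eq_iff)
    then have "gtr ?B (gmul (fib E1 x) (v x) (u x)) - gtr ?B (gid ?B) =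
       gtr ?B (gmul ?B (k x) (dif E0 x)) - gtr ?B (\<lambda>i j. msign (-1) * gmul ?B (dif E0 x) (k x) i j)"
      by (simp only: gtr_diff[symmetric])
    also have "gtr ?B (\<lambda>i j. msign (-1) * gmul ?B (dif E0 x) (k x) i j) = msign (-1) * gtr ?B (gmul ?B (dif E0 x) (k x))"
      by (simp add: gtr_def sum_distrib_left mult_ac)
    also have "gtr ?B (gmul ?B (k x) (dif E0 x)) = msign (-1) * gtr ?B (gmul ?B (dif E0 x) (k x))"
      by (rule gtr_gmul_swap[OF km finite_fib[OF perf_ob_bundle[OF E0]] finite_fib[OF perf_ob_bundle[OF E0]] dm])
    finally show ?thesis by simp
  qed
  obtain f' k k' where f: "f \<in> Hom (Perf M) E E' 0" and f': "f' \<in> Hom (Perf M) E' E 0"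
    and k: "k \<in> Hom (Perf M) E E (-1)" "Dif (Perf M) E E (-1) k = Cmp (Perf M) E E' E f' f - Idn (Perf M) E"
    and k': "k' \<in> Hom (Perf M) E' E' (-1)" "Dif (Perf M) E' E' (-1) k' = Cmp (Perf M) E' E E' f f' - Idn (Perf M) E'"
    using h unfolding homotopy_equiv_def by blast
  have "f' x \<in> gmats (fib E x) (fib E' x) 0" "f x \<in> gmats (fib E' x) (fib E x) (- 0)"
    using f f' by (auto simp: Perf_def intro: bundle_maps_gmats)
  from gtr_gmul_swap[OF this(1) finite_fib[OF b(2)] finite_fib[OF b(1)] this(2)]
  have "gtr (fib E x) (gmul (fib E' x) (f' x) (f x)) = gtr (fib E' x) (gmul (fib E x) (f x) (f' x))" by simp
  then show ?thesis
    unfolding euler_char_gtr[OF b(1)] euler_char_gtr[OF b(2)] null[OF E k] null[OF E' k'] .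
qed

lemma hol_form_0: "hol_form M N k 0"
  by (auto simp: hol_form_def alt_multilinear_def holo_on_iff zero_fun_def holo_at_const)

text \<open>Ranks are constant on the domain of a trivialisation, so the function is locally
  constant.\<close>

lemma hol_form_euler_char:
  assumes M: "complex_manifold M" and E: "graded_bundle M E"
  shows "hol_form M (pts M) 0 (fun_form M (euler_char E))"
  unfolding hol_form_def
proof (intro conjI allI impI ballI)
  fix ch x assume "ch \<notin> charts M \<or> x \<notin> pts M \<inter> fst ch"
  then show "fun_form M (euler_char E) ch x = 0" using chart_pts[OF M, of ch x] by (auto simp: fun_form_def fun_eq_iff)
next
  fix ch x show "alt_multilinear (model M) 0 (fun_form M (euler_char E) ch x)"
    unfolding alt_multilinear_def by (intro conjI allI impI) (auto simp: fun_form_def split: if_splits)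
next
  fix ch ch' x and vs :: "(complex ^ 'b) list"
  assume "ch \<in> charts M" "ch' \<in> charts M" "x \<in> pts M \<inter> fst ch \<inter> fst ch'" "length vs = 0 \<and> set vs \<subseteq> model M"
  then show "fun_form M (euler_char E) ch x vs = fun_form M (euler_char E) ch' x (map (jac ch ch' (\<lambda>y. y) x) vs)"
    by (simp add: fun_form_def)
next
  fix ch and vs :: "(complex ^ 'b) list" assume ch: "ch \<in> charts M"
  show "holo_on (model M) (snd ch ` (pts M \<inter> fst ch)) (\<lambda>z. fun_form M (euler_char E) ch (chart_inv ch z) vs)"
    unfolding holo_on_iff
  proof
    fix z assume "z \<in> snd ch ` (pts M \<inter> fst ch)"
    then obtain x where x: "x \<in> fst ch" "z = snd ch x" by auto
    have xn: "x \<in> nb E x" by (rule nb_self[OF E chart_pts[OF M ch x(1)]])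
    have "hdiff M ch x (\<lambda>y. fun_form M (euler_char E) ch y vs)"
    proof (rule hdiff_cong[OF M ch nb_openin[OF E] xn x(1) _ hdiff_const])
      fix y assume y: "y \<in> nb E x" "y \<in> fst ch"
      have "euler_char E y = euler_char E x"
        unfolding euler_char_gtr[OF E] nb_fib[OF E y(1)] ..
      then show "(if vs = [] then euler_char E x else 0) = fun_form M (euler_char E) ch y vs"
        using ch y by (simp add: fun_form_def)
    qed
    then show "holo_at (model M) z (\<lambda>z. fun_form M (euler_char E) ch (chart_inv ch z) vs)"
      by (simp add: hdiff_def x(2))
  qed
qed

lemma cellsD:
  assumes "\<sigma> \<in> cells n"
  shows "\<sigma> \<noteq> []" "sorted_wrt (<) \<sigma>" "set \<sigma> \<subseteq> {..n}"
  using assms by (auto simp: cells_def)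

lemma face_cells:
  assumes "\<sigma> \<in> cells n" "length \<sigma> = k + 1" "k \<ge> 1" "j \<le> k"
  shows "face j \<sigma> \<in> cells n"
proof -
  have "length (face j \<sigma>) = k" using assms by (simp add: length_face)
  then have "face j \<sigma> \<noteq> []" using assms(3) by auto
  moreover have "sorted_wrt (<) (face j \<sigma>)"
    using cellsD(2)[OF assms(1)] assms(2,4)
    by (auto simp: face_def sorted_wrt_iff_nth_less nth_append)
  moreover have "set (face j \<sigma>) \<subseteq> {..n}"
    using cellsD(3)[OF assms(1)] by (auto simp: face_def dest: in_set_takeD in_set_dropD)
  ultimately show ?thesis by (simp add: cells_def)
qed

text \<open>In total degree \<open>- k\<close> the coefficient of \<open>u^k\<close> is a form of
  degree \<open>2 * k - k\<close>, and the other coefficients of the monomial are 0.\<close>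

lemma form_cx_monom:
  assumes "hol_form M (pts M) k \<omega>"
  shows "monom \<omega> k \<in> form_cx M k"
proof -
  have "2 * k - k = k" by simp
  then show ?thesis using assms hol_form_0 by (auto simp: form_cx_def)
qed

lemma signed_0: "signed j 0 = 0"
  by (simp add: signed_def)

lemma coeff_signed: "coeff (signed j p) i = signed j (coeff p i)"
  by (simp add: signed_def)

lemma signed_form: "signed j (\<omega> :: ('a, 'm, complex) form) ch x vs = msign (int j) * \<omega> ch x vs"
  by (simp add: signed_def msign_def)

section \<open>The labeling as a simplex, and simplicial operators\<close>

lemma Ch_in_Omega:
  assumes M: "complex_manifold M" and F: "F \<in> IVB M n"
  shows "Ch M n F \<in> Omega M n"
  unfolding Omega_def mem_Collect_eq
proof (intro conjI allI impI ballI)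
  show "Ch M n F \<sigma> = 0" if "\<sigma> \<notin> cells n" for \<sigma> using that by (simp add: Ch_def Let_def)
next
  fix \<sigma> k assume \<sigma>: "\<sigma> \<in> cells n" and len: "length \<sigma> = k + 1"
  let ?F = "total_ivb n F"
  note coh = coherent_total[OF F]
  have hd\<sigma>: "hd \<sigma> \<le> n" by (rule hd_last_le(1)[OF cellsD(1,3)[OF \<sigma>]])
  show "Ch M n F \<sigma> \<in> form_cx M k"
  proof (cases "k = 0")
    case True
    have "Ch M n F \<sigma> = monom (fun_form M (euler_char (ob_of F (hd \<sigma>)))) 0"
      using \<sigma> len True by (simp add: Ch_def Let_def)
    then show ?thesis unfolding True
      using form_cx_monom[OF hol_form_euler_char[OF M perf_ob_bundle[OF IVB_perf_ob[OF F hd\<sigma>]]]] by (simp only:)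
  next
    case False
    have "hol_form M (pts M) k (\<lambda>ch x vs. Tr F (fam_power (ob_of F) (fam_A M F) k) \<sigma> ch x vs / fact k)"
      unfolding Tr_total[OF cellsD(1,3)[OF \<sigma>], where F = F and M = M] by (rule hol_form_Tr[OF M coh]) (use len False in auto)
    note form_cx_monom[OF this]
    moreover have "Ch M n F \<sigma> = monom (\<lambda>ch x vs. Tr F (fam_power (ob_of F) (fam_A M F) k) \<sigma> ch x vs / fact k) k"
      using \<sigma> len False by (simp add: Ch_def Let_def)
    ultimately show ?thesis by (simp only:)
  qed
  assume k: "k \<ge> 1"
  have fc: "face j \<sigma> \<in> cells n" "length (face j \<sigma>) = k" if "j \<le> k" for j
    using face_cells[OF \<sigma> len k that] that len by (simp_all add: length_face)
  show "(\<Sum>j\<le>k. signed j (Ch M n F (face j \<sigma>))) = 0"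
  \<comment> \<open>The faces of a 1-cell are labelled by Euler characteristics instead of traces.
    Its edge is a homotopy equivalence because the simplex lies in the Kan subcomplex.\<close>
  proof (cases "k = 1")
    case True
    then obtain i0 i1 where s: "\<sigma> = [i0, i1]" using len by (cases \<sigma>; cases "tl \<sigma>") auto
    have i: "i0 \<le> n" "i1 \<le> n" using cellsD(3)[OF \<sigma>] s by auto
    have h: "[i0, i1] \<in> hat n 1" using i by (simp add: hat_def)
    have core: "F [i0, i1] \<in> dgnerve_core (Perf M) 1" by (rule IVB_core[OF F h])
    have "homotopy_equiv (Perf M) (fst (F [i0, i1]) 1) (fst (F [i0, i1]) 0) (snd (F [i0, i1]) [0, 1])"
      using core unfolding dgnerve_core_def by (cases "F [i0, i1]") auto
    then have "homotopy_equiv (Perf M) (ob_of F i1) (ob_of F i0) (snd (F [i0, i1]) [0, 1])"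
      using IVB_ob[OF F h, of 0] IVB_ob[OF F h, of 1] by simp
    from homotopy_equiv_euler_char[OF IVB_perf_ob[OF F i(2)] IVB_perf_ob[OF F i(1)] this]
    have "euler_char (ob_of F i1) = euler_char (ob_of F i0)" by (rule ext)
    moreover have "face 0 \<sigma> = [i1]" "face 1 \<sigma> = [i0]" by (simp_all add: s face_def)
    moreover have "{..k} = {0, 1}" using True by auto
    ultimately show ?thesis using fc[of 0] fc[of 1] True
      by (simp add: Ch_def Let_def signed_def)
  next
    case False
    define m where "m = k - 1"
    have m: "k = m + 1" "m \<ge> 1" using False k by (auto simp: m_def)
    let ?T = "\<lambda>j ch x vs. Tr F (fam_power (ob_of F) (fam_A M F) m) (face j \<sigma>) ch x vs / fact m"
    have Ch: "Ch M n F (face j \<sigma>) = monom (?T j) m" if "j \<le> k" for j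
      using fc[OF that] m by (simp add: Ch_def Let_def)
    \<comment> \<open>All faces are labelled by multiples of the same power \<open>u^m\<close> with
      the same factor \<open>1 / fact m\<close>, so the claim concerns the traces only.\<close>
    have T0: "(\<Sum>j\<le>k. signed j (?T j)) = 0"
    proof (intro ext)
      fix ch x vs
      have "(\<Sum>j\<le>k. signed j (?T j)) ch x vs = (\<Sum>j\<le>k. msign (int j) * ?T j ch x vs)"
        by (simp add: sum_fun_apply signed_form)
      also have "\<dots> = (\<Sum>j<m + 2. msign (int j) * Tr ?F (fam_power (ob_of ?F) (fam_A M ?F) m) (face j \<sigma>) ch x vs) / fact m"
        unfolding sum_divide_distrib
      proof (rule sum.cong)
        fix j assume "j \<in> {..<m + 2}"
        then have j: "j \<le> k" using m by simp
        show "msign (int j) * ?T j ch x vs = msign (int j) * Tr ?F (fam_power (ob_of ?F) (fam_A M ?F) m) (face j \<sigma>) ch x vs / fact m"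
          unfolding Tr_total[OF cellsD(1,3)[OF fc(1)[OF j]], where F = F and M = M] by simp
      qed (use m in auto)
      also have "\<dots> = 0"
      \<comment> \<open>\<open>Tr_face_sum\<close> speaks of lists of \<open>m\<close> vectors; on
        all other lists each single trace is 0.\<close>
      proof (cases "length vs = m")
        case True
        then show ?thesis using Tr_face_sum[OF M coh, of \<sigma> m vs ch x] len m by simp
      next
        case False
        then show ?thesis
          by (simp add: Tr_expand[of m "fam_power (ob_of ?F) (fam_A M ?F) m" ch x, OF fam_power_fam_A_length] fam_power_fam_A_length)
      qed
      finally show "(\<Sum>j\<le>k. signed j (?T j)) ch x vs = 0 ch x vs" by simp
    qed
    show ?thesis
    proof (rule poly_eqI)
      fix i
      have "coeff (\<Sum>j\<le>k. signed j (Ch M n F (face j \<sigma>))) i = (\<Sum>j\<le>k. signed j (coeff (monom (?T j) m) i))"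
        by (simp add: coeff_sum coeff_signed Ch del: coeff_monom)
      also have "\<dots> = 0"
        using T0 by (cases "i = m") (simp_all add: signed_0)
      finally show "coeff (\<Sum>j\<le>k. signed j (Ch M n F (face j \<sigma>))) i = coeff 0 i" by simp
    qed
  qed
qed

lemma IVB_op_facts:
  assumes \<phi>: "delta_map m n \<phi>"
  shows "k \<le> m \<Longrightarrow> ob_of (IVB_op m \<phi> F) k = ob_of F (\<phi> k)"
    and "set \<beta> \<subseteq> {..m} \<Longrightarrow> mor_of (IVB_op m \<phi> F) \<beta> = mor_of F (map \<phi> \<beta>)"
  unfolding ob_of_def mor_of_def IVB_op_def hat_iff by auto

lemma Ch_simplicial:
  assumes M: "complex_manifold M" and F: "F \<in> IVB M n" and \<phi>: "delta_map m n \<phi>"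
  shows "Ch M m (IVB_op m \<phi> F) = Omega_op m \<phi> (Ch M n F)"
proof
  fix \<sigma>
  show "Ch M m (IVB_op m \<phi> F) \<sigma> = Omega_op m \<phi> (Ch M n F) \<sigma>"
  proof (cases "\<sigma> \<in> cells m")
    case False then show ?thesis by (simp add: Ch_def Omega_op_def Let_def)
  next
    case \<sigma>: True
    note c = cellsD[OF \<sigma>]
    let ?G = "IVB_op m \<phi> F"
    have im: "set (map \<phi> \<sigma>) \<subseteq> {..n}" using c(3) \<phi> by (auto simp: delta_map_def)
    have Tr: "Tr ?G (fam_power (ob_of ?G) (fam_A M ?G) k) \<sigma> ch x vs = Tr F (fam_power (ob_of F) (fam_A M F) k) (map \<phi> \<sigma>) ch x vs" for k ch x vs
      by (rule Tr_index[where S = "{..m}", OF _ _ c(1,3)]) (simp_all add: IVB_op_facts[OF \<phi>])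
    have mono: "\<sigma> ! i < \<sigma> ! j" "\<phi> (\<sigma> ! i) \<le> \<phi> (\<sigma> ! j)" if "i < j" "j < length \<sigma>" for i j
    proof -
      show lt: "\<sigma> ! i < \<sigma> ! j" using c(2) that by (auto simp: sorted_wrt_iff_nth_less)
      have "\<sigma> ! i \<in> {..m}" "\<sigma> ! j \<in> {..m}" using c(3) that by (meson nth_mem order_less_trans subsetD)+
      then show "\<phi> (\<sigma> ! i) \<le> \<phi> (\<sigma> ! j)" using \<phi> lt unfolding delta_map_def mono_on_def by (meson less_imp_le)
    qed
    show ?thesis
    proof (cases "inj_on \<phi> (set \<sigma>)")
      case True
      have "sorted_wrt (<) (map \<phi> \<sigma>)"
        unfolding sorted_wrt_iff_nth_less
      proof (intro allI impI)
        fix i j assume ij: "i < j" "j < length (map \<phi> \<sigma>)"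
        then have "\<phi> (\<sigma> ! i) \<noteq> \<phi> (\<sigma> ! j)"
          using inj_onD[OF True, of "\<sigma> ! i" "\<sigma> ! j"] mono(1)[of i j] by auto
        then show "map \<phi> \<sigma> ! i < map \<phi> \<sigma> ! j" using mono(2)[of i j] ij by simp
      qed
      then have "map \<phi> \<sigma> \<in> cells n" using c(1) im by (simp add: cells_def)
      moreover have "hd \<sigma> \<le> m" by (rule hd_last_le(1)[OF c(1,3)])
      ultimately show ?thesis using \<sigma> True c(1)
        by (simp add: Ch_def Omega_op_def Let_def Tr IVB_op_facts[OF \<phi>] hd_map)
    next
      case False
      then have len: "length \<sigma> - 1 \<noteq> 0" using c(1) by (cases \<sigma>; cases "tl \<sigma>") auto
      \<comment> \<open>A monotone map that separates all neighbours of an increasing sequence is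
        strictly increasing on it, hence injective.\<close>
      have "\<exists>a. Suc a < length \<sigma> \<and> map \<phi> \<sigma> ! a = map \<phi> \<sigma> ! Suc a"
      proof (rule ccontr)
        assume no: "\<not> ?thesis"
        have st: "\<phi> (\<sigma> ! a) < \<phi> (\<sigma> ! Suc a)" if "Suc a < length \<sigma>" for a
        proof -
          have "\<phi> (\<sigma> ! a) \<noteq> \<phi> (\<sigma> ! Suc a)" using no that by auto
          then show ?thesis using mono(2)[of a "Suc a"] that by simp
        qed
        have "sorted_wrt (<) (map \<phi> \<sigma>)"
          by (subst sorted_wrt_iff_nth_Suc_transp) (auto simp: st)
        then have "distinct (map \<phi> \<sigma>)" by (simp add: strict_sorted_iff)
        then show False using False by (simp add: distinct_map)
      qed
      then obtain a where a: "Suc a < length (map \<phi> \<sigma>)" "map \<phi> \<sigma> ! a = map \<phi> \<sigma> ! Suc a" by auto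
      have "(\<lambda>ch x vs. Tr ?G (fam_power (ob_of ?G) (fam_A M ?G) (length \<sigma> - 1)) \<sigma> ch x vs / fact (length \<sigma> - 1)) = 0"
        by (intro ext) (simp add: Tr Tr_repeat[OF M F im a])
      then show ?thesis using \<sigma> False len by (simp add: Ch_def Omega_op_def Let_def)
    qed
  qed
qed

section \<open>Compatibility with pullback\<close>

lemma pull_form_0: "pull_form M M' \<phi> 0 = 0"
  by (intro ext) (simp add: pull_form_def Let_def)

lemma pull_map_add: "pull_map M \<phi> (f + g) = pull_map M \<phi> f + pull_map M \<phi> g"
  by (intro ext) (simp add: pull_map_def)

lemma pull_map_0: "pull_map M \<phi> 0 = 0"
  by (intro ext) (simp add: pull_map_def)

lemma IVB_pull_facts:
  shows "k \<le> n \<Longrightarrow> ob_of (IVB_pull M M' \<phi> n F) k = pull_perf M M' \<phi> (ob_of F k)"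
    and "set \<beta> \<subseteq> {..n} \<Longrightarrow> mor_of (IVB_pull M M' \<phi> n F) \<beta> = pull_map M \<phi> (mor_of F \<beta>)"
    and "\<beta> \<noteq> [] \<Longrightarrow> set \<beta> \<subseteq> {..n} \<Longrightarrow> gfam (IVB_pull M M' \<phi> n F) \<beta> = pull_map M \<phi> (gfam F \<beta>)"
proof -
  show ob: "ob_of (IVB_pull M M' \<phi> n F) k = pull_perf M M' \<phi> (ob_of F k)" if "k \<le> n" for k
    using that unfolding ob_of_def IVB_pull_def hat_iff by simp
  show mor: "mor_of (IVB_pull M M' \<phi> n F) \<beta> = pull_map M \<phi> (mor_of F \<beta>)" if "set \<beta> \<subseteq> {..n}" for \<beta>
    using that unfolding mor_of_def IVB_pull_def hat_iff by (auto simp: pull_map_0)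
  assume \<beta>: "\<beta> \<noteq> []" "set \<beta> \<subseteq> {..n}"
  have "hd \<beta> \<le> n" by (rule hd_last_le(1)[OF \<beta>])
  then show "gfam (IVB_pull M M' \<phi> n F) \<beta> = pull_map M \<phi> (gfam F \<beta>)"
    unfolding gfam_def pull_map_add mor[OF \<beta>(2)] ob[OF \<open>hd \<beta> \<le> n\<close>] by (simp add: pull_map_0) (simp add: pull_perf_def)
qed

lemma euler_char_pull: "x \<in> pts M \<Longrightarrow> euler_char (pull_perf M M' \<phi> E) x = euler_char E (\<phi> x)"
  by (simp add: euler_char_def pull_perf_def)

lemma Ch_pull:
  assumes M: "complex_manifold M" and M': "complex_manifold M'" and \<phi>: "holomorphic_map M M' \<phi>"
    and F: "F \<in> IVB M' n"
  shows "Omega_pull M M' \<phi> (Ch M' n F) = Ch M n (IVB_pull M M' \<phi> n F)"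
proof
  fix \<sigma>
  let ?G = "IVB_pull M M' \<phi> n F"
  show "Omega_pull M M' \<phi> (Ch M' n F) \<sigma> = Ch M n ?G \<sigma>"
  proof (cases "\<sigma> \<in> cells n")
    case False then show ?thesis by (simp add: Ch_def Omega_pull_def Let_def)
  next
    case \<sigma>: True
    note c = cellsD[OF \<sigma>]
    define k where "k = length \<sigma> - 1"
    have hd: "hd \<sigma> \<le> n" by (rule hd_last_le(1)[OF c(1,3)])
    \<comment> \<open>The chart that \<open>pull_form\<close> selects around the image point;
      \<open>hom_conn_pull\<close> is stated for the same selection.\<close>
    let ?s = "\<lambda>x. SOME ch'. ch' \<in> charts M' \<and> \<phi> x \<in> fst ch'"
    have s: "?s x \<in> charts M'" "\<phi> x \<in> fst (?s x)" if "x \<in> pts M" for x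
    proof -
      have "\<phi> x \<in> pts M'" using \<phi> that by (auto simp: holomorphic_map_def continuous_map_def)
      then have "\<exists>ch'. ch' \<in> charts M' \<and> \<phi> x \<in> fst ch'" using charts_cover[OF M'] by blast
      from someI_ex[OF this] show "?s x \<in> charts M'" "\<phi> x \<in> fst (?s x)" by auto
    qed
    show ?thesis
    proof (cases "k = 0")
      case True
      have "pull_form M M' \<phi> (fun_form M' (euler_char (ob_of F (hd \<sigma>)))) = fun_form M (euler_char (ob_of ?G (hd \<sigma>)))"
      proof (intro ext)
        fix ch x vs
        show "pull_form M M' \<phi> (fun_form M' (euler_char (ob_of F (hd \<sigma>)))) ch x vs = fun_form M (euler_char (ob_of ?G (hd \<sigma>))) ch x vs"
        proof (cases "ch \<in> charts M \<and> x \<in> fst ch")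
          case True
          then have x: "x \<in> pts M" using chart_pts[OF M] by blast
          show ?thesis using True s[OF x]
            by (auto simp: pull_form_def fun_form_def Let_def IVB_pull_facts(1)[OF hd] euler_char_pull[OF x])
        next
          case False
          then show ?thesis by (auto simp: pull_form_def fun_form_def)
        qed
      qed
      then show ?thesis using \<sigma> True
        by (simp add: Ch_def Omega_pull_def Let_def k_def map_poly_monom pull_form_0)
    next
      case False
      let ?T = "\<lambda>ch x vs. Tr F (fam_power (ob_of F) (fam_A M' F) k) \<sigma> ch x vs / fact k"
      let ?T' = "\<lambda>ch x vs. Tr ?G (fam_power (ob_of ?G) (fam_A M ?G) k) \<sigma> ch x vs / fact k"
      have "pull_form M M' \<phi> ?T = ?T'"
      proof (intro ext)
        fix ch x vs
        show "pull_form M M' \<phi> ?T ch x vs = ?T' ch x vs"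
        proof (cases "ch \<in> charts M \<and> x \<in> fst ch \<and> set vs \<subseteq> model M")
          case True
          then have ch: "ch \<in> charts M" "x \<in> fst ch" and vs: "set vs \<subseteq> model M" by auto
          have x: "x \<in> pts M" by (rule chart_pts[OF M ch])
          have A: "fam_A M ?G \<beta> ch x [v] = fam_A M' F (map (\<lambda>k. k) \<beta>) (?s x) (\<phi> x) [jac ch (?s x) \<phi> x v]"
            if \<beta>: "\<beta> \<noteq> []" "set \<beta> \<subseteq> {..n}" and v: "v \<in> model M" for \<beta> v
          proof -
            note hl = hd_last_le[OF \<beta>]
            show ?thesis
              by (intro ext) (simp add: fam_A_eq IVB_pull_facts(1)[OF hl(1)] IVB_pull_facts(1)[OF hl(2)] IVB_pull_facts(3)[OF \<beta>]
                hom_conn_pull(1)[OF M M' \<phi> IVB_perf_ob[OF F hl(2)] IVB_perf_ob[OF F hl(1)] gfam_IVB(1)[OF F \<beta>] ch v refl])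
          qed
          have fibG: "fib (ob_of ?G j) x = fib (ob_of F j) (\<phi> x)" if "j \<le> n" for j
            by (simp add: IVB_pull_facts(1)[OF that] fib_pull[OF x])
          have "Tr ?G (fam_power (ob_of ?G) (fam_A M ?G) k) \<sigma> ch x vs =
            Tr F (fam_power (ob_of F) (fam_A M' F) k) (map (\<lambda>k. k) \<sigma>) (?s x) (\<phi> x) (map (jac ch (?s x) \<phi> x) vs)"
          proof (rule Tr_map[where f = "fam_power (ob_of ?G) (fam_A M ?G) k" and f' = "fam_power (ob_of F) (fam_A M' F) k" and m = k])
            fix \<beta> assume "set \<beta> \<subseteq> set \<sigma>"
            then have \<beta>: "set \<beta> \<subseteq> {..n}" using c(3) by blast
            show "mor_of ?G \<beta> x = mor_of F (map (\<lambda>k. k) \<beta>) (\<phi> x)"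
              using x by (simp add: IVB_pull_facts(2)[OF \<beta>] pull_map_def)
            show "fam_power (ob_of ?G) (fam_A M ?G) k \<beta> ch x vs =
               fam_power (ob_of F) (fam_A M' F) k (map (\<lambda>k. k) \<beta>) (?s x) (\<phi> x) (map (jac ch (?s x) \<phi> x) vs)"
              by (rule fam_power_map[where A = "fam_A M ?G" and A' = "fam_A M' F" and S = "{..n}" and V = "model M" and J = "jac ch (?s x) \<phi> x" and \<phi> = "\<lambda>k. k",
                    OF fam_A_one_form[of M ?G ch x] fam_A_one_form[of M' F "?s x" "\<phi> x"] A])
                 (use \<beta> vs fibG in simp_all)
          next
            fix j assume "j \<in> set \<sigma>"
            then show "fib (ob_of ?G j) x = fib (ob_of F j) (\<phi> x)" using fibG c(3) by auto
          qed (rule fam_power_fam_A_length fam_power_fam_A_length c(1))+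
          then show ?thesis using True by (simp add: pull_form_def Let_def)
        next
          \<comment> \<open>The pulled back form is 0 by definition. The trace vanishes too: either
            some vector lies outside the model space, or chart and point do not match.\<close>
          case bad: False
          have "fam_power (ob_of ?G) (fam_A M ?G) k \<beta> ch x vs i j = 0" for \<beta> i j
          proof (cases "length vs = k")
            case len: True
            show ?thesis
            proof (cases "ch \<in> charts M \<and> x \<in> fst ch")
              case True
              then obtain v where v: "v \<in> set vs" "v \<notin> model M" using bad by auto
              show ?thesis
              proof (rule fam_power_support[of "fam_A M ?G" ch x, OF fam_A_one_form _ v])
                fix \<beta> u assume "u \<notin> model M"
                then show "fam_A M ?G \<beta> ch x [u] = 0" by (intro ext) (simp add: fam_A_eq hom_conn_eq_0)
              qed
            next
              case nch: False
              have v: "hd vs \<in> set vs" using len False by (cases vs) auto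
              show ?thesis
              \<comment> \<open>Off the chart every vector is annihilated, so the set of admissible
                vectors is empty. Since \<open>k\<close> is positive, the list contains a vector to
                apply this to.\<close>
              proof (rule fam_power_support[of "fam_A M ?G" ch x "{}", OF fam_A_one_form _ v])
                fix \<beta> u
                have "hom_conn M E E' f ch x [u] = 0" for E E' f by (rule hom_conn_eq_0) (use nch in blast)
                then show "fam_A M ?G \<beta> ch x [u] = 0" by (intro ext) (simp add: fam_A_eq)
              qed simp
            qed
          next
            case False
            show ?thesis by (simp add: fam_power_fam_A_length[rule_format, OF False])
          qed
          then have "Tr ?G (fam_power (ob_of ?G) (fam_A M ?G) k) \<sigma> ch x vs = 0"
            by (simp add: Tr_expand[of k "fam_power (ob_of ?G) (fam_A M ?G) k" ch x, OF fam_power_fam_A_length])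
          then show ?thesis using bad by (auto simp: pull_form_def)
        qed
      qed
      then show ?thesis using \<sigma> False
        unfolding Ch_def Omega_pull_def Let_def k_def[symmetric] by (simp add: map_poly_monom pull_form_0)
    qed
  qed
qed

theorem theorem3p13:
  fixes U :: "('a, 'm::finite) cmfd" and U' :: "('b, 'k::finite) cmfd" and \<phi> :: "'a \<Rightarrow> 'b"
  assumes "complex_manifold U"
  shows "simplicial_map (IVB U) IVB_op (Omega U) Omega_op (Ch U) \<and>
    (complex_manifold U' \<and> holomorphic_map U U' \<phi> \<longrightarrow>
      (\<forall>n. \<forall>F\<in>IVB U' n.
         Omega_pull U U' \<phi> (Ch U' n F) = Ch U n (IVB_pull U U' \<phi> n F)))"
  unfolding simplicial_map_def
  using Ch_in_Omega[OF assms] Ch_simplicial[OF assms] Ch_pull[OF assms] by blast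

end
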